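(* Let $n\in\mathbb{N}$ with $n\geq 3$, let input pairs $p_0,g_0,\dots,p_{n-1},g_{n-1}$ with arrival times $a:\{p_0,g_0,\dots,p_{n-1},g_{n-1}\}\to\mathbb{N}$ be given, and let $W=\sum_{i=0}^{n-1}\big(2^{a(p_i)}+2^{a(g_i)}\big)$. Then one can construct in polynomial time an adder circuit $C_n$ on these input pairs with $$\mathrm{del}(C_n)\leq \log_2 W+3\log_2\log_2 n+3\log_2\log_2\log_2 n+11.085\quad\text{and}\quad \mathrm{s}(C_n)\leq 24.436\, n\log_2\log_2 n.$$
   Context: A circuit over the basis $\{\land,\lor\}$ is a finite acyclic directed graph whose vertices are either inputs (in-degree $0$, each labeled with a distinct Boolean variable or a constant) or gates (each labeled $\land$ or $\lor$ with two ordered predecessors), together with a designated nonempty set of outputs; each vertex computes a Boolean function of the inputs recursively. Given arrival times of the inputs, the arrival time of a gate is the maximum arrival time of its predecessors plus $1$, and the delay $\mathrm{del}$ of a circuit is the maximum arrival time of an output. The size $\mathrm{s}$ is the number of gates. The carry bits of input pairs $p_0,g_0,\dots,p_{n-1},g_{n-1}$ are $c_0=0$ and $c_{i+1}=g_i\lor(p_i\land c_i)$ for $i\in\{0,\dots,n-1\}$. An adder circuit on these input pairs is a circuit over $\{\land,\lor\}$ with inputs $p_0,g_0,\dots,p_{n-1},g_{n-1}$ having, for each $i\in\{1,\dots,n\}$, an output computing $c_i$. *)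

theory Defs
  imports Complex_Main "HOL-Computational_Algebra.Polynomial"
begin

section \<open>Circuits\<close>

datatype gate_op = AND | OR

fun apply_op :: "gate_op \<Rightarrow> bool \<Rightarrow> bool \<Rightarrow> bool" where
  "apply_op AND x y = (x \<and> y)"
| "apply_op OR x y = (x \<or> y)"

datatype 'x vertex = Variable 'x | Constant bool | Gate gate_op nat nat

text \<open>The vertices of a circuit are the positions \<open>v < length (vertices C)\<close>; the entry at
  position \<open>v\<close> is the label of \<open>v\<close>, which for a gate includes its two ordered predecessors.
  The order of the list carries no meaning: acyclicity is a separate requirement in
  \<open>is_circuit\<close>.\<close>

datatype 'x circuit = Circuit (vertices: "'x vertex list") (outputs: "nat list")

definition edges :: "'x circuit \<Rightarrow> (nat \<times> nat) set" where
  "edges C = {(u, v). v < length (vertices C) \<and>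
     (\<exists>f w. vertices C ! v = Gate f u w \<or> vertices C ! v = Gate f w u)}"

definition is_circuit :: "'x circuit \<Rightarrow> bool" where
  "is_circuit C \<longleftrightarrow>
     edges C \<subseteq> {..<length (vertices C)} \<times> {..<length (vertices C)} \<and>
     acyclic (edges C) \<and>
     (\<forall>u < length (vertices C). \<forall>v < length (vertices C). \<forall>x.
        vertices C ! u = Variable x \<and> vertices C ! v = Variable x \<longrightarrow> u = v) \<and>
     outputs C \<noteq> [] \<and> set (outputs C) \<subseteq> {..<length (vertices C)}"

text \<open>Both recursions run along \<open>edges C\<close>, which is well-founded for every circuit; see the
  unfolding lemmas below. Constants are available at time \<open>0\<close>.\<close>

definition vertex_value :: "'x circuit \<Rightarrow> ('x \<Rightarrow> bool) \<Rightarrow> nat \<Rightarrow> bool" where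
  "vertex_value C \<rho> = wfrec (edges C) (\<lambda>val v.
     case vertices C ! v of
       Variable x \<Rightarrow> \<rho> x
     | Constant b \<Rightarrow> b
     | Gate f u w \<Rightarrow> apply_op f (val u) (val w))"

definition arrival_time :: "'x circuit \<Rightarrow> ('x \<Rightarrow> nat) \<Rightarrow> nat \<Rightarrow> nat" where
  "arrival_time C a = wfrec (edges C) (\<lambda>arr v.
     case vertices C ! v of
       Variable x \<Rightarrow> a x
     | Constant b \<Rightarrow> 0
     | Gate f u w \<Rightarrow> max (arr u) (arr w) + 1)"

definition delay :: "'x circuit \<Rightarrow> ('x \<Rightarrow> nat) \<Rightarrow> nat" where
  "delay C a = Max (arrival_time C a ` set (outputs C))"

definition circuit_size :: "'x circuit \<Rightarrow> nat" where
  "circuit_size C = card {v. v < length (vertices C) \<and> (\<exists>f u w. vertices C ! v = Gate f u w)}"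

lemma wf_edges:
  assumes "is_circuit C"
  shows "wf (edges C)"
proof (rule finite_acyclic_wf)
  show "finite (edges C)"
    using assms unfolding is_circuit_def by (meson finite_SigmaI finite_lessThan finite_subset)
  show "acyclic (edges C)"
    using assms unfolding is_circuit_def by blast
qed

lemma vertex_value_unfold:
  assumes "is_circuit C" "v < length (vertices C)"
  shows "vertex_value C \<rho> v =
    (case vertices C ! v of
       Variable x \<Rightarrow> \<rho> x
     | Constant b \<Rightarrow> b
     | Gate f u w \<Rightarrow> apply_op f (vertex_value C \<rho> u) (vertex_value C \<rho> w))"
proof -
  have "(u, v) \<in> edges C \<and> (w, v) \<in> edges C" if "vertices C ! v = Gate f u w" for f u w
    using that assms(2) unfolding edges_def by blast
  then show ?thesis
    unfolding vertex_value_def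
    by (subst wfrec[OF wf_edges[OF assms(1)]]) (auto simp: cut_apply split: vertex.split)
qed

lemma arrival_time_unfold:
  assumes "is_circuit C" "v < length (vertices C)"
  shows "arrival_time C a v =
    (case vertices C ! v of
       Variable x \<Rightarrow> a x
     | Constant b \<Rightarrow> 0
     | Gate f u w \<Rightarrow> max (arrival_time C a u) (arrival_time C a w) + 1)"
proof -
  have "(u, v) \<in> edges C \<and> (w, v) \<in> edges C" if "vertices C ! v = Gate f u w" for f u w
    using that assms(2) unfolding edges_def by blast
  then show ?thesis
    unfolding arrival_time_def
    by (subst wfrec[OF wf_edges[OF assms(1)]]) (auto simp: cut_apply split: vertex.split)
qed


section \<open>Adder circuits\<close>

datatype adder_input = Propagate nat | Generate nat

fun carry :: "(adder_input \<Rightarrow> bool) \<Rightarrow> nat \<Rightarrow> bool" where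
  "carry \<rho> 0 = False"
| "carry \<rho> (Suc i) = (\<rho> (Generate i) \<or> (\<rho> (Propagate i) \<and> carry \<rho> i))"

text \<open>The inputs of an adder circuit are exactly \<open>p\<^sub>0, g\<^sub>0, \<dots>, p\<^sub>n\<^sub>-\<^sub>1, g\<^sub>n\<^sub>-\<^sub>1\<close>; in particular it
  has no constant inputs.\<close>

definition adder_circuit :: "nat \<Rightarrow> adder_input circuit \<Rightarrow> bool" where
  "adder_circuit n C \<longleftrightarrow>
     is_circuit C \<and>
     {x. Variable x \<in> set (vertices C)} = Propagate ` {..<n} \<union> Generate ` {..<n} \<and>
     (\<forall>b. Constant b \<notin> set (vertices C)) \<and>
     (\<forall>i\<in>{1..n}. \<exists>v\<in>set (outputs C). \<forall>\<rho>. vertex_value C \<rho> v = carry \<rho> i)"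


section \<open>Polynomial time\<close>

text \<open>The machine model is Jones's first-order functional language over S-expressions
  (N. D. Jones, Computability and Complexity from a Programming Perspective, 1997), in which
  every elementary operation costs one unit. Sharing subtrees, a Turing machine simulates it
  with polynomial overhead, and conversely. A program is a list of function bodies; in a body,
  \<open>Var i\<close> is the \<open>i\<close>-th argument. Execution starts in function \<open>0\<close>. As usual, \<open>Hd\<close> and \<open>Tl\<close>
  of \<open>Leaf\<close> are \<open>Leaf\<close>, and \<open>Leaf\<close> counts as false.\<close>

datatype sexp = Leaf | Dot sexp sexp

datatype expr =
    Var nat
  | Nil_expr
  | Cons_expr expr expr
  | Hd expr
  | Tl expr
  | Cond expr expr expr
  | Call nat "expr list"

fun sexp_hd :: "sexp \<Rightarrow> sexp" where
  "sexp_hd Leaf = Leaf"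
| "sexp_hd (Dot x y) = x"

fun sexp_tl :: "sexp \<Rightarrow> sexp" where
  "sexp_tl Leaf = Leaf"
| "sexp_tl (Dot x y) = y"

text \<open>\<open>eval prog env e v t\<close>: with the arguments \<open>env\<close>, the expression \<open>e\<close> evaluates to \<open>v\<close>
  in exactly \<open>t\<close> steps.\<close>

inductive eval :: "expr list \<Rightarrow> sexp list \<Rightarrow> expr \<Rightarrow> sexp \<Rightarrow> nat \<Rightarrow> bool"
  and evals :: "expr list \<Rightarrow> sexp list \<Rightarrow> expr list \<Rightarrow> sexp list \<Rightarrow> nat \<Rightarrow> bool"
  for prog where
  eval_Var: "i < length env \<Longrightarrow> eval prog env (Var i) (env ! i) 1"
| eval_Nil: "eval prog env Nil_expr Leaf 1"
| eval_Cons: "eval prog env e1 v1 t1 \<Longrightarrow> eval prog env e2 v2 t2 \<Longrightarrow>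
    eval prog env (Cons_expr e1 e2) (Dot v1 v2) (t1 + t2 + 1)"
| eval_Hd: "eval prog env e v t \<Longrightarrow> eval prog env (Hd e) (sexp_hd v) (t + 1)"
| eval_Tl: "eval prog env e v t \<Longrightarrow> eval prog env (Tl e) (sexp_tl v) (t + 1)"
| eval_Cond_True: "eval prog env e v t \<Longrightarrow> v \<noteq> Leaf \<Longrightarrow> eval prog env e1 v1 t1 \<Longrightarrow>
    eval prog env (Cond e e1 e2) v1 (t + t1 + 1)"
| eval_Cond_False: "eval prog env e Leaf t \<Longrightarrow> eval prog env e2 v2 t2 \<Longrightarrow>
    eval prog env (Cond e e1 e2) v2 (t + t2 + 1)"
| eval_Call: "f < length prog \<Longrightarrow> evals prog env es vs t \<Longrightarrow> eval prog vs (prog ! f) v t' \<Longrightarrow>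
    eval prog env (Call f es) v (t + t' + 1)"
| evals_Nil: "evals prog env [] [] 0"
| evals_Cons: "eval prog env e v t \<Longrightarrow> evals prog env es vs t' \<Longrightarrow>
    evals prog env (e # es) (v # vs) (t + t')"

definition runs :: "expr list \<Rightarrow> sexp \<Rightarrow> sexp \<Rightarrow> nat \<Rightarrow> bool" where
  "runs prog x y t \<longleftrightarrow> prog \<noteq> [] \<and> eval prog [x] (prog ! 0) y t"

inductive_cases eval_elims:
  "eval prog env (Var i) v t" "eval prog env Nil_expr v t"
  "eval prog env (Cons_expr e1 e2) v t" "eval prog env (Hd e) v t" "eval prog env (Tl e) v t"
  "eval prog env (Cond e e1 e2) v t" "eval prog env (Call f es) v t"
  "evals prog env [] vs t" "evals prog env (e # es) vs t"

lemma eval_deterministic: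
  "eval prog env e v t \<Longrightarrow> \<forall>v' t'. eval prog env e v' t' \<longrightarrow> v' = v \<and> t' = t"
  "evals prog env es vs s \<Longrightarrow> \<forall>vs' s'. evals prog env es vs' s' \<longrightarrow> vs' = vs \<and> s' = s"
  by (induction rule: eval_evals.inducts) 
    (intro allI impI, erule eval_elims; metis One_nat_def Suc_eq_plus1)+

text \<open>Only the inputs in \<open>A\<close> matter; the time bound is in terms of the size of the encoded input
  (its number of pairs).\<close>

definition poly_time_computable ::
    "'i set \<Rightarrow> ('i \<Rightarrow> sexp) \<Rightarrow> ('o \<Rightarrow> sexp) \<Rightarrow> ('i \<Rightarrow> 'o) \<Rightarrow> bool" where
  "poly_time_computable A enc_in enc_out F \<longleftrightarrow>
     (\<exists>prog (q :: nat poly). \<forall>x\<in>A. \<exists>t.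
        runs prog (enc_in x) (enc_out (F x)) t \<and> t \<le> poly q (size (enc_in x)))"


section \<open>Encodings\<close>

fun enc_bool :: "bool \<Rightarrow> sexp" where
  "enc_bool False = Leaf"
| "enc_bool True = Dot Leaf Leaf"

text \<open>Binary, least significant bit first.\<close>

fun enc_nat :: "nat \<Rightarrow> sexp" where
  "enc_nat n = (if n = 0 then Leaf else Dot (enc_bool (odd n)) (enc_nat (n div 2)))"

declare enc_nat.simps [simp del]

fun enc_list :: "('a \<Rightarrow> sexp) \<Rightarrow> 'a list \<Rightarrow> sexp" where
  "enc_list enc [] = Leaf"
| "enc_list enc (x # xs) = Dot (enc x) (enc_list enc xs)"

fun enc_adder_input :: "adder_input \<Rightarrow> sexp" where
  "enc_adder_input (Propagate i) = Dot (enc_bool False) (enc_nat i)"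
| "enc_adder_input (Generate i) = Dot (enc_bool True) (enc_nat i)"

fun enc_vertex :: "('x \<Rightarrow> sexp) \<Rightarrow> 'x vertex \<Rightarrow> sexp" where
  "enc_vertex enc (Variable x) = Dot (enc_nat 0) (enc x)"
| "enc_vertex enc (Constant b) = Dot (enc_nat 1) (enc_bool b)"
| "enc_vertex enc (Gate f u w) =
     Dot (enc_nat 2) (Dot (enc_bool (f = OR)) (Dot (enc_nat u) (enc_nat w)))"

definition enc_circuit :: "adder_input circuit \<Rightarrow> sexp" where
  "enc_circuit C =
     Dot (enc_list (enc_vertex enc_adder_input) (vertices C)) (enc_list enc_nat (outputs C))"

text \<open>An instance is the list of the \<open>n\<close> pairs of arrival times; the values of \<open>a\<close> outside the
  \<open>n\<close> input pairs are not part of it.\<close>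

fun enc_instance :: "nat \<times> (adder_input \<Rightarrow> nat) \<Rightarrow> sexp" where
  "enc_instance (n, a) =
     enc_list (\<lambda>i. Dot (enc_nat (a (Propagate i))) (enc_nat (a (Generate i)))) [0..<n]"

lemma enc_bool_inject [simp]: "enc_bool b = enc_bool c \<longleftrightarrow> b = c"
  by (cases b; cases c) auto

lemma enc_nat_inject [simp]: "enc_nat m = enc_nat n \<longleftrightarrow> m = n"
proof
  show "enc_nat m = enc_nat n \<Longrightarrow> m = n"
  proof (induction m arbitrary: n rule: less_induct)
    case (less m)
    show ?case
    proof (cases "m = 0 \<or> n = 0")
      case True
      then show ?thesis using less.prems by (auto simp: enc_nat.simps split: if_splits)
    next
      case False
      then have "odd m = odd n" "enc_nat (m div 2) = enc_nat (n div 2)"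
        using less.prems by (simp_all add: enc_nat.simps[of m] enc_nat.simps[of n])
      moreover from this have "m div 2 = n div 2" using less.IH[of "m div 2"] False by simp
      ultimately show ?thesis by (metis bit_eq_rec)
    qed
  qed
qed simp

lemma enc_list_inject:
  assumes "inj enc"
  shows "enc_list enc xs = enc_list enc ys \<longleftrightarrow> xs = ys"
proof (induction xs arbitrary: ys)
  case Nil
  then show ?case by (cases ys) auto
next
  case (Cons x xs)
  then show ?case using assms by (cases ys) (auto dest: injD)
qed

lemma inj_enc_circuit: "inj enc_circuit"
proof -
  have 1: "inj enc_nat" by (simp add: inj_def)
  have 2: "enc_adder_input x = enc_adder_input y \<longleftrightarrow> x = y" for x y
    by (cases x; cases y) (auto simp del: enc_bool.simps)
  have "enc_vertex enc_adder_input x = enc_vertex enc_adder_input y \<Longrightarrow> x = y" for x y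
    by (cases x; cases y) (auto simp: 2 simp del: enc_bool.simps, (metis gate_op.exhaust)+)
  then have 3: "inj (enc_vertex enc_adder_input)" by (simp add: inj_def)
  show ?thesis
    unfolding enc_circuit_def
    by (rule injI) (auto simp: enc_list_inject[OF 1] enc_list_inject[OF 3] intro: circuit.expand)
qed

end

theory Submission imports Defs begin

text \<open>The carries are obtained by composing the maps \<open>c \<mapsto> g \<or> (p \<and> c)\<close> of the input pairs. Arrival
  times enter through the weights \<open>2 ^ a\<close>: a tree of gates over inputs of total weight at most
  \<open>2 ^ d\<close> can be arranged to finish at time \<open>d\<close>, and an and-or path over inputs of total weight \<open>X\<close>
  finishes at time \<open>d\<close> as soon as \<open>(3 d + 2) X \<le> 2 ^ d\<close>. For the latter, the path is cut at an input
  pair chosen such that everything behind it, merged into one wire, takes half of the available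
  weight; the two parts are treated recursively, with \<open>d - 1\<close> and a dual path for the rear one. Such a
  path costs about \<open>2 d\<close> gates per input and yields a single carry, so it is only used on short
  blocks: with \<open>q\<close> about half of \<open>log\<^sub>2 n\<close>, the pairs are divided into groups of \<open>q\<^sup>2\<close> pairs, and
  these into blocks of \<open>q\<close> pairs. Sklansky's prefix circuit works inside the blocks and on the blocks
  of a group, while the carry into each group is a path over logarithmically many blocks of groups.

  Arrival times that lie more than \<open>log\<^sub>2 n + 4\<close> below the latest one are rounded up. This changes the
  total weight by a constant factor only and makes all weights polynomial in \<open>n\<close>, so that they can be
  handled in unary.\<close>

section \<open>Programs and polynomial time\<close>

text \<open>The size bound fixes the shape. The carry into a group costs on the order of (log n)^2
  gates, mostly for blocks of groups, so groups of about (log n)^2 pairs keep this part linear.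
  Everything else costs a multiple of \<open>clog q\<close> per pair. Taking \<open>q\<close> as
  half of log n, and not all of it, gives \<open>clog q \<le> log 2 (log 2 n)\<close> in spite of
  the rounding up, and the factor 24.436 then has room for the additive constants.

  The delay bound leaves more slack. A path of depth d multiplies the weight by a multiple of d.
  Three nested paths (over a group, over a block of groups, over a list of such blocks) give about
  log n (log log n)^2; inside a group, one path and Sklansky's circuit give about (log n)^2 log log
  n. Both stay below the admissible cube of log n log log n, and the spare powers absorb the
  constants.

  Dualising a path requires that g implies p in each of its pairs. Therefore each propagate input is
  first replaced by g or p, and every block that becomes part of a further path is closed in the
  same way.\<close>

fun shift_expr :: "nat \<Rightarrow> expr \<Rightarrow> expr" where
  "shift_expr m (Var i) = Var i"
| "shift_expr m Nil_expr = Nil_expr"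
| "shift_expr m (Cons_expr a b) = Cons_expr (shift_expr m a) (shift_expr m b)"
| "shift_expr m (Hd a) = Hd (shift_expr m a)"
| "shift_expr m (Tl a) = Tl (shift_expr m a)"
| "shift_expr m (Cond a b c) = Cond (shift_expr m a) (shift_expr m b) (shift_expr m c)"
| "shift_expr m (Call f es) = Call (m + f) (map (shift_expr m) es)"

text \<open>Programs address functions by position, so joining two programs moves the functions of
  the second one, while variables refer to arguments and stay. Neither value nor step count changes,
  and time bounds carry over exactly.\<close>

lemma eval_shift:
  "eval prog env e v t \<Longrightarrow>
     eval (pre @ map (shift_expr (length pre)) prog @ post) env (shift_expr (length pre) e) v t"
  "evals prog env es vs t \<Longrightarrow>
     evals (pre @ map (shift_expr (length pre)) prog @ post) env (map (shift_expr (length pre)) es) vs t"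
proof (induction rule: eval_evals.inducts)
  case (eval_Call f env es vs t v t')
  have "(pre @ map (shift_expr (length pre)) prog @ post) ! (length pre + f)
      = shift_expr (length pre) (prog ! f)"
    using eval_Call by (simp add: nth_append)
  then show ?case
    using eval_Call eval_evals.eval_Call[of "length pre + f" "pre @ map (shift_expr (length pre)) prog @ post"]
    by simp
qed (auto intro: eval_evals.intros[simplified])

lemma eval_append:
  "eval prog env e v t \<Longrightarrow> eval (prog @ post) env e v t"
  "evals prog env es vs t \<Longrightarrow> evals (prog @ post) env es vs t"
proof (induction rule: eval_evals.inducts)
  case (eval_Call f env es vs t v t')
  then show ?case using eval_evals.eval_Call[of f "prog @ post"] by (simp add: nth_append)
qed (auto intro: eval_evals.intros[simplified])

text \<open>A power of \<open>N i + 2\<close> in place of a polynomial: one exponent covers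
  constants, since the base is at least 2, and products just add exponents.\<close>

definition poly_bounded :: "'w set \<Rightarrow> ('w \<Rightarrow> nat) \<Rightarrow> ('w \<Rightarrow> nat) \<Rightarrow> bool" where
  "poly_bounded I N T \<longleftrightarrow> (\<exists>k. \<forall>i\<in>I. T i \<le> (N i + 2) ^ k)"

lemma poly_boundedI: "(\<And>i. i \<in> I \<Longrightarrow> T i \<le> (N i + 2) ^ k) \<Longrightarrow> poly_bounded I N T"
  by (auto simp: poly_bounded_def)

lemma poly_bounded_mono:
  assumes "poly_bounded I N T" "\<And>i. i \<in> I' \<Longrightarrow> i \<in> I" "\<And>i. i \<in> I' \<Longrightarrow> T' i \<le> T i"
  shows "poly_bounded I' N T'"
proof -
  obtain k where "\<forall>i\<in>I. T i \<le> (N i + 2) ^ k" using assms(1) by (auto simp: poly_bounded_def)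
  then show ?thesis using assms(2,3) by (intro poly_boundedI[where k = k]) (meson le_trans)
qed

lemma poly_bounded_const [intro]: "poly_bounded I N (\<lambda>_. c)"
proof (rule poly_boundedI)
  fix i :: 'a
  have "c \<le> 2 ^ c" by (simp add: less_imp_le)
  also have "\<dots> \<le> (N i + 2) ^ c" by (intro power_mono) auto
  finally show "c \<le> (N i + 2) ^ c" .
qed

lemma poly_bounded_id [intro]: "poly_bounded I N N"
  by (rule poly_boundedI[where k = 1]) auto

lemma poly_bounded_mult [intro]:
  assumes "poly_bounded I N S" "poly_bounded I N T"
  shows "poly_bounded I N (\<lambda>i. S i * T i)"
proof -
  obtain a b where "\<forall>i\<in>I. S i \<le> (N i + 2) ^ a" "\<forall>i\<in>I. T i \<le> (N i + 2) ^ b"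
    using assms by (auto simp: poly_bounded_def)
  then show ?thesis
    by (intro poly_boundedI[where k = "a + b"]) (auto simp: power_add intro!: mult_mono)
qed

text \<open>Reduced to products by S + T \<le> (S + 1) (T + 1).\<close>

lemma poly_bounded_add [intro]:
  assumes "poly_bounded I N S" "poly_bounded I N T"
  shows "poly_bounded I N (\<lambda>i. S i + T i)"
proof -
  have "poly_bounded I N (\<lambda>i. S i + 1)" if S: "poly_bounded I N S" for S
  proof -
    from S obtain a where a: "\<forall>i\<in>I. S i \<le> (N i + 2) ^ a"
      by (auto simp: poly_bounded_def)
    show ?thesis
    proof (rule poly_boundedI[where k = "Suc a"])
      fix i assume "i \<in> I"
      have "(1::nat) \<le> (N i + 2) ^ a" by simp
      then have "S i + 1 \<le> (N i + 2) ^ a + (N i + 2) ^ a"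
        using a \<open>i \<in> I\<close> by (intro add_mono) auto
      then show "S i + 1 \<le> (N i + 2) ^ Suc a" by (simp add: add_mult_distrib)
    qed
  qed
  from this[OF assms(1)] this[OF assms(2)]
  have "poly_bounded I N (\<lambda>i. (S i + 1) * (T i + 1))" by (rule poly_bounded_mult)
  then show ?thesis by (rule poly_bounded_mono) auto
qed

lemma poly_bounded_Suc [intro]: "poly_bounded I N T \<Longrightarrow> poly_bounded I N (\<lambda>i. Suc (T i))"
  using poly_bounded_add[OF _ poly_bounded_const, of I N T 1] by simp

lemma poly_bounded_power [intro]: "poly_bounded I N T \<Longrightarrow> poly_bounded I N (\<lambda>i. T i ^ k)"
  by (induction k) (auto intro: poly_bounded_mult)

lemma poly_bounded_reindex:
  assumes "poly_bounded I N T" "poly_bounded I' N' (\<lambda>i. N (\<phi> i))" "\<And>i. i \<in> I' \<Longrightarrow> \<phi> i \<in> I"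
  shows "poly_bounded I' N' (\<lambda>i. T (\<phi> i))"
proof -
  obtain k where k: "\<forall>i\<in>I. T i \<le> (N i + 2) ^ k" using assms(1) by (auto simp: poly_bounded_def)
  have "poly_bounded I' N' (\<lambda>i. (N (\<phi> i) + 2) ^ k)"
    using assms(2) by (intro poly_bounded_power poly_bounded_add poly_bounded_const) auto
  then show ?thesis by (rule poly_bounded_mono) (use k assms(3) in auto)
qed

text \<open>\<open>PT I N G v\<close>: one program computes \<open>v i\<close> from the values \<open>g i\<close> of the families \<open>g\<close> in
  \<open>G\<close>, for all \<open>i \<in> I\<close>, in time polynomial in \<open>N i\<close>. Elementary operations have unit cost
  whatever the size of their arguments, so that only the lengths of loops need to be bounded.\<close>

definition PT :: "'w set \<Rightarrow> ('w \<Rightarrow> nat) \<Rightarrow> ('w \<Rightarrow> sexp) list \<Rightarrow> ('w \<Rightarrow> sexp) \<Rightarrow> bool" where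
  "PT I N G v \<longleftrightarrow> (\<exists>prog e T. poly_bounded I N T \<and>
     (\<forall>i\<in>I. \<exists>t\<le>T i. eval prog (map (\<lambda>g. g i) G) e (v i) t))"

definition PTs :: "'w set \<Rightarrow> ('w \<Rightarrow> nat) \<Rightarrow> ('w \<Rightarrow> sexp) list \<Rightarrow> ('w \<Rightarrow> sexp) list \<Rightarrow> bool" where
  "PTs I N G vs \<longleftrightarrow> (\<exists>prog es T. poly_bounded I N T \<and>
     (\<forall>i\<in>I. \<exists>t\<le>T i. evals prog (map (\<lambda>g. g i) G) es (map (\<lambda>g. g i) vs) t))"

lemma PTE:
  assumes "PT I N G v"
  obtains prog e T where "poly_bounded I N T"
    "\<And>i. i \<in> I \<Longrightarrow> \<exists>t\<le>T i. eval prog (map (\<lambda>g. g i) G) e (v i) t"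
  using assms unfolding PT_def by blast

lemma PTsE:
  assumes "PTs I N G vs"
  obtains prog es T where "poly_bounded I N T"
    "\<And>i. i \<in> I \<Longrightarrow> \<exists>t\<le>T i. evals prog (map (\<lambda>g. g i) G) es (map (\<lambda>g. g i) vs) t"
  using assms unfolding PTs_def by blast

lemma PT_cong:
  assumes "\<And>i. i \<in> I \<Longrightarrow> v i = v' i" "PT I N G v'"
  shows "PT I N G v"
  using assms unfolding PT_def by auto

lemma PT_subset: "PT I N G v \<Longrightarrow> I' \<subseteq> I \<Longrightarrow> PT I' N G v"
proof -
  assume *: "PT I N G v" "I' \<subseteq> I"
  obtain prog e T where 1: "poly_bounded I N T"
    "\<And>i. i \<in> I \<Longrightarrow> \<exists>t\<le>T i. eval prog (map (\<lambda>g. g i) G) e (v i) t"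
    by (rule PTE[OF *(1)], rule that)
  have "poly_bounded I' N T" by (rule poly_bounded_mono[OF 1(1)]) (use *(2) in auto)
  then show ?thesis unfolding PT_def using 1(2) *(2) by blast
qed

lemma PT_nth:
  assumes "m < length G"
  shows "PT I N G (\<lambda>i. (G ! m) i)"
proof -
  have "\<exists>t\<le>1. eval [] (map (\<lambda>g. g i) G) (Var m) ((G ! m) i) t" for i
    using eval_Var[of m "map (\<lambda>g. g i) G" "[]"] assms by auto
  then show ?thesis unfolding PT_def using poly_bounded_const by blast
qed

lemma PT_var: "v \<in> set G \<Longrightarrow> PT I N G v"
  using PT_nth by (metis in_set_conv_nth)

lemma PT_Leaf: "PT I N G (\<lambda>_. Leaf)"
  unfolding PT_def
  by (intro exI[of _ "[]"] exI[of _ Nil_expr] exI[of _ "\<lambda>_. 1"]) (auto intro: eval_Nil[simplified])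

lemma PT_unary:
  assumes "PT I N G u"
    and "\<And>prog env e v t. eval prog env e v t \<Longrightarrow> eval prog env (op e) (f v) (t + 1)"
  shows "PT I N G (\<lambda>i. f (u i))"
proof -
  obtain prog e T where *: "poly_bounded I N T"
      "\<And>i. i \<in> I \<Longrightarrow> \<exists>t\<le>T i. eval prog (map (\<lambda>g. g i) G) e (u i) t"
    by (rule PTE[OF assms(1)], rule that)
  show ?thesis unfolding PT_def
    by (intro exI[of _ prog] exI[of _ "op e"] exI[of _ "\<lambda>i. T i + 1"] conjI ballI)
       (use * assms(2) in \<open>auto, metis Suc_le_mono\<close>)
qed

lemma PT_Hd: "PT I N G u \<Longrightarrow> PT I N G (\<lambda>i. sexp_hd (u i))"
  by (rule PT_unary[where op = Hd]) (auto intro: eval_Hd[simplified])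

lemma PT_Tl: "PT I N G u \<Longrightarrow> PT I N G (\<lambda>i. sexp_tl (u i))"
  by (rule PT_unary[where op = Tl]) (auto intro: eval_Tl[simplified])

lemma PT_imp_PTs: "PT I N G v \<Longrightarrow> PTs I N G [v]"
proof -
  assume *: "PT I N G v"
  obtain prog e T where *: "poly_bounded I N T"
      "\<And>i. i \<in> I \<Longrightarrow> \<exists>t\<le>T i. eval prog (map (\<lambda>g. g i) G) e (v i) t"
    by (rule PTE[OF *], rule that)
  have "evals prog env [e] [v] t" if "eval prog env e v t" for env v t
    using evals_Cons[OF that evals_Nil] by simp
  then show ?thesis using * unfolding PTs_def
    by (intro exI[of _ prog] exI[of _ "[e]"] exI[of _ T]) fastforce
qed

lemma PTs_Nil: "PTs I N G []"
  unfolding PTs_def by (intro exI[of _ "[]"] exI[of _ "\<lambda>_. 0"]) (auto intro: evals_Nil)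

lemma evals_append:
  "evals prog env es vs t \<Longrightarrow> evals prog env es' vs' t' \<Longrightarrow> evals prog env (es @ es') (vs @ vs') (t + t')"
proof (induction es arbitrary: vs t)
  case Nil
  then show ?case by (auto elim: eval_elims)
next
  case (Cons e es)
  from Cons.prems(1) obtain v ws t1 t2 where
    *: "eval prog env e v t1" "evals prog env es ws t2" "vs = v # ws" "t = t1 + t2"
    by (auto elim: eval_elims)
  show ?case
    using evals_Cons[OF *(1) Cons.IH[OF *(2) Cons.prems(2)]] * by (simp add: add.assoc)
qed

lemma PTs_append:
  assumes "PTs I N G us" "PTs I N G vs"
  shows "PTs I N G (us @ vs)"
proof -
  obtain p1 e1 T1 where 1: "poly_bounded I N T1"
      "\<And>i. i \<in> I \<Longrightarrow> \<exists>t\<le>T1 i. evals p1 (map (\<lambda>g. g i) G) e1 (map (\<lambda>g. g i) us) t"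
    by (rule PTsE[OF assms(1)], rule that)
  obtain p2 e2 T2 where 2: "poly_bounded I N T2"
      "\<And>i. i \<in> I \<Longrightarrow> \<exists>t\<le>T2 i. evals p2 (map (\<lambda>g. g i) G) e2 (map (\<lambda>g. g i) vs) t"
    by (rule PTsE[OF assms(2)], rule that)
  let ?p = "p1 @ map (shift_expr (length p1)) p2 @ []"
  have "\<exists>t\<le>T1 i + T2 i. evals ?p (map (\<lambda>g. g i) G) (e1 @ map (shift_expr (length p1)) e2)
      (map (\<lambda>g. g i) (us @ vs)) t" if i: "i \<in> I" for i
  proof -
    obtain t1 where t1: "t1 \<le> T1 i" "evals p1 (map (\<lambda>g. g i) G) e1 (map (\<lambda>g. g i) us) t1"
      using 1(2)[OF i] by auto
    obtain t2 where t2: "t2 \<le> T2 i" "evals p2 (map (\<lambda>g. g i) G) e2 (map (\<lambda>g. g i) vs) t2"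
      using 2(2)[OF i] by auto
    have "evals ?p (map (\<lambda>g. g i) G) e1 (map (\<lambda>g. g i) us) t1"
      using eval_append(2)[OF t1(2), of "map (shift_expr (length p1)) p2"] by simp
    from evals_append[OF this eval_shift(2)[OF t2(2), of p1 "[]"]]
    show ?thesis using t1(1) t2(1) by (intro exI[of _ "t1 + t2"]) auto
  qed
  moreover have "poly_bounded I N (\<lambda>i. T1 i + T2 i)" using 1(1) 2(1) by auto
  ultimately show ?thesis unfolding PTs_def by blast
qed

lemma PTs_Cons: "PT I N G v \<Longrightarrow> PTs I N G vs \<Longrightarrow> PTs I N G (v # vs)"
  using PTs_append[OF PT_imp_PTs, of I N G v vs] by simp

lemma PTsI: "(\<And>v. v \<in> set vs \<Longrightarrow> PT I N G v) \<Longrightarrow> PTs I N G vs"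
  by (induction vs) (auto intro: PTs_Nil PTs_Cons)

lemma PTs_two:
  assumes "PT I N G u" "PT I N G v"
  obtains prog e1 e2 T1 T2 where
    "poly_bounded I N T1" "\<And>i. i \<in> I \<Longrightarrow> \<exists>t\<le>T1 i. eval prog (map (\<lambda>g. g i) G) e1 (u i) t"
    "poly_bounded I N T2" "\<And>i. i \<in> I \<Longrightarrow> \<exists>t\<le>T2 i. eval prog (map (\<lambda>g. g i) G) e2 (v i) t"
proof -
  obtain p1 e1 T1 where 1: "poly_bounded I N T1"
      "\<And>i. i \<in> I \<Longrightarrow> \<exists>t\<le>T1 i. eval p1 (map (\<lambda>g. g i) G) e1 (u i) t"
    by (rule PTE[OF assms(1)], rule that)
  obtain p2 e2 T2 where 2: "poly_bounded I N T2"
      "\<And>i. i \<in> I \<Longrightarrow> \<exists>t\<le>T2 i. eval p2 (map (\<lambda>g. g i) G) e2 (v i) t"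
    by (rule PTE[OF assms(2)], rule that)
  show thesis
  proof (rule that[of T1 "p1 @ map (shift_expr (length p1)) p2 @ []" e1 T2 "shift_expr (length p1) e2"])
    show "\<exists>t\<le>T1 i. eval (p1 @ map (shift_expr (length p1)) p2 @ []) (map (\<lambda>g. g i) G) e1 (u i) t"
      if "i \<in> I" for i using 1(2)[OF that] eval_append(1) by fastforce
    show "\<exists>t\<le>T2 i. eval (p1 @ map (shift_expr (length p1)) p2 @ []) (map (\<lambda>g. g i) G)
        (shift_expr (length p1) e2) (v i) t"
      if "i \<in> I" for i using 2(2)[OF that] eval_shift(1) by blast
  qed (use 1 2 in auto)
qed

lemma PT_Dot:
  assumes "PT I N G u" "PT I N G v"
  shows "PT I N G (\<lambda>i. Dot (u i) (v i))"
proof -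
  obtain prog e1 e2 T1 T2 where *:
    "poly_bounded I N T1" "\<And>i. i \<in> I \<Longrightarrow> \<exists>t\<le>T1 i. eval prog (map (\<lambda>g. g i) G) e1 (u i) t"
    "poly_bounded I N T2" "\<And>i. i \<in> I \<Longrightarrow> \<exists>t\<le>T2 i. eval prog (map (\<lambda>g. g i) G) e2 (v i) t"
    by (rule PTs_two[OF assms], rule that)
  show ?thesis unfolding PT_def
  proof (intro exI[of _ prog] exI[of _ "Cons_expr e1 e2"] exI[of _ "\<lambda>i. T1 i + T2 i + 1"] conjI ballI)
    fix i assume "i \<in> I"
    then obtain t1 t2 where "t1 \<le> T1 i" "t2 \<le> T2 i"
      "eval prog (map (\<lambda>g. g i) G) e1 (u i) t1" "eval prog (map (\<lambda>g. g i) G) e2 (v i) t2"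
      using * by meson
    then show "\<exists>t\<le>T1 i + T2 i + 1.
        eval prog (map (\<lambda>g. g i) G) (Cons_expr e1 e2) (Dot (u i) (v i)) t"
      by (intro exI[of _ "t1 + t2 + 1"]) (auto intro: eval_Cons[simplified])
  qed (use * in auto)
qed

lemma PT_const: "PT I N G (\<lambda>_. c)"
  by (induction c) (auto intro: PT_Leaf PT_Dot)

lemma eval_split3:
  assumes "PT I1 N G u" "PT I2 N G v" "PT I3 N G w"
  obtains prog e1 e2 e3 T1 T2 T3 where
    "poly_bounded I1 N T1" "\<And>i. i \<in> I1 \<Longrightarrow> \<exists>t\<le>T1 i. eval prog (map (\<lambda>g. g i) G) e1 (u i) t"
    "poly_bounded I2 N T2" "\<And>i. i \<in> I2 \<Longrightarrow> \<exists>t\<le>T2 i. eval prog (map (\<lambda>g. g i) G) e2 (v i) t"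
    "poly_bounded I3 N T3" "\<And>i. i \<in> I3 \<Longrightarrow> \<exists>t\<le>T3 i. eval prog (map (\<lambda>g. g i) G) e3 (w i) t"
proof -
  obtain p1 e1 T1 where 1: "poly_bounded I1 N T1"
      "\<And>i. i \<in> I1 \<Longrightarrow> \<exists>t\<le>T1 i. eval p1 (map (\<lambda>g. g i) G) e1 (u i) t"
    by (rule PTE[OF assms(1)], rule that)
  obtain p2 e2 T2 where 2: "poly_bounded I2 N T2"
      "\<And>i. i \<in> I2 \<Longrightarrow> \<exists>t\<le>T2 i. eval p2 (map (\<lambda>g. g i) G) e2 (v i) t"
    by (rule PTE[OF assms(2)], rule that)
  obtain p3 e3 T3 where 3: "poly_bounded I3 N T3"
      "\<And>i. i \<in> I3 \<Longrightarrow> \<exists>t\<le>T3 i. eval p3 (map (\<lambda>g. g i) G) e3 (w i) t"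
    by (rule PTE[OF assms(3)], rule that)
  define s where "s = length p1"
  define p12 where "p12 = p1 @ map (shift_expr s) p2 @ []"
  define r where "r = length p12"
  define p where "p = p12 @ map (shift_expr r) p3 @ []"
  have ev1: "eval p env e1 x t" if "eval p1 env e1 x t" for env x t
    using eval_append(1)[OF eval_append(1)[OF that]] by (simp add: p_def p12_def)
  have ev2: "eval p env (shift_expr s e2) x t" if "eval p2 env e2 x t" for env x t
    using eval_append(1)[OF eval_shift(1)[OF that, of p1 "[]"]] by (simp add: p_def p12_def s_def)
  have ev3: "eval p env (shift_expr r e3) x t" if "eval p3 env e3 x t" for env x t
    using eval_shift(1)[OF that, of p12 "[]"] by (simp add: p_def r_def)
  show thesis
  proof (rule that[of T1 p e1 T2 "shift_expr s e2" T3 "shift_expr r e3"])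
    show "\<exists>t\<le>T1 i. eval p (map (\<lambda>g. g i) G) e1 (u i) t" if "i \<in> I1" for i
      using 1(2)[OF that] ev1 by blast
    show "\<exists>t\<le>T2 i. eval p (map (\<lambda>g. g i) G) (shift_expr s e2) (v i) t" if "i \<in> I2" for i
      using 2(2)[OF that] ev2 by blast
    show "\<exists>t\<le>T3 i. eval p (map (\<lambda>g. g i) G) (shift_expr r e3) (w i) t" if "i \<in> I3" for i
      using 3(2)[OF that] ev3 by blast
  qed (use 1(1) 2(1) 3(1) in auto)
qed

text \<open>Each branch is required only on the indices that reach it. Partial operations such as
  \<open>hd\<close>, and bounds that fail elsewhere, depend on this.\<close>

lemma PT_if_raw:
  assumes "PT I N G c" "PT {i\<in>I. c i \<noteq> Leaf} N G u" "PT {i\<in>I. c i = Leaf} N G v"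
  shows "PT I N G (\<lambda>i. if c i \<noteq> Leaf then u i else v i)"
proof -
  obtain prog e1 e2 e3 T1 T2 T3 where *:
    "poly_bounded I N T1" "\<And>i. i \<in> I \<Longrightarrow> \<exists>t\<le>T1 i. eval prog (map (\<lambda>g. g i) G) e1 (c i) t"
    "poly_bounded {i\<in>I. c i \<noteq> Leaf} N T2"
    "\<And>i. i \<in> {i\<in>I. c i \<noteq> Leaf} \<Longrightarrow> \<exists>t\<le>T2 i. eval prog (map (\<lambda>g. g i) G) e2 (u i) t"
    "poly_bounded {i\<in>I. c i = Leaf} N T3"
    "\<And>i. i \<in> {i\<in>I. c i = Leaf} \<Longrightarrow> \<exists>t\<le>T3 i. eval prog (map (\<lambda>g. g i) G) e3 (v i) t"
    by (rule eval_split3[OF assms], rule that)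
  define T where "T = (\<lambda>i. T1 i + (if c i \<noteq> Leaf then T2 i else T3 i) + 1)"
  have "poly_bounded I N (\<lambda>i. if c i \<noteq> Leaf then T2 i else T3 i)"
  proof -
    obtain k l where kl: "\<forall>i\<in>{i\<in>I. c i \<noteq> Leaf}. T2 i \<le> (N i + 2) ^ k"
        "\<forall>i\<in>{i\<in>I. c i = Leaf}. T3 i \<le> (N i + 2) ^ l"
      using *(3,5) by (auto simp: poly_bounded_def)
    have "poly_bounded I N (\<lambda>i. (N i + 2) ^ k + (N i + 2) ^ l)"
      by (intro poly_bounded_add poly_bounded_power poly_bounded_id poly_bounded_const)
    then show ?thesis by (rule poly_bounded_mono) (use kl in \<open>auto intro: trans_le_add1 trans_le_add2\<close>)
  qed
  then have T: "poly_bounded I N T" unfolding T_def using *(1) by auto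
  have "\<exists>t\<le>T i. eval prog (map (\<lambda>g. g i) G) (Cond e1 e2 e3) (if c i \<noteq> Leaf then u i else v i) t"
    if i: "i \<in> I" for i
  proof -
    obtain t1 where t1: "t1 \<le> T1 i" "eval prog (map (\<lambda>g. g i) G) e1 (c i) t1"
      using *(2)[OF i] by auto
    show ?thesis
    proof (cases "c i \<noteq> Leaf")
      case True
      then obtain t2 where "t2 \<le> T2 i" "eval prog (map (\<lambda>g. g i) G) e2 (u i) t2"
        using *(4)[of i] i by auto
      then show ?thesis using True t1 eval_Cond_True[of prog _ e1 _ t1 e2 "u i" t2 e3]
        by (intro exI[of _ "t1 + t2 + 1"]) (auto simp: T_def)
    next
      case False
      then obtain t2 where "t2 \<le> T3 i" "eval prog (map (\<lambda>g. g i) G) e3 (v i) t2"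
        using *(6)[of i] i by auto
      then show ?thesis using False t1 eval_Cond_False[of prog _ e1 t1 e3 "v i" t2 e2]
        by (intro exI[of _ "t1 + t2 + 1"]) (auto simp: T_def)
    qed
  qed
  with T show ?thesis unfolding PT_def by blast
qed

text \<open>The subroutine may be verified over its own index set with its own size parameter;
  \<phi> names the instance on which it is called. A function whose recursion needs invariants on
  its arguments can thus be treated in isolation and then be used anywhere.\<close>

lemma PT_call:
  assumes "PT I' N' G' v" "\<And>i. i \<in> I \<Longrightarrow> \<phi> i \<in> I'" "poly_bounded I N (\<lambda>i. N' (\<phi> i))"
    and "PTs I N G (map (\<lambda>g i. g (\<phi> i)) G')"
  shows "PT I N G (\<lambda>i. v (\<phi> i))"
proof -
  obtain p1 e1 T1 where 1: "poly_bounded I' N' T1"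
      "\<And>i. i \<in> I' \<Longrightarrow> \<exists>t\<le>T1 i. eval p1 (map (\<lambda>g. g i) G') e1 (v i) t"
    by (rule PTE[OF assms(1)], rule that)
  obtain p2 es T2 where 2: "poly_bounded I N T2"
      "\<And>i. i \<in> I \<Longrightarrow> \<exists>t\<le>T2 i. evals p2 (map (\<lambda>g. g i) G) es
         (map (\<lambda>g. g i) (map (\<lambda>g i. g (\<phi> i)) G')) t"
    by (rule PTsE[OF assms(4)], rule that)
  define s where "s = length p2"
  define p where "p = p2 @ map (shift_expr s) p1 @ [shift_expr s e1]"
  define T where "T = (\<lambda>i. T2 i + T1 (\<phi> i) + 1)"
  have "poly_bounded I N (\<lambda>i. T1 (\<phi> i))"
    by (rule poly_bounded_reindex[OF 1(1) assms(3,2)])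
  then have "poly_bounded I N T" unfolding T_def using 2(1) by auto
  moreover have "\<exists>t\<le>T i. eval p (map (\<lambda>g. g i) G) (Call (s + length p1) es) (v (\<phi> i)) t"
    if i: "i \<in> I" for i
  proof -
    obtain t1 where t1: "t1 \<le> T1 (\<phi> i)" "eval p1 (map (\<lambda>g. g (\<phi> i)) G') e1 (v (\<phi> i)) t1"
      using 1(2)[OF assms(2)[OF i]] by auto
    obtain t2 where t2: "t2 \<le> T2 i"
      "evals p2 (map (\<lambda>g. g i) G) es (map (\<lambda>g. g (\<phi> i)) G') t2"
      using 2(2)[OF i] by (auto simp: comp_def)
    have "p ! (s + length p1) = shift_expr s e1" by (simp add: p_def s_def nth_append)
    moreover have "eval p (map (\<lambda>g. g (\<phi> i)) G') (shift_expr s e1) (v (\<phi> i)) t1"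
      using eval_shift(1)[OF t1(2), of p2] by (simp add: p_def s_def)
    moreover have "evals p (map (\<lambda>g. g i) G) es (map (\<lambda>g. g (\<phi> i)) G') t2"
      using eval_append(2)[OF t2(2)] by (simp add: p_def)
    ultimately have "eval p (map (\<lambda>g. g i) G) (Call (s + length p1) es) (v (\<phi> i)) (t2 + t1 + 1)"
      by (intro eval_Call) (auto simp: p_def s_def)
    then show ?thesis using t1 t2 by (intro exI[of _ "t2 + t1 + 1"]) (auto simp: T_def)
  qed
  ultimately show ?thesis unfolding PT_def by blast
qed

lemma PT_trans:
  assumes "PT I N G' v" "\<And>g. g \<in> set G' \<Longrightarrow> PT I N G g"
  shows "PT I N G v"
  using PT_call[OF assms(1), of I "\<lambda>i. i" N G] assms(2) by (auto intro: PTsI)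

section \<open>Recursive programs\<close>

lemma evals_Vars: "evals prog env (map Var [0..<length env]) env (length env)"
proof -
  have "evals prog env (map Var [k..<k + length vs]) vs (length vs)"
    if "k + length vs \<le> length env" "vs = take (length vs) (drop k env)" for k vs
    using that
  proof (induction vs arbitrary: k)
    case Nil
    then show ?case by (simp add: evals_Nil)
  next
    case (Cons v vs)
    have k: "k < length env" using Cons.prems by simp
    have v: "v = env ! k" "vs = take (length vs) (drop (Suc k) env)"
      using Cons.prems(2) unfolding Cons_nth_drop_Suc[OF k, symmetric] by simp_all
    have "eval prog env (Var k) v 1" using eval_Var[OF k] v by simp
    from evals_Cons[OF this Cons.IH[of "Suc k"]] Cons.prems(1) v(2) k show ?case
      by (simp add: upt_conv_Cons del: upt_Suc)
  qed
  from this[of 0 env] show ?thesis by simp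
qed

text \<open>Properties that survive placing a program before or behind other functions. Several
  existence statements about programs can then be met by one common program, as a recursive
  definition needs.\<close>

definition embeddable :: "(expr list \<Rightarrow> bool) \<Rightarrow> bool" where
  "embeddable A \<longleftrightarrow> (\<forall>p q. A p \<longrightarrow> A (p @ q)) \<and> (\<forall>p. A p \<longrightarrow> (\<forall>q. A (q @ map (shift_expr (length q)) p)))"

lemma embeddable_conj:
  assumes "embeddable A" "embeddable B" "\<exists>p. A p" "\<exists>p. B p"
  shows "embeddable (\<lambda>p. A p \<and> B p)" "\<exists>p. A p \<and> B p"
  subgoal using assms(1,2) unfolding embeddable_def by blast
  subgoal using assms unfolding embeddable_def by blast
  done

lemma embeddable_eval:
  "embeddable (\<lambda>p. \<exists>e. \<forall>i\<in>I. \<exists>t\<le>T i. eval p (env i) e (v i) t)"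
  "embeddable (\<lambda>p. \<exists>es. \<forall>i\<in>I. \<exists>t\<le>T i. evals p (env i) es (vs i) t)"
proof -
  have 1: "eval p env e x t \<Longrightarrow> eval (p @ q) env e x t"
    "eval p env e x t \<Longrightarrow> eval (q @ map (shift_expr (length q)) p) env (shift_expr (length q) e) x t"
    for p q env e x t
    using eval_append(1) eval_shift(1)[where post = "[]"] by simp_all
  show "embeddable (\<lambda>p. \<exists>e. \<forall>i\<in>I. \<exists>t\<le>T i. eval p (env i) e (v i) t)"
    unfolding embeddable_def
  proof (intro conjI allI impI; elim exE)
    fix p q e assume "\<forall>i\<in>I. \<exists>t\<le>T i. eval p (env i) e (v i) t"
    then show "\<exists>e. \<forall>i\<in>I. \<exists>t\<le>T i. eval (p @ q) (env i) e (v i) t"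
      "\<exists>e. \<forall>i\<in>I. \<exists>t\<le>T i. eval (q @ map (shift_expr (length q)) p) (env i) e (v i) t"
      using 1[of p] by blast+
  qed
  have 2: "evals p env e x t \<Longrightarrow> evals (p @ q) env e x t"
    "evals p env e x t \<Longrightarrow> evals (q @ map (shift_expr (length q)) p) env (map (shift_expr (length q)) e) x t"
    for p q env e x t
    using eval_append(2) eval_shift(2)[where post = "[]"] by simp_all
  show "embeddable (\<lambda>p. \<exists>es. \<forall>i\<in>I. \<exists>t\<le>T i. evals p (env i) es (vs i) t)"
    unfolding embeddable_def
  proof (intro conjI allI impI; elim exE)
    fix p q es assume "\<forall>i\<in>I. \<exists>t\<le>T i. evals p (env i) es (vs i) t"
    then show "\<exists>e. \<forall>i\<in>I. \<exists>t\<le>T i. evals (p @ q) (env i) e (vs i) t"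
      "\<exists>e. \<forall>i\<in>I. \<exists>t\<le>T i. evals (q @ map (shift_expr (length q)) p) (env i) e (vs i) t"
      using 2[of p] by blast+
  qed
qed

text \<open>Recursion with up to two calls, made when the flags \<open>bl\<close> and
  \<open>br\<close> hold; an omitted call contributes \<open>Leaf\<close>. The condition on
  \<open>m\<close> makes \<open>m i\<close> bound the number of calls in the whole recursion tree,
  and since \<open>N\<close> does not increase along calls, each of them costs at most a fixed
  polynomial in the initial \<open>N\<close>.\<close>

lemma PT_rec:
  fixes I :: "'w set"
  assumes bl: "PT I N G (\<lambda>i. enc_bool (bl i))" and br: "PT I N G (\<lambda>i. enc_bool (br i))"
    and l: "\<And>g. g \<in> set G \<Longrightarrow> PT {i\<in>I. bl i} N G (\<lambda>i. g (l i))"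
    and r: "\<And>g. g \<in> set G \<Longrightarrow> PT {i\<in>I. br i} N G (\<lambda>i. g (r i))"
    and step: "PT I N ((\<lambda>i. if bl i then v (l i) else Leaf) #
      (\<lambda>i. if br i then v (r i) else Leaf) # G) v"
    and cl: "\<And>i. i \<in> I \<Longrightarrow> bl i \<Longrightarrow> l i \<in> I \<and> N (l i) \<le> N i"
    and cr: "\<And>i. i \<in> I \<Longrightarrow> br i \<Longrightarrow> r i \<in> I \<and> N (r i) \<le> N i"
    and m: "\<And>i. i \<in> I \<Longrightarrow> (if bl i then m (l i) else 0) + (if br i then m (r i) else 0) < (m i :: nat)"
    and pm: "poly_bounded I N m"
  shows "PT I N G v"
proof -
  define env where "env = (\<lambda>i. map (\<lambda>g. g i) G)"
  \<comment> \<open>The time bound is replaced by a power of \<open>N i + 2\<close>, which is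
    monotone in \<open>N\<close>; an arbitrary bound might grow along the recursion.\<close>
  have "\<exists>k. (\<exists>p e. \<forall>i\<in>I'. \<exists>t\<le>(N i + 2) ^ k. eval p (map (\<lambda>g. g i) G') e (u i) t)"
    if PT': "PT I' N G' u" for I' G' and u :: "'w \<Rightarrow> sexp"
  proof -
    obtain prog e T where 1: "poly_bounded I' N T"
      "\<And>i. i \<in> I' \<Longrightarrow> \<exists>t\<le>T i. eval prog (map (\<lambda>g. g i) G') e (u i) t"
      by (rule PTE[OF PT'], rule that)
    then obtain k where "\<forall>i\<in>I'. T i \<le> (N i + 2) ^ k" by (auto simp: poly_bounded_def)
    then show ?thesis using 1(2) le_trans by blast
  qed
  note ex1 = this
  have ex2: "\<exists>k. (\<exists>p es. \<forall>i\<in>I'. \<exists>t\<le>(N i + 2) ^ k. evals p (map (\<lambda>g. g i) G) es (map (\<lambda>g. g i) us) t)"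
    if PT': "PTs I' N G us" for I' and us :: "('w \<Rightarrow> sexp) list"
  proof -
    obtain prog es T where 1: "poly_bounded I' N T"
      "\<And>i. i \<in> I' \<Longrightarrow> \<exists>t\<le>T i. evals prog (map (\<lambda>g. g i) G) es (map (\<lambda>g. g i) us) t"
      by (rule PTsE[OF PT'], rule that)
    then obtain k where "\<forall>i\<in>I'. T i \<le> (N i + 2) ^ k" by (auto simp: poly_bounded_def)
    then show ?thesis using 1(2) le_trans by blast
  qed
  let ?Il = "{i\<in>I. bl i}" and ?Ir = "{i\<in>I. br i}"
  have jl: "PTs ?Il N G (map (\<lambda>g i. g (l i)) G)" by (rule PTsI) (use l in auto)
  have jr: "PTs ?Ir N G (map (\<lambda>g i. g (r i)) G)" by (rule PTsI) (use r in auto)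
  define sarg where "sarg = (\<lambda>i. [if bl i then v (l i) else Leaf, if br i then v (r i) else Leaf] @ env i)"
  obtain k1 where k1: "\<exists>p e. \<forall>i\<in>I. \<exists>t\<le>(N i + 2) ^ k1. eval p (env i) e (enc_bool (bl i)) t"
    using ex1[OF bl] by (auto simp: env_def)
  obtain k2 where k2: "\<exists>p e. \<forall>i\<in>I. \<exists>t\<le>(N i + 2) ^ k2. eval p (env i) e (enc_bool (br i)) t"
    using ex1[OF br] by (auto simp: env_def)
  obtain k3 where k3: "\<exists>p es. \<forall>i\<in>?Il. \<exists>t\<le>(N i + 2) ^ k3. evals p (env i) es (env (l i)) t"
    using ex2[OF jl] by (auto simp: env_def comp_def)
  obtain k4 where k4: "\<exists>p es. \<forall>i\<in>?Ir. \<exists>t\<le>(N i + 2) ^ k4. evals p (env i) es (env (r i)) t"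
    using ex2[OF jr] by (auto simp: env_def comp_def)
  obtain k5 where k5: "\<exists>p e. \<forall>i\<in>I. \<exists>t\<le>(N i + 2) ^ k5. eval p (sarg i) e (v i) t"
    using ex1[OF step] by (auto simp: env_def sarg_def)
  note c12 = embeddable_conj[OF embeddable_eval(1) embeddable_eval(1) k1 k2]
  note c123 = embeddable_conj[OF c12(1) embeddable_eval(2) c12(2) k3]
  note c1234 = embeddable_conj[OF c123(1) embeddable_eval(2) c123(2) k4]
  note c = embeddable_conj[OF c1234(1) embeddable_eval(1) c1234(2) k5]
  obtain p0 where p0: "((((\<exists>e. \<forall>i\<in>I. \<exists>t\<le>(N i + 2) ^ k1. eval p0 (env i) e (enc_bool (bl i)) t) \<and>
    (\<exists>e. \<forall>i\<in>I. \<exists>t\<le>(N i + 2) ^ k2. eval p0 (env i) e (enc_bool (br i)) t)) \<and>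
    (\<exists>es. \<forall>i\<in>?Il. \<exists>t\<le>(N i + 2) ^ k3. evals p0 (env i) es (env (l i)) t)) \<and>
    (\<exists>es. \<forall>i\<in>?Ir. \<exists>t\<le>(N i + 2) ^ k4. evals p0 (env i) es (env (r i)) t)) \<and>
    (\<exists>e. \<forall>i\<in>I. \<exists>t\<le>(N i + 2) ^ k5. eval p0 (sarg i) e (v i) t)"
    using c(2) by blast
  then obtain e1' e2' es3' es4' e5' where e':
    "\<And>i. i \<in> I \<Longrightarrow> \<exists>t\<le>(N i + 2) ^ k1. eval p0 (env i) e1' (enc_bool (bl i)) t"
    "\<And>i. i \<in> I \<Longrightarrow> \<exists>t\<le>(N i + 2) ^ k2. eval p0 (env i) e2' (enc_bool (br i)) t"
    "\<And>i. i \<in> I \<Longrightarrow> bl i \<Longrightarrow> \<exists>t\<le>(N i + 2) ^ k3. evals p0 (env i) es3' (env (l i)) t"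
    "\<And>i. i \<in> I \<Longrightarrow> br i \<Longrightarrow> \<exists>t\<le>(N i + 2) ^ k4. evals p0 (env i) es4' (env (r i)) t"
    "\<And>i. i \<in> I \<Longrightarrow> \<exists>t\<le>(N i + 2) ^ k5. eval p0 (sarg i) e5' (v i) t"
    by blast
  define n where "n = length G"
  let ?vars = "map Var [0..<n]" and ?sh = "shift_expr 2"
  \<comment> \<open>Function 0 performs the recursive calls and hands their results, with the
    original arguments, to function 1, the combining step. The auxiliary functions start at position
    2, hence the shift by 2.\<close>
  define main where "main = Call 1 (Cond (?sh e1') (Call 0 (map ?sh es3')) Nil_expr #
    Cond (?sh e2') (Call 0 (map ?sh es4')) Nil_expr # ?vars)"
  define p where "p = [main, ?sh e5'] @ map ?sh p0 @ []"
  have sh: "eval p env' (?sh e) x t" if "eval p0 env' e x t" for env' e x t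
    using eval_shift(1)[OF that, of "[main, ?sh e5']" "[]"] by (simp add: p_def numeral_2_eq_2)
  have shs: "evals p env' (map ?sh e) x t" if "evals p0 env' e x t" for env' e x t
    using eval_shift(2)[OF that, of "[main, ?sh e5']" "[]"] by (simp add: p_def numeral_2_eq_2)
  have pn: "p ! 0 = main" "p ! 1 = ?sh e5'" "1 < length p" by (simp_all add: p_def)
  define K where "K = k1 + k2 + k3 + k4 + k5"
  \<comment> \<open>The cost of one call apart from its recursive calls: five auxiliary evaluations
    and the fixed overhead of \<open>main\<close>.\<close>
  define C where "C = (\<lambda>i. 5 * (N i + 2) ^ K + 8 + n)"
  have Kle: "(N i + 2) ^ k \<le> (N i + 2) ^ K" if "k \<le> K" for k i
    using that by (intro power_increasing) auto
  have Cmono: "C i \<le> C i'" if "N i \<le> N i'" for i i'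
    unfolding C_def using that by (intro add_mono mult_mono power_mono) auto
  have main: "\<exists>t\<le>m i * C i. eval p (env i) main (v i) t" if "i \<in> I" for i
    using that
  proof (induction "m i" arbitrary: i rule: less_induct)
    case less
    note i = \<open>i \<in> I\<close>
    have child: "\<exists>t\<le>(if b i then m (h i) else 0) * C i + 2 * (N i + 2) ^ K + 3.
        eval p (env i) (Cond (?sh e) (Call 0 (map ?sh es)) Nil_expr) (if b i then v (h i) else Leaf) t"
      if e: "\<exists>t\<le>(N i + 2) ^ K. eval p0 (env i) e (enc_bool (b i)) t"
        and es: "b i \<Longrightarrow> \<exists>t\<le>(N i + 2) ^ K. evals p0 (env i) es (env (h i)) t"
        and h: "b i \<Longrightarrow> h i \<in> I \<and> N (h i) \<le> N i \<and> m (h i) < m i"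
      for e es b h
    proof -
      obtain t1 where t1: "t1 \<le> (N i + 2) ^ K" "eval p0 (env i) e (enc_bool (b i)) t1"
        using e by blast
      show ?thesis
      proof (cases "b i")
        case True
        then obtain t2 where t2: "t2 \<le> (N i + 2) ^ K" "evals p0 (env i) es (env (h i)) t2"
          using es by blast
        obtain t3 where t3: "t3 \<le> m (h i) * C (h i)" "eval p (env (h i)) main (v (h i)) t3"
          using less.hyps h[OF True] by blast
        have "eval p (env i) (Call 0 (map ?sh es)) (v (h i)) (t2 + t3 + 1)"
          by (rule eval_Call) (use pn shs[OF t2(2)] t3(2) in auto)
        from eval_Cond_True[OF sh[OF t1(2)] _ this, of Nil_expr] True
        have "eval p (env i) (Cond (?sh e) (Call 0 (map ?sh es)) Nil_expr) (v (h i)) (t1 + (t2 + t3 + 1) + 1)"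
          by simp
        moreover have "m (h i) * C (h i) \<le> m (h i) * C i"
          using h[OF True] Cmono by (intro mult_left_mono) auto
        then have "t1 + (t2 + t3 + 1) + 1 \<le> m (h i) * C i + 2 * (N i + 2) ^ K + 3"
          using t1(1) t2(1) t3(1) by linarith
        ultimately show ?thesis using True by (intro exI[of _ "t1 + (t2 + t3 + 1) + 1"]) auto
      next
        case False
        then have "eval p (env i) (?sh e) Leaf t1" using sh[OF t1(2)] by simp
        from eval_Cond_False[OF this eval_Nil] False t1(1) show ?thesis
          by (intro exI[of _ "t1 + 1 + 1"]) auto
      qed
    qed
    have le: "x \<le> (N i + 2) ^ k \<Longrightarrow> k \<le> K \<Longrightarrow> x \<le> (N i + 2) ^ K" for x k
      using Kle le_trans by blast
    have kK: "k1 \<le> K" "k2 \<le> K" "k3 \<le> K" "k4 \<le> K" "k5 \<le> K" by (simp_all add: K_def)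
    have mi: "bl i \<Longrightarrow> m (l i) < m i" "br i \<Longrightarrow> m (r i) < m i"
      using m[OF i] by (auto split: if_splits)
    have "\<exists>t\<le>(if bl i then m (l i) else 0) * C i + 2 * (N i + 2) ^ K + 3.
        eval p (env i) (Cond (?sh e1') (Call 0 (map ?sh es3')) Nil_expr) (if bl i then v (l i) else Leaf) t"
      by (rule child[of e1' bl es3' l])
         (use e'(1)[OF i] e'(3)[OF i] cl[OF i] mi le[OF _ kK(1)] le[OF _ kK(3)] in blast)+
    then obtain tl where tl: "tl \<le> (if bl i then m (l i) else 0) * C i + 2 * (N i + 2) ^ K + 3"
      "eval p (env i) (Cond (?sh e1') (Call 0 (map ?sh es3')) Nil_expr) (if bl i then v (l i) else Leaf) tl"
      by blast
    have "\<exists>t\<le>(if br i then m (r i) else 0) * C i + 2 * (N i + 2) ^ K + 3.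
        eval p (env i) (Cond (?sh e2') (Call 0 (map ?sh es4')) Nil_expr) (if br i then v (r i) else Leaf) t"
      by (rule child[of e2' br es4' r])
         (use e'(2)[OF i] e'(4)[OF i] cr[OF i] mi le[OF _ kK(2)] le[OF _ kK(4)] in blast)+
    then obtain tr where tr: "tr \<le> (if br i then m (r i) else 0) * C i + 2 * (N i + 2) ^ K + 3"
      "eval p (env i) (Cond (?sh e2') (Call 0 (map ?sh es4')) Nil_expr) (if br i then v (r i) else Leaf) tr"
      by blast
    obtain ts where ts: "ts \<le> (N i + 2) ^ K" "eval p0 (sarg i) e5' (v i) ts"
      using e'(5)[OF i] le[OF _ kK(5)] by blast
    have vars: "evals p (env i) ?vars (env i) n" using evals_Vars[of p "env i"] by (simp add: env_def n_def)
    have "evals p (env i) (Cond (?sh e1') (Call 0 (map ?sh es3')) Nil_expr #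
       Cond (?sh e2') (Call 0 (map ?sh es4')) Nil_expr # ?vars) (sarg i) (tl + (tr + n))"
      unfolding sarg_def append.simps by (intro evals_Cons tl(2) tr(2) vars)
    from eval_Call[OF pn(3) this, of "v i" ts] sh[OF ts(2)]
    have "eval p (env i) main (v i) (tl + (tr + n) + ts + 1)" by (simp add: pn(2)[unfolded One_nat_def] main_def)
    moreover have "tl + (tr + n) + ts + 1 \<le> m i * C i"
    proof -
      let ?a = "if bl i then m (l i) else 0" and ?b = "if br i then m (r i) else 0"
      have "tl + (tr + n) + ts + 1 \<le> ?a * C i + ?b * C i + (5 * (N i + 2) ^ K + 7 + n)"
        using tl(1) tr(1) ts(1) by linarith
      also have "\<dots> \<le> ?a * C i + ?b * C i + C i" by (simp add: C_def)
      also have "\<dots> = (?a + ?b + 1) * C i" by (simp add: algebra_simps)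
      also have "\<dots> \<le> m i * C i" using m[OF i] by (intro mult_right_mono) auto
      finally show ?thesis .
    qed
    ultimately show ?case by blast
  qed
  have "poly_bounded I N (\<lambda>i. m i * C i)"
    unfolding C_def using pm by (intro poly_bounded_mult poly_bounded_add poly_bounded_power) auto
  then show ?thesis unfolding PT_def using main unfolding env_def by blast
qed

section \<open>Formulas with arrival times\<close>

datatype 'x trm = In nat 'x | Gt gate_op "'x trm" "'x trm"

fun arr :: "'x trm \<Rightarrow> nat" where
  "arr (In k x) = k"
| "arr (Gt f s t) = Suc (max (arr s) (arr t))"

fun val :: "('x \<Rightarrow> bool) \<Rightarrow> 'x trm \<Rightarrow> bool" where
  "val \<rho> (In k x) = \<rho> x"
| "val \<rho> (Gt f s t) = apply_op f (val \<rho> s) (val \<rho> t)"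

text \<open>A set, because equal subformulas become one gate of the circuit. Gate counts below have
  the form card (gates - U), where U holds gates that are already paid for, so that shared parts are
  charged once.\<close>

fun gates :: "'x trm \<Rightarrow> 'x trm set" where
  "gates (In k x) = {}"
| "gates (Gt f s t) = insert (Gt f s t) (gates s \<union> gates t)"

lemma finite_gates [simp]: "finite (gates t)"
  by (induction t) auto

fun dual :: "gate_op \<Rightarrow> gate_op" where
  "dual AND = OR"
| "dual OR = AND"

lemma dual_dual [simp]: "dual (dual f) = f"
  by (cases f) auto

definition neutral :: "gate_op \<Rightarrow> bool" where
  "neutral f \<longleftrightarrow> f = AND"

lemma apply_op_neutral [simp]:
  "apply_op f (neutral f) x = x" "apply_op f x (neutral f) = x"
  by (cases f; simp add: neutral_def)+

lemma apply_op_assoc: "apply_op f (apply_op f x y) z = apply_op f x (apply_op f y z)"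
  by (cases f) auto

lemma apply_op_left_commute: "apply_op f x (apply_op f y z) = apply_op f y (apply_op f x z)"
  by (cases f) auto

text \<open>A wire is a formula together with a bound for its arrival time, up to a common offset.\<close>

type_synonym 'x wire = "nat \<times> 'x trm"

definition weight :: "(nat \<times> 'a) list \<Rightarrow> nat" where
  "weight xs = (\<Sum>x\<leftarrow>xs. 2 ^ fst x)"

lemma weight_simps [simp]:
  "weight [] = 0" "weight (x # xs) = 2 ^ fst x + weight xs" "weight (xs @ ys) = weight xs + weight ys"
  by (auto simp: weight_def)

lemma weight_pos: "xs \<noteq> [] \<Longrightarrow> 0 < weight xs"
  by (cases xs) auto

lemma weight_mono_mem: "x \<in> set xs \<Longrightarrow> 2 ^ fst x \<le> weight xs"
  by (induction xs) auto

definition fold_op :: "gate_op \<Rightarrow> ('x \<Rightarrow> bool) \<Rightarrow> 'x wire list \<Rightarrow> bool" where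
  "fold_op f \<rho> ws = foldr (\<lambda>w. apply_op f (val \<rho> (snd w))) ws (neutral f)"

lemma fold_op_simps [simp]:
  "fold_op f \<rho> [] = neutral f"
  "fold_op f \<rho> (w # ws) = apply_op f (val \<rho> (snd w)) (fold_op f \<rho> ws)"
  by (auto simp: fold_op_def)

lemma fold_op_append: "fold_op f \<rho> (us @ vs) = apply_op f (fold_op f \<rho> us) (fold_op f \<rho> vs)"
  by (induction us) (auto simp: apply_op_assoc)

definition wire_gates :: "'x wire list \<Rightarrow> 'x trm set" where
  "wire_gates ws = (\<Union>w\<in>set ws. gates (snd w))"

lemma wire_gates_simps [simp]:
  "wire_gates [] = {}" "wire_gates (w # ws) = gates (snd w) \<union> wire_gates ws"
  "wire_gates (us @ vs) = wire_gates us \<union> wire_gates vs"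
  by (auto simp: wire_gates_def)

lemma finite_wire_gates [simp]: "finite (wire_gates ws)"
  by (simp add: wire_gates_def)


section \<open>Huffman trees\<close>

definition merge :: "gate_op \<Rightarrow> 'x wire \<Rightarrow> 'x wire \<Rightarrow> 'x wire" where
  "merge f v w = (Suc (max (fst v) (fst w)), Gt f (snd v) (snd w))"

text \<open>Huffman's algorithm with max + 1, instead of the sum, as the key of a merged wire: the
  list is kept sorted and its two earliest wires are joined.\<close>

function huffman :: "gate_op \<Rightarrow> 'x wire list \<Rightarrow> 'x wire" where
  "huffman f ws = (if length ws \<le> 1 then hd ws
     else huffman f (insort_key fst (merge f (hd ws) (hd (tl ws))) (tl (tl ws))))"
  by auto
termination by (relation "Wellfounded.measure (\<lambda>(f, ws). length ws)") auto

declare huffman.simps [simp del]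

lemma huffman_simps [simp]:
  "huffman f [w] = w"
  "huffman f (v # w # ws) = huffman f (insort_key fst (merge f v w) ws)"
  by (simp_all add: huffman.simps[of f "[w]"] huffman.simps[of f "v # w # ws"])

definition tree :: "gate_op \<Rightarrow> 'x wire list \<Rightarrow> 'x wire" where
  "tree f ws = huffman f (sort_key fst ws)"

lemma huffman_induct [consumes 1, case_names one two]:
  assumes "ws \<noteq> []" "\<And>w. P [w]"
    "\<And>v w ws. P (insort_key fst (merge f v w) ws) \<Longrightarrow> P (v # w # ws)"
  shows "P ws"
  using assms(1)
proof (induction "length ws" arbitrary: ws rule: less_induct)
  case less
  show ?case
  proof (cases ws)
    case (Cons v vs)
    then show ?thesis
      using assms(2) assms(3)[of v "hd vs" "tl vs"] less(1)[of "insort_key fst (merge f v (hd vs)) (tl vs)"]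
      by (cases vs) (auto simp: insort_not_Nil)
  qed (use less in auto)
qed

lemma weight_mset: "mset xs = mset ys \<Longrightarrow> weight xs = weight ys"
  unfolding weight_def sum_mset_sum_list[symmetric] mset_map by simp

lemma weight_insort [simp]: "weight (insort_key f x xs) = 2 ^ fst x + weight xs"
  using weight_mset[of "insort_key f x xs" "x # xs"] by simp

lemma weight_sort [simp]: "weight (sort_key f xs) = weight xs"
  using weight_mset[of "sort_key f xs" xs] by simp

lemma fold_op_insort [simp]:
  "fold_op f \<rho> (insort_key g w ws) = apply_op f (val \<rho> (snd w)) (fold_op f \<rho> ws)"
  by (induction ws) (auto simp: apply_op_left_commute)

lemma fold_op_sort [simp]: "fold_op f \<rho> (sort_key g ws) = fold_op f \<rho> ws"
  by (induction ws) auto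

lemma val_merge [simp]: "val \<rho> (snd (merge f v w)) = apply_op f (val \<rho> (snd v)) (val \<rho> (snd w))"
  by (simp add: merge_def)

lemma sort_key_Nil_iff [simp]: "sort_key f xs = [] \<longleftrightarrow> xs = []"
  by (metis length_0_conv length_sort)

lemma val_tree: "ws \<noteq> [] \<Longrightarrow> val \<rho> (snd (tree f ws)) = fold_op f \<rho> ws"
proof -
  have "ws \<noteq> [] \<Longrightarrow> val \<rho> (snd (huffman f ws)) = fold_op f \<rho> ws" for ws :: "'a wire list"
    by (induction rule: huffman_induct[where f = f]) (auto simp: apply_op_assoc)
  from this[of "sort_key fst ws"] show "ws \<noteq> [] \<Longrightarrow> ?thesis"
    by (simp add: tree_def)
qed

text \<open>When the two least exponents are merged, all other weights are multiples of the second one,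
  so the sum stays below the power of two.\<close>

lemma huffman_le:
  "ws \<noteq> [] \<Longrightarrow> sorted (map fst ws) \<Longrightarrow> weight ws \<le> 2 ^ d \<Longrightarrow> fst (huffman f ws) \<le> d"
proof (induction rule: huffman_induct[where f = f])
  case (one w)
  then show ?case by (simp add: power_increasing_iff)
next
  case (two v w ws)
  let ?b = "fst w"
  have s: "fst v \<le> ?b" "\<forall>x\<in>set ws. ?b \<le> fst x" "sorted (map fst ws)" using two.prems(1) by auto
  have b: "?b < d"
  proof (rule ccontr)
    assume "\<not> ?b < d"
    then have "(2::nat) ^ d \<le> 2 ^ ?b" by (intro power_increasing) auto
    moreover have "(0::nat) < 2 ^ fst v" by simp
    ultimately show False using two.prems(2) unfolding weight_simps by linarith
  qed
  have "(2::nat) ^ ?b dvd weight ws" using s(2) by (induction ws) (auto simp: le_imp_power_dvd)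
  then obtain q where q: "weight ws = 2 ^ ?b * q" by (auto simp: dvd_def)
  have d: "(2::nat) ^ d = 2 ^ ?b * 2 ^ (d - ?b)" using b by (simp flip: power_add)
  have "(0::nat) < 2 ^ fst v" by simp
  then have "2 ^ ?b + 2 ^ ?b * q < 2 ^ d"
    using two.prems(2) q unfolding weight_simps by linarith
  then have "2 ^ ?b * (1 + q) < 2 ^ ?b * 2 ^ (d - ?b)" using d by (simp add: algebra_simps)
  then have "1 + q < 2 ^ (d - ?b)" by (simp only: mult_less_cancel1)
  \<comment> \<open>Integrality: all remaining weights are multiples of \<open>2 ^ ?b\<close>, so a
    strict inequality leaves room for a full unit, and \<open>v\<close> may be charged as if its
    exponent were that of \<open>w\<close>.\<close>
  then have "2 + q \<le> 2 ^ (d - ?b)" by linarith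
  then have "2 ^ ?b * (2 + q) \<le> 2 ^ d" using d by (metis mult_le_mono2)
  then have "weight (insort_key fst (merge f v w) ws) \<le> 2 ^ d"
    using s(1) q by (simp add: merge_def max_def algebra_simps)
  moreover have "sorted (map fst (insort_key fst (merge f v w) ws))"
    using s(3) by (simp add: sorted_insort_key)
  ultimately show ?case using two.IH by simp
qed

lemma tree_le: "ws \<noteq> [] \<Longrightarrow> weight ws \<le> 2 ^ d \<Longrightarrow> fst (tree f ws) \<le> d"
  unfolding tree_def by (rule huffman_le) auto

lemma ex_power2_between:
  assumes "0 < (n::nat)"
  obtains d where "n \<le> 2 ^ d" "2 ^ d < 2 * n"
proof -
  define d where "d = (LEAST d. n \<le> 2 ^ d)"
  have "n \<le> 2 ^ n" by (simp add: less_imp_le)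
  then have 1: "n \<le> 2 ^ d" unfolding d_def by (rule LeastI)
  have "2 ^ d < 2 * n"
  proof (cases d)
    case (Suc e)
    then have "\<not> n \<le> 2 ^ e" unfolding d_def by (metis lessI not_less_Least)
    then show ?thesis using Suc by simp
  qed (use assms in auto)
  with 1 show thesis by (rule that)
qed

lemma tree_weight: "ws \<noteq> [] \<Longrightarrow> 2 ^ fst (tree f ws) < 2 * weight ws"
proof -
  assume ws: "ws \<noteq> []"
  then obtain d where d: "weight ws \<le> 2 ^ d" "2 ^ d < 2 * weight ws"
    using ex_power2_between[of "weight ws"] weight_pos by blast
  have "(2::nat) ^ fst (tree f ws) \<le> 2 ^ d"
    using tree_le[OF ws d(1)] by (intro power_increasing) auto
  then show ?thesis using d(2) by (rule le_less_trans)
qed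

definition valid :: "nat \<Rightarrow> 'x wire \<Rightarrow> bool" where
  "valid b w \<longleftrightarrow> arr (snd w) \<le> b + fst w"

lemma valid_merge: "valid b v \<Longrightarrow> valid b w \<Longrightarrow> valid b (merge f v w)"
  by (auto simp: valid_def merge_def)

lemma valid_tree: "ws \<noteq> [] \<Longrightarrow> \<forall>w\<in>set ws. valid b w \<Longrightarrow> valid b (tree f ws)"
proof -
  have "ws \<noteq> [] \<Longrightarrow> \<forall>w\<in>set ws. valid b w \<Longrightarrow> valid b (huffman f ws)" for ws :: "'a wire list"
    by (induction rule: huffman_induct[where f = f]) (auto simp: valid_merge set_insort_key)
  from this[of "sort_key fst ws"] show "ws \<noteq> [] \<Longrightarrow> \<forall>w\<in>set ws. valid b w \<Longrightarrow> ?thesis"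
    by (simp add: tree_def)
qed

lemma card_insert_diff_le: "finite A \<Longrightarrow> card (insert x A - U) \<le> Suc (card (A - U))"
  by (cases "x \<in> U") (auto simp: insert_Diff_if card_insert_if)

lemma card_Un_diff_le: "card (A \<union> B - U) \<le> card (A - U) + card (B - U)"
  by (metis Un_Diff card_Un_le)

lemma wire_gates_insort [simp]: "wire_gates (insort_key g w ws) = gates (snd w) \<union> wire_gates ws"
  by (auto simp: wire_gates_def set_insort_key)

lemma wire_gates_sort [simp]: "wire_gates (sort_key g ws) = wire_gates ws"
  by (simp add: wire_gates_def)

text \<open>A tree over k wires adds at most k - 1 gates to those of the wires; the 1 stands on the
  left to avoid a subtraction.\<close>

lemma gates_tree:
  "ws \<noteq> [] \<Longrightarrow> card (gates (snd (tree f ws)) - U) + 1 \<le> card (wire_gates ws - U) + length ws"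
proof -
  have *: "ws \<noteq> [] \<Longrightarrow> card (gates (snd (huffman f ws)) - U) + 1 \<le> card (wire_gates ws - U) + length ws"
    for ws :: "'a wire list"
  proof (induction rule: huffman_induct[where f = f])
    case (two v w ws)
    have "wire_gates (insort_key fst (merge f v w) ws) =
        insert (snd (merge f v w)) (wire_gates (v # w # ws))"
      by (auto simp: merge_def)
    then have "card (wire_gates (insort_key fst (merge f v w) ws) - U) \<le> Suc (card (wire_gates (v # w # ws) - U))"
      using card_insert_diff_le[of "wire_gates (v # w # ws)" "snd (merge f v w)" U]
      by (simp del: wire_gates_simps wire_gates_insort add: finite_wire_gates)
    then show ?case using two by simp
  qed auto
  from *[of "sort_key fst ws"] show "ws \<noteq> [] \<Longrightarrow> ?thesis"
    by (simp add: tree_def)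
qed


section \<open>And-or paths\<close>

text \<open>An item \<open>(k, u, v)\<close> stands for the map sending \<open>x\<close> to \<open>u \<circ> (v \<circ>' x)\<close>, where \<open>\<circ>\<close> is the
  operation \<open>f\<close> and \<open>\<circ>'\<close> its dual; the exponent \<open>k\<close> bounds the arrival times of both formulas.
  If \<open>u \<circ> v = v\<close>, this equals \<open>v \<circ>' (u \<circ> x)\<close>, so that exchanging \<open>u\<close> and \<open>v\<close> dualises.\<close>

type_synonym 'x item = "nat \<times> 'x trm \<times> 'x trm"

definition swap :: "'x item \<Rightarrow> 'x item" where
  "swap x = (fst x, snd (snd x), fst (snd x))"

definition wire1 :: "'x item \<Rightarrow> 'x wire" where
  "wire1 x = (fst x, fst (snd x))"

definition wire2 :: "'x item \<Rightarrow> 'x wire" where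
  "wire2 x = (fst x, snd (snd x))"

lemma fst_swap [simp]: "fst (swap x) = fst x" "fst (wire1 x) = fst x" "fst (wire2 x) = fst x"
  by (simp_all add: swap_def wire1_def wire2_def)

lemma swap_swap [simp]: "swap (swap x) = x" "wire1 (swap x) = wire2 x" "wire2 (swap x) = wire1 x"
  by (simp_all add: swap_def wire1_def wire2_def)

lemma weight_map [simp]:
  "weight (map swap xs) = weight xs" "weight (map wire1 xs) = weight xs" "weight (map wire2 xs) = weight xs"
  by (induction xs) auto

fun chain :: "gate_op \<Rightarrow> ('x \<Rightarrow> bool) \<Rightarrow> 'x item list \<Rightarrow> bool \<Rightarrow> bool" where
  "chain f \<rho> [] r = r"
| "chain f \<rho> (x # xs) r =
     apply_op f (val \<rho> (snd (wire1 x))) (apply_op (dual f) (val \<rho> (snd (wire2 x))) (chain f \<rho> xs r))"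

definition consistent :: "gate_op \<Rightarrow> ('x \<Rightarrow> bool) \<Rightarrow> 'x item \<Rightarrow> bool" where
  "consistent f \<rho> x \<longleftrightarrow>
     apply_op f (val \<rho> (snd (wire1 x))) (val \<rho> (snd (wire2 x))) = val \<rho> (snd (wire2 x))"

lemma consistent_swap: "consistent f \<rho> x \<Longrightarrow> consistent (dual f) \<rho> (swap x)"
  by (cases f) (auto simp: consistent_def)

text \<open>This turns the part of a path behind the pivot into an instance of the same construction
  for the dual operation.\<close>

lemma chain_swap:
  "\<forall>x\<in>set xs. consistent f \<rho> x \<Longrightarrow> chain (dual f) \<rho> (map swap xs) r = chain f \<rho> xs r"
proof (induction xs)
  case (Cons x xs)
  then show ?case by (cases f) (auto simp: consistent_def)
qed auto

text \<open>The remainder of a path influences the result only through all second formulas before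
  it. Ending the front part with the neutral element and combining it with one separate term for the
  remainder allows both to be computed in parallel.\<close>

lemma chain_append:
  "chain f \<rho> (xs @ ys) r = apply_op f (chain f \<rho> xs (neutral f))
     (apply_op (dual f) (fold_op (dual f) \<rho> (map wire2 xs)) (chain f \<rho> ys r))"
proof (induction xs)
  case Nil
  then show ?case by (cases f) (auto simp: neutral_def)
next
  case (Cons x xs)
  then show ?case by (cases f) auto
qed

text \<open>The largest j with 2 W(j) + c W(j - 1) \<le> r, where W(j) is the weight of the first j
  items; the two lemmas below state that it fits and that it is maximal. Truncated subtraction is
  harmless, since at remainder 0 no further item passes the test.\<close>

fun cut :: "nat \<Rightarrow> nat \<Rightarrow> 'x item list \<Rightarrow> nat" where
  "cut c r [] = 0"
| "cut c r (x # xs) = (if 2 * 2 ^ fst x \<le> r then Suc (cut c (r - (c + 2) * 2 ^ fst x) xs) else 0)"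

lemma cut_le: "cut c r xs \<le> length xs"
  by (induction c r xs rule: cut.induct) auto

lemma cut_fits:
  "0 < cut c r xs \<Longrightarrow> 2 * weight (take (cut c r xs) xs) + c * weight (take (cut c r xs - 1) xs) \<le> r"
proof (induction c r xs rule: cut.induct)
  case (2 c r x xs)
  then have x: "2 * 2 ^ fst x \<le> r" by (auto split: if_splits)
  show ?case
  proof (cases "cut c (r - (c + 2) * 2 ^ fst x) xs")
    case 0
    then show ?thesis using x by simp
  next
    case (Suc j)
    then have IH: "2 * weight (take (Suc j) xs) + c * weight (take j xs) \<le> r - (c + 2) * 2 ^ fst x"
      using 2(1)[OF x] by simp
    have "0 < weight (take (Suc j) xs)"
      using Suc cut_le[of c "r - (c + 2) * 2 ^ fst x" xs] by (intro weight_pos) auto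
    then have "2 * weight (take (Suc j) xs) + c * weight (take j xs) + (c + 2) * 2 ^ fst x \<le> r"
      using IH by linarith
    then show ?thesis using x Suc by (simp add: algebra_simps)
  qed
qed auto

lemma cut_maximal:
  "cut c r xs < length xs \<Longrightarrow>
     r < 2 * weight (take (Suc (cut c r xs)) xs) + c * weight (take (cut c r xs) xs)"
proof (induction c r xs rule: cut.induct)
  case (2 c r x xs)
  show ?case
  proof (cases "2 * 2 ^ fst x \<le> r")
    case True
    then have *: "cut c r (x # xs) = Suc (cut c (r - (c + 2) * 2 ^ fst x) xs)" by simp
    have "r - (c + 2) * 2 ^ fst x < 2 * weight (take (Suc (cut c (r - (c + 2) * 2 ^ fst x) xs)) xs) +
        c * weight (take (cut c (r - (c + 2) * 2 ^ fst x) xs) xs)"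
      using 2(1)[OF True] 2(2) * by simp
    then show ?thesis unfolding * by (simp add: algebra_simps)
  qed auto
qed auto

text \<open>\<open>pieces f e d s xs\<close> is a list of wires whose combination by \<open>f\<close> is the path \<open>xs\<close>, ended by
  the neutral element of \<open>f\<close> if \<open>e\<close> holds and of its dual otherwise. Their total weight is at most
  \<open>2 ^ d - s\<close>. The path is cut at a pivot item with formulas \<open>u\<close>, \<open>v\<close>: with \<open>V\<close> the dual
  combination of the second formulas before the pivot, the pieces are \<open>V \<circ>' u\<close>, those of the part
  before the pivot, and the single wire \<open>V \<circ>' v \<circ>' rest\<close>, which gets half of the available
  weight.\<close>

fun pieces :: "gate_op \<Rightarrow> bool \<Rightarrow> nat \<Rightarrow> nat \<Rightarrow> 'x item list \<Rightarrow> 'x wire list" where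
  "pieces f e 0 s xs = []"
| "pieces f e (Suc d) s xs = (if xs = [] then [] else
     (let j = cut (3 * d + 2) (2 ^ d - s) xs in
      if j = 0 then pieces f e d (s - 2 ^ d) xs else
      (let L = take (j - 1) xs; x = xs ! (j - 1); R = drop j xs; W = weight (take j xs) in
       tree (dual f) (wire1 x # map wire2 L) # pieces f True d (s + 2 * W) L @
       (if R = [] \<and> e then [] else
         [tree (dual f) (wire2 x # map wire2 L @ pieces (dual f) (\<not> e) d W (map swap R))]))))"

declare pieces.simps(2) [simp del]

lemma pieces_Nil [simp]: "pieces f e d s [] = []"
  by (cases d) (auto simp: pieces.simps)

text \<open>\<open>s\<close> is the part of the budget \<open>2 ^ d\<close> that is reserved for
  other pieces. The slope 3 is what one step needs: going from \<open>d + 1\<close> to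
  \<open>d\<close> releases three times the weight. With W the weight up to and including the pivot,
  2 W pays for the first tree and W for the wires merged into the rear tree.\<close>

definition fits :: "nat \<Rightarrow> nat \<Rightarrow> 'x item list \<Rightarrow> bool" where
  "fits d s xs \<longleftrightarrow> s + (3 * d + 2) * weight xs \<le> 2 ^ d"

lemma fits_swap [simp]: "fits d s (map swap xs) = fits d s xs"
  by (simp add: fits_def)

text \<open>A nonempty path has weight at least 1, and 4 is the least \<open>d\<close> with 3 d + 2
  \<le> 2 ^ d. The term d - 3 in the gate counts comes from here.\<close>

lemma fits_ge: 
  assumes "fits d s xs" "xs \<noteq> []" shows "4 \<le> d"
proof (rule ccontr)
  assume "\<not> 4 \<le> d"
  moreover have "3 * d + 2 \<le> 2 ^ d"
  proof -
    have "3 * d + 2 \<le> (3 * d + 2) * weight xs"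
      using mult_le_mono2[of 1 "weight xs" "3 * d + 2"] weight_pos[OF assms(2)] by simp
    then show ?thesis using assms(1) by (simp add: fits_def)
  qed
  moreover have "d = 0 \<or> d = 1 \<or> d = 2 \<or> d = 3" if "d < 4" using that by linarith
  ultimately show False by auto
qed

text \<open>Let X be the weight of \<open>xs\<close> and W that of its first j items. The assumption
  says s + (3 d + 5) X \<le> 2 * 2 ^ d, and maximality of the cut says that s + (3 d + 4) W plus
  twice the weight of the next item exceeds 2 ^ d. Subtracting leaves enough for the rest with
  reserve W. For j = 0 the same subtraction shows that the whole path fits into depth d.\<close>

lemma cut_fits_rest:
  assumes f: "fits (Suc d) s xs" and ne: "xs \<noteq> []" and j: "j = cut (3 * d + 2) (2 ^ d - s) xs"
  shows "j = 0 \<Longrightarrow> fits d (s - 2 ^ d) xs"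
    and "0 < j \<Longrightarrow> s + 2 * weight (take j xs) + (3 * d + 2) * weight (take (j - 1) xs) \<le> 2 ^ d"
    and "0 < j \<Longrightarrow> fits d (weight (take j xs)) (drop j xs)"
proof -
  have inv: "s + (3 * d + 5) * weight xs \<le> 2 * 2 ^ d"
    using f by (simp add: fits_def algebra_simps)
  show "fits d (s - 2 ^ d) xs" if "j = 0"
  \<comment> \<open>The reserve is taken from one of the two halves of \<open>2 ^ Suc d\<close>;
    only its excess over that half is passed on.\<close>
  proof (cases "s < 2 ^ d")
    case less: True
    obtain x ys where xs: "xs = x # ys" using ne by (cases xs) auto
    have "2 ^ d - s < 2 * 2 ^ fst x"
      using cut_maximal[of "3 * d + 2" "2 ^ d - s" xs] that xs by (simp add: j del: cut.simps)
    then have "2 ^ d < s + 2 * weight xs" using less xs by simp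
    then have "(3 * d + 2) * weight xs \<le> 2 ^ d" using inv by (simp add: algebra_simps)
    then show ?thesis using less by (simp add: fits_def)
  next
    case False
    then show ?thesis using inv by (simp add: fits_def algebra_simps)
  qed
  let ?W = "weight (take j xs)"
  assume pos: "0 < j"
  have jle: "j \<le> length xs" unfolding j by (rule cut_le)
  have "2 * ?W + (3 * d + 2) * weight (take (j - 1) xs) \<le> 2 ^ d - s"
    using cut_fits[of "3 * d + 2" "2 ^ d - s" xs] pos unfolding j[symmetric] by simp
  moreover have "0 < ?W" using pos ne by (intro weight_pos) auto
  ultimately show A: "s + 2 * ?W + (3 * d + 2) * weight (take (j - 1) xs) \<le> 2 ^ d" by linarith
  show "fits d ?W (drop j xs)"
  proof (cases "drop j xs")
    case Nil
    then show ?thesis using A by (simp add: fits_def)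
  next
    case R': (Cons y R')
    then have "j < length xs" by (metis drop_all linorder_not_less list.distinct(1))
    then have "2 ^ d - s < 2 * weight (take (Suc j) xs) + (3 * d + 2) * ?W"
      using cut_maximal[of "3 * d + 2" "2 ^ d - s" xs] unfolding j[symmetric] by simp
    moreover have "take (Suc j) xs = take j xs @ [y]"
      using \<open>j < length xs\<close> R' by (simp add: take_Suc_conv_app_nth Cons_nth_drop_Suc[symmetric])
    ultimately have "2 ^ d - s < 2 * ?W + 2 * 2 ^ fst y + (3 * d + 2) * ?W" by simp
    moreover have "weight xs = ?W + 2 ^ fst y + weight R'"
      using arg_cong[OF append_take_drop_id[of j xs, unfolded R'], of weight] by simp
    ultimately show ?thesis using inv A R' by (simp add: fits_def algebra_simps)
  qed
qed

text \<open>Value, weight, arrival times and gate count of \<open>pieces\<close> are four inductions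
  along the same case distinction. The recursive results appear as arbitrary lists
  \<open>ws1\<close> and \<open>ws2\<close>, and empty parts are separate cases because
  \<open>P\<close> is available for nonempty paths only.\<close>

lemma pieces_induct [consumes 2, case_names skip split]:
  fixes P :: "gate_op \<Rightarrow> bool \<Rightarrow> nat \<Rightarrow> nat \<Rightarrow> 'x item list \<Rightarrow> 'x wire list \<Rightarrow> bool"
  assumes "fits d s xs" "xs \<noteq> []"
    and skip: "\<And>f e d s xs ws. fits d (s - 2 ^ d) xs \<Longrightarrow> xs \<noteq> [] \<Longrightarrow>
      weight xs + s \<le> 2 ^ Suc d \<Longrightarrow> P f e d (s - 2 ^ d) xs ws \<Longrightarrow> P f e (Suc d) s xs ws"
    and split: "\<And>f e d s L x R W ws1 ws2. fits d (s + 2 * W) L \<Longrightarrow> fits d W R \<Longrightarrow>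
      W = weight L + 2 ^ fst x \<Longrightarrow> s + 2 * W + (3 * d + 2) * weight L \<le> 2 ^ d \<Longrightarrow> 3 \<le> d \<Longrightarrow>
      (L = [] \<and> ws1 = []) \<or> (L \<noteq> [] \<and> P f True d (s + 2 * W) L ws1) \<Longrightarrow>
      (R = [] \<and> ws2 = []) \<or> (R \<noteq> [] \<and> P (dual f) (\<not> e) d W (map swap R) ws2) \<Longrightarrow>
      P f e (Suc d) s (L @ x # R) (tree (dual f) (wire1 x # map wire2 L) # ws1 @
       (if R = [] \<and> e then [] else [tree (dual f) (wire2 x # map wire2 L @ ws2)]))"
  shows "P f e d s xs (pieces f e d s xs)"
  using assms(1,2)
proof (induction d arbitrary: f e s xs)
  case 0
  then show ?case using fits_ge[OF 0] by simp
next
  case (Suc d)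
  have d: "3 \<le> d" using fits_ge[OF Suc.prems] by simp
  define j where "j = cut (3 * d + 2) (2 ^ d - s) xs"
  have inv: "s + (3 * d + 5) * weight xs \<le> 2 * 2 ^ d"
    using Suc.prems(1) by (simp add: fits_def algebra_simps)
  show ?case
  proof (cases "j = 0")
    case True
    have "fits d (s - 2 ^ d) xs" by (rule cut_fits_rest(1)[OF Suc.prems j_def True])
    moreover have "pieces f e (Suc d) s xs = pieces f e d (s - 2 ^ d) xs"
      using Suc.prems(2) True by (simp add: pieces.simps(2) j_def)
    moreover have "weight xs + s \<le> 2 ^ Suc d" using inv by (simp add: algebra_simps)
    ultimately show ?thesis using skip Suc.IH Suc.prems(2) by simp
  next
    case False
    define L where "L = take (j - 1) xs"
    define x where "x = xs ! (j - 1)"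
    define R where "R = drop j xs"
    define W where "W = weight (take j xs)"
    have jle: "j \<le> length xs" unfolding j_def by (rule cut_le)
    have xs: "xs = L @ x # R"
      using False jle id_take_nth_drop[of "j - 1" xs] by (simp add: L_def x_def R_def)
    have "take j xs = L @ [x]"
      using take_Suc_conv_app_nth[of "j - 1" xs] False jle by (simp add: L_def x_def)
    then have W: "W = weight L + 2 ^ fst x" by (simp add: W_def)
    have A: "s + 2 * W + (3 * d + 2) * weight L \<le> 2 ^ d"
      using cut_fits_rest(2)[OF Suc.prems j_def] False by (simp add: W_def L_def)
    then have fL: "fits d (s + 2 * W) L" by (simp add: fits_def)
    have fR: "fits d W R"
      using cut_fits_rest(3)[OF Suc.prems j_def] False by (simp add: W_def R_def)
    have eq: "pieces f e (Suc d) s xs = tree (dual f) (wire1 x # map wire2 L) # pieces f True d (s + 2 * W) L @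
       (if R = [] \<and> e then [] else
         [tree (dual f) (wire2 x # map wire2 L @ pieces (dual f) (\<not> e) d W (map swap R))])"
      using Suc.prems(2) False unfolding pieces.simps(2) Let_def j_def[symmetric]
      by (simp add: L_def x_def R_def W_def)
    have 1: "(L = [] \<and> pieces f True d (s + 2 * W) L = []) \<or>
        (L \<noteq> [] \<and> P f True d (s + 2 * W) L (pieces f True d (s + 2 * W) L))"
      using Suc.IH[OF fL] by (cases "L = []") auto
    have 2: "(R = [] \<and> pieces (dual f) (\<not> e) d W (map swap R) = []) \<or>
        (R \<noteq> [] \<and> P (dual f) (\<not> e) d W (map swap R) (pieces (dual f) (\<not> e) d W (map swap R)))"
      using Suc.IH[of W "map swap R" "dual f" "\<not> e"] fR by (cases "R = []") auto
    have "P f e (Suc d) s (L @ x # R) (pieces f e (Suc d) s xs)"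
      unfolding eq
      by (rule split[OF fL fR W A d 1 2])
    then show ?thesis using xs by simp
  qed
qed

lemma pieces_fold:
  assumes "fits d s xs" "xs \<noteq> []" "\<forall>x\<in>set xs. consistent f \<rho> x"
  shows "fold_op f \<rho> (pieces f e d s xs) = chain f \<rho> xs (neutral (if e then f else dual f))"
proof -
  define P where "P = (\<lambda>f e (d::nat) (s::nat) xs ws. (\<forall>x\<in>set xs. consistent f \<rho> x) \<longrightarrow>
    fold_op f \<rho> ws = chain f \<rho> xs (neutral (if e then f else dual f)))"
  have "P f e d s xs (pieces f e d s xs)"
    using assms(1,2)
  proof (rule pieces_induct[where P = P])
    fix f e d s ws and xs :: "'a item list"
    assume "P f e d (s - 2 ^ d) xs ws"
    then show "P f e (Suc d) s xs ws" unfolding P_def .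
  next
    fix f e d s W ws1 ws2 and L R :: "'a item list" and x :: "'a item"
    assume ih1: "(L = [] \<and> ws1 = []) \<or> (L \<noteq> [] \<and> P f True d (s + 2 * W) L ws1)"
      and ih2: "(R = [] \<and> ws2 = []) \<or> (R \<noteq> [] \<and> P (dual f) (\<not> e) d W (map swap R) ws2)"
    show "P f e (Suc d) s (L @ x # R) (tree (dual f) (wire1 x # map wire2 L) # ws1 @
       (if R = [] \<and> e then [] else [tree (dual f) (wire2 x # map wire2 L @ ws2)]))"
      unfolding P_def
    proof (intro impI)
      assume c: "\<forall>x\<in>set (L @ x # R). consistent f \<rho> x"
      define r where "r = neutral (if e then f else dual f)"
      have 1: "fold_op f \<rho> ws1 = chain f \<rho> L (neutral f)" using ih1 c by (auto simp: P_def)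
      \<comment> \<open>For \<open>R = []\<close> and \<open>e\<close> the path ends in the neutral
        element of \<open>f\<close>, which absorbs under the dual operation. The rear wire would
        then contribute nothing and is left out, so this case is excluded.\<close>
      have 2: "fold_op (dual f) \<rho> ws2 = chain f \<rho> R r" if "\<not> (R = [] \<and> e)"
      proof (cases "R = []")
        case True
        then show ?thesis using ih2 that by (auto simp: r_def)
      next
        case False
        then have "fold_op (dual f) \<rho> ws2 = chain (dual f) \<rho> (map swap R) (neutral (if \<not> e then dual f else f))"
          using ih2 c by (auto simp: P_def consistent_swap)
        then show ?thesis using c by (simp add: chain_swap r_def)
      qed
      show "fold_op f \<rho> (tree (dual f) (wire1 x # map wire2 L) # ws1 @
         (if R = [] \<and> e then [] else [tree (dual f) (wire2 x # map wire2 L @ ws2)])) =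
         chain f \<rho> (L @ x # R) (neutral (if e then f else dual f))"
        unfolding chain_append r_def[symmetric] using 1 2
        by (cases f; cases "R = [] \<and> e") (auto simp: val_tree fold_op_append neutral_def r_def)
    qed
  qed
  then show ?thesis using assms(3) by (simp add: P_def)
qed

text \<open>With W the weight up to and including the pivot, the budget \<open>2 ^ Suc d - s\<close>
  splits into 2 W for the first tree, \<open>2 ^ d - s - 2 * W\<close> for the pieces of the front
  part and \<open>2 ^ d\<close> for the rear wire. The rear pieces weigh at most
  \<open>2 ^ d - W\<close>, so that their tree can take in wires of weight W.\<close>

lemma pieces_weight:
  assumes "fits d s xs" "xs \<noteq> []"
  shows "weight (pieces f e d s xs) + s \<le> 2 ^ d" "pieces f e d s xs \<noteq> []"
proof -
  define P where "P = (\<lambda>(f::gate_op) (e::bool) (d::nat) s (xs :: 'a item list) (ws :: 'a wire list).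
    weight ws + s \<le> 2 ^ d \<and> ws \<noteq> [])"
  have "P f e d s xs (pieces f e d s xs)"
    using assms
  proof (rule pieces_induct[where P = P])
    fix f e d s ws and xs :: "'a item list"
    assume "P f e d (s - 2 ^ d) xs ws"
    then have "weight ws + (s - 2 ^ d) \<le> 2 ^ d" "ws \<noteq> []" by (simp_all add: P_def)
    then have "weight ws + s \<le> 2 ^ Suc d" unfolding power_Suc by linarith
    with \<open>ws \<noteq> []\<close> show "P f e (Suc d) s xs ws" by (simp add: P_def)
  next
    fix f e d s W ws1 ws2 and L R :: "'a item list" and x :: "'a item"
    assume W: "W = weight L + 2 ^ fst x" and A: "s + 2 * W + (3 * d + 2) * weight L \<le> 2 ^ d"
      and ih1: "(L = [] \<and> ws1 = []) \<or> (L \<noteq> [] \<and> P f True d (s + 2 * W) L ws1)"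
      and ih2: "(R = [] \<and> ws2 = []) \<or> (R \<noteq> [] \<and> P (dual f) (\<not> e) d W (map swap R) ws2)"
    have "2 ^ fst (tree (dual f) (wire1 x # map wire2 L)) < 2 * W"
      using tree_weight[of "wire1 x # map wire2 L" "dual f"] W by simp
    moreover have "weight ws1 + (s + 2 * W) \<le> 2 ^ d"
      using ih1 A by (auto simp: P_def)
    moreover have "2 ^ fst (tree (dual f) (wire2 x # map wire2 L @ ws2)) \<le> (2::nat) ^ d"
    proof (intro power_increasing tree_le)
      show "weight (wire2 x # map wire2 L @ ws2) \<le> 2 ^ d" using ih2 A W by (auto simp: P_def)
    qed auto
    ultimately show "P f e (Suc d) s (L @ x # R) (tree (dual f) (wire1 x # map wire2 L) # ws1 @
       (if R = [] \<and> e then [] else [tree (dual f) (wire2 x # map wire2 L @ ws2)]))"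
      unfolding P_def weight_simps power_Suc by (auto simp del: power_increasing_iff)
  qed
  then show "weight (pieces f e d s xs) + s \<le> 2 ^ d" "pieces f e d s xs \<noteq> []" by (simp_all add: P_def)
qed

lemma pieces_valid:
  assumes "fits d s xs" "xs \<noteq> []" "\<forall>x\<in>set xs. valid b (wire1 x) \<and> valid b (wire2 x)"
  shows "\<forall>w\<in>set (pieces f e d s xs). valid b w"
proof -
  define P where "P = (\<lambda>(f::gate_op) (e::bool) (d::nat) (s::nat) (xs :: 'a item list) (ws :: 'a wire list).
    (\<forall>x\<in>set xs. valid b (wire1 x) \<and> valid b (wire2 x)) \<longrightarrow> (\<forall>w\<in>set ws. valid b w))"
  have "P f e d s xs (pieces f e d s xs)"
    using assms(1,2)
  proof (rule pieces_induct[where P = P])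
    fix f e d s ws and xs :: "'a item list"
    assume "P f e d (s - 2 ^ d) xs ws"
    then show "P f e (Suc d) s xs ws" unfolding P_def .
  next
    fix f e d s W ws1 ws2 and L R :: "'a item list" and x :: "'a item"
    assume ih1: "(L = [] \<and> ws1 = []) \<or> (L \<noteq> [] \<and> P f True d (s + 2 * W) L ws1)"
      and ih2: "(R = [] \<and> ws2 = []) \<or> (R \<noteq> [] \<and> P (dual f) (\<not> e) d W (map swap R) ws2)"
    show "P f e (Suc d) s (L @ x # R) (tree (dual f) (wire1 x # map wire2 L) # ws1 @
       (if R = [] \<and> e then [] else [tree (dual f) (wire2 x # map wire2 L @ ws2)]))"
      unfolding P_def
    proof (intro impI)
      assume "\<forall>x\<in>set (L @ x # R). valid b (wire1 x) \<and> valid b (wire2 x)"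
      then have v: "\<forall>w\<in>set (wire1 x # map wire2 L). valid b w" "\<forall>w\<in>set ws1. valid b w"
        "\<forall>w\<in>set (wire2 x # map wire2 L @ ws2). valid b w"
        using ih1 ih2 by (auto simp: P_def)
      then show "\<forall>w\<in>set (tree (dual f) (wire1 x # map wire2 L) # ws1 @
         (if R = [] \<and> e then [] else [tree (dual f) (wire2 x # map wire2 L @ ws2)])). valid b w"
        using valid_tree[OF _ v(1)] valid_tree[OF _ v(3)] by auto
    qed
  qed
  then show ?thesis using assms(3) by (simp add: P_def)
qed

text \<open>The number of pieces is counted along, because joining them in a tree costs about one
  gate each. A cut charges two gates to every item up to the pivot and nothing to the items behind
  it: two trees over the front part, and two new wires charged to the pivot.\<close>

lemma pieces_gates:
  assumes "fits d s xs" "xs \<noteq> []" "\<forall>x\<in>set xs. gates (snd (wire1 x)) \<subseteq> U \<and> gates (snd (wire2 x)) \<subseteq> U"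
  shows "card (wire_gates (pieces f e d s xs) - U) + length (pieces f e d s xs) \<le> 2 * (d - 3) * length xs"
proof -
  define P where "P = (\<lambda>(f::gate_op) (e::bool) (d::nat) (s::nat) (xs :: 'a item list) (ws :: 'a wire list).
    (\<forall>x\<in>set xs. gates (snd (wire1 x)) \<subseteq> U \<and> gates (snd (wire2 x)) \<subseteq> U) \<longrightarrow>
    card (wire_gates ws - U) + length ws \<le> 2 * (d - 3) * length xs)"
  have "P f e d s xs (pieces f e d s xs)"
    using assms(1,2)
  proof (rule pieces_induct[where P = P])
    fix f e d s ws and xs :: "'a item list"
    assume "P f e d (s - 2 ^ d) xs ws"
    moreover have "2 * (d - 3) * length xs \<le> 2 * (Suc d - 3) * length xs" by (intro mult_le_mono) auto
    ultimately show "P f e (Suc d) s xs ws" unfolding P_def using le_trans by blast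
  next
    fix f e d s W ws1 ws2 and L R :: "'a item list" and x :: "'a item"
    assume d: "3 \<le> d"
      and ih1: "(L = [] \<and> ws1 = []) \<or> (L \<noteq> [] \<and> P f True d (s + 2 * W) L ws1)"
      and ih2: "(R = [] \<and> ws2 = []) \<or> (R \<noteq> [] \<and> P (dual f) (\<not> e) d W (map swap R) ws2)"
    show "P f e (Suc d) s (L @ x # R) (tree (dual f) (wire1 x # map wire2 L) # ws1 @
       (if R = [] \<and> e then [] else [tree (dual f) (wire2 x # map wire2 L @ ws2)]))"
      unfolding P_def
    proof (intro impI)
      assume U: "\<forall>x\<in>set (L @ x # R). gates (snd (wire1 x)) \<subseteq> U \<and> gates (snd (wire2 x)) \<subseteq> U"
      let ?t1 = "tree (dual f) (wire1 x # map wire2 L)"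
      let ?t2 = "tree (dual f) (wire2 x # map wire2 L @ ws2)"
      have L: "wire_gates (map wire2 L) \<subseteq> U" using U by (auto simp: wire_gates_def)
      have e1: "wire_gates (wire1 x # map wire2 L) - U = {}" using U L by auto
      have 1: "card (gates (snd ?t1) - U) \<le> length L"
        using gates_tree[of "wire1 x # map wire2 L" "dual f" U] unfolding e1 by simp
      have e2: "wire_gates (wire2 x # map wire2 L @ ws2) - U = wire_gates ws2 - U" using U L by auto
      have 2: "card (gates (snd ?t2) - U) \<le> length L + (card (wire_gates ws2 - U) + length ws2)"
        using gates_tree[of "wire2 x # map wire2 L @ ws2" "dual f" U] unfolding e2 by simp
      have 3: "card (wire_gates ws1 - U) + length ws1 \<le> 2 * (d - 3) * length L"
        using ih1 U by (auto simp: P_def)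
      have 4: "card (wire_gates ws2 - U) + length ws2 \<le> 2 * (d - 3) * length R"
        using ih2 U by (auto simp: P_def)
      let ?tl = "if R = [] \<and> e then [] else [?t2]"
      have "card (wire_gates ?tl - U) + length ?tl \<le> length L + 2 * (d - 3) * length R + 1"
        using 2 4 by auto
      moreover have "card (wire_gates (?t1 # ws1 @ ?tl) - U) \<le>
          card (gates (snd ?t1) - U) + (card (wire_gates ws1 - U) + card (wire_gates ?tl - U))"
        unfolding wire_gates_simps
        by (rule order_trans[OF card_Un_diff_le add_left_mono[OF card_Un_diff_le]])
      ultimately have "card (wire_gates (?t1 # ws1 @ ?tl) - U) + length (?t1 # ws1 @ ?tl) \<le>
          2 * length L + 2 + 2 * (d - 3) * length L + 2 * (d - 3) * length R"
        using 1 3 by simp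
      also have "\<dots> \<le> 2 * (Suc d - 3) * length (L @ x # R)"
      proof -
        obtain m where "d = 3 + m" using d le_Suc_ex by blast
        then show ?thesis by (simp add: algebra_simps)
      qed
      finally show "card (wire_gates (?t1 # ws1 @ ?tl) - U) + length (?t1 # ws1 @ ?tl) \<le>
          2 * (Suc d - 3) * length (L @ x # R)" .
    qed
  qed
  then show ?thesis using assms(3) by (simp add: P_def)
qed

section \<open>Carry computation for short blocks\<close>

type_synonym 'x pair = "'x trm \<times> 'x trm"

text \<open>A pair \<open>(g, p)\<close> maps the incoming carry \<open>c\<close> to \<open>g \<or> (p \<and> c)\<close>. Lists of pairs start at the
  least significant position, except for the argument of \<open>path\<close>.\<close>

definition sem :: "('x \<Rightarrow> bool) \<Rightarrow> 'x pair \<Rightarrow> bool \<Rightarrow> bool" where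
  "sem \<rho> p c \<longleftrightarrow> val \<rho> (fst p) \<or> (val \<rho> (snd p) \<and> c)"

definition ready :: "'x pair \<Rightarrow> nat" where
  "ready p = max (arr (fst p)) (arr (snd p))"

definition pair_gates :: "'x pair list \<Rightarrow> 'x trm set" where
  "pair_gates ps = (\<Union>p\<in>set ps. gates (fst p) \<union> gates (snd p))"

lemma pair_gates_simps [simp]:
  "pair_gates [] = {}" "pair_gates (p # ps) = gates (fst p) \<union> gates (snd p) \<union> pair_gates ps"
  "pair_gates (ps @ qs) = pair_gates ps \<union> pair_gates qs" "pair_gates (rev ps) = pair_gates ps"
  by (auto simp: pair_gates_def)

lemma finite_pair_gates [simp]: "finite (pair_gates ps)"
  by (simp add: pair_gates_def)

lemma pair_gates_mono: "set ps \<subseteq> set qs \<Longrightarrow> pair_gates ps \<subseteq> pair_gates qs"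
  by (auto simp: pair_gates_def)

definition pair_weight :: "'x pair list \<Rightarrow> nat" where
  "pair_weight ps = (\<Sum>p\<leftarrow>ps. 2 ^ ready p)"

lemma pair_weight_simps [simp]:
  "pair_weight [] = 0" "pair_weight (p # ps) = 2 ^ ready p + pair_weight ps"
  "pair_weight (ps @ qs) = pair_weight ps + pair_weight qs" "pair_weight (rev ps) = pair_weight ps"
  by (auto simp: pair_weight_def rev_map[symmetric] sum_list_rev)

lemma pair_weight_mem: "p \<in> set ps \<Longrightarrow> 2 ^ ready p \<le> pair_weight ps"
  by (induction ps) auto

section \<open>Offset, depth and delay of a path\<close>

definition items :: "nat \<Rightarrow> 'x pair list \<Rightarrow> 'x item list" where
  "items b ps = map (\<lambda>p. (ready p - b, p)) ps"

text \<open>Times are measured from an offset, with earlier ones rounded up to it. The least offset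
  that makes the weight linear in the number of pairs is chosen, so that the depth is bounded by the
  length alone. By minimality, the bound 8 means that the rounding costs a factor of at most 9 /
  7.\<close>

definition base :: "'x pair list \<Rightarrow> nat" where
  "base ps = (LEAST b. weight (items b ps) \<le> 8 * length ps)"

definition depth :: "nat \<Rightarrow> nat" where
  "depth W = (LEAST d. (3 * d + 2) * W \<le> 2 ^ d)"

definition path_of :: "'x item list \<Rightarrow> 'x trm" where
  "path_of xs = snd (tree OR (pieces OR True (depth (weight xs)) 0 xs))"

definition path :: "'x pair list \<Rightarrow> 'x trm" where
  "path ps = path_of (items (base ps) ps)"

lemma length_items [simp]: "length (items b ps) = length ps"
  by (simp add: items_def)

lemma weight_items_large: "weight (items (pair_weight ps) ps) = length ps"
proof -
  have "weight (items b qs) = length qs" if "\<forall>p\<in>set qs. ready p \<le> b" for b and qs :: "'a pair list"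
    using that by (induction qs) (auto simp: items_def)
  moreover have "ready p \<le> pair_weight ps" if "p \<in> set ps" for p
    using pair_weight_mem[OF that] less_exp[of "ready p"] by linarith
  ultimately show ?thesis by blast
qed

lemma weight_base: "weight (items (base ps) ps) \<le> 8 * length ps"
  unfolding base_def by (rule LeastI[of _ "pair_weight ps"]) (simp add: weight_items_large)

lemma linear_le_power: "6 * k + 20 \<le> (2::nat) ^ (k + 5)"
proof (induction k)
  case (Suc k)
  then show ?case unfolding add_Suc power_Suc mult_Suc_right by linarith
qed auto

lemma depth_exists: "\<exists>d. (3 * d + 2) * W \<le> (2::nat) ^ d"
proof -
  \<comment> \<open>The witness 2 W + 6 turns the linear factor into 6 W + 20, which is at most 2 ^
    (W + 5), while W \<le> 2 ^ W.\<close>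
  have "(3 * (2 * W + 6) + 2) * W \<le> 2 ^ (W + 5) * 2 ^ W"
    using linear_le_power[of W] by (intro mult_le_mono) (auto simp: less_imp_le)
  also have "\<dots> \<le> 2 ^ (2 * W + 6)" by (simp flip: power_add)
  finally show ?thesis by blast
qed

lemma depth_fits: "(3 * depth W + 2) * W \<le> 2 ^ depth W"
  unfolding depth_def using depth_exists by (rule LeastI_ex)

lemma depth_le: "(3 * D + 2) * (8 * n) \<le> 2 ^ D \<Longrightarrow> W \<le> 8 * n \<Longrightarrow> depth W \<le> D"
  unfolding depth_def by (rule Least_le) (meson le_trans mult_le_mono2)

lemma depth_less:
  assumes "0 < W"
  shows "0 < depth W" "2 ^ depth W < 2 * (3 * depth W - 1) * W"
proof -
  show pos: "0 < depth W" using depth_fits[of W] assms by (cases "depth W") auto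
  then obtain e where e: "depth W = Suc e" by (cases "depth W") auto
  have "\<not> (3 * e + 2) * W \<le> 2 ^ e"
    using not_less_Least[of e "\<lambda>d. (3 * d + 2) * W \<le> 2 ^ d"] e by (simp add: depth_def)
  then show "2 ^ depth W < 2 * (3 * depth W - 1) * W" using e by simp
qed

lemma weight_items_scaled: "weight (items b ps) * 2 ^ b \<le> pair_weight ps + length ps * 2 ^ b"
proof (induction ps)
  case (Cons p ps)
  have "(2::nat) ^ (ready p - b) * 2 ^ b \<le> 2 ^ ready p + 2 ^ b"
    by (cases "b \<le> ready p") (auto simp flip: power_add)
  then show ?case using Cons by (simp add: items_def algebra_simps)
qed (simp add: items_def)

lemma weight_base_scaled: "7 * (weight (items (base ps) ps) * 2 ^ base ps) \<le> 9 * pair_weight ps"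
proof (cases "base ps")
  case 0
  have "weight (items 0 ps) = pair_weight ps" by (induction ps) (auto simp: items_def)
  then show ?thesis using 0 by simp
next
  case (Suc b)
  have "\<not> weight (items b ps) \<le> 8 * length ps"
    using not_less_Least[of b "\<lambda>b. weight (items b ps) \<le> 8 * length ps"] Suc by (simp add: base_def)
  then have "8 * length ps * 2 ^ b \<le> weight (items b ps) * 2 ^ b" by (intro mult_le_mono1) auto
  then have "7 * length ps * 2 ^ b \<le> pair_weight ps" using weight_items_scaled[of b ps] by linarith
  moreover have "weight (items (base ps) ps) * 2 ^ base ps \<le> pair_weight ps + 2 * (length ps * 2 ^ b)"
    using weight_items_scaled[of "base ps" ps] Suc by (simp add: algebra_simps)
  ultimately show ?thesis by simp
qed

text \<open>The loss of a path of depth at most \<open>D\<close> against its total weight: 9 / 7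
  from the rounding in \<open>base\<close>, and 2 (3 D - 1) because the depth is the least one
  possible.\<close>

definition path_factor :: "nat \<Rightarrow> real" where
  "path_factor D = 18 / 7 * (3 * real D - 1)"

context
  fixes ps :: "'x pair list" and xs :: "'x item list" and d :: nat
  assumes ne: "ps \<noteq> []"
  defines "xs \<equiv> items (base ps) ps"
  defines "d \<equiv> depth (weight xs)"
begin

lemma path_fits: "fits d 0 xs" "xs \<noteq> []"
  using depth_fits[of "weight xs"] ne by (auto simp: fits_def d_def xs_def items_def)

lemma path_unfold: "path ps = snd (tree OR (pieces OR True d 0 xs))"
  by (simp add: path_def path_of_def d_def xs_def)

lemma arr_path: "arr (path ps) \<le> base ps + d"
proof -
  let ?ws = "pieces OR True d 0 xs"
  have "\<forall>w\<in>set ?ws. valid (base ps) w"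
    by (rule pieces_valid[OF path_fits]) (auto simp: xs_def items_def valid_def wire1_def wire2_def ready_def)
  then have "valid (base ps) (tree OR ?ws)"
    using pieces_weight(2)[OF path_fits] by (intro valid_tree) auto
  moreover have "fst (tree OR ?ws) \<le> d"
    using pieces_weight[OF path_fits, of OR True] by (intro tree_le) auto
  ultimately show ?thesis unfolding path_unfold valid_def by simp
qed

lemma depth_path_le:
  assumes "(3 * D + 2) * (8 * length ps) \<le> 2 ^ D" shows "d \<le> D"
  unfolding d_def using depth_le[OF assms] weight_base[of ps] by (simp add: xs_def)

lemma path_bound:
  assumes "(3 * D + 2) * (8 * length ps) \<le> 2 ^ D"
  shows "2 ^ arr (path ps) \<le> path_factor D * pair_weight ps"
proof -
  have W: "0 < weight xs" using path_fits(2) weight_pos by blast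
  have "(2::nat) ^ arr (path ps) \<le> 2 ^ (base ps + d)"
    using arr_path by (intro power_increasing) auto
  also have "\<dots> = 2 ^ d * 2 ^ base ps" by (simp add: power_add)
  finally have "7 * 2 ^ arr (path ps) \<le> 7 * (2 ^ d * 2 ^ base ps :: nat)" by simp
  also have "\<dots> \<le> 7 * (2 * (3 * d - 1) * weight xs * 2 ^ base ps)"
    using depth_less(2)[OF W] by (intro mult_le_mono2 mult_le_mono1) (simp add: d_def)
  also have "\<dots> = 2 * (3 * d - 1) * (7 * (weight xs * 2 ^ base ps))" by simp
  also have "\<dots> \<le> 2 * (3 * d - 1) * (9 * pair_weight ps)"
    unfolding xs_def by (intro mult_le_mono2 weight_base_scaled)
  also have "\<dots> \<le> 2 * (3 * D - 1) * (9 * pair_weight ps)"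
    using depth_path_le[OF assms] by (intro mult_le_mono1 mult_le_mono2) auto
  finally have "7 * 2 ^ arr (path ps) \<le> 18 * ((3 * D - 1) * pair_weight ps)" by simp
  then have "real (7 * 2 ^ arr (path ps)) \<le> real (18 * ((3 * D - 1) * pair_weight ps))"
    by (simp only: of_nat_le_iff)
  moreover have "real (3 * D - 1) = 3 * real D - 1"
    using depth_path_le[OF assms] depth_less(1)[OF W] by (simp add: d_def)
  ultimately show ?thesis by (simp add: path_factor_def field_simps)
qed

lemma path_gates:
  assumes "(3 * D + 2) * (8 * length ps) \<le> 2 ^ D" "pair_gates ps \<subseteq> U"
  shows "card (gates (path ps) - U) \<le> 2 * (D - 3) * length ps"
proof -
  let ?ws = "pieces OR True d 0 xs"
  have "card (gates (path ps) - U) + 1 \<le> card (wire_gates ?ws - U) + length ?ws"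
    unfolding path_unfold using pieces_weight(2)[OF path_fits] by (intro gates_tree)
  also have "\<dots> \<le> 2 * (d - 3) * length xs"
    by (rule pieces_gates[OF path_fits])
       (use assms(2) in \<open>auto simp: xs_def items_def wire1_def wire2_def pair_gates_def\<close>)
  also have "\<dots> \<le> 2 * (D - 3) * length ps"
    using depth_path_le[OF assms(1)] by (intro mult_le_mono diff_le_mono) (auto simp: xs_def)
  finally show ?thesis by simp
qed

text \<open>With OR as the operation, g as first and p as second formula, consistency of an item is
  the implication from g to p. The incoming carry False is the neutral element that ends the
  path.\<close>

lemma val_path:
  assumes "\<forall>p\<in>set ps. val \<rho> (fst p) \<longrightarrow> val \<rho> (snd p)"
  shows "val \<rho> (path ps) = foldr (sem \<rho>) ps False"
proof -
  have "chain OR \<rho> (items b qs) r = foldr (sem \<rho>) qs r" for b qs r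
    by (induction qs) (auto simp: items_def sem_def wire1_def wire2_def)
  moreover have "fold_op OR \<rho> (pieces OR True d 0 xs) = chain OR \<rho> xs (neutral OR)"
    using pieces_fold[OF path_fits, of OR \<rho> True] assms
    by (auto simp: xs_def items_def consistent_def wire1_def wire2_def)
  ultimately show ?thesis
    unfolding path_unfold using pieces_weight(2)[OF path_fits]
    by (simp add: val_tree xs_def neutral_def)
qed

end

section \<open>Merging a block into one pair\<close>

definition conj_of :: "'x pair list \<Rightarrow> 'x trm" where
  "conj_of ps = snd (tree AND (map (\<lambda>p. (arr (snd p), snd p)) ps))"

lemma val_conj_of: "ps \<noteq> [] \<Longrightarrow> val \<rho> (conj_of ps) \<longleftrightarrow> (\<forall>p\<in>set ps. val \<rho> (snd p))"
proof -
  have "fold_op AND \<rho> (map (\<lambda>p. (arr (snd p), snd p)) ps) \<longleftrightarrow> (\<forall>p\<in>set ps. val \<rho> (snd p))"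
    by (induction ps) (auto simp: neutral_def)
  then show "ps \<noteq> [] \<Longrightarrow> ?thesis" by (simp add: conj_of_def val_tree)
qed

lemma conj_of_bound: "ps \<noteq> [] \<Longrightarrow> 2 ^ arr (conj_of ps) \<le> 2 * pair_weight ps"
proof -
  assume ps: "ps \<noteq> []"
  let ?ws = "map (\<lambda>p. (arr (snd p), snd p)) ps"
  have "valid 0 (tree AND ?ws)" using ps by (intro valid_tree) (auto simp: valid_def)
  then have "(2::nat) ^ arr (conj_of ps) \<le> 2 ^ fst (tree AND ?ws)"
    unfolding conj_of_def valid_def by (intro power_increasing) auto
  also have "\<dots> \<le> 2 * weight ?ws" using tree_weight[of ?ws AND] ps by simp
  also have "weight ?ws \<le> pair_weight ps"
  proof (induction ps)
    case (Cons p ps)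
    have "(2::nat) ^ arr (snd p) \<le> 2 ^ ready p" by (intro power_increasing) (auto simp: ready_def)
    then show ?case using Cons unfolding list.map weight_simps pair_weight_simps fst_conv by linarith
  qed auto
  finally show ?thesis by simp
qed

lemma conj_of_gates: "ps \<noteq> [] \<Longrightarrow> pair_gates ps \<subseteq> U \<Longrightarrow> card (gates (conj_of ps) - U) \<le> length ps - 1"
proof -
  assume ps: "ps \<noteq> []" "pair_gates ps \<subseteq> U"
  let ?ws = "map (\<lambda>p. (arr (snd p), snd p)) ps"
  have e: "wire_gates ?ws - U = {}" using ps(2) by (auto simp: wire_gates_def pair_gates_def)
  show ?thesis using gates_tree[of ?ws AND U] ps(1) unfolding conj_of_def e by simp
qed


text \<open>Used where blocks are only composed further, as in Sklansky's circuit, which does not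
  rely on the implication from g to p.\<close>

definition block :: "'x pair list \<Rightarrow> 'x pair" where
  "block ps = (path (rev ps), conj_of ps)"

text \<open>Adding \<open>g\<close> to the propagate formula keeps the meaning of the pair and restores the
  implication from the first to the second component that paths rely on.\<close>

definition closed_block :: "'x pair list \<Rightarrow> 'x pair" where
  "closed_block ps = (path (rev ps), Gt OR (path (rev ps)) (conj_of ps))"

definition closed_pair :: "('x \<Rightarrow> bool) \<Rightarrow> 'x pair \<Rightarrow> bool" where
  "closed_pair \<rho> p \<longleftrightarrow> (val \<rho> (fst p) \<longrightarrow> val \<rho> (snd p))"

lemma closed_closed_block: "closed_pair \<rho> (closed_block ps)"
  by (simp add: closed_pair_def closed_block_def)

lemma fold_sem_iff: "fold (sem \<rho>) ps c \<longleftrightarrow> fold (sem \<rho>) ps False \<or> ((\<forall>p\<in>set ps. val \<rho> (snd p)) \<and> c)"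
  if "\<forall>p\<in>set ps. closed_pair \<rho> p"
  using that
proof (induction ps rule: rev_induct)
  case (snoc p ps)
  then show ?case by (auto simp: sem_def closed_pair_def)
qed auto

lemma sem_block:
  assumes "ps \<noteq> []" "\<forall>p\<in>set ps. closed_pair \<rho> p"
  shows "sem \<rho> (block ps) = fold (sem \<rho>) ps" "sem \<rho> (closed_block ps) = fold (sem \<rho>) ps"
proof -
  have 1: "val \<rho> (path (rev ps)) = fold (sem \<rho>) ps False"
    using val_path[of "rev ps" \<rho>] assms by (simp add: closed_pair_def foldr_conv_fold)
  have "sem \<rho> (block ps) c = fold (sem \<rho>) ps c \<and> sem \<rho> (closed_block ps) c = fold (sem \<rho>) ps c" for c
    using fold_sem_iff[OF assms(2), of c] 1 val_conj_of[OF assms(1), of \<rho>]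
    by (auto simp: sem_def block_def closed_block_def)
  then show "sem \<rho> (block ps) = fold (sem \<rho>) ps" "sem \<rho> (closed_block ps) = fold (sem \<rho>) ps"
    by (simp_all add: fun_eq_iff)
qed

definition compose :: "'x pair \<Rightarrow> 'x pair \<Rightarrow> 'x pair" where
  "compose x y = (Gt OR (fst x) (Gt AND (snd x) (fst y)), Gt AND (snd x) (snd y))"

lemma sem_compose: "sem \<rho> (compose x y) c = sem \<rho> x (sem \<rho> y c)"
  by (auto simp: sem_def compose_def)

lemma ready_compose: "ready (compose x y) \<le> max (ready x) (ready y) + 2"
  by (auto simp: ready_def compose_def)

fun carries :: "('x \<Rightarrow> bool) \<Rightarrow> bool \<Rightarrow> 'x pair list \<Rightarrow> bool list" where
  "carries \<rho> c [] = []"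
| "carries \<rho> c (p # ps) = sem \<rho> p c # carries \<rho> (sem \<rho> p c) ps"

lemma length_carries [simp]: "length (carries \<rho> c ps) = length ps"
  by (induction ps arbitrary: c) auto

lemma carries_append: "carries \<rho> c (ps @ qs) = carries \<rho> c ps @ carries \<rho> (fold (sem \<rho>) ps c) qs"
  by (induction ps arbitrary: c) auto

lemma last_carries: "ps \<noteq> [] \<Longrightarrow> last (carries \<rho> c ps) = fold (sem \<rho>) ps c"
proof (induction ps arbitrary: c)
  case (Cons p ps)
  then show ?case by (cases ps) auto
qed auto

section \<open>Prefix circuits\<close>

definition half :: "'a list \<Rightarrow> nat" where
  "half xs = (length xs + 1) div 2"

lemma half_bounds: "1 < length xs \<Longrightarrow> 0 < half xs \<and> half xs < length xs"
  by (auto simp: half_def)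

lemma half_take_drop:
  assumes "length xs \<le> 2 ^ Suc k"
  shows "length (take (half xs) xs) \<le> 2 ^ k" "length (drop (half xs) xs) \<le> 2 ^ k"
  using assms by (auto simp: half_def)

function sklansky :: "'x pair list \<Rightarrow> 'x pair list" where
  "sklansky ps = (if length ps \<le> 1 then ps else
     sklansky (take (half ps) ps) @
     map (\<lambda>x. compose x (last (sklansky (take (half ps) ps)))) (sklansky (drop (half ps) ps)))"
  by auto
termination by (relation "Wellfounded.measure length") (auto simp: half_def)

declare sklansky.simps [simp del]

lemma sklansky_induct [case_names short long]:
  assumes "\<And>ps. length ps \<le> 1 \<Longrightarrow> P ps"
    and "\<And>ps. 1 < length ps \<Longrightarrow> P (take (half ps) ps) \<Longrightarrow> P (drop (half ps) ps) \<Longrightarrow> P ps"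
  shows "P (ps :: 'a list)"
proof (induction "length ps" arbitrary: ps rule: less_induct)
  case less
  show ?case
  proof (cases "length ps \<le> 1")
    case False
    then show ?thesis using assms(2)[of ps] less half_bounds[of ps] by auto
  qed (rule assms(1))
qed

lemma length_sklansky [simp]: "length (sklansky ps) = length ps"
proof (induction ps rule: sklansky_induct)
  case (long ps)
  then show ?case using half_bounds[of ps] by (simp add: sklansky.simps[of ps])
qed (simp add: sklansky.simps)

lemma sklansky_Nil_iff [simp]: "sklansky ps = [] \<longleftrightarrow> ps = []"
  by (metis length_0_conv length_sklansky)

lemma sem_sklansky: "map (\<lambda>y. sem \<rho> y c) (sklansky ps) = carries \<rho> c ps"
proof (induction ps arbitrary: c rule: sklansky_induct)
  case (short ps)
  then show ?case by (cases ps) (auto simp: sklansky.simps)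
next
  case (long ps)
  let ?l = "sklansky (take (half ps) ps)" and ?r = "sklansky (drop (half ps) ps)"
  have t: "take (half ps) ps \<noteq> []" using half_bounds[OF long(1)] by auto
  then have l: "?l \<noteq> []" by simp
  have "sem \<rho> (last ?l) c = last (map (\<lambda>y. sem \<rho> y c) ?l)" using l by (simp add: last_map)
  also have "\<dots> = fold (sem \<rho>) (take (half ps) ps) c" using long(2) last_carries[OF t] by simp
  finally have "map (\<lambda>y. sem \<rho> y c) (map (\<lambda>x. compose x (last ?l)) ?r) =
      carries \<rho> (fold (sem \<rho>) (take (half ps) ps) c) (drop (half ps) ps)"
    using long(3)[of "sem \<rho> (last ?l) c"] by (simp add: sem_compose comp_def)
  then show ?case
    using long(1,2) carries_append[of \<rho> c "take (half ps) ps" "drop (half ps) ps"]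
    by (simp add: sklansky.simps[of ps])
qed

lemma sklansky_ready:
  "length ps \<le> 2 ^ k \<Longrightarrow> \<forall>p\<in>set ps. ready p \<le> M \<Longrightarrow> \<forall>y\<in>set (sklansky ps). ready y \<le> M + 2 * k"
proof (induction ps arbitrary: k rule: sklansky_induct)
  case (short ps)
  then show ?case by (auto simp: sklansky.simps)
next
  case (long ps)
  obtain j where k: "k = Suc j" using long(1,4) by (cases k) auto
  let ?l = "sklansky (take (half ps) ps)" and ?r = "sklansky (drop (half ps) ps)"
  have h: "length (take (half ps) ps) \<le> 2 ^ j" "length (drop (half ps) ps) \<le> 2 ^ j"
    using half_take_drop[of ps j] long(4) k by simp_all
  have l: "\<forall>y\<in>set ?l. ready y \<le> M + 2 * j"
    using long(5) by (intro long(2)[OF h(1)]) (auto dest: in_set_takeD)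
  have r: "\<forall>y\<in>set ?r. ready y \<le> M + 2 * j"
    using long(5) by (intro long(3)[OF h(2)]) (auto dest: in_set_dropD)
  have "?l \<noteq> []" using half_bounds[OF long(1)] long(1) by auto
  then have last: "ready (last ?l) \<le> M + 2 * j" using l by simp
  have "ready (compose x (last ?l)) \<le> M + 2 * k" if "x \<in> set ?r" for x
    using ready_compose[of x "last ?l"] r that last k by (auto simp: max_def split: if_splits)
  then show ?case using long(1) l k by (auto simp: sklansky.simps[of ps])
qed

lemma card_compose_gates:
  "card (pair_gates (map (\<lambda>x. compose x y) xs) - U) \<le> 3 * length xs + card (pair_gates xs \<union> pair_gates [y] - U)"
proof -
  define N where "N = (\<Union>x\<in>set xs. {Gt OR (fst x) (Gt AND (snd x) (fst y)), Gt AND (snd x) (fst y), Gt AND (snd x) (snd y)})"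
  have "pair_gates (map (\<lambda>x. compose x y) xs) - U \<subseteq> N \<union> (pair_gates xs \<union> pair_gates [y] - U)"
    by (auto simp: pair_gates_def N_def compose_def)
  moreover have "finite N" by (auto simp: N_def)
  ultimately have "card (pair_gates (map (\<lambda>x. compose x y) xs) - U) \<le> card (N \<union> (pair_gates xs \<union> pair_gates [y] - U))"
    by (intro card_mono) auto
  also have "\<dots> \<le> card N + card (pair_gates xs \<union> pair_gates [y] - U)" by (rule card_Un_le)
  also have "card N \<le> (\<Sum>x\<in>set xs. card {Gt OR (fst x) (Gt AND (snd x) (fst y)), Gt AND (snd x) (fst y), Gt AND (snd x) (snd y)})"
    unfolding N_def by (rule card_UN_le) simp
  also have "\<dots> \<le> (\<Sum>x\<in>set xs. 3)" by (intro sum_mono) (simp add: card_insert_if)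
  also have "\<dots> \<le> 3 * length xs" using card_length[of xs] by simp
  finally show ?thesis by simp
qed

text \<open>A level adds three gates for every pair of the right half, which is at most half of the
  list since \<open>half\<close> rounds up: 3 / 2 gates per pair and level. The factor 2 clears the
  fraction.\<close>

lemma sklansky_gates:
  "length ps \<le> 2 ^ k \<Longrightarrow> pair_gates ps \<subseteq> U \<Longrightarrow> 2 * card (pair_gates (sklansky ps) - U) \<le> 3 * k * length ps"
proof (induction ps arbitrary: k rule: sklansky_induct)
  case (short ps)
  then have "pair_gates (sklansky ps) - U = {}" by (auto simp: sklansky.simps)
  then have "card (pair_gates (sklansky ps) - U) = 0" by (simp only: card.empty)
  then show ?case by (simp only: mult_0_right zero_le)
next
  case (long ps)
  obtain j where k: "k = Suc j" using long(1,4) by (cases k) auto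
  let ?l = "sklansky (take (half ps) ps)" and ?r = "sklansky (drop (half ps) ps)"
  have h: "length (take (half ps) ps) \<le> 2 ^ j" "length (drop (half ps) ps) \<le> 2 ^ j"
    using half_take_drop[of ps j] long(4) k by simp_all
  have l: "2 * card (pair_gates ?l - U) \<le> 3 * j * length (take (half ps) ps)"
    using pair_gates_mono[OF set_take_subset[of "half ps" ps]] long(5) by (intro long(2)[OF h(1)]) auto
  have r: "2 * card (pair_gates ?r - U) \<le> 3 * j * length (drop (half ps) ps)"
    using pair_gates_mono[OF set_drop_subset[of "half ps" ps]] long(5) by (intro long(3)[OF h(2)]) auto
  have "?l \<noteq> []" using half_bounds[OF long(1)] long(1) by auto
  then have last: "pair_gates [last ?l] \<subseteq> pair_gates ?l" by (intro pair_gates_mono) simp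
  let ?m = "map (\<lambda>x. compose x (last ?l)) ?r" and ?V = "U \<union> pair_gates ?l"
  have "pair_gates (sklansky ps) - U \<subseteq> (pair_gates ?l - U) \<union> (pair_gates ?m - ?V)"
    using long(1) by (auto simp: sklansky.simps[of ps])
  then have "card (pair_gates (sklansky ps) - U) \<le> card ((pair_gates ?l - U) \<union> (pair_gates ?m - ?V))"
    by (intro card_mono) auto
  also have "\<dots> \<le> card (pair_gates ?l - U) + card (pair_gates ?m - ?V)" by (rule card_Un_le)
  also have "card (pair_gates ?m - ?V) \<le> 3 * length ?r + card (pair_gates ?r \<union> pair_gates [last ?l] - ?V)"
    by (rule card_compose_gates)
  also have "card (pair_gates ?r \<union> pair_gates [last ?l] - ?V) \<le> card (pair_gates ?r - U)"
    using last by (intro card_mono) auto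
  finally have "2 * card (pair_gates (sklansky ps) - U) \<le>
      3 * j * (length (take (half ps) ps) + length (drop (half ps) ps)) + 6 * length (drop (half ps) ps)"
    using l r by (simp add: algebra_simps)
  also have "length (take (half ps) ps) + length (drop (half ps) ps) = length ps"
    using half_bounds[OF long(1)] by simp
  also have "6 * length (drop (half ps) ps) \<le> 3 * length ps" by (simp add: half_def)
  finally show ?case by (simp add: k algebra_simps)
qed

section \<open>Division into blocks and recombination\<close>

function chunk :: "nat \<Rightarrow> 'a list \<Rightarrow> 'a list list" where
  "chunk q xs = (if xs = [] \<or> q = 0 then [] else take q xs # chunk q (drop q xs))"
  by auto
termination by (relation "Wellfounded.measure (\<lambda>(q, xs). length xs)") auto

declare chunk.simps [simp del]

lemma chunk_Nil [simp]: "chunk q [] = []"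
  by (subst chunk.simps) simp

lemma chunk_step: "xs \<noteq> [] \<Longrightarrow> 0 < q \<Longrightarrow> chunk q xs = take q xs # chunk q (drop q xs)"
  by (subst chunk.simps) simp

lemma chunk_props:
  assumes "0 < q"
  shows "concat (chunk q xs) = xs" "\<forall>c\<in>set (chunk q xs). c \<noteq> [] \<and> length c \<le> q"
    "length (chunk q xs) * q < length xs + q"
proof -
  have "concat (chunk q xs) = xs \<and> (\<forall>c\<in>set (chunk q xs). c \<noteq> [] \<and> length c \<le> q) \<and>
      length (chunk q xs) * q < length xs + q"
  proof (induction "length xs" arbitrary: xs rule: less_induct)
    case less
    show ?case
    proof (cases "xs = []")
      case True
      then show ?thesis using assms by simp
    next
      case False
      let ?d = "drop q xs"
      have IH: "concat (chunk q ?d) = ?d" "\<forall>c\<in>set (chunk q ?d). c \<noteq> [] \<and> length c \<le> q"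
        "length (chunk q ?d) * q < length ?d + q"
        using less[of ?d] False assms by auto
      have step: "chunk q xs = take q xs # chunk q ?d" using chunk_step[OF False assms] .
      have "length (chunk q xs) * q < length xs + q"
      proof (cases "length xs < q")
        case True
        then have "?d = []" by simp
        then show ?thesis using False unfolding step by simp
      next
        case False
        then have "length (chunk q xs) * q = q + length (chunk q ?d) * q" unfolding step by simp
        then show ?thesis using IH(3) False by simp
      qed
      moreover have "concat (chunk q xs) = xs" unfolding step using IH(1) by simp
      moreover have "\<forall>c\<in>set (chunk q xs). c \<noteq> [] \<and> length c \<le> q"
        unfolding step using IH(2) False assms by simp
      ultimately show ?thesis by blast
    qed
  qed
  then show "concat (chunk q xs) = xs" "\<forall>c\<in>set (chunk q xs). c \<noteq> [] \<and> length c \<le> q"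
    "length (chunk q xs) * q < length xs + q" by blast+
qed

lemma length_chunk_le: "0 < q \<Longrightarrow> length (chunk q xs) \<le> length xs"
proof -
  assume q: "0 < q"
  have "length yss \<le> length (concat yss)" if "\<forall>c\<in>set yss. c \<noteq> []" for yss :: "'a list list"
    using that
  proof (induction yss)
    case (Cons ys yss)
    then show ?case by (cases ys) auto
  qed auto
  from this[of "chunk q xs"] show ?thesis using chunk_props[OF q, of xs] by auto
qed

text \<open>\<open>cs\<close> holds for every block the prefix up to its end. The first block stays
  as it is, and each later one is composed with the prefix of its predecessor; \<open>zip\<close>
  discards the last prefix.\<close>

definition combine :: "'x pair list list \<Rightarrow> 'x pair list \<Rightarrow> 'x pair list" where
  "combine pss cs = (if pss = [] then [] else
     hd pss @ concat (map (\<lambda>p. map (\<lambda>y. compose y (fst p)) (snd p)) (zip cs (tl pss))))"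

fun block_carries :: "('x \<Rightarrow> bool) \<Rightarrow> bool \<Rightarrow> 'x pair list list \<Rightarrow> bool list" where
  "block_carries \<rho> c [] = []"
| "block_carries \<rho> c (ps # pss) = fold (sem \<rho>) ps c # block_carries \<rho> (fold (sem \<rho>) ps c) pss"

lemma carries_blocks:
  "\<forall>ps\<in>set pss. sem \<rho> (h ps) = fold (sem \<rho>) ps \<Longrightarrow> carries \<rho> c (map h pss) = block_carries \<rho> c pss"
  by (induction pss arbitrary: c) auto

lemma sem_combine:
  assumes "\<forall>ps\<in>set pss. \<forall>c. map (\<lambda>y. sem \<rho> y c) (h ps) = carries \<rho> c ps"
    and "map (\<lambda>y. sem \<rho> y c) cs = block_carries \<rho> c pss"
  shows "map (\<lambda>y. sem \<rho> y c) (combine (map h pss) cs) = carries \<rho> c (concat pss)"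
proof -
  \<comment> \<open>The invariant runs one block ahead: \<open>ds\<close> starts with the prefix
    that ends right before \<open>qss\<close>, whose value is the carry \<open>d\<close> into the
    first block of \<open>qss\<close>.\<close>
  have *: "map (\<lambda>y. sem \<rho> y c) (concat (map (\<lambda>p. map (\<lambda>y. compose y (fst p)) (snd p)) (zip ds (map h qss)))) =
      carries \<rho> d (concat qss)"
    if "\<forall>ps\<in>set qss. \<forall>c. map (\<lambda>y. sem \<rho> y c) (h ps) = carries \<rho> c ps"
      "map (\<lambda>y. sem \<rho> y c) ds = d # block_carries \<rho> d qss" for d ds qss
    using that
  proof (induction qss arbitrary: d ds)
    case (Cons qs qss)
    from Cons.prems(2) obtain d' ds' where ds: "ds = d' # ds'" "sem \<rho> d' c = d"
      "map (\<lambda>y. sem \<rho> y c) ds' = fold (sem \<rho>) qs d # block_carries \<rho> (fold (sem \<rho>) qs d) qss"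
      by (auto simp: map_eq_Cons_conv)
    have "map (\<lambda>y. sem \<rho> y c) (map (\<lambda>y. compose y d') (h qs)) = carries \<rho> d qs"
      using Cons.prems(1) ds(2) by (simp add: sem_compose comp_def)
    then show ?case using Cons.IH[OF _ ds(3)] Cons.prems(1) ds(1) by (simp add: carries_append)
  qed auto
  show ?thesis
  proof (cases pss)
    case (Cons ps qss)
    then show ?thesis using assms *[of qss cs "fold (sem \<rho>) ps c"]
      by (simp add: combine_def carries_append)
  qed (auto simp: combine_def)
qed

lemma in_set_combine:
  "y \<in> set (combine pss cs) \<Longrightarrow> (\<exists>ps\<in>set pss. y \<in> set ps) \<or> (\<exists>c\<in>set cs. \<exists>ps\<in>set pss. \<exists>x\<in>set ps. y = compose x c)"
proof -
  assume y: "y \<in> set (combine pss cs)"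
  then have ne: "pss \<noteq> []" by (auto simp: combine_def)
  from y ne consider "y \<in> set (hd pss)"
    | p x where "p \<in> set (zip cs (tl pss))" "x \<in> set (snd p)" "y = compose x (fst p)"
    by (auto simp: combine_def)
  then show ?thesis
  proof cases
    case 1
    then show ?thesis using ne by (meson list.set_sel(1))
  next
    case 2
    then have "fst p \<in> set cs" "snd p \<in> set (tl pss)"
      by (metis in_set_zipE prod.collapse)+
    then have "snd p \<in> set pss" using ne list.set_sel(2) by metis
    with 2 \<open>fst p \<in> set cs\<close> show ?thesis by blast
  qed
qed

section \<open>Carries at block boundaries\<close>

text \<open>\<open>deep_enough D n\<close>: paths of length \<open>n\<close> get depth at most \<open>D\<close>, relative to their offset.\<close>

definition deep_enough :: "nat \<Rightarrow> nat \<Rightarrow> bool" where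
  "deep_enough D n \<longleftrightarrow> (3 * D + 2) * (8 * n) \<le> 2 ^ D"

lemma deep_enough_mono: "deep_enough D n \<Longrightarrow> m \<le> n \<Longrightarrow> deep_enough D m"
  unfolding deep_enough_def by (meson le_trans mult_le_mono2)

lemma deep_enough_factor: "deep_enough D n \<Longrightarrow> 0 < n \<Longrightarrow> 2 \<le> path_factor D"
proof -
  assume "deep_enough D n" "0 < n"
  then have "D \<noteq> 0" by (intro notI) (simp add: deep_enough_def)
  then have "1 \<le> real D" by simp
  then show ?thesis by (simp add: path_factor_def)
qed

text \<open>The path factor is at least 2 and therefore also covers the tree of the propagate
  formula. The further factor 2 of a closed block is its additional gate.\<close>

lemma block_bounds:
  assumes "deep_enough D (length ps)" "ps \<noteq> []"
  shows "2 ^ ready (block ps) \<le> path_factor D * pair_weight ps"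
    "2 ^ ready (closed_block ps) \<le> 2 * path_factor D * pair_weight ps"
proof -
  have f: "2 \<le> path_factor D" using assms by (intro deep_enough_factor) auto
  have 1: "2 ^ arr (path (rev ps)) \<le> path_factor D * pair_weight ps"
    using path_bound[of "rev ps" D] assms by (simp add: deep_enough_def)
  have "real (2 ^ arr (conj_of ps)) \<le> real (2 * pair_weight ps)"
    using conj_of_bound[OF assms(2)] by (simp only: of_nat_le_iff)
  also have "\<dots> \<le> path_factor D * pair_weight ps" using f by (simp add: mult_right_mono)
  finally have 2: "2 ^ arr (conj_of ps) \<le> path_factor D * pair_weight ps" by simp
  show "2 ^ ready (block ps) \<le> path_factor D * pair_weight ps"
    using 1 2 by (simp add: ready_def block_def max_def)
  have "0 \<le> path_factor D * pair_weight ps" using f by simp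
  then have "2 ^ arr (path (rev ps)) \<le> 2 * (path_factor D * pair_weight ps)"
    "2 * 2 ^ arr (path (rev ps)) \<le> 2 * (path_factor D * pair_weight ps)"
    "2 * 2 ^ arr (conj_of ps) \<le> 2 * (path_factor D * pair_weight ps)" using 1 2 by linarith+
  then show "2 ^ ready (closed_block ps) \<le> 2 * path_factor D * pair_weight ps"
    by (simp add: ready_def closed_block_def max_def)
qed

lemma block_gates:
  assumes "deep_enough D (length ps)" "ps \<noteq> []" "pair_gates ps \<subseteq> U"
  shows "card (pair_gates [block ps] - U) \<le> (2 * (D - 3) + 1) * length ps"
    "card (pair_gates [closed_block ps] - U) \<le> (2 * (D - 3) + 2) * length ps"
proof -
  have 1: "card (gates (path (rev ps)) - U) \<le> 2 * (D - 3) * length ps"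
    using path_gates[of "rev ps" D U] assms by (simp add: deep_enough_def)
  have 2: "card (gates (conj_of ps) - U) + 1 \<le> length ps"
    using conj_of_gates[OF assms(2,3)] assms(2) by (cases ps) auto
  have 3: "card (gates (path (rev ps)) \<union> gates (conj_of ps) - U) + 1 \<le> 2 * (D - 3) * length ps + length ps"
    using card_Un_diff_le[of "gates (path (rev ps))" "gates (conj_of ps)" U] 1 2 by linarith
  then show "card (pair_gates [block ps] - U) \<le> (2 * (D - 3) + 1) * length ps"
    by (simp add: block_def algebra_simps)
  have "pair_gates [closed_block ps] = insert (Gt OR (path (rev ps)) (conj_of ps))
      (gates (path (rev ps)) \<union> gates (conj_of ps))" by (auto simp: closed_block_def)
  then have "card (pair_gates [closed_block ps] - U) \<le> Suc (card (gates (path (rev ps)) \<union> gates (conj_of ps) - U))"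
    using card_insert_diff_le[of "gates (path (rev ps)) \<union> gates (conj_of ps)"] by simp
  then show "card (pair_gates [closed_block ps] - U) \<le> (2 * (D - 3) + 2) * length ps"
    using 3 by (simp add: algebra_simps)
qed

text \<open>The second argument is the list of the lower blocks whose carries are already combined
  with the path of each position; the most significant block comes first.\<close>

function boundary_carries :: "'x pair list \<Rightarrow> 'x pair list \<Rightarrow> 'x pair list" where
  "boundary_carries acc ps = (if length ps \<le> 1 then map (\<lambda>p. (path (p # acc), path (p # acc))) ps else
     boundary_carries acc (take (half ps) ps) @ boundary_carries (closed_block (take (half ps) ps) # acc) (drop (half ps) ps))"
  by auto
termination by (relation "Wellfounded.measure (\<lambda>(acc, ps). length ps)") (auto simp: half_def)

declare boundary_carries.simps [simp del]

lemma boundary_carries_single [simp]: "boundary_carries acc [p] = [(path (p # acc), path (p # acc))]"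
  by (subst boundary_carries.simps) simp

text \<open>At a boundary the carry itself is known and no map is left. Duplicating its formula
  makes it a pair, as \<open>combine\<close> expects, without any new gate.\<close>

lemma sem_diagonal: "sem \<rho> (t, t) False = val \<rho> t"
  by (simp add: sem_def)

lemma boundary_carries_induct [case_names short long]:
  assumes "\<And>acc ps. length ps \<le> 1 \<Longrightarrow> P acc ps"
    and "\<And>acc ps. 1 < length ps \<Longrightarrow> take (half ps) ps \<noteq> [] \<Longrightarrow> P acc (take (half ps) ps) \<Longrightarrow>
      P (closed_block (take (half ps) ps) # acc) (drop (half ps) ps) \<Longrightarrow> P acc ps"
  shows "P acc (ps :: 'x pair list)"
proof (induction ps arbitrary: acc rule: sklansky_induct)
  case (long ps)
  then have "take (half ps) ps \<noteq> []" using half_bounds[of ps] by auto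
  then show ?case using assms(2)[of ps acc] long by blast
qed (rule assms(1))

lemma length_boundary_carries [simp]: "length (boundary_carries acc ps) = length ps"
proof (induction acc ps rule: boundary_carries_induct)
  case (long acc ps)
  then show ?case using half_bounds[of ps] by (simp add: boundary_carries.simps[of acc ps])
qed (simp add: boundary_carries.simps)

lemma sem_boundary_carries:
  "\<forall>p\<in>set acc \<union> set ps. closed_pair \<rho> p \<Longrightarrow>
     map (\<lambda>y. sem \<rho> y False) (boundary_carries acc ps) = carries \<rho> (foldr (sem \<rho>) acc False) ps"
proof (induction acc ps rule: boundary_carries_induct)
  case (short acc ps)
  show ?case
  proof (cases ps)
    case (Cons p qs)
    then have "ps = [p]" using short by simp
    then show ?thesis using val_path[of "p # acc" \<rho>] short(2)
      by (simp add: sem_diagonal closed_pair_def)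
  qed (simp add: boundary_carries.simps)
next
  case (long acc ps)
  let ?l = "take (half ps) ps" and ?r = "drop (half ps) ps"
  have c: "\<forall>p\<in>set ?l. closed_pair \<rho> p" "\<forall>p\<in>set ?r. closed_pair \<rho> p"
    using long(5) by (auto dest: in_set_takeD in_set_dropD)
  have "sem \<rho> (closed_block ?l) = fold (sem \<rho>) ?l" using sem_block(2)[OF long(2) c(1)] .
  then have "map (\<lambda>y. sem \<rho> y False) (boundary_carries (closed_block ?l # acc) ?r) =
      carries \<rho> (fold (sem \<rho>) ?l (foldr (sem \<rho>) acc False)) ?r"
    using long(4) long(5) c closed_closed_block[of \<rho> ?l] by (auto simp: ball_Un)
  moreover have "map (\<lambda>y. sem \<rho> y False) (boundary_carries acc ?l) = carries \<rho> (foldr (sem \<rho>) acc False) ?l"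
    using long(3) long(5) c by (auto simp: ball_Un)
  ultimately show ?case
    using long(1) carries_append[of \<rho> "foldr (sem \<rho>) acc False" ?l ?r]
    by (simp add: boundary_carries.simps[of acc ps])
qed

text \<open>The sum in parentheses does not grow along the recursion: turning the left half into one
  closed block of \<open>acc\<close> costs at most the factor 2 \<open>path_factor D\<close> that it
  was charged in advance. Neither does \<open>length acc + k\<close> grow, so that no path has more
  than \<open>length acc + k + 1\<close> pairs.\<close>

lemma boundary_carries_bound:
  "length ps \<le> 2 ^ k \<Longrightarrow> deep_enough D (length ps) \<Longrightarrow> deep_enough E (length acc + k + 1) \<Longrightarrow>
     y \<in> set (boundary_carries acc ps) \<Longrightarrow>
     2 ^ arr (fst y) \<le> path_factor E * (pair_weight acc + 2 * path_factor D * pair_weight ps)"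
proof (induction acc ps arbitrary: k rule: boundary_carries_induct)
  case (short acc ps)
  then obtain p where ps: "ps = [p]" using short(1,5) by (cases ps) (auto simp: boundary_carries.simps)
  have E: "deep_enough E (length (p # acc))" using deep_enough_mono[OF short(4)] by simp
  have f: "2 \<le> path_factor D" "2 \<le> path_factor E"
    using deep_enough_factor[OF short(3)] deep_enough_factor[OF short(4)] ps by auto
  have "2 ^ arr (fst y) \<le> path_factor E * pair_weight (p # acc)"
    using path_bound[of "p # acc" E] short(5) ps E by (simp add: deep_enough_def)
  also have "\<dots> \<le> path_factor E * (pair_weight acc + 2 * path_factor D * pair_weight ps)"
  proof (rule mult_left_mono)
    have "1 * real (pair_weight ps) \<le> 2 * path_factor D * pair_weight ps"
      using f by (intro mult_right_mono) auto
    then show "real (pair_weight (p # acc)) \<le> pair_weight acc + 2 * path_factor D * pair_weight ps"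
      using ps by simp
  qed (use f in auto)
  finally show ?case .
next
  case (long acc ps)
  obtain j where k: "k = Suc j" using long(1,5) by (cases k) auto
  let ?l = "take (half ps) ps" and ?r = "drop (half ps) ps"
  have h: "length ?l \<le> 2 ^ j" "length ?r \<le> 2 ^ j"
    using half_take_drop[of ps j] long(5) k by simp_all
  have d: "deep_enough D (length ?l)" "deep_enough D (length ?r)"
    using deep_enough_mono[OF long(6)] by simp_all
  have f: "2 \<le> path_factor D" "2 \<le> path_factor E"
    using deep_enough_factor[OF long(6)] deep_enough_factor[OF long(7)] long(1) by (cases ps; simp)+
  have w: "pair_weight ps = pair_weight ?l + pair_weight ?r"
    by (metis append_take_drop_id pair_weight_simps(3))
  from long(8) long(1) consider "y \<in> set (boundary_carries acc ?l)" | "y \<in> set (boundary_carries (closed_block ?l # acc) ?r)"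
    by (auto simp: boundary_carries.simps[of acc ps])
  then show ?case
  proof cases
    case 1
    have "2 ^ arr (fst y) \<le> path_factor E * (pair_weight acc + 2 * path_factor D * pair_weight ?l)"
      by (rule long(3)[OF h(1) d(1) _ 1]) (use deep_enough_mono[OF long(7)] k in simp)
    also have "\<dots> \<le> path_factor E * (pair_weight acc + 2 * path_factor D * pair_weight ps)"
      using f w by (intro mult_left_mono add_left_mono) auto
    finally show ?thesis .
  next
    case 2
    have "2 ^ arr (fst y) \<le> path_factor E *
        (pair_weight (closed_block ?l # acc) + 2 * path_factor D * pair_weight ?r)"
      by (rule long(4)[OF h(2) d(2) _ 2]) (use long(7) k in simp)
    also have "\<dots> \<le> path_factor E * (pair_weight acc + 2 * path_factor D * pair_weight ps)"
      using f w block_bounds(2)[OF d(1) long(2)] by (intro mult_left_mono) (auto simp: algebra_simps)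
    finally show ?thesis .
  qed
qed

text \<open>On each of the \<open>k\<close> levels closed blocks are built over left halves only, at
  most 2 (D - 3) + 2 gates per pair, and every position finally gets one path.\<close>

lemma boundary_carries_gates:
  "length ps \<le> 2 ^ k \<Longrightarrow> deep_enough D (length ps) \<Longrightarrow> deep_enough E (length acc + k + 1) \<Longrightarrow>
     pair_gates acc \<union> pair_gates ps \<subseteq> U \<Longrightarrow>
     card (pair_gates (boundary_carries acc ps) - U) \<le>
       length ps * (k * (2 * (D - 3) + 2) + 2 * (E - 3) * (length acc + k + 1))"
proof (induction acc ps arbitrary: k U rule: boundary_carries_induct)
  case (short acc ps)
  show ?case
  proof (cases ps)
    case (Cons p qs)
    then have ps: "ps = [p]" using short(1) by simp
    have E: "deep_enough E (length (p # acc))" using deep_enough_mono[OF short(4)] by simp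
    have "card (pair_gates (boundary_carries acc ps) - U) \<le> 2 * (E - 3) * length (p # acc)"
      using path_gates[of "p # acc" E U] short(5) ps E by (simp add: deep_enough_def)
    also have "\<dots> \<le> 2 * (E - 3) * (length acc + k + 1)" by (intro mult_le_mono2) simp
    finally show ?thesis using ps by simp
  qed (simp add: boundary_carries.simps)
next
  case (long acc ps)
  obtain j where k: "k = Suc j" using long(1,5) by (cases k) auto
  let ?l = "take (half ps) ps" and ?r = "drop (half ps) ps"
  let ?a = "2 * (D - 3) + 2" and ?b = "2 * (E - 3) * (length acc + k + 1)"
  have h: "length ?l \<le> 2 ^ j" "length ?r \<le> 2 ^ j"
    using half_take_drop[of ps j] long(5) k by simp_all
  have d: "deep_enough D (length ?l)" "deep_enough D (length ?r)"
    using deep_enough_mono[OF long(6)] by simp_all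
  have U: "pair_gates ?l \<subseteq> U" "pair_gates ?r \<subseteq> U" "pair_gates acc \<subseteq> U"
    using long(8) pair_gates_mono[OF set_take_subset[of "half ps" ps]]
      pair_gates_mono[OF set_drop_subset[of "half ps" ps]] by auto
  let ?V = "U \<union> pair_gates [closed_block ?l]"
  have "card (pair_gates (boundary_carries acc ?l) - U) \<le> length ?l * (j * ?a + 2 * (E - 3) * (length acc + j + 1))"
    by (rule long(3)[OF h(1) d(1)]) (use deep_enough_mono[OF long(7)] k U in auto)
  also have "\<dots> \<le> length ?l * (j * ?a + ?b)" using k by (intro mult_le_mono2 add_left_mono mult_le_mono2) auto
  finally have 1: "card (pair_gates (boundary_carries acc ?l) - U) \<le> length ?l * (j * ?a + ?b)" .
  have "card (pair_gates (boundary_carries (closed_block ?l # acc) ?r) - ?V) \<le>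
      length ?r * (j * ?a + 2 * (E - 3) * (length (closed_block ?l # acc) + j + 1))"
    by (rule long(4)[OF h(2) d(2)]) (use long(7) k U in auto)
  then have 2: "card (pair_gates (boundary_carries (closed_block ?l # acc) ?r) - ?V) \<le> length ?r * (j * ?a + ?b)"
    using k by simp
  have 3: "card (pair_gates [closed_block ?l] - U) \<le> ?a * length ?l"
    by (rule block_gates(2)[OF d(1) long(2) U(1)])
  have "pair_gates (boundary_carries acc ps) - U \<subseteq> (pair_gates (boundary_carries acc ?l) - U) \<union>
      ((pair_gates (boundary_carries (closed_block ?l # acc) ?r) - ?V) \<union> (pair_gates [closed_block ?l] - U))"
    using long(1) by (auto simp: boundary_carries.simps[of acc ps])
  then have "card (pair_gates (boundary_carries acc ps) - U) \<le> card ((pair_gates (boundary_carries acc ?l) - U) \<union>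
      ((pair_gates (boundary_carries (closed_block ?l # acc) ?r) - ?V) \<union> (pair_gates [closed_block ?l] - U)))"
    by (intro card_mono) auto
  also have "\<dots> \<le> card (pair_gates (boundary_carries acc ?l) - U) +
      (card (pair_gates (boundary_carries (closed_block ?l # acc) ?r) - ?V) + card (pair_gates [closed_block ?l] - U))"
    by (rule order_trans[OF card_Un_le add_left_mono[OF card_Un_le]])
  also have "\<dots> \<le> length ?l * (j * ?a + ?b) + (length ?r * (j * ?a + ?b) + ?a * length ?l)"
    using 1 2 3 by linarith
  also have "\<dots> = (length ?l + length ?r) * (j * ?a + ?b) + ?a * length ?l" by (simp only: add_mult_distrib add.assoc)
  also have "length ?l + length ?r = length ps" using half_bounds[OF long(1)] by simp
  also have "length ps * (j * ?a + ?b) + ?a * length ?l \<le> length ps * (j * ?a + ?b) + ?a * length ps"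
    by (intro add_left_mono mult_le_mono2) simp
  also have "x * (j * a + b) + a * x = x * (k * a + b)" for x a b :: nat by (simp add: k algebra_simps)
  finally show ?case .
qed

section \<open>The adder\<close>

text \<open>A composition takes at most two time units, which is a factor 4 of the weight per
  level.\<close>

lemma sklansky_bound:
  assumes "length ps \<le> 2 ^ k" "\<forall>p\<in>set ps. 2 ^ ready p \<le> (B::real)" "y \<in> set (sklansky ps)"
  shows "2 ^ ready y \<le> 4 ^ k * B"
proof -
  define M where "M = Max (ready ` set ps)"
  have ne: "ps \<noteq> []" using assms(3) by (metis length_0_conv length_sklansky list.set(1) empty_iff)
  have "ready y \<le> M + 2 * k"
    using sklansky_ready[OF assms(1), of M] assms(3) by (auto simp: M_def)
  then have "(2::real) ^ ready y \<le> 2 ^ (M + 2 * k)" by (intro power_increasing) auto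
  also have "\<dots> = 2 ^ M * 4 ^ k" by (simp add: power_add power_mult)
  also have "\<dots> = 4 ^ k * 2 ^ M" by (rule mult.commute)
  also have "M \<in> ready ` set ps" unfolding M_def using ne by (intro Max_in) auto
  then have "(2::real) ^ M \<le> B" using assms(2) by auto
  then have "4 ^ k * (2::real) ^ M \<le> 4 ^ k * B" by simp
  finally show ?thesis .
qed

lemma compose_bound:
  assumes "2 ^ ready x \<le> (B::real)" "2 ^ ready y \<le> B"
  shows "2 ^ ready (compose x y) \<le> 4 * B"
proof -
  have "(2::real) ^ ready (compose x y) \<le> 2 ^ (max (ready x) (ready y) + 2)"
    by (rule power_increasing[OF ready_compose]) simp
  also have "\<dots> = 4 * 2 ^ max (ready x) (ready y)" by simp
  also have "(2::real) ^ max (ready x) (ready y) \<le> B" using assms by (simp add: max_def)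
  finally show ?thesis by simp
qed

lemma combine_gates:
  assumes "(\<Union>ps\<in>set pss. pair_gates ps) \<union> pair_gates cs \<subseteq> V"
  shows "card (pair_gates (combine pss cs) - V) \<le> 3 * length (concat pss)"
proof -
  have *: "card (pair_gates (concat (map (\<lambda>p. map (\<lambda>y. compose y (fst p)) (snd p)) (zip ds qss))) - V)
      \<le> 3 * length (concat qss)"
    if "(\<Union>ps\<in>set qss. pair_gates ps) \<union> pair_gates ds \<subseteq> V" for ds qss
    using that
  proof (induction qss arbitrary: ds)
    case (Cons qs qss)
    show ?case
    proof (cases ds)
      case ds: (Cons d ds')
      have e: "pair_gates qs \<union> pair_gates [d] - V = {}" using Cons.prems ds by auto
      have "card (pair_gates (map (\<lambda>x. compose x d) qs) - V) \<le> 3 * length qs"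
        using card_compose_gates[of d qs V] unfolding e by simp
      moreover have "card (pair_gates (concat (map (\<lambda>p. map (\<lambda>y. compose y (fst p)) (snd p)) (zip ds' qss))) - V)
          \<le> 3 * length (concat qss)" using Cons.prems ds by (intro Cons.IH) auto
      ultimately show ?thesis
        using card_Un_diff_le[of "pair_gates (map (\<lambda>x. compose x d) qs)"
          "pair_gates (concat (map (\<lambda>p. map (\<lambda>y. compose y (fst p)) (snd p)) (zip ds' qss)))" V]
        unfolding ds by simp
    qed simp
  qed simp
  show ?thesis
  proof (cases pss)
    case (Cons ps qss)
    have "pair_gates (combine pss cs) - V =
        pair_gates (concat (map (\<lambda>p. map (\<lambda>y. compose y (fst p)) (snd p)) (zip cs qss))) - V"
      using assms Cons by (auto simp: combine_def)
    then show ?thesis using *[of qss cs] assms Cons by simp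
  qed (simp add: combine_def)
qed

text \<open>Pays for intermediate gates \<open>V\<close> separately, so that a later stage is
  charged only for what it adds to them.\<close>

lemma card_diff_trans: "finite A \<Longrightarrow> finite V \<Longrightarrow> card (A - U) \<le> card (A - (U \<union> V)) + card (V - U)"
proof -
  assume f: "finite A" "finite V"
  have "card (A - U) \<le> card ((A - (U \<union> V)) \<union> (V - U))" using f by (intro card_mono) auto
  then show ?thesis using card_Un_le le_trans by blast
qed

lemma pair_gates_map_sum:
  "(\<forall>c\<in>set cs. card (pair_gates (h c) - U) \<le> \<alpha> * length c) \<Longrightarrow>
     card ((\<Union>c\<in>set cs. pair_gates (h c)) - U) \<le> \<alpha> * length (concat cs)"
proof (induction cs)
  case (Cons c cs)
  have "card (pair_gates (h c) \<union> (\<Union>c\<in>set cs. pair_gates (h c)) - U) \<le>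
      card (pair_gates (h c) - U) + card ((\<Union>c\<in>set cs. pair_gates (h c)) - U)"
    by (rule card_Un_diff_le)
  then show ?case using Cons by (simp add: algebra_simps)
qed simp

lemma pair_gates_map: "pair_gates (map h cs) = (\<Union>c\<in>set cs. pair_gates [h c])"
  by (auto simp: pair_gates_def)

lemma set_chunk: "0 < q \<Longrightarrow> c \<in> set (chunk q ps) \<Longrightarrow> p \<in> set c \<Longrightarrow> p \<in> set ps"
  using chunk_props(1)[of q ps] by (metis UN_I set_concat)

lemma pair_gates_chunk: "0 < q \<Longrightarrow> c \<in> set (chunk q ps) \<Longrightarrow> pair_gates c \<subseteq> pair_gates ps"
  by (intro pair_gates_mono subsetI) (rule set_chunk)

definition group_prefix :: "nat \<Rightarrow> 'x pair list \<Rightarrow> 'x pair list" where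
  "group_prefix q ps =
     combine (map sklansky (chunk q ps)) (sklansky (map block (chunk q ps)))"

definition adder :: "nat \<Rightarrow> 'x pair list \<Rightarrow> 'x pair list" where
  "adder q ps = combine (map (group_prefix q) (chunk (q * q) ps))
     (boundary_carries [] (map closed_block (chunk (q * q) ps)))"

lemma sem_group_prefix:
  assumes "0 < q" "\<forall>p\<in>set ps. closed_pair \<rho> p"
  shows "map (\<lambda>y. sem \<rho> y c) (group_prefix q ps) = carries \<rho> c ps"
proof -
  have "\<forall>cs\<in>set (chunk q ps). sem \<rho> (block cs) = fold (sem \<rho>) cs"
    using sem_block(1) chunk_props(2)[OF assms(1), of ps] set_chunk[OF assms(1), of _ ps] assms(2) by blast
  then have "map (\<lambda>y. sem \<rho> y c) (group_prefix q ps) = carries \<rho> c (concat (chunk q ps))"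
    unfolding group_prefix_def by (intro sem_combine) (auto simp: sem_sklansky carries_blocks)
  then show ?thesis using chunk_props(1)[OF assms(1), of ps] by simp
qed

lemma sem_adder:
  assumes "0 < q" "\<forall>p\<in>set ps. closed_pair \<rho> p"
  shows "map (\<lambda>y. sem \<rho> y False) (adder q ps) = carries \<rho> False ps"
proof -
  have q: "0 < q * q" using assms(1) by simp
  have c: "\<forall>cs\<in>set (chunk (q * q) ps). \<forall>p\<in>set cs. closed_pair \<rho> p"
    using set_chunk[OF q, of _ ps] assms(2) by blast
  have "\<forall>cs\<in>set (chunk (q * q) ps). sem \<rho> (closed_block cs) = fold (sem \<rho>) cs"
    using sem_block(2) chunk_props(2)[OF q, of ps] c by blast
  moreover have "map (\<lambda>y. sem \<rho> y False) (boundary_carries [] (map closed_block (chunk (q * q) ps))) =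
      carries \<rho> False (map closed_block (chunk (q * q) ps))"
    using sem_boundary_carries[of "[]" "map closed_block (chunk (q * q) ps)" \<rho>] by (auto simp: closed_closed_block)
  ultimately have "map (\<lambda>y. sem \<rho> y False) (adder q ps) = carries \<rho> False (concat (chunk (q * q) ps))"
    unfolding adder_def
    by (intro sem_combine ballI allI sem_group_prefix[OF assms(1)]) (use c in \<open>auto simp: carries_blocks\<close>)
  then show ?thesis using chunk_props(1)[OF q, of ps] by simp
qed

lemma pair_weight_chunk: "0 < q \<Longrightarrow> (\<Sum>c\<leftarrow>chunk q ps. pair_weight c) = pair_weight ps"
proof -
  have "pair_weight (concat pss) = (\<Sum>c\<leftarrow>pss. pair_weight c)" for pss :: "'a pair list list"
    by (induction pss) auto
  from this[of "chunk q ps"] show "0 < q \<Longrightarrow> ?thesis" using chunk_props(1)[of q ps] by simp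
qed

lemma pair_weight_chunk_le: "0 < q \<Longrightarrow> c \<in> set (chunk q ps) \<Longrightarrow> pair_weight c \<le> pair_weight ps"
  using pair_weight_chunk[of q ps] member_le_sum_list[of "pair_weight c" "map pair_weight (chunk q ps)"] by simp

lemma length_chunk_square: "0 < q \<Longrightarrow> length ps \<le> q * q \<Longrightarrow> length (chunk q ps) \<le> q"
proof -
  assume q: "0 < q" "length ps \<le> q * q"
  then have "length (chunk q ps) * q < Suc q * q" using chunk_props(3)[OF q(1), of ps] by simp
  then have "length (chunk q ps) < Suc q" by (simp only: mult_less_cancel2)
  then show ?thesis by simp
qed

text \<open>The circuit inside the blocks and the one on the blocks run in parallel, so that
  \<open>4 ^ k\<close> enters once. The path factor stems from merging the blocks, and the last 4
  from composing the two results.\<close>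

lemma group_prefix_bound:
  assumes q: "0 < q" "q \<le> 2 ^ k" "length ps \<le> q * q" "deep_enough D q" "y \<in> set (group_prefix q ps)"
  shows "2 ^ ready y \<le> 4 * (4 ^ k * (path_factor D * pair_weight ps))"
proof -
  let ?B = "path_factor D * real (pair_weight ps)"
  have f: "2 \<le> path_factor D" using deep_enough_factor[OF q(4,1)] .
  have B: "real (pair_weight ps) \<le> ?B" using f mult_right_mono[of 1 "path_factor D" "real (pair_weight ps)"] by simp
  have 0: "0 \<le> 4 ^ k * ?B" using f by simp
  have 1: "2 ^ ready x \<le> 4 ^ k * ?B" if "x \<in> set (sklansky cs)" "cs \<in> set (chunk q ps)" for x cs
  proof (rule sklansky_bound[OF _ _ that(1)])
    show "length cs \<le> 2 ^ k" using chunk_props(2)[OF q(1), of ps] that(2) q(2) le_trans by blast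
    show "\<forall>p\<in>set cs. 2 ^ ready p \<le> ?B"
    proof
      fix p assume "p \<in> set cs"
      then have "p \<in> set ps" using set_chunk[OF q(1) that(2)] by blast
      then have "real (2 ^ ready p) \<le> real (pair_weight ps)"
        using pair_weight_mem by (simp only: of_nat_le_iff)
      then have "2 ^ ready p \<le> real (pair_weight ps)" by (simp only: of_nat_power of_nat_numeral)
      then show "2 ^ ready p \<le> ?B" using B by linarith
    qed
  qed
  have 2: "2 ^ ready x \<le> 4 ^ k * ?B" if "x \<in> set (sklansky (map block (chunk q ps)))" for x
  proof (rule sklansky_bound[OF _ _ that])
    show "length (map block (chunk q ps)) \<le> 2 ^ k"
      using length_chunk_square[OF q(1,3)] q(2) by simp
    show "\<forall>p\<in>set (map block (chunk q ps)). 2 ^ ready p \<le> ?B"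
    proof
      fix p assume "p \<in> set (map block (chunk q ps))"
      then obtain cs where cs: "cs \<in> set (chunk q ps)" "p = block cs" by auto
      then have c: "cs \<noteq> []" "length cs \<le> q" using chunk_props(2)[OF q(1), of ps] by auto
      have "2 ^ ready p \<le> path_factor D * pair_weight cs"
        using block_bounds(1)[OF deep_enough_mono[OF q(4) c(2)] c(1)] cs(2) by simp
      also have "\<dots> \<le> ?B"
        using f pair_weight_chunk_le[OF q(1) cs(1)] by (intro mult_left_mono) auto
      finally show "2 ^ ready p \<le> ?B" .
    qed
  qed
  from in_set_combine[OF q(5)[unfolded group_prefix_def]]
  show ?thesis
  proof (elim disjE bexE)
    fix cs assume "cs \<in> set (map sklansky (chunk q ps))" "y \<in> set cs"
    then show ?thesis using 1[of y] 0 by fastforce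
  next
    fix c cs x assume "c \<in> set (sklansky (map block (chunk q ps)))" "cs \<in> set (map sklansky (chunk q ps))"
      "x \<in> set cs" "y = compose x c"
    then show ?thesis using compose_bound[OF 1 2, of x _ c] by auto
  qed
qed

text \<open>An output waits either for the prefix inside its group or for the carry into the group;
  the alternatives have bounds of different order and are kept apart. The second one passes through
  three nested paths, over a group (\<open>D'\<close>), over a block of groups (\<open>D''\<close>)
  and over a list of such blocks (\<open>E\<close>). Its 16 consists of 2 for each of the two closed
  blocks and 4 for the final composition.\<close>

lemma adder_bound:
  assumes q: "0 < q" "q \<le> 2 ^ k" "deep_enough D q" "deep_enough D' (q * q)"
    and m: "length (chunk (q * q) ps) \<le> m" "m \<le> 2 ^ l" "deep_enough D'' m" "deep_enough E (l + 1)" "0 < m"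
    and y: "y \<in> set (adder q ps)"
  shows "2 ^ arr (fst y) \<le> 16 * (4 ^ k * (path_factor D * pair_weight ps)) \<or>
    2 ^ arr (fst y) \<le> 16 * (path_factor E * path_factor D'' * path_factor D' * pair_weight ps)"
proof -
  let ?cs = "chunk (q * q) ps"
  have qq: "0 < q * q" using q(1) by simp
  let ?A = "4 * (4 ^ k * (path_factor D * real (pair_weight ps)))"
  let ?B = "4 * (path_factor E * path_factor D'' * path_factor D' * real (pair_weight ps))"
  have f: "2 \<le> path_factor D" "2 \<le> path_factor D'" "2 \<le> path_factor D''" "2 \<le> path_factor E"
    using deep_enough_factor q(1,3,4) m by auto
  have 1: "2 ^ ready x \<le> ?A" if "x \<in> set (group_prefix q cs)" "cs \<in> set ?cs" for x cs
  proof -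
    have "length cs \<le> q * q" using chunk_props(2)[OF qq, of ps] that(2) by blast
    then have "2 ^ ready x \<le> 4 * (4 ^ k * (path_factor D * pair_weight cs))"
      by (rule group_prefix_bound[OF q(1,2) _ q(3) that(1)])
    also have "\<dots> \<le> ?A" using f pair_weight_chunk_le[OF qq that(2)] by (intro mult_left_mono) auto
    finally show ?thesis .
  qed
  have "real (pair_weight (map closed_block cs)) \<le> 2 * path_factor D' * real (\<Sum>c\<leftarrow>cs. pair_weight c)"
    if "\<forall>c\<in>set cs. c \<noteq> [] \<and> length c \<le> q * q" for cs :: "'a pair list list"
    using that
  proof (induction cs)
    case (Cons c cs)
    have "2 ^ ready (closed_block c) \<le> 2 * path_factor D' * pair_weight c"
      using Cons.prems deep_enough_mono[OF q(4)] by (intro block_bounds) auto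
    then show ?case using Cons by (simp add: algebra_simps)
  qed simp
  from this[of ?cs] have w: "real (pair_weight (map closed_block ?cs)) \<le> 2 * path_factor D' * pair_weight ps"
    using chunk_props(2)[OF qq, of ps] pair_weight_chunk[OF qq, of ps] by simp
  have 2: "2 ^ arr (fst c) \<le> ?B" if "c \<in> set (boundary_carries [] (map closed_block ?cs))" for c
  proof -
    have "2 ^ arr (fst c) \<le> path_factor E * (pair_weight ([] :: 'a pair list) + 2 * path_factor D'' * pair_weight (map closed_block ?cs))"
      by (rule boundary_carries_bound[where k = l, OF _ _ _ that]) (use m deep_enough_mono[OF m(3)] in auto)
    also have "\<dots> \<le> path_factor E * (pair_weight ([] :: 'a pair list) + 2 * path_factor D'' * (2 * path_factor D' * pair_weight ps))"
      using f w by (intro mult_left_mono add_left_mono) auto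
    also have "\<dots> = ?B" by simp
    finally show ?thesis .
  qed
  from in_set_combine[OF y[unfolded adder_def]]
  show ?thesis
  proof (elim disjE bexE)
    fix cs assume "cs \<in> set (map (group_prefix q) ?cs)" "y \<in> set cs"
    then obtain ds where "ds \<in> set ?cs" "y \<in> set (group_prefix q ds)" by auto
    then have "2 ^ ready y \<le> ?A" using 1 by blast
    moreover have "(2::real) ^ arr (fst y) \<le> 2 ^ ready y" by (intro power_increasing) (auto simp: ready_def)
    moreover have "0 \<le> ?A" using f by simp
    ultimately show ?thesis by linarith
  next
    fix c cs x assume *: "c \<in> set (boundary_carries [] (map closed_block ?cs))" "cs \<in> set (map (group_prefix q) ?cs)"
      "x \<in> set cs" "y = compose x c"
    then obtain ds where "ds \<in> set ?cs" "x \<in> set (group_prefix q ds)" by auto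
    then have x: "2 ^ ready x \<le> ?A" using 1 by blast
    have "arr (fst y) \<le> max (ready x) (arr (fst c)) + 2" using *(4) by (auto simp: compose_def ready_def)
    then have "(2::real) ^ arr (fst y) \<le> 2 ^ (max (ready x) (arr (fst c)) + 2)" by (intro power_increasing) auto
    then have "(2::real) ^ arr (fst y) \<le> 4 * 2 ^ max (ready x) (arr (fst c))" by simp
    then show ?thesis using x 2[OF *(1)] by (auto simp: max_def split: if_splits)
  qed
qed

text \<open>The summand 3 k collects 3 k / 2 from each of the two Sklansky circuits; merging the
  blocks costs 2 (D - 3) + 1 and the final composition 3 gates per pair.\<close>

lemma group_prefix_gates:
  assumes q: "0 < q" "q \<le> 2 ^ k" "length ps \<le> q * q" "deep_enough D q" "pair_gates ps \<subseteq> U"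
  shows "card (pair_gates (group_prefix q ps) - U) \<le> (3 * k + 2 * (D - 3) + 4) * length ps"
proof -
  let ?cs = "chunk q ps"
  let ?S = "\<Union>c\<in>set ?cs. pair_gates (sklansky c)"
  let ?bs = "map block ?cs"
  let ?W = "U \<union> pair_gates ?bs"
  have len: "length (concat ?cs) = length ps" using chunk_props(1)[OF q(1), of ps] by simp
  have 1: "2 * card (?S - U) \<le> 3 * k * length ps"
  proof -
    have "2 * card (pair_gates (sklansky c) - U) \<le> 3 * k * length c" if "c \<in> set ?cs" for c
      using pair_gates_chunk[OF q(1) that] q(2,5) chunk_props(2)[OF q(1), of ps] that
      by (intro sklansky_gates) (auto intro: le_trans)
    then have "2 * card ((\<Union>c\<in>set cs. pair_gates (sklansky c)) - U) \<le> 3 * k * length (concat cs)"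
      if "set cs \<subseteq> set ?cs" for cs
      using that
    proof (induction cs)
      case (Cons c cs)
      have "card (pair_gates (sklansky c) \<union> (\<Union>c\<in>set cs. pair_gates (sklansky c)) - U) \<le>
          card (pair_gates (sklansky c) - U) + card ((\<Union>c\<in>set cs. pair_gates (sklansky c)) - U)"
        by (rule card_Un_diff_le)
      moreover have "2 * card (pair_gates (sklansky c) - U) \<le> 3 * k * length c" using Cons.prems by auto
      moreover have "2 * card ((\<Union>c\<in>set cs. pair_gates (sklansky c)) - U) \<le> 3 * k * length (concat cs)"
        using Cons by auto
      ultimately show ?case by (simp add: algebra_simps)
    qed simp
    then show ?thesis using len by (metis order_refl)
  qed
  have "card (pair_gates [block c] - U) \<le> (2 * (D - 3) + 1) * length c" if "c \<in> set ?cs" for c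
    using pair_gates_chunk[OF q(1) that] q(5) chunk_props(2)[OF q(1), of ps] that deep_enough_mono[OF q(4)]
    by (intro block_gates(1)) auto
  then have 2: "card (pair_gates ?bs - U) \<le> (2 * (D - 3) + 1) * length ps"
    unfolding pair_gates_map using pair_gates_map_sum[of ?cs "\<lambda>c. [block c]" U "2 * (D - 3) + 1"] len by simp
  have 3: "2 * card (pair_gates (sklansky ?bs) - ?W) \<le> 3 * k * length ps"
  proof -
    have "2 * card (pair_gates (sklansky ?bs) - ?W) \<le> 3 * k * length ?bs"
      using length_chunk_square[OF q(1,3)] q(2) by (intro sklansky_gates) auto
    also have "\<dots> \<le> 3 * k * length ps" using length_chunk_le[OF q(1), of ps] by simp
    finally show ?thesis .
  qed
  have 4: "card (pair_gates (group_prefix q ps) - (U \<union> (?S \<union> pair_gates (sklansky ?bs)))) \<le> 3 * length ps"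
  proof -
    have "length (concat (map sklansky cs)) = length (concat cs)" for cs :: "'a pair list list"
      by (induction cs) auto
    then show ?thesis
      using combine_gates[of "map sklansky ?cs" "sklansky ?bs" "U \<union> (?S \<union> pair_gates (sklansky ?bs))"] len
      by (auto simp: group_prefix_def)
  qed
  have "card (pair_gates (group_prefix q ps) - U) \<le> 3 * length ps + card (?S \<union> pair_gates (sklansky ?bs) - U)"
    using card_diff_trans[of "pair_gates (group_prefix q ps)" "?S \<union> pair_gates (sklansky ?bs)" U] 4 by simp
  also have "card (?S \<union> pair_gates (sklansky ?bs) - U) \<le> card (?S - U) + card (pair_gates (sklansky ?bs) - U)"
    by (rule card_Un_diff_le)
  also have "card (pair_gates (sklansky ?bs) - U) \<le>
      card (pair_gates (sklansky ?bs) - ?W) + card (pair_gates ?bs - U)"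
    by (rule card_diff_trans) auto
  finally have "2 * card (pair_gates (group_prefix q ps) - U) \<le>
      6 * length ps + 3 * k * length ps + 3 * k * length ps + 2 * ((2 * (D - 3) + 1) * length ps)"
    using 1 2 3 by linarith
  also have "\<dots> = 2 * ((3 * k + 2 * (D - 3) + 4) * length ps)" by (simp add: algebra_simps)
  finally show ?thesis by simp
qed

text \<open>Per pair: the group prefix, 2 (D' - 3) + 2 gates for the closed block of its group, and
  3 for the final composition. The carries into groups are paid per group, hence the factor
  \<open>m\<close>.\<close>

lemma adder_gates:
  assumes q: "0 < q" "q \<le> 2 ^ k" "deep_enough D q" "deep_enough D' (q * q)"
    and m: "length (chunk (q * q) ps) \<le> m" "m \<le> 2 ^ l" "deep_enough D'' m" "deep_enough E (l + 1)"
  shows "card (pair_gates (adder q ps) - pair_gates ps) \<le>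
    (3 * k + 2 * (D - 3) + 2 * (D' - 3) + 9) * length ps +
      m * (l * (2 * (D'' - 3) + 2) + 2 * (E - 3) * (l + 1))"
proof -
  let ?cs = "chunk (q * q) ps" and ?U = "pair_gates ps"
  let ?S = "\<Union>c\<in>set ?cs. pair_gates (group_prefix q c)"
  let ?bs = "map closed_block ?cs"
  let ?W = "?U \<union> pair_gates ?bs"
  let ?T = "l * (2 * (D'' - 3) + 2) + 2 * (E - 3) * (l + 1)"
  have qq: "0 < q * q" using q(1) by simp
  have len: "length (concat ?cs) = length ps" using chunk_props(1)[OF qq, of ps] by simp
  have "card (pair_gates (group_prefix q c) - ?U) \<le> (3 * k + 2 * (D - 3) + 4) * length c" if "c \<in> set ?cs" for c
    using pair_gates_chunk[OF qq that] chunk_props(2)[OF qq, of ps] that q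
    by (intro group_prefix_gates) auto
  then have 1: "card (?S - ?U) \<le> (3 * k + 2 * (D - 3) + 4) * length ps"
    using pair_gates_map_sum[of ?cs "group_prefix q" ?U] len by simp
  have "card (pair_gates [closed_block c] - ?U) \<le> (2 * (D' - 3) + 2) * length c" if "c \<in> set ?cs" for c
    using pair_gates_chunk[OF qq that] chunk_props(2)[OF qq, of ps] that deep_enough_mono[OF q(4)]
    by (intro block_gates(2)) auto
  then have 2: "card (pair_gates ?bs - ?U) \<le> (2 * (D' - 3) + 2) * length ps"
    unfolding pair_gates_map using pair_gates_map_sum[of ?cs "\<lambda>c. [closed_block c]" ?U "2 * (D' - 3) + 2"] len by simp
  have "card (pair_gates (boundary_carries [] ?bs) - ?W) \<le> length ?bs * (l * (2 * (D'' - 3) + 2) + 2 * (E - 3) * (length ([]::'a pair list) + l + 1))"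
    by (rule boundary_carries_gates) (use m deep_enough_mono[OF m(3)] in auto)
  also have "\<dots> \<le> m * ?T" using m(1) by (intro mult_le_mono) auto
  finally have 3: "card (pair_gates (boundary_carries [] ?bs) - ?W) \<le> m * ?T" .
  have 4: "card (pair_gates (adder q ps) - (?U \<union> (?S \<union> pair_gates (boundary_carries [] ?bs)))) \<le> 3 * length ps"
  proof -
    have "length (sklansky c) = length c" for c :: "'a pair list" by simp
    have cl: "length (combine pss cs) \<le> length (concat pss)" for pss :: "'a pair list list" and cs
    proof -
      have "length (concat (map (\<lambda>p. map (\<lambda>y. compose y (fst p)) (snd p)) (zip ds qss))) \<le> length (concat qss)"
        for ds :: "'a pair list" and qss
      proof (induction qss arbitrary: ds)
        case (Cons qs qss)
        show ?case
        proof (cases ds)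
          case c: (Cons d ds')
          then show ?thesis using Cons[of ds'] by simp
        qed simp
      qed simp
      then show ?thesis by (cases pss) (auto simp: combine_def)
    qed
    have "length (concat (map sklansky cs)) = length (concat cs)" for cs :: "'a pair list list"
      by (induction cs) auto
    then have "length (group_prefix q c) \<le> length c" for c :: "'a pair list"
      using cl[of "map sklansky (chunk q c)"] chunk_props(1)[OF q(1), of c] by (metis group_prefix_def)
    then have "length (concat (map (group_prefix q) cs)) \<le> length (concat cs)" for cs :: "'a pair list list"
      by (induction cs) (auto intro: add_mono)
    from this[of ?cs] show ?thesis
      using combine_gates[of "map (group_prefix q) ?cs" "boundary_carries [] ?bs" "?U \<union> (?S \<union> pair_gates (boundary_carries [] ?bs))"] len
      unfolding adder_def by (fastforce intro: le_trans)
  qed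
  have "card (pair_gates (adder q ps) - ?U) \<le> 3 * length ps + card (?S \<union> pair_gates (boundary_carries [] ?bs) - ?U)"
    using card_diff_trans[of "pair_gates (adder q ps)" "?S \<union> pair_gates (boundary_carries [] ?bs)" ?U] 4 by simp
  also have "card (?S \<union> pair_gates (boundary_carries [] ?bs) - ?U) \<le> card (?S - ?U) + card (pair_gates (boundary_carries [] ?bs) - ?U)"
    by (rule card_Un_diff_le)
  also have "card (pair_gates (boundary_carries [] ?bs) - ?U) \<le>
      card (pair_gates (boundary_carries [] ?bs) - ?W) + card (pair_gates ?bs - ?U)"
    by (rule card_diff_trans) auto
  finally have "card (pair_gates (adder q ps) - ?U) \<le> 3 * length ps + ((3 * k + 2 * (D - 3) + 4) * length ps +
      (m * ?T + (2 * (D' - 3) + 2) * length ps))" using 1 2 3 by linarith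
  then show ?thesis by (simp add: algebra_simps)
qed

section \<open>Circuits from formulas\<close>

fun subterms :: "'x trm \<Rightarrow> 'x trm list" where
  "subterms (In k x) = []"
| "subterms (Gt f s t) = Gt f s t # subterms s @ subterms t"

fun leaves :: "'x trm \<Rightarrow> 'x trm set" where
  "leaves (In k x) = {In k x}"
| "leaves (Gt f s t) = leaves s \<union> leaves t"

lemma set_subterms [simp]: "set (subterms t) = gates t"
  by (induction t) auto

lemma gates_trans: "s \<in> gates t \<Longrightarrow> gates s \<subseteq> gates t \<and> leaves s \<subseteq> leaves t"
  by (induction t) auto

fun position :: "'a list \<Rightarrow> 'a \<Rightarrow> nat" where
  "position [] x = 0"
| "position (y # ys) x = (if y = x then 0 else Suc (position ys x))"

lemma position: "x \<in> set xs \<Longrightarrow> position xs x < length xs \<and> xs ! position xs x = x"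
  by (induction xs) auto

text \<open>Sharing takes place here: every distinct gate formula becomes a single vertex, which
  makes the circuit size the cardinality of the set of gates.\<close>

definition distinct_subterms :: "'x trm list \<Rightarrow> 'x trm list" where
  "distinct_subterms ts = remdups (concat (map subterms ts))"

definition nodes :: "'x trm list \<Rightarrow> 'x trm list \<Rightarrow> 'x trm list" where
  "nodes ls ts = ls @ distinct_subterms ts"

fun vertex_of :: "'x trm list \<Rightarrow> 'x trm \<Rightarrow> 'x vertex" where
  "vertex_of ns (In k x) = Variable x"
| "vertex_of ns (Gt f s t) = Gate f (position ns s) (position ns t)"

definition circuit_of :: "'x trm list \<Rightarrow> 'x trm list \<Rightarrow> 'x circuit" where
  "circuit_of ls ts = Circuit (map (vertex_of (nodes ls ts)) (nodes ls ts)) (map (position (nodes ls ts)) ts)"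

fun is_leaf :: "'x trm \<Rightarrow> bool" where
  "is_leaf (In k x) = True"
| "is_leaf (Gt f s t) = False"

fun leaf_name :: "'x trm \<Rightarrow> 'x" where
  "leaf_name (In k x) = x"

text \<open>Distinctness is required of the names and not of the leaves, because two leaves of one
  name with different times would be two vertices for the same variable.\<close>

locale formula_circuit =
  fixes ls ts :: "'x trm list"
  assumes ts: "ts \<noteq> []"
    and is_leaf: "\<And>l. l \<in> set ls \<Longrightarrow> is_leaf l"
    and leaves: "\<And>t. t \<in> set ts \<Longrightarrow> leaves t \<subseteq> set ls"
    and distinct_leaves: "distinct (map leaf_name ls)"
begin

abbreviation "ns \<equiv> nodes ls ts"
abbreviation "C \<equiv> circuit_of ls ts"

lemma set_nodes: "set ns = set ls \<union> (\<Union>t\<in>set ts. gates t)"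
  by (simp add: nodes_def distinct_subterms_def)

lemma self_node: "leaves t \<subseteq> set ls \<Longrightarrow> gates t \<subseteq> set ns \<Longrightarrow> t \<in> set ns"
  by (cases t) (auto simp: set_nodes)

lemma node_children: "Gt f s t \<in> set ns \<Longrightarrow> s \<in> set ns \<and> t \<in> set ns"
proof -
  assume "Gt f s t \<in> set ns"
  then obtain u where u: "u \<in> set ts" "Gt f s t \<in> gates u"
    using is_leaf unfolding set_nodes by fastforce
  then have "gates (Gt f s t) \<subseteq> set ns" "leaves (Gt f s t) \<subseteq> set ls"
    using gates_trans[OF u(2)] leaves[OF u(1)] by (auto simp: set_nodes)
  then show ?thesis by (auto intro!: self_node)
qed

lemma output_node: "t \<in> set ts \<Longrightarrow> t \<in> set ns"
  using leaves by (intro self_node) (auto simp: set_nodes)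

lemma vertices_C [simp]: "vertices C = map (vertex_of ns) ns" "outputs C = map (position ns) ts"
  by (simp_all add: circuit_of_def)

lemma gate_vertex:
  assumes "v < length ns" "vertex_of ns (ns ! v) = Gate f u w"
  obtains s t where "ns ! v = Gt f s t" "u < length ns" "w < length ns" "ns ! u = s" "ns ! w = t"
proof -
  obtain s t where st: "ns ! v = Gt f s t" "u = position ns s" "w = position ns t"
    using assms(2) by (cases "ns ! v") auto
  have "Gt f s t \<in> set ns" using assms(1) st(1) by (metis nth_mem)
  then have "s \<in> set ns" "t \<in> set ns" using node_children by blast+
  from position[OF this(1)] position[OF this(2)] show thesis
    by (intro that[OF st(1)]) (simp_all add: st(2,3))
qed

text \<open>The size of the formula decreases from a gate to its predecessors, whatever the order of
  the vertices. Acyclicity follows, and the same measure drives the later inductions over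
  vertices.\<close>

lemma edges_C: "(u, v) \<in> edges C \<Longrightarrow> u < length ns \<and> v < length ns \<and> size (ns ! u) < size (ns ! v)"
proof -
  assume "(u, v) \<in> edges C"
  then have *: "v < length (vertices C) \<and> (\<exists>f w. vertices C ! v = Gate f u w \<or> vertices C ! v = Gate f w u)"
    by (simp only: edges_def mem_Collect_eq case_prod_conv)
  then have v: "v < length ns" by simp
  from * obtain f w where "vertices C ! v = Gate f u w \<or> vertices C ! v = Gate f w u" by blast
  then have "vertex_of ns (ns ! v) = Gate f u w \<or> vertex_of ns (ns ! v) = Gate f w u" using v by simp
  then show ?thesis
  proof
    assume "vertex_of ns (ns ! v) = Gate f u w"
    then show ?thesis by (rule gate_vertex[OF v]) (use v in simp)
  next
    assume "vertex_of ns (ns ! v) = Gate f w u"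
    then show ?thesis by (rule gate_vertex[OF v]) (use v in simp)
  qed
qed

lemma is_circuit_C: "is_circuit C"
proof -
  have "edges C \<subseteq> {(u, v). (ns ! u, ns ! v) \<in> Wellfounded.measure size}" using edges_C by auto
  moreover have "acyclic {(u, v). (ns ! u, ns ! v) \<in> Wellfounded.measure size}"
  proof -
    have "wf (inv_image (Wellfounded.measure size) (\<lambda>v. ns ! v))" by simp
    then show ?thesis by (intro wf_acyclic) (simp add: inv_image_def)
  qed
  ultimately have "acyclic (edges C)" using acyclic_subset by blast
  moreover have "u = v" if uv: "u < length ns" "v < length ns" "vertex_of ns (ns ! u) = Variable x"
    "vertex_of ns (ns ! v) = Variable x" for u v x
  proof -
    have *: "w < length ls \<and> map leaf_name ls ! w = x" if w: "w < length ns" "vertex_of ns (ns ! w) = Variable x" for w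
    proof -
      obtain k where k: "ns ! w = In k x" using w(2) by (cases "ns ! w") auto
      have "w < length ls"
      proof (rule ccontr)
        assume "\<not> w < length ls"
        then have "ns ! w \<in> set (distinct_subterms ts)" using w(1) by (simp add: nodes_def nth_append)
        then obtain t where "In k x \<in> gates t" using k by (auto simp: distinct_subterms_def)
        then show False by (induction t) auto
      qed
      then show ?thesis using k by (simp add: nodes_def nth_append)
    qed
    from *[OF uv(1,3)] *[OF uv(2,4)] show ?thesis
      using nth_eq_iff_index_eq[OF distinct_leaves, of u v] by simp
  qed
  moreover have "edges C \<subseteq> {..<length ns} \<times> {..<length ns}" using edges_C by auto
  moreover have "set (map (position ns) ts) \<subseteq> {..<length ns}" using output_node position[of _ ns] by auto
  ultimately show ?thesis using ts unfolding is_circuit_def vertices_C by simp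
qed

lemma vertex_value_C: "v < length ns \<Longrightarrow> vertex_value C \<rho> v = val \<rho> (ns ! v)"
proof (induction "size (ns ! v)" arbitrary: v rule: less_induct)
  case less
  show ?case
  proof (cases "ns ! v")
    case (In k x)
    then show ?thesis using vertex_value_unfold[OF is_circuit_C, of v \<rho>] less.prems by simp
  next
    case (Gt f s t)
    then obtain u w where uw: "vertex_of ns (ns ! v) = Gate f u w" by simp
    from gate_vertex[OF less.prems uw] Gt have "u < length ns" "w < length ns" "ns ! u = s" "ns ! w = t" by auto
    then show ?thesis
      using vertex_value_unfold[OF is_circuit_C, of v \<rho>] less uw Gt by simp
  qed
qed

text \<open>Formulas count time from a different origin: real times are at most formula times plus m
  - h. The inequality is written with sums, as m - h may be negative.\<close>

lemma arrival_time_C: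
  assumes "\<And>k x. In k x \<in> set ls \<Longrightarrow> a x + h \<le> k + m"
  shows "v < length ns \<Longrightarrow> arrival_time C a v + h \<le> arr (ns ! v) + m"
proof (induction "size (ns ! v)" arbitrary: v rule: less_induct)
  case less
  show ?case
  proof (cases "ns ! v")
    case (In k x)
    then have "In k x \<in> set ns" using less.prems by (metis nth_mem)
    moreover have "In k x \<notin> gates t" for t by (induction t) auto
    ultimately have "In k x \<in> set ls" by (auto simp: set_nodes)
    then show ?thesis using arrival_time_unfold[OF is_circuit_C, of v a] less.prems In assms by simp
  next
    case (Gt f s t)
    then obtain u w where uw: "vertex_of ns (ns ! v) = Gate f u w" by simp
    from gate_vertex[OF less.prems uw] Gt have *: "u < length ns" "w < length ns" "ns ! u = s" "ns ! w = t" by auto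
    have "arrival_time C a u + h \<le> arr s + m" "arrival_time C a w + h \<le> arr t + m"
      using less.hyps[of u] less.hyps[of w] * Gt less.prems by auto
    then show ?thesis
      using arrival_time_unfold[OF is_circuit_C, of v a] less.prems uw Gt by auto
  qed
qed

lemma circuit_size_C: "circuit_size C = card (\<Union>t\<in>set ts. gates t)"
proof -
  have leaf: "\<exists>x. vertex_of ns l = Variable x" if "l \<in> set ls" for l
    using is_leaf[OF that] by (cases l) auto
  have gate: "\<exists>f u w. vertex_of ns t = Gate f u w" if "t \<in> set (distinct_subterms ts)" for t
  proof -
    have "In k x \<notin> gates s" for k x and s :: "'x trm" by (induction s) auto
    then show ?thesis using that by (cases t) (auto simp: distinct_subterms_def)
  qed
  have "{v. v < length (vertices C) \<and> (\<exists>f u w. vertices C ! v = Gate f u w)} =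
      {length ls..<length ns}" (is "?A = ?B")
  proof (intro set_eqI iffI)
    fix v assume "v \<in> ?A"
    then obtain f u w where v: "v < length ns" "vertex_of ns (ns ! v) = Gate f u w" by auto
    have "\<not> v < length ls"
    proof
      assume l: "v < length ls"
      then have "ns ! v \<in> set ls" by (simp add: nodes_def nth_append)
      then show False using leaf v(2) by fastforce
    qed
    then show "v \<in> ?B" using v(1) by simp
  next
    fix v assume v: "v \<in> ?B"
    then have "ns ! v \<in> set (distinct_subterms ts)" by (auto simp: nodes_def nth_append)
    then show "v \<in> ?A" using gate v by simp
  qed
  then have "circuit_size C = length (distinct_subterms ts)" by (simp add: circuit_size_def nodes_def)
  also have "\<dots> = card (set (distinct_subterms ts))" by (simp add: distinct_subterms_def length_remdups_card_conv)
  finally show ?thesis by (simp add: distinct_subterms_def)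
qed

end


section \<open>The adder circuit of an instance\<close>

text \<open>For \<open>x \<le> M\<close> this is the arrival time \<open>x\<close> relative to \<open>M - K\<close>, truncated at \<open>0\<close>; counting
  upwards from \<open>x\<close> needs only successors of binary numbers.\<close>

fun rel_arrival :: "nat \<Rightarrow> nat \<Rightarrow> nat \<Rightarrow> nat" where
  "rel_arrival 0 M x = 0"
| "rel_arrival (Suc K) M x = (if x = M then Suc K else rel_arrival K M (Suc x))"

lemma rel_arrival: "x \<le> M \<Longrightarrow> rel_arrival K M x = K - (M - x)"
  by (induction K M x rule: rel_arrival.induct) auto

definition clog :: "nat \<Rightarrow> nat" where
  "clog n = (LEAST k. n \<le> 2 ^ k)"

lemma clog_le: "n \<le> 2 ^ clog n"
  unfolding clog_def by (rule LeastI[of _ n]) (simp add: less_imp_le)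

lemma clog_less: "1 < n \<Longrightarrow> 2 ^ clog n < 2 * n"
proof -
  assume n: "1 < n"
  then obtain k where k: "clog n = Suc k" using clog_le[of n] by (cases "clog n") auto
  then have "\<not> n \<le> 2 ^ k" using not_less_Least[of k "\<lambda>k. n \<le> 2 ^ k"] by (simp add: clog_def)
  then show ?thesis using k by simp
qed

definition times :: "nat \<Rightarrow> (adder_input \<Rightarrow> nat) \<Rightarrow> (nat \<times> nat) list" where
  "times n a = map (\<lambda>i. (a (Propagate i), a (Generate i))) [0..<n]"

definition latest :: "(nat \<times> nat) list \<Rightarrow> nat" where
  "latest ts = foldr (\<lambda>t m. max (fst t) (max (snd t) m)) ts 0"

definition rel_times :: "(nat \<times> nat) list \<Rightarrow> (nat \<times> nat) list" where
  "rel_times ts = map (\<lambda>t. (rel_arrival (clog (length ts) + 4) (latest ts) (fst t),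
     rel_arrival (clog (length ts) + 4) (latest ts) (snd t))) ts"

definition inputs :: "(nat \<times> nat) list \<Rightarrow> (adder_input trm \<times> adder_input trm) list" where
  "inputs rs = map (\<lambda>p. (In (fst (snd p)) (Propagate (fst p)), In (snd (snd p)) (Generate (fst p))))
     (zip [0..<length rs] rs)"

text \<open>Replacing p by g or p leaves the carry map unchanged and makes every pair closed, at the
  price of one gate and one time unit per pair.\<close>

definition elements :: "(adder_input trm \<times> adder_input trm) list \<Rightarrow> adder_input pair list" where
  "elements ins = map (\<lambda>p. (snd p, Gt OR (snd p) (fst p))) ins"

text \<open>Up to \<open>clog\<close> 12 the delay of a plain Sklansky circuit is within the bound.
  The estimates of the blocked construction start at 13.\<close>

definition outputs_of :: "adder_input pair list \<Rightarrow> adder_input pair list" where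
  "outputs_of ps = (if clog (length ps) \<le> 12 then sklansky ps
     else adder ((clog (length ps) + 1) div 2) ps)"

definition leaf_list :: "('x trm \<times> 'x trm) list \<Rightarrow> 'x trm list" where
  "leaf_list ins = concat (map (\<lambda>p. [fst p, snd p]) ins)"

definition circuit_of_times :: "(nat \<times> nat) list \<Rightarrow> adder_input circuit" where
  "circuit_of_times ts = (let ins = inputs (rel_times ts) in
     circuit_of (leaf_list ins) (map fst (outputs_of (elements ins))))"

lemma latest_ge: "t \<in> set ts \<Longrightarrow> fst t \<le> latest ts \<and> snd t \<le> latest ts"
  by (induction ts) (auto simp: latest_def)

section \<open>Correctness of the circuit\<close>

text \<open>A predicate preserved by gates passes from the inputs through every construction to the
  outputs. It is instantiated with the property of having only inputs of the instance as
  leaves.\<close>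

definition gate_closed :: "('x trm \<Rightarrow> bool) \<Rightarrow> bool" where
  "gate_closed P \<longleftrightarrow> (\<forall>f s t. P s \<longrightarrow> P t \<longrightarrow> P (Gt f s t))"

context
  fixes P :: "'x trm \<Rightarrow> bool"
  assumes P: "gate_closed P"
begin

lemma gate_closed_tree: "ws \<noteq> [] \<Longrightarrow> \<forall>w\<in>set ws. P (snd w) \<Longrightarrow> P (snd (tree f ws))"
proof -
  have "ws \<noteq> [] \<Longrightarrow> \<forall>w\<in>set ws. P (snd w) \<Longrightarrow> P (snd (huffman f ws))" for ws
  proof (induction rule: huffman_induct[where f = f])
    case (two v w ws)
    then have "P (snd (merge f v w))" using P by (auto simp: merge_def gate_closed_def)
    then show ?case using two by (auto simp: set_insort_key)
  qed auto
  from this[of "sort_key fst ws"] show "ws \<noteq> [] \<Longrightarrow> \<forall>w\<in>set ws. P (snd w) \<Longrightarrow> ?thesis"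
    by (simp add: tree_def)
qed

lemma gate_closed_pieces:
  "\<forall>x\<in>set xs. P (snd (wire1 x)) \<and> P (snd (wire2 x)) \<Longrightarrow> \<forall>w\<in>set (pieces f e d s xs). P (snd w)"
proof (induction d arbitrary: f e s xs)
  case (Suc d)
  define j where "j = cut (3 * d + 2) (2 ^ d - s) xs"
  show ?case
  proof (cases "xs = [] \<or> j = 0")
    case True
    then have "pieces f e (Suc d) s xs = (if xs = [] then [] else pieces f e d (s - 2 ^ d) xs)"
      unfolding pieces.simps(2) Let_def j_def[symmetric] by auto
    then show ?thesis using Suc.IH[OF Suc.prems] by simp
  next
    case False
    define L where "L = take (j - 1) xs"
    define x where "x = xs ! (j - 1)"
    define R where "R = drop j xs"
    define input_weight where "input_weight = weight (take j xs)"
    have "j \<le> length xs" unfolding j_def by (rule cut_le)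
    then have "x \<in> set xs" using False by (auto simp: x_def)
    moreover have "set L \<subseteq> set xs" "set R \<subseteq> set xs" by (auto simp: L_def R_def set_take_subset set_drop_subset)
    ultimately have sub: "\<forall>y\<in>set (x # L @ R). P (snd (wire1 y)) \<and> P (snd (wire2 y))" using Suc.prems by auto
    have eq: "pieces f e (Suc d) s xs = tree (dual f) (wire1 x # map wire2 L) # pieces f True d (s + 2 * input_weight) L @
       (if R = [] \<and> e then [] else
         [tree (dual f) (wire2 x # map wire2 L @ pieces (dual f) (\<not> e) d input_weight (map swap R))])"
      using False unfolding pieces.simps(2) Let_def j_def[symmetric]
      by (simp add: L_def x_def R_def input_weight_def)
    have "\<forall>w\<in>set (pieces f True d (s + 2 * input_weight) L). P (snd w)" using sub by (intro Suc.IH) auto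
    moreover have 2: "\<forall>w\<in>set (pieces (dual f) (\<not> e) d input_weight (map swap R)). P (snd w)"
      using sub by (intro Suc.IH) auto
    moreover have "P (snd (tree (dual f) (wire1 x # map wire2 L)))" using sub by (intro gate_closed_tree) auto
    moreover have "P (snd (tree (dual f) (wire2 x # map wire2 L @ pieces (dual f) (\<not> e) d input_weight (map swap R))))"
      using sub 2 by (intro gate_closed_tree) auto
    ultimately show ?thesis unfolding eq by auto
  qed
qed simp

definition pair_closed :: "'x pair \<Rightarrow> bool" where
  "pair_closed p \<longleftrightarrow> P (fst p) \<and> P (snd p)"

lemma gate_closed_path: "ps \<noteq> [] \<Longrightarrow> \<forall>p\<in>set ps. pair_closed p \<Longrightarrow> P (path ps)"
  unfolding path_unfold
  using pieces_weight(2)[OF path_fits, of ps]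
  by (intro gate_closed_tree gate_closed_pieces) (auto simp: items_def wire1_def wire2_def pair_closed_def)

lemma gate_closed_conj_of: "ps \<noteq> [] \<Longrightarrow> \<forall>p\<in>set ps. pair_closed p \<Longrightarrow> P (conj_of ps)"
  unfolding conj_of_def by (intro gate_closed_tree) (auto simp: pair_closed_def)

lemma pair_closed_block:
  "ps \<noteq> [] \<Longrightarrow> \<forall>p\<in>set ps. pair_closed p \<Longrightarrow> pair_closed (block ps) \<and> pair_closed (closed_block ps)"
  using gate_closed_path[of "rev ps"] gate_closed_conj_of[of ps] P
  by (auto simp: pair_closed_def block_def closed_block_def gate_closed_def)

lemma pair_closed_compose: "pair_closed x \<Longrightarrow> pair_closed y \<Longrightarrow> pair_closed (compose x y)"
  using P by (auto simp: pair_closed_def compose_def gate_closed_def)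

lemma pair_closed_sklansky: "\<forall>p\<in>set ps. pair_closed p \<Longrightarrow> \<forall>y\<in>set (sklansky ps). pair_closed y"
proof (induction ps rule: sklansky_induct)
  case (short ps)
  then show ?case by (simp add: sklansky.simps)
next
  case (long ps)
  let ?l = "sklansky (take (half ps) ps)" and ?r = "sklansky (drop (half ps) ps)"
  have l: "\<forall>y\<in>set ?l. pair_closed y" by (rule long(2)) (use long(4) in_set_takeD in fast)
  have r: "\<forall>y\<in>set ?r. pair_closed y" by (rule long(3)) (use long(4) in_set_dropD in fast)
  have "?l \<noteq> []" using half_bounds[OF long(1)] long(1) by auto
  then have "pair_closed (last ?l)" using l by simp
  then have "\<forall>y\<in>set (map (\<lambda>x. compose x (last ?l)) ?r). pair_closed y" using r pair_closed_compose by simp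
  moreover have "sklansky ps = ?l @ map (\<lambda>x. compose x (last ?l)) ?r"
    using long(1) by (subst sklansky.simps) simp
  ultimately show ?case using l by (metis Un_iff set_append)
qed

lemma pair_closed_combine:
  assumes "\<forall>ps\<in>set pss. \<forall>p\<in>set ps. pair_closed p" "\<forall>c\<in>set cs. pair_closed c"
  shows "\<forall>y\<in>set (combine pss cs). pair_closed y"
proof
  fix y assume "y \<in> set (combine pss cs)"
  from in_set_combine[OF this] show "pair_closed y" using assms pair_closed_compose by blast
qed

lemma pair_closed_boundary:
  "\<forall>p\<in>set acc \<union> set ps. pair_closed p \<Longrightarrow> \<forall>y\<in>set (boundary_carries acc ps). pair_closed y"
proof (induction acc ps rule: boundary_carries_induct)
  case (short acc ps)
  show ?case
  proof (cases ps)
    case (Cons p qs)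
    then have "ps = [p]" using short(1) by simp
    then show ?thesis using short(2) gate_closed_path[of "p # acc"] by (simp add: pair_closed_def)
  qed (simp add: boundary_carries.simps)
next
  case (long acc ps)
  have l: "\<forall>p\<in>set (take (half ps) ps). pair_closed p" "\<forall>p\<in>set (drop (half ps) ps). pair_closed p"
    using long(5) by (auto dest: in_set_takeD in_set_dropD)
  have "\<forall>y\<in>set (boundary_carries acc (take (half ps) ps)). pair_closed y" using long(3,5) l by blast
  moreover have "\<forall>y\<in>set (boundary_carries (closed_block (take (half ps) ps) # acc) (drop (half ps) ps)). pair_closed y"
    using pair_closed_block[OF long(2) l(1)] long(5) l by (intro long(4)) auto
  ultimately show ?case using long(1) by (auto simp: boundary_carries.simps[of acc ps])
qed

lemma pair_closed_group_prefix:
  assumes "0 < q" "\<forall>p\<in>set ps. pair_closed p"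
  shows "\<forall>y\<in>set (group_prefix q ps). pair_closed y"
proof -
  have "\<forall>c\<in>set (chunk q ps). c \<noteq> [] \<and> (\<forall>p\<in>set c. pair_closed p)"
    using chunk_props(2)[OF assms(1), of ps] set_chunk[OF assms(1), of _ ps] assms(2) by blast
  then show ?thesis unfolding group_prefix_def
    using pair_closed_sklansky pair_closed_block
    by (intro pair_closed_combine pair_closed_sklansky) auto
qed

lemma pair_closed_adder:
  assumes "0 < q" "\<forall>p\<in>set ps. pair_closed p"
  shows "\<forall>y\<in>set (adder q ps). pair_closed y"
proof -
  have "\<forall>c\<in>set (chunk (q * q) ps). c \<noteq> [] \<and> (\<forall>p\<in>set c. pair_closed p)"
    using chunk_props(2)[of "q * q" ps] set_chunk[of "q * q" _ ps] assms by auto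
  then show ?thesis unfolding adder_def
    using pair_closed_group_prefix[OF assms(1)] pair_closed_block
    by (intro pair_closed_combine pair_closed_boundary) auto
qed

end

lemma length_combine:
  assumes "\<forall>c\<in>set gs. length (h c) = length c" "length cs = length gs"
  shows "length (combine (map h gs) cs) = length (concat gs)"
proof -
  have *: "length (concat (map (\<lambda>p. map (\<lambda>y. compose y (fst p)) (snd p)) (zip ds (map h hs)))) = length (concat hs)"
    if "\<forall>c\<in>set hs. length (h c) = length c" "length hs \<le> length ds" for ds hs
    using that
  proof (induction hs arbitrary: ds)
    case (Cons c hs)
    then show ?case by (cases ds) auto
  qed simp
  show ?thesis using assms *[of "tl gs" cs] by (cases gs) (auto simp: combine_def)
qed

lemma length_adder: "0 < q \<Longrightarrow> length (adder q ps) = length ps"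
proof -
  assume q: "0 < q"
  have "length (group_prefix q c) = length c" for c :: "'a pair list"
    unfolding group_prefix_def using chunk_props(1)[OF q, of c] by (simp add: length_combine)
  then show ?thesis unfolding adder_def using chunk_props(1)[of "q * q" ps] q by (simp add: length_combine)
qed

lemma outputs_of_props:
  "length (outputs_of ps) = length ps"
  "\<forall>p\<in>set ps. closed_pair \<rho> p \<Longrightarrow> map (\<lambda>y. val \<rho> (fst y)) (outputs_of ps) = carries \<rho> False ps"
  "gate_closed P \<Longrightarrow> \<forall>p\<in>set ps. P (fst p) \<and> P (snd p) \<Longrightarrow> \<forall>y\<in>set (outputs_of ps). P (fst y)"
proof -
  have q: "0 < (clog (length ps) + 1) div 2" if "\<not> clog (length ps) \<le> 12" using that by simp
  show "length (outputs_of ps) = length ps" using q by (auto simp: outputs_of_def length_adder)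
  have f: "sem \<rho> y False = val \<rho> (fst y)" for y by (simp add: sem_def)
  show "map (\<lambda>y. val \<rho> (fst y)) (outputs_of ps) = carries \<rho> False ps" if "\<forall>p\<in>set ps. closed_pair \<rho> p"
    using sem_sklansky[of \<rho> False ps] sem_adder[OF q that] unfolding f by (simp add: outputs_of_def)
  show "\<forall>y\<in>set (outputs_of ps). P (fst y)" if "gate_closed P" "\<forall>p\<in>set ps. P (fst p) \<and> P (snd p)"
    using pair_closed_sklansky[OF that(1), of ps] pair_closed_adder[OF that(1) q, of ps] that
    by (auto simp: outputs_of_def pair_closed_def[OF that(1)])
qed

section \<open>The circuit of a fixed instance\<close>

context
  fixes n :: nat and a :: "adder_input \<Rightarrow> nat"
  assumes n: "3 \<le> n"
begin

definition "rel x = rel_arrival (clog n + 4) (latest (times n a)) (a x)"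
definition "in_p i = In (rel (Propagate i)) (Propagate i)"
definition "in_g i = In (rel (Generate i)) (Generate i)"
definition "the_ins = map (\<lambda>i. (in_p i, in_g i)) [0..<n]"
definition "the_elements = map (\<lambda>i. (in_g i, Gt OR (in_g i) (in_p i))) [0..<n]"

lemma inputs_times: "inputs (rel_times (times n a)) = the_ins"
  by (rule nth_equalityI)
     (auto simp: inputs_def rel_times_def times_def the_ins_def in_p_def in_g_def rel_def)

lemma elements_times: "elements the_ins = the_elements"
  by (simp add: elements_def the_ins_def the_elements_def)

lemma length_the_elements [simp]: "length the_elements = n"
  by (simp add: the_elements_def)

definition "the_terms = map fst (outputs_of the_elements)"

lemma circuit_of_times: "circuit_of_times (times n a) = circuit_of (leaf_list the_ins) the_terms"
  by (simp add: circuit_of_times_def inputs_times elements_times the_terms_def)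

lemma set_leaf_list: "set (leaf_list the_ins) = in_p ` {..<n} \<union> in_g ` {..<n}"
  by (auto simp: leaf_list_def the_ins_def)

lemma distinct_leaf_list: "distinct (map leaf_name (leaf_list the_ins))"
proof -
  have "map leaf_name (leaf_list the_ins) = concat (map (\<lambda>i. [Propagate i, Generate i]) [0..<n])"
    by (simp add: leaf_list_def the_ins_def map_concat comp_def in_p_def in_g_def)
  moreover have "distinct (concat (map (\<lambda>i. [Propagate i, Generate i]) is))" if "distinct is" for "is"
    using that by (induction "is") auto
  ultimately show ?thesis by simp
qed

lemma leaves_terms: "t \<in> set the_terms \<Longrightarrow> leaves t \<subseteq> set (leaf_list the_ins)"
proof -
  have "gate_closed (\<lambda>t. leaves t \<subseteq> set (leaf_list the_ins))" by (auto simp: gate_closed_def)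
  then have "\<forall>y\<in>set (outputs_of the_elements). leaves (fst y) \<subseteq> set (leaf_list the_ins)"
    by (rule outputs_of_props(3)) (auto simp: the_elements_def set_leaf_list in_p_def in_g_def)
  then show "t \<in> set the_terms \<Longrightarrow> ?thesis" by (auto simp: the_terms_def)
qed

lemma the_terms_length: "length the_terms = n"
  by (simp add: the_terms_def outputs_of_props(1))

interpretation fc: formula_circuit "leaf_list the_ins" the_terms
proof
  show "the_terms \<noteq> []" using the_terms_length n by auto
  show "is_leaf l" if "l \<in> set (leaf_list the_ins)" for l
    using that by (auto simp: set_leaf_list in_p_def in_g_def)
qed (use leaves_terms distinct_leaf_list in auto)

lemma val_terms: "i < n \<Longrightarrow> val \<rho> (the_terms ! i) = carry \<rho> (Suc i)"
proof -
  assume i: "i < n"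
  have c: "closed_pair \<rho> p" if "p \<in> set the_elements" for p
    using that by (auto simp: the_elements_def closed_pair_def)
  have "carries \<rho> (carry \<rho> j) (map (\<lambda>i. (in_g i, Gt OR (in_g i) (in_p i))) [j..<j + m]) = map (\<lambda>i. carry \<rho> (Suc i)) [j..<j + m]" for j m
  proof (induction m arbitrary: j)
    case (Suc m)
    have "[j..<j + Suc m] = j # [Suc j..<Suc j + m]" by (simp add: upt_conv_Cons)
    moreover have "sem \<rho> (in_g j, Gt OR (in_g j) (in_p j)) (carry \<rho> j) = carry \<rho> (Suc j)"
      by (auto simp: sem_def in_g_def in_p_def)
    ultimately show ?case using Suc[of "Suc j"] by (simp del: upt_Suc)
  qed simp
  from this[of 0 n] have "map (\<lambda>y. val \<rho> (fst y)) (outputs_of the_elements) = map (\<lambda>i. carry \<rho> (Suc i)) [0..<n]"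
    using outputs_of_props(2)[of the_elements \<rho>] c by (simp add: the_elements_def)
  then have "map (val \<rho>) the_terms ! i = map (\<lambda>i. carry \<rho> (Suc i)) [0..<n] ! i"
    by (simp add: the_terms_def comp_def)
  then show ?thesis using i the_terms_length by simp
qed

lemma adder_circuit_times: "adder_circuit n (circuit_of_times (times n a))"
proof -
  let ?ns = "nodes (leaf_list the_ins) the_terms"
  have gt: "In k x \<notin> gates t" for k x and t :: "adder_input trm" by (induction t) auto
  have "Variable x \<in> set (map (vertex_of ?ns) ?ns) \<longleftrightarrow> (\<exists>k. In k x \<in> set ?ns)" for x
  proof
    assume "Variable x \<in> set (map (vertex_of ?ns) ?ns)"
    then have "Variable x \<in> vertex_of ?ns ` set ?ns" by (simp only: set_map)
    then obtain t where t: "t \<in> set ?ns" "vertex_of ?ns t = Variable x" by (metis imageE)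
    from t(2) obtain k where "t = In k x" by (cases t) simp_all
    then show "\<exists>k. In k x \<in> set ?ns" using t(1) by blast
  qed force
  then have 1: "{x. Variable x \<in> set (map (vertex_of ?ns) ?ns)} = Propagate ` {..<n} \<union> Generate ` {..<n}"
    using gt by (auto simp: fc.set_nodes set_leaf_list in_p_def in_g_def)
  have 2: "Constant b \<notin> set (map (vertex_of ?ns) ?ns)" for b
  proof
    assume "Constant b \<in> set (map (vertex_of ?ns) ?ns)"
    then obtain t where "vertex_of ?ns t = Constant b" by auto
    then show False by (cases t) auto
  qed
  have 3: "\<exists>v\<in>set (map (position ?ns) the_terms). \<forall>\<rho>. vertex_value (circuit_of (leaf_list the_ins) the_terms) \<rho> v = carry \<rho> i"
    if i: "i \<in> {1..n}" for i
  proof -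
    let ?t = "the_terms ! (i - 1)"
    have "i - 1 < n" using i by auto
    then have t: "?t \<in> set the_terms" using the_terms_length by auto
    have p: "position ?ns ?t < length ?ns" "?ns ! position ?ns ?t = ?t"
      using position[OF fc.output_node[OF t]] by simp_all
    have "Suc (i - 1) = i" using i by simp
    then have "\<forall>\<rho>. vertex_value (circuit_of (leaf_list the_ins) the_terms) \<rho> (position ?ns ?t) = carry \<rho> i"
      unfolding fc.vertex_value_C[OF p(1)] p(2) val_terms[OF \<open>i - 1 < n\<close>] by simp
    moreover have "position ?ns ?t \<in> set (map (position ?ns) the_terms)" using t by simp
    ultimately show ?thesis by blast
  qed
  show ?thesis unfolding circuit_of_times adder_circuit_def fc.vertices_C
    using fc.is_circuit_C 1 2 3 by blast
qed

lemma latest_weight: "us \<noteq> [] \<Longrightarrow> 2 ^ latest us \<le> (\<Sum>t\<leftarrow>us. 2 ^ fst t + 2 ^ snd t :: real)"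
proof (induction us)
  case (Cons t us)
  let ?s = "\<Sum>t\<leftarrow>us. 2 ^ fst t + 2 ^ snd t :: real"
  have mx: "(2::real) ^ max i j \<le> 2 ^ i + 2 ^ j" for i j :: nat by (simp add: max_def)
  show ?case
  proof (cases us)
    case Nil
    then show ?thesis using mx[of "fst t" "snd t"] by (simp add: latest_def)
  next
    case (Cons u vs)
    have "2 ^ latest (t # us) \<le> 2 ^ fst t + (2 ^ snd t + 2 ^ latest us :: real)"
      using mx[of "fst t" "max (snd t) (latest us)"] mx[of "snd t" "latest us"] by (simp add: latest_def)
    then show ?thesis using Cons.IH Cons by simp
  qed
qed simp

definition "input_weight = (\<Sum>i<n. 2 ^ a (Propagate i) + 2 ^ a (Generate i) :: real)"

lemma input_weight_latest: "2 ^ latest (times n a) \<le> input_weight"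
proof -
  have "2 ^ latest (times n a) \<le> (\<Sum>t\<leftarrow>times n a. 2 ^ fst t + 2 ^ snd t :: real)"
    using n by (intro latest_weight) (auto simp: times_def)
  also have "\<dots> = input_weight"
    by (simp add: times_def input_weight_def comp_def interv_sum_list_conv_sum_set_nat atLeast0LessThan)
  finally show ?thesis .
qed

lemma in_latest: "i < n \<Longrightarrow> a (Propagate i) \<le> latest (times n a) \<and> a (Generate i) \<le> latest (times n a)"
  using latest_ge[of "(a (Propagate i), a (Generate i))" "times n a"] by (auto simp: times_def)

text \<open>Relative and true weights are compared after clearing denominators. A time that is
  rounded up gets relative weight 1, which the last summand covers.\<close>

lemma weight_rel:
  assumes "a x \<le> latest (times n a)"
  shows "2 ^ rel x * 2 ^ latest (times n a) \<le> 2 ^ (clog n + 4) * 2 ^ a x + (2 ^ latest (times n a) :: real)"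
proof (cases "latest (times n a) - a x \<le> clog n + 4")
  case True
  then have "rel x + latest (times n a) = clog n + 4 + a x"
    using assms by (simp add: rel_def rel_arrival)
  then have "2 ^ rel x * 2 ^ latest (times n a) = (2 ^ (clog n + 4) * 2 ^ a x :: real)"
    by (simp flip: power_add)
  then show ?thesis by simp
next
  case False
  then have "rel x = 0" using assms by (simp add: rel_def rel_arrival)
  then show ?thesis by simp
qed

text \<open>The constant is 2 + 1 / 4. The gate in front of each pair doubles the weights. Rounding
  adds at most 2 * 2 n units of \<open>2 ^ latest\<close>, and the 4 in \<open>clog n + 4\<close>
  makes this at most a quarter of \<open>2 ^ (clog n + 4)\<close> times the true weight, which is at
  least \<open>2 ^ latest\<close>.\<close>

lemma weight_elements: "pair_weight the_elements * 2 ^ latest (times n a) \<le> 9 / 4 * 2 ^ (clog n + 4) * input_weight"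
proof -
  let ?M = "2 ^ latest (times n a) :: real" and ?K = "2 ^ (clog n + 4) :: real"
  have "pair_weight the_elements = (\<Sum>i<n. 2 ^ Suc (max (rel (Generate i)) (max (rel (Generate i)) (rel (Propagate i)))))"
    by (simp add: pair_weight_def the_elements_def comp_def ready_def in_p_def in_g_def
        interv_sum_list_conv_sum_set_nat atLeast0LessThan max_def cong: if_cong)
       (intro sum.cong refl, auto)
  then have "real (pair_weight the_elements) \<le> (\<Sum>i<n. 2 * (2 ^ rel (Propagate i) + 2 ^ rel (Generate i)))"
    by (auto intro!: sum_mono simp: max_def)
  then have "pair_weight the_elements * ?M \<le> (\<Sum>i<n. 2 * (2 ^ rel (Propagate i) + 2 ^ rel (Generate i))) * ?M"
    by (intro mult_right_mono) auto
  also have "\<dots> = (\<Sum>i<n. 2 * (2 ^ rel (Propagate i) * ?M + 2 ^ rel (Generate i) * ?M))"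
    unfolding sum_distrib_right by (intro sum.cong refl) (simp add: algebra_simps)
  also have "\<dots> \<le> (\<Sum>i<n. 2 * ((?K * 2 ^ a (Propagate i) + ?M) + (?K * 2 ^ a (Generate i) + ?M)))"
    using in_latest weight_rel by (intro sum_mono mult_left_mono add_mono) auto
  also have "\<dots> = (\<Sum>i<n. (2 * ?K) * (2 ^ a (Propagate i) + 2 ^ a (Generate i))) + (\<Sum>i<n. 4 * ?M)"
    unfolding sum.distrib[symmetric] by (intro sum.cong refl) (simp add: algebra_simps)
  also have "\<dots> = 2 * ?K * input_weight + 4 * real n * ?M"
    unfolding input_weight_def sum_distrib_left[symmetric] by simp
  also have "\<dots> \<le> 2 * ?K * input_weight + ?K / 4 * input_weight"
  proof (intro add_left_mono mult_mono)
    have "real n \<le> 2 ^ clog n" using clog_le[of n] by (simp add: le_log2_of_power of_nat_le_iff[symmetric] del: of_nat_le_iff)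
    then show "4 * real n \<le> ?K / 4" by (simp add: power_add)
  qed (use input_weight_latest in auto)
  finally show ?thesis by (simp add: algebra_simps)
qed

lemma delay_times:
  fixes c :: real
  assumes "\<And>t. t \<in> set the_terms \<Longrightarrow> 2 ^ arr t \<le> c * pair_weight the_elements" "0 < c"
  shows "delay (circuit_of_times (times n a)) a \<le> log 2 (9 / 4 * c * input_weight)"
proof -
  let ?C = "circuit_of (leaf_list the_ins) the_terms" and ?ns = "nodes (leaf_list the_ins) the_terms"
  let ?M = "latest (times n a)" and ?K = "clog n + 4"
  have leaf: "a x + ?K \<le> k + ?M" if "In k x \<in> set (leaf_list the_ins)" for k x
    using that in_latest by (auto simp: set_leaf_list in_p_def in_g_def rel_def rel_arrival)
  have Wpos: "0 < input_weight" by (rule less_le_trans[OF _ input_weight_latest]) simp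
  have each: "arrival_time ?C a (position ?ns t) \<le> log 2 (9 / 4 * c * input_weight)" if t: "t \<in> set the_terms" for t
  proof -
    let ?r = "arrival_time ?C a (position ?ns t)"
    have p: "position ?ns t < length ?ns" "?ns ! position ?ns t = t"
      using position[OF fc.output_node[OF t]] by simp_all
    have "?r + ?K \<le> arr t + ?M" using fc.arrival_time_C[OF leaf p(1)] p(2) by simp
    then have "(2::real) ^ (?r + ?K) \<le> 2 ^ (arr t + ?M)" by (intro power_increasing) auto
    then have "2 ^ ?r * 2 ^ ?K \<le> 2 ^ arr t * (2 ^ ?M :: real)" by (simp only: power_add)
    also have "\<dots> \<le> c * pair_weight the_elements * 2 ^ ?M" using assms(1)[OF t] by (intro mult_right_mono) auto
    also have "\<dots> = c * (pair_weight the_elements * 2 ^ ?M)" by simp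
    also have "\<dots> \<le> c * (9 / 4 * 2 ^ ?K * input_weight)" using assms(2) weight_elements by (intro mult_left_mono) auto
    also have "\<dots> = (9 / 4 * c * input_weight) * 2 ^ ?K" by simp
    finally have "2 ^ ?r \<le> 9 / 4 * c * input_weight" by (rule mult_right_le_imp_le) simp
    then show ?thesis by (intro le_log_of_power) auto
  qed
  have "delay ?C a \<in> arrival_time ?C a ` set (outputs ?C)"
    unfolding delay_def using fc.is_circuit_C by (intro Max_in) (auto simp: is_circuit_def)
  then show ?thesis unfolding circuit_of_times using each by auto
qed

text \<open>The additional \<open>n\<close> gates are those that form g or p. The counts are doubled
  because Sklansky's circuit is bounded by 3 / 2 gates per pair and level.\<close>

lemma size_times:
  assumes "2 * card (pair_gates (outputs_of the_elements) - pair_gates the_elements) \<le> s"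
  shows "2 * circuit_size (circuit_of_times (times n a)) \<le> s + 2 * n"
proof -
  have "circuit_size (circuit_of_times (times n a)) = card (\<Union>t\<in>set the_terms. gates t)"
    unfolding circuit_of_times by (rule fc.circuit_size_C)
  also have "\<dots> \<le> card (pair_gates (outputs_of the_elements))"
    by (intro card_mono) (auto simp: the_terms_def pair_gates_def)
  also have "\<dots> \<le> card (pair_gates (outputs_of the_elements) - pair_gates the_elements) + card (pair_gates the_elements)"
    using card_diff_trans[of "pair_gates (outputs_of the_elements)" "pair_gates the_elements" "{}"] by simp
  finally have "2 * circuit_size (circuit_of_times (times n a)) \<le> s + 2 * card (pair_gates the_elements)"
    using assms by linarith
  moreover have "pair_gates the_elements = (\<lambda>i. Gt OR (in_g i) (in_p i)) ` {..<n}"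
    by (auto simp: the_elements_def pair_gates_def in_g_def in_p_def)
  then have "card (pair_gates the_elements) \<le> n" using card_image_le[of "{..<n}"] by simp
  ultimately show ?thesis by linarith
qed

end

section \<open>Estimates\<close>

lemma six_le_power: "3 \<le> k \<Longrightarrow> 9 * k + 20 \<le> (2::nat) ^ (k + 3)"
proof (induction k rule: dec_induct)
  case (step k)
  then show ?case unfolding add_Suc power_Suc mult_Suc_right by linarith
qed simp

lemma log_ge:
  assumes "2 ^ l \<le> x" shows "real l \<le> log 2 x"
  using le_log_of_power[OF assms] by simp

text \<open>With \<open>x = log\<^sub>2 n\<close> and \<open>L = log\<^sub>2 x\<close>, the admissible delay is more than
  \<open>log\<^sub>2 W + log\<^sub>2 (2048 (x L)\<^sup>3)\<close>.\<close>

lemma delay_le: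
  fixes x L c W :: real
  assumes "0 < x" "0 < L" "0 < W" "0 < c" "9 / 4 * c \<le> 2048 * (x * L) ^ 3"
  shows "log 2 (9 / 4 * c * W) \<le> log 2 W + 3 * log 2 x + 3 * log 2 L + 11.085"
proof -
  have "log 2 (9 / 4 * c * W) = log 2 (9 / 4 * c) + log 2 W"
    using assms by (subst log_mult) auto
  also have "log 2 (9 / 4 * c) \<le> log 2 (2048 * (x * L) ^ 3)"
    using assms by (intro log_mono) auto
  also have "log 2 (2048 * (x * L) ^ 3) = log 2 2048 + 3 * (log 2 x + log 2 L)"
    using assms by (simp add: log_mult log_nat_power)
  also have "log 2 2048 = (11::real)" using log_pow_cancel[of "2::real" 11] by simp
  finally show ?thesis by simp
qed

lemma clog_log:
  assumes "1 < n"
  shows "real (clog n) - 1 < log 2 n" "log 2 n \<le> clog n"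
proof -
  have "real (2 ^ clog n) < real (2 * n)" using clog_less[OF assms] by (simp only: of_nat_less_iff)
  then have "2 ^ clog n / 2 < real n" by simp
  moreover have "2 powr (real (clog n) - 1) = 2 ^ clog n / 2" by (simp add: powr_diff powr_realpow)
  ultimately show "real (clog n) - 1 < log 2 n" using assms by (subst less_log_iff) auto
  have "real n \<le> real (2 ^ clog n)" using clog_le[of n] by (simp only: of_nat_le_iff)
  then show "log 2 n \<le> clog n" using assms by (subst log_le_iff) (auto simp: powr_realpow)
qed

text \<open>Only finitely many values of \<open>clog n\<close> occur. Both inequalities are monotone
  in x and L, so each value is settled by rational lower bounds: \<open>clog n - 1\<close> for x
  and, for L, the integer part of its logarithm; \<open>clog n = 2\<close> uses 3 / 2 and 1 / 2. At
  \<open>clog n = 13\<close> these crude bounds would no longer suffice for the delay.\<close>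

lemma small_estimates:
  assumes n: "3 \<le> n" "clog n \<le> 12"
  defines "x \<equiv> log 2 n" and "L \<equiv> log 2 (log 2 n)"
  shows "0 < x" "0 < L" "9 / 4 * 4 ^ clog n \<le> 2048 * (x * L) ^ 3"
    "3 * real (clog n) + 2 \<le> 2 * 24.436 * L"
proof -
  let ?k = "clog n"
  have k: "real ?k - 1 < x" unfolding x_def using clog_log(1)[of n] n by simp
  have k2: "2 \<le> ?k"
  proof (rule ccontr)
    assume "\<not> 2 \<le> ?k"
    then have "(2::nat) ^ ?k \<le> 2 ^ 1" by (intro power_increasing) auto
    then show False using clog_le[of n] n by simp
  qed
  \<comment> \<open>From 2 ^ 3 \<le> 3 ^ 2.\<close>
  have "3 / 2 \<le> x"
  proof -
    have "(2::real) ^ 3 \<le> real n ^ 2" using power_mono[of 3 "real n" 2] n by simp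
    then have "3 \<le> log 2 (real n ^ 2)" using log_ge[of 3 "real n ^ 2"] by simp
    then show ?thesis using n by (simp add: log_nat_power x_def)
  qed
  have main: "0 < x \<and> 0 < L \<and> 9 / 4 * 4 ^ ?k \<le> 2048 * (x * L) ^ 3 \<and> 3 * real ?k + 2 \<le> 2 * 24.436 * L"
    if "y \<le> x" "l \<le> L" "0 < y" "0 < l" "9 / 4 * 4 ^ ?k \<le> 2048 * (y * l) ^ 3" "3 * real ?k + 2 \<le> 2 * 24.436 * l" for y l :: real
  proof -
    have "(y * l) ^ 3 \<le> (x * L) ^ 3" using that by (intro power_mono mult_mono) auto
    then have "9 / 4 * 4 ^ ?k \<le> 2048 * (x * L) ^ 3" using that(5) by linarith
    moreover have "2 * 24.436 * l \<le> 2 * 24.436 * L" using that(2) by simp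
    then have "3 * real ?k + 2 \<le> 2 * 24.436 * L" using that(6) by (rule order_trans[rotated])
    ultimately show ?thesis using that(1-4) by (intro conjI) auto
  qed
  have "2 powr (1 / 2) \<le> x"
  proof -
    have "sqrt 2 \<le> 3 / 2" by (rule real_le_lsqrt) (auto simp: power2_eq_square)
    then show ?thesis using \<open>3 / 2 \<le> x\<close> by (simp add: powr_half_sqrt)
  qed
  then have L1: "1 / 2 \<le> L" unfolding L_def x_def[symmetric] using \<open>3 / 2 \<le> x\<close> by (subst le_log_iff) auto
  have Ll: "real l \<le> L" if "2 ^ l \<le> real ?k - 1" for l :: nat
    unfolding L_def x_def[symmetric] using that k by (intro log_ge) linarith
  \<comment> \<open>Grouped by the integer part of the logarithm of \<open>?k - 1\<close>, the lower
    bound that is used for L.\<close>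
  consider "?k = 2" | "3 \<le> ?k" "?k \<le> 4" | "5 \<le> ?k" "?k \<le> 8" | "9 \<le> ?k" using k2 by linarith
  then have "0 < x \<and> 0 < L \<and> 9 / 4 * 4 ^ ?k \<le> 2048 * (x * L) ^ 3 \<and> 3 * real ?k + 2 \<le> 2 * 24.436 * L"
  proof cases
    case 1
    then show ?thesis using main[of "3 / 2" "1 / 2"] \<open>3 / 2 \<le> x\<close> L1 by (simp add: eval_nat_numeral)
  next
    case 2
    then have "?k = 3 \<or> ?k = 4" by linarith
    then show ?thesis using main[of "real ?k - 1" 1] Ll[of 1] k by (elim disjE) (auto simp: eval_nat_numeral)
  next
    case 3
    then have "?k = 5 \<or> ?k = 6 \<or> ?k = 7 \<or> ?k = 8" by linarith
    then show ?thesis using main[of "real ?k - 1" 2] Ll[of 2] k by (elim disjE) auto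
  next
    case 4
    then have "?k = 9 \<or> ?k = 10 \<or> ?k = 11 \<or> ?k = 12" using n(2) by linarith
    then show ?thesis using main[of "real ?k - 1" 3] Ll[of 3] k by (elim disjE) auto
  qed
  then show "0 < x" "0 < L" "9 / 4 * 4 ^ clog n \<le> 2048 * (x * L) ^ 3"
    "3 * real (clog n) + 2 \<le> 2 * 24.436 * L" by blast+
qed

section \<open>Estimates for \<open>clog n\<close> at least 13\<close>

locale large_instance =
  fixes n k q \<kappa> m :: nat
  assumes k: "k = clog n" and k_large: "13 \<le> k"
    and q: "q = (k + 1) div 2" and \<kappa>: "\<kappa> = clog q"
    and m: "m * (q * q) < n + q * q"
begin

lemma q_bounds: "7 \<le> q" "2 * q \<le> k + 1" "k \<le> 2 * q"
  using k_large q by auto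

lemma q_le: "q \<le> 2 ^ \<kappa>"
  unfolding \<kappa> by (rule clog_le)

lemma kappa_ge: "3 \<le> \<kappa>"
proof (rule ccontr)
  assume "\<not> 3 \<le> \<kappa>"
  then have "(2::nat) ^ \<kappa> \<le> 2 ^ 2" by (intro power_increasing) auto
  then show False using q_le q_bounds by simp
qed

text \<open>From \<open>2 ^ (\<kappa> - 1) \<le> q - 1\<close>, doubled. This is the gain from
  taking \<open>q\<close> as half of the logarithm: \<open>2 ^ \<kappa>\<close> stays below log n
  and \<kappa> below log log n, although both logarithms are rounded up.\<close>

lemma kappa_le: "2 ^ \<kappa> + 1 \<le> k"
proof -
  obtain j where j: "\<kappa> = Suc j" using kappa_ge by (cases \<kappa>) auto
  have "2 ^ \<kappa> < 2 * q" unfolding \<kappa> using q_bounds by (intro clog_less) auto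
  then have "2 ^ j < q" using j by simp
  then show ?thesis using q_bounds j by simp
qed

lemma kappa_quarter: "4 * \<kappa> \<le> k"
proof (cases "\<kappa> = 3")
  case False
  then have "4 \<le> \<kappa>" using kappa_ge by simp
  then have "4 * \<kappa> \<le> 2 ^ \<kappa>"
  proof (induction \<kappa> rule: dec_induct)
    case (step j)
    then show ?case unfolding power_Suc mult_Suc_right by linarith
  qed simp
  then show ?thesis using kappa_le by linarith
qed (use k_large in simp)

text \<open>A sufficient depth is the logarithm of the length, plus 3 for the factor 8, plus a bound
  on the logarithm of the linear term in the depth itself: here \<kappa> + 3 + (\<kappa> + 3).
  \<open>deep2\<close> has 2 \<kappa> for the length, and \<open>deep4\<close> has (\<kappa> + 2) +
  3 + (\<kappa> + 5).\<close>

lemma deep1: "deep_enough (2 * \<kappa> + 6) q"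
proof -
  have "(3 * (2 * \<kappa> + 6) + 2) * (8 * q) \<le> (9 * \<kappa> + 20) * (8 * q)" by (intro mult_le_mono1) simp
  also have "\<dots> \<le> 2 ^ (\<kappa> + 3) * (8 * 2 ^ \<kappa>)"
    using six_le_power[OF kappa_ge] q_le by (intro mult_le_mono) auto
  also have "\<dots> = 2 ^ (2 * \<kappa> + 6)"
  proof -
    have e: "2 * \<kappa> + 6 = (\<kappa> + 3) + (3 + \<kappa>)" by simp
    show ?thesis unfolding e power_add by simp
  qed
  finally show ?thesis by (simp add: deep_enough_def)
qed

lemma deep2: "deep_enough (3 * \<kappa> + 6) (q * q)"
proof -
  have "(3 * (3 * \<kappa> + 6) + 2) * (8 * (q * q)) \<le> 2 ^ (\<kappa> + 3) * (8 * (2 ^ \<kappa> * 2 ^ \<kappa>))"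
    using six_le_power[OF kappa_ge] q_le by (intro mult_le_mono) auto
  also have "\<dots> = 2 ^ (3 * \<kappa> + 6)"
  proof -
    have e: "3 * \<kappa> + 6 = (\<kappa> + 3) + (3 + (\<kappa> + \<kappa>))" by simp
    show ?thesis unfolding e power_add by simp
  qed
  finally show ?thesis by (simp add: deep_enough_def)
qed

lemma n_bounds: "n \<le> 2 ^ k" "2 ^ k < 2 * n" "1 < n"
proof -
  show le: "n \<le> 2 ^ k" unfolding k by (rule clog_le)
  have "\<not> n \<le> 2 ^ 0"
  proof
    assume "n \<le> 2 ^ 0"
    then have "clog n \<le> 0" unfolding clog_def by (rule Least_le)
    then show False using k k_large by simp
  qed
  then show "1 < n" by simp
  then show "2 ^ k < 2 * n" unfolding k by (rule clog_less)
qed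

lemma square_power: "23 * (k * k) + 60 * k \<le> (2::nat) ^ k"
  using k_large
proof (induction k rule: dec_induct)
  case (step j)
  have "23 * (Suc j * Suc j) + 60 * Suc j = (23 * (j * j) + 60 * j) + (46 * j + 83)" by simp
  also have "46 * j + 83 \<le> 23 * (j * j) + 60 * j" using step(1) by simp
  finally show ?case using step by simp
qed simp

lemma m_bound: "m * (k * k) \<le> 4 * 2 ^ k + (k + 1) * (k + 1)"
proof -
  have "m * (k * k) \<le> m * ((2 * q) * (2 * q))" using q_bounds by (intro mult_le_mono2 mult_le_mono)
  also have "\<dots> = 4 * (m * (q * q))" by simp
  also have "\<dots> \<le> 4 * (2 ^ k + q * q)" using m n_bounds by simp
  also have "\<dots> = 4 * 2 ^ k + (2 * q) * (2 * q)" by simp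
  also have "\<dots> \<le> 4 * 2 ^ k + (k + 1) * (k + 1)" using q_bounds by (intro add_left_mono mult_le_mono)
  finally show ?thesis .
qed

text \<open>The number of groups is about 4 * 2 ^ k / k^2 at most. The quadratic denominator absorbs
  the factor linear in the depth, so that an additive constant suffices.\<close>

lemma deep3: "deep_enough (k + 4) m"
proof -
  have kk: "13 * k \<le> k * k" using k_large by simp
  have "(24 * k + 112) * (4 * 2 ^ k + (k + 1) * (k + 1)) \<le> 16 * 2 ^ k * (k * k)"
  proof -
    have "(24 * k + 112) * ((k + 1) * (k + 1)) \<le> (33 * k) * (2 * (k * k))"
    proof (rule mult_le_mono)
      have "(k + 1) * (k + 1) = k * k + 2 * k + 1" by simp
      then show "(k + 1) * (k + 1) \<le> 2 * (k * k)" using kk k_large by linarith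
    qed (use k_large in simp)
    also have "\<dots> = (66 * k) * (k * k)" by simp
    also have "\<dots> \<le> 5 * 2 ^ k * (k * k)"
      using square_power kk by (intro mult_le_mono1) linarith
    finally have 1: "(24 * k + 112) * ((k + 1) * (k + 1)) \<le> 5 * 2 ^ k * (k * k)" .
    have "(24 * k + 112) * 4 \<le> 11 * (13 * k)" using k_large by simp
    also have "\<dots> \<le> 11 * (k * k)" using kk by (rule mult_le_mono2)
    finally have "(24 * k + 112) * 4 \<le> 11 * (k * k)" .
    then have "(24 * k + 112) * 4 * 2 ^ k \<le> 11 * (k * k) * 2 ^ k" by (rule mult_le_mono1)
    from add_mono[OF this 1] show ?thesis by (simp add: algebra_simps)
  qed
  then have "(24 * k + 112) * (m * (k * k)) \<le> 16 * 2 ^ k * (k * k)"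
    using mult_le_mono2[OF m_bound, of "24 * k + 112"] by linarith
  then have "((24 * k + 112) * m) * (k * k) \<le> (16 * 2 ^ k) * (k * k)" by (simp only: mult.assoc)
  then have "(24 * k + 112) * m \<le> 16 * 2 ^ k" using k_large by simp
  then show ?thesis by (simp add: deep_enough_def power_add algebra_simps)
qed

lemma deep4: "deep_enough (2 * \<kappa> + 10) (k + 1)"
proof -
  have "k + 1 \<le> 2 ^ (\<kappa> + 2)" using q_bounds q_le by (simp add: power_add)
  moreover have "3 * (2 * \<kappa> + 10) + 2 \<le> 2 ^ (\<kappa> + 5)"
    using six_le_power[OF kappa_ge] kappa_ge by (simp add: power_add)
  ultimately have "(3 * (2 * \<kappa> + 10) + 2) * (8 * (k + 1)) \<le> 2 ^ (\<kappa> + 5) * (8 * 2 ^ (\<kappa> + 2))"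
    by (intro mult_le_mono) auto
  also have "\<dots> = 2 ^ (2 * \<kappa> + 10)"
  proof -
    have e: "2 * \<kappa> + 10 = (\<kappa> + 5) + (3 + (\<kappa> + 2))" by simp
    show ?thesis unfolding e power_add by simp
  qed
  finally show ?thesis by (simp add: deep_enough_def)
qed

definition "x = log 2 (real n)"
definition "L = log 2 x"

lemma x_bounds: "12 \<le> x" "real k \<le> x + 1" "2 ^ \<kappa> \<le> x"
proof -
  show 1: "real k \<le> x + 1" using clog_log(1)[OF n_bounds(3)] k by (simp add: x_def)
  then show "12 \<le> x" using k_large by linarith
  have "real (2 ^ \<kappa> + 1) \<le> real k" using kappa_le by (simp only: of_nat_le_iff)
  then show "2 ^ \<kappa> \<le> x" using 1 by simp
qed

lemma L_bounds: "7 / 2 \<le> L" "real \<kappa> \<le> L"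
proof -
  \<comment> \<open>x is at least 12, and 12 ^ 2 exceeds 2 ^ 7.\<close>
  have "2 ^ 7 \<le> x ^ 2" using power_mono[OF x_bounds(1), of 2] by simp
  then have "7 \<le> log 2 (x ^ 2)" using log_ge[of 7 "x ^ 2"] by simp
  then show "7 / 2 \<le> L" using x_bounds by (simp add: log_nat_power L_def)
  show "real \<kappa> \<le> L" unfolding L_def by (rule log_ge[OF x_bounds(3)])
qed

lemma delay1: "9 / 4 * (16 * (4 ^ \<kappa> * path_factor (2 * \<kappa> + 6))) \<le> 2048 * (x * L) ^ 3"
proof -
  have "(4::real) ^ \<kappa> = 2 ^ \<kappa> * 2 ^ \<kappa>" by (simp flip: power_mult_distrib)
  also have "\<dots> \<le> x * x" using x_bounds by (intro mult_mono) auto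
  finally have 1: "4 ^ \<kappa> \<le> x * x" .
  \<comment> \<open>The linear term is 6 \<kappa> + 17, and 17 is at most 5 times 7 / 2.\<close>
  have "path_factor (2 * \<kappa> + 6) \<le> 18 / 7 * (11 * L)"
    using L_bounds by (simp add: path_factor_def)
  then have "4 ^ \<kappa> * path_factor (2 * \<kappa> + 6) \<le> (x * x) * (18 / 7 * (11 * L))"
    using 1 by (intro mult_mono) (auto simp: path_factor_def)
  also have "\<dots> = (x * x * L) * (198 / 7)" by simp
  finally have "4 ^ \<kappa> * path_factor (2 * \<kappa> + 6) \<le> (x * x * L) * (198 / 7)" .
  moreover have "0 \<le> x * x * L" using L_bounds by simp
  ultimately have "9 / 4 * (16 * (4 ^ \<kappa> * path_factor (2 * \<kappa> + 6))) \<le> (x * x * L) * 2048" by linarith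
  also have "\<dots> \<le> (x * x * L) * (2048 * (x * (L * L)))"
  proof (rule mult_left_mono)
    have "1 * (1 * 1) \<le> x * (L * L)" using x_bounds L_bounds by (intro mult_mono) auto
    then show "2048 \<le> 2048 * (x * (L * L))" by simp
  qed (use x_bounds L_bounds in auto)
  also have "\<dots> = 2048 * (x * L) ^ 3" by (simp add: power3_eq_cube)
  finally show ?thesis .
qed

lemma delay2:
  "9 / 4 * (16 * (path_factor (2 * \<kappa> + 10) * path_factor (k + 4) * path_factor (3 * \<kappa> + 6))) \<le> 2048 * (x * L) ^ 3"
proof -
  \<comment> \<open>The linear terms are 6 \<kappa> + 29, 3 k + 11 and 9 \<kappa> + 17. Constants
    are absorbed by L \<ge> 7 / 2 and x \<ge> 12; the product 15 * 5 * 14 is the 1050 below, which a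
    spare factor x x L then covers.\<close>
  have f: "path_factor (2 * \<kappa> + 10) \<le> 18 / 7 * (15 * L)" "path_factor (k + 4) \<le> 18 / 7 * (5 * x)"
    "path_factor (3 * \<kappa> + 6) \<le> 18 / 7 * (14 * L)"
    using L_bounds x_bounds by (simp_all add: path_factor_def)
  have "path_factor (2 * \<kappa> + 10) * path_factor (k + 4) * path_factor (3 * \<kappa> + 6) \<le>
      (18 / 7 * (15 * L)) * (18 / 7 * (5 * x)) * (18 / 7 * (14 * L))"
    using f L_bounds x_bounds by (intro mult_mono) (auto simp: path_factor_def)
  also have "\<dots> = (x * L * L) * (1050 * (18 / 7) ^ 3)" by (simp add: power3_eq_cube)
  also have "\<dots> \<le> (x * L * L) * (2048 / 36 * (x * x * L))"
  proof (rule mult_left_mono)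
    have "12 * 12 * (7 / 2) \<le> x * x * L" using x_bounds L_bounds by (intro mult_mono) auto
    then have "2048 / 36 * (12 * 12 * (7 / 2)) \<le> 2048 / 36 * (x * x * L)" by (rule mult_left_mono) simp
    moreover have "1050 * (18 / 7) ^ 3 \<le> (2048 / 36 * (12 * 12 * (7 / 2)) :: real)"
      by (simp add: power3_eq_cube)
    ultimately show "1050 * (18 / 7) ^ 3 \<le> 2048 / 36 * (x * x * L)" by (rule order_trans[rotated])
  qed (use x_bounds L_bounds in auto)
  also have "\<dots> = 2048 / 36 * (x * L) ^ 3" by (simp add: power3_eq_cube)
  finally show ?thesis by (simp add: mult_ac)
qed

text \<open>The coefficient 13 \<kappa> + 22 is that of \<open>adder_gates\<close> for the depths
  above, with one gate per pair for g or p. The part paid per group is about 2 k^2 times the number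
  of groups, which is linear in \<open>n\<close> since a group has about k^2 / 4 pairs; 94 / 5
  bounds its coefficient.\<close>

lemma size_bound:
  "real ((13 * \<kappa> + 22) * n + m * (k * (2 * (k + 1) + 2) + 2 * (2 * \<kappa> + 7) * (k + 1))) \<le> 24.436 * n * L"
proof -
  define T where "T = k * (2 * (k + 1) + 2) + 2 * (2 * \<kappa> + 7) * (k + 1)"
  have "2 * (2 * \<kappa> + 7) * (k + 1) \<le> (k + 14) * (k + 1)" using kappa_quarter by (intro mult_le_mono1) simp
  then have "T \<le> 3 * (k * k) + 19 * k + 14" by (simp add: T_def algebra_simps)
  moreover have "13 * k \<le> k * k" using k_large by simp
  ultimately have T: "5 * T \<le> 23 * (k * k)" using k_large by linarith
  have "5 * (m * T) \<le> m * (23 * (k * k))" using mult_le_mono2[OF T, of m] by (simp add: algebra_simps)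
  also have "\<dots> = 23 * (m * (k * k))" by simp
  also have "m * (k * k) \<le> 4 * (m * (q * q))"
  proof -
    have "m * (k * k) \<le> m * ((2 * q) * (2 * q))" using q_bounds by (intro mult_le_mono2 mult_le_mono)
    then show ?thesis by simp
  qed
  also have "\<dots> \<le> 4 * n + (2 * q) * (2 * q)" using m by simp
  also have "(2 * q) * (2 * q) \<le> (k + 1) * (k + 1)" using q_bounds by (intro mult_le_mono)
  finally have "5 * (m * T) \<le> 92 * n + 23 * ((k + 1) * (k + 1))" by simp
  moreover have "23 * ((k + 1) * (k + 1)) \<le> 2 ^ k" using square_power k_large by (simp add: algebra_simps)
  ultimately have "5 * (m * T) \<le> 94 * n" using n_bounds by linarith
  then have "real (5 * (m * T)) \<le> real (94 * n)" by (simp only: of_nat_le_iff)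
  then have mT: "real (m * T) \<le> 94 / 5 * real n" by simp
  \<comment> \<open>\<kappa> = 3 is special: \<kappa> \<le> L would give only 3 \<le> L, which is
    not enough, whereas L \<ge> 7 / 2 is. From 4 on the slope 24.436 covers the constants.\<close>
  have "13 * real \<kappa> + 22 + 94 / 5 \<le> 24.436 * L"
  proof (cases "\<kappa> = 3")
    case False
    then have "4 \<le> real \<kappa>" using kappa_ge by simp
    then have "13 * real \<kappa> + 22 + 94 / 5 \<le> 24.436 * real \<kappa>" by simp
    also have "\<dots> \<le> 24.436 * L" using L_bounds(2) by simp
    finally show ?thesis .
  qed (use L_bounds(1) in simp)
  then have "(13 * real \<kappa> + 22 + 94 / 5) * real n \<le> 24.436 * L * real n" by (rule mult_right_mono) simp
  then show ?thesis unfolding T_def[symmetric] using mT by (simp add: algebra_simps)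
qed

end

text \<open>The factor \<open>c\<close> between the output weights and the input weight is exposed
  because it serves twice: for the delay, and for a polynomial bound on the formulas that the
  program writes out.\<close>

lemma arrival_size_bounds:
  assumes n: "3 \<le> n"
  defines "x \<equiv> log 2 (real n)" and "L \<equiv> log 2 (log 2 (real n))"
  shows "\<exists>c. 0 < x \<and> 0 < L \<and> 0 < c \<and> 9 / 4 * c \<le> 2048 * (x * L) ^ 3 \<and>
      (\<forall>t\<in>set (the_terms n a). 2 ^ arr t \<le> c * real (pair_weight (the_elements n a)))"
    and "real (circuit_size (circuit_of_times (times n a))) \<le> 24.436 * real n * L"
proof -
  let ?x = "log 2 (real n)" and ?L = "log 2 (log 2 (real n))"
  let ?ps = "the_elements n a"
  have len: "length ?ps = n" using length_the_elements[OF n] .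
  have mem: "2 ^ ready p \<le> real (pair_weight ?ps)" if "p \<in> set ?ps" for p
  proof -
    have "real (2 ^ ready p) \<le> real (pair_weight ?ps)" using pair_weight_mem[OF that] by (simp only: of_nat_le_iff)
    then show ?thesis by simp
  qed
  have arr_ready: "(2::real) ^ arr (fst y) \<le> 2 ^ ready y" for y :: "adder_input pair"
    by (intro power_increasing) (auto simp: ready_def)
  let ?D = "\<exists>c. 0 < ?x \<and> 0 < ?L \<and> 0 < c \<and> 9 / 4 * c \<le> 2048 * (?x * ?L) ^ 3 \<and>
      (\<forall>t\<in>set (the_terms n a). 2 ^ arr t \<le> c * real (pair_weight ?ps))"
  let ?S = "real (circuit_size (circuit_of_times (times n a))) \<le> 24.436 * real n * ?L"
  have "?D \<and> ?S"
  proof (cases "clog n \<le> 12")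
    case True
    note sm = small_estimates[OF n True]
    have out: "outputs_of ?ps = sklansky ?ps" using True len by (simp add: outputs_of_def)
    have "2 ^ arr t \<le> 4 ^ clog n * real (pair_weight ?ps)" if "t \<in> set (the_terms n a)" for t
    proof -
      from that obtain y where y: "y \<in> set (sklansky ?ps)" "t = fst y"
        by (auto simp: the_terms_def[OF n] out)
      have "2 ^ ready y \<le> 4 ^ clog n * real (pair_weight ?ps)"
        by (rule sklansky_bound[OF _ _ y(1)]) (use mem len clog_le[of n] in auto)
      then show ?thesis unfolding y(2) by (rule order_trans[OF arr_ready])
    qed
    then have 1: ?D using sm by (intro exI[of _ "4 ^ clog n"]) auto
    have "2 * circuit_size (circuit_of_times (times n a)) \<le> 3 * clog n * n + 2 * n"
      using sklansky_gates[of ?ps "clog n" "pair_gates ?ps"] clog_le[of n] len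
      by (intro size_times[OF n]) (simp add: out)
    then have "real (2 * circuit_size (circuit_of_times (times n a))) \<le> real (3 * clog n * n + 2 * n)"
      by (simp only: of_nat_le_iff)
    also have "\<dots> = (3 * real (clog n) + 2) * real n" by (simp add: algebra_simps)
    also have "\<dots> \<le> (2 * 24.436 * ?L) * real n" using sm(4) by (rule mult_right_mono) simp
    finally have 2: "real (circuit_size (circuit_of_times (times n a))) \<le> 24.436 * real n * ?L"
      by (simp add: mult_ac)
    show ?thesis using 1 2 by simp
  next
    case False
    define k where "k = clog n"
    define q where "q = (k + 1) div 2"
    define \<kappa> where "\<kappa> = clog q"
    define m where "m = length (chunk (q * q) ?ps)"
    have qpos: "0 < q" using False by (simp add: q_def k_def)
    have mm: "m * (q * q) < n + q * q" using chunk_props(3)[of "q * q" ?ps] qpos len by (simp add: m_def)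
    interpret li: large_instance n k q \<kappa> m
      by unfold_locales (use False mm in \<open>auto simp: k_def q_def \<kappa>_def\<close>)
    have out: "outputs_of ?ps = adder q ?ps" using False len by (simp add: outputs_of_def q_def k_def)
    have mn: "m \<le> 2 ^ k" using length_chunk_le[of "q * q" ?ps] qpos len li.n_bounds(1) by (simp add: m_def)
    have mpos: "0 < m" using n qpos len unfolding m_def
      by (cases ?ps) (auto simp: chunk_step)
    \<comment> \<open>The largest value that the estimate of the delay admits, whichever of the two
      alternatives determines an output.\<close>
    define c where "c = 2048 * (li.x * li.L) ^ 3 * (4 / 9 :: real)"
    have c: "0 < c" using li.x_bounds(1) li.L_bounds(1) by (simp add: c_def)
    have xL: "li.x = ?x" "li.L = ?L" by (simp_all add: li.x_def li.L_def)
    have "2 ^ arr t \<le> c * real (pair_weight ?ps)" if "t \<in> set (the_terms n a)" for t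
    proof -
      from that obtain y where y: "y \<in> set (adder q ?ps)" "t = fst y"
        by (auto simp: the_terms_def[OF n] out)
      have *: "u \<le> c * real (pair_weight ?ps)" if "u \<le> 16 * (f * real (pair_weight ?ps))" "9 / 4 * (16 * f) \<le> 2048 * (li.x * li.L) ^ 3" for u f :: real
      proof -
        have "16 * f \<le> c" using that(2) by (simp add: c_def)
        then have "16 * f * real (pair_weight ?ps) \<le> c * real (pair_weight ?ps)" by (rule mult_right_mono) simp
        then show ?thesis using that(1) by (simp add: mult.assoc)
      qed
      from adder_bound[OF qpos li.q_le li.deep1 li.deep2 _ mn li.deep3 li.deep4 mpos y(1)]
      have "2 ^ arr t \<le> 16 * (4 ^ \<kappa> * (path_factor (2 * \<kappa> + 6) * pair_weight ?ps)) \<or>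
        2 ^ arr t \<le> 16 * (path_factor (2 * \<kappa> + 10) * path_factor (k + 4) * path_factor (3 * \<kappa> + 6) * pair_weight ?ps)"
        unfolding m_def y(2) by simp
      then show ?thesis
      proof
        assume "2 ^ arr t \<le> 16 * (4 ^ \<kappa> * (path_factor (2 * \<kappa> + 6) * pair_weight ?ps))"
        then show ?thesis by (intro *[OF _ li.delay1]) (simp add: mult.assoc)
      next
        assume "2 ^ arr t \<le> 16 * (path_factor (2 * \<kappa> + 10) * path_factor (k + 4) * path_factor (3 * \<kappa> + 6) * pair_weight ?ps)"
        then show ?thesis by (intro *[OF _ li.delay2])
      qed
    qed
    then have 1: ?D using c li.x_bounds(1) li.L_bounds(1)
      by (intro exI[of _ c]) (auto simp: c_def xL)
    let ?T = "k * (2 * (k + 1) + 2) + 2 * (2 * \<kappa> + 7) * (k + 1)"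
    have "card (pair_gates (outputs_of ?ps) - pair_gates ?ps) \<le> (13 * \<kappa> + 21) * n + m * ?T"
    proof -
      have "card (pair_gates (adder q ?ps) - pair_gates ?ps) \<le>
          (3 * \<kappa> + 2 * (2 * \<kappa> + 6 - 3) + 2 * (3 * \<kappa> + 6 - 3) + 9) * length ?ps +
          m * (k * (2 * (k + 4 - 3) + 2) + 2 * (2 * \<kappa> + 10 - 3) * (k + 1))"
        by (rule adder_gates[OF qpos li.q_le li.deep1 li.deep2 _ mn li.deep3 li.deep4]) (simp add: m_def)
      then show ?thesis unfolding out len by (simp add: algebra_simps)
    qed
    then have "2 * circuit_size (circuit_of_times (times n a)) \<le> 2 * ((13 * \<kappa> + 21) * n + m * ?T) + 2 * n"
      by (intro size_times[OF n]) simp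
    moreover have "2 * ((b + 21) * n + d) + 2 * n = 2 * ((b + 22) * n + d)" for b d :: nat
      by (simp add: algebra_simps)
    ultimately have "2 * circuit_size (circuit_of_times (times n a)) \<le> 2 * ((13 * \<kappa> + 22) * n + m * ?T)"
      by metis
    then have "circuit_size (circuit_of_times (times n a)) \<le> (13 * \<kappa> + 22) * n + m * ?T"
      by (simp only: nat_mult_le_cancel1)
    then have "real (circuit_size (circuit_of_times (times n a))) \<le> real ((13 * \<kappa> + 22) * n + m * ?T)"
      by (simp only: of_nat_le_iff)
    also have "\<dots> \<le> 24.436 * real n * ?L" using li.size_bound by (simp only: xL)
    finally have 2: "real (circuit_size (circuit_of_times (times n a))) \<le> 24.436 * real n * ?L" .
    show ?thesis using 1 2 by simp
  qed
  then show "\<exists>c. 0 < x \<and> 0 < L \<and> 0 < c \<and> 9 / 4 * c \<le> 2048 * (x * L) ^ 3 \<and>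
      (\<forall>t\<in>set (the_terms n a). 2 ^ arr t \<le> c * real (pair_weight (the_elements n a)))"
    "real (circuit_size (circuit_of_times (times n a))) \<le> 24.436 * real n * L"
    unfolding x_def L_def by blast+
qed

theorem delay_bound:
  assumes n: "3 \<le> n"
  shows "real (delay (circuit_of_times (times n a)) a)
      \<le> log 2 (input_weight n a) + 3 * log 2 (log 2 (real n)) + 3 * log 2 (log 2 (log 2 (real n))) + 11.085"
proof -
  obtain c where c: "0 < log 2 (real n)" "0 < log 2 (log 2 (real n))" "0 < c"
    "9 / 4 * c \<le> 2048 * (log 2 (real n) * log 2 (log 2 (real n))) ^ 3"
    "\<forall>t\<in>set (the_terms n a). 2 ^ arr t \<le> c * real (pair_weight (the_elements n a))"
    using arrival_size_bounds(1)[OF n] by blast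
  have "0 < input_weight n a" by (rule less_le_trans[OF _ input_weight_latest[OF n]]) simp
  then show ?thesis
    using order_trans[OF delay_times[OF n, of a c] delay_le[of "log 2 (real n)" "log 2 (log 2 (real n))" "input_weight n a" c]] c by simp
qed

text \<open>A formula written out as a tree has fewer than \<open>2 ^ arr t\<close> gates. A crude
  polynomial bound on this number lets the program build the formulas without sharing and merge
  equal parts afterwards.\<close>

lemma terms_arr_bound:
  assumes n: "3 \<le> n" and t: "t \<in> set (the_terms n a)"
  shows "2 ^ arr t \<le> 500000 * n ^ 6 * pair_weight (the_elements n a)"
proof -
  let ?x = "log 2 (real n)" and ?L = "log 2 (log 2 (real n))"
  obtain c where c: "0 < ?x" "0 < ?L" "9 / 4 * c \<le> 2048 * (?x * ?L) ^ 3"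
    "\<forall>t\<in>set (the_terms n a). 2 ^ arr t \<le> c * real (pair_weight (the_elements n a))"
    using arrival_size_bounds(1)[OF n] by blast
  have l: "log 2 y \<le> 2 * y" if "0 < y" for y :: real
  proof -
    have "1 / 2 \<le> ln (2 :: real)" using ln_le_minus_one[of "1 / 2 :: real"] by (simp add: ln_div)
    then have "y \<le> 2 * y * ln 2" using mult_left_mono[of "1 / 2" "ln 2" "2 * y"] that by simp
    moreover have "ln y \<le> y" using ln_le_minus_one[OF that] by simp
    ultimately show ?thesis by (simp add: log_def divide_le_eq)
  qed
  have x: "?x \<le> 2 * real n" using l[of "real n"] n by simp
  then have "?L \<le> 4 * real n" using l[OF c(1)] by linarith
  with x have "?x * ?L \<le> 2 * real n * (4 * real n)" using c(2) by (intro mult_mono) auto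
  then have "(?x * ?L) ^ 3 \<le> (2 * real n * (4 * real n)) ^ 3" using c(1,2) by (intro power_mono) auto
  also have "\<dots> = 512 * real n ^ 6" by (simp add: power_mult_distrib flip: power_add)
  \<comment> \<open>Both logarithms are linear in n, so the cube is at most 512 n ^ 6, and 2048 *
    512 * 4 / 9 is below 500000.\<close>
  finally have "c \<le> 500000 * real n ^ 6" using c(3) zero_le_power[of "real n" 6] by linarith
  then have "c * real (pair_weight (the_elements n a)) \<le> 500000 * real n ^ 6 * pair_weight (the_elements n a)"
    by (rule mult_right_mono) simp
  with c(4) t have "2 ^ arr t \<le> 500000 * real n ^ 6 * pair_weight (the_elements n a)" by fastforce
  then have "real (2 ^ arr t) \<le> real (500000 * n ^ 6 * pair_weight (the_elements n a))" by simp
  then show ?thesis by (simp only: of_nat_le_iff)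
qed

section \<open>Closure properties of polynomial time\<close>

lemma enc_bool_Leaf [simp]: "enc_bool b = Leaf \<longleftrightarrow> \<not> b"
  by (cases b) auto

lemma PT_if:
  assumes "PT I N G (\<lambda>i. enc_bool (b i))" "PT {i\<in>I. b i} N G u" "PT {i\<in>I. \<not> b i} N G v"
  shows "PT I N G (\<lambda>i. if b i then u i else v i)"
  using PT_if_raw[OF assms(1), of u v] assms(2,3) by simp

lemma PT_enc_bool:
  assumes "PT I N G c" "\<And>i. i \<in> I \<Longrightarrow> b i \<longleftrightarrow> c i \<noteq> Leaf"
  shows "PT I N G (\<lambda>i. enc_bool (b i))"
  by (rule PT_cong[OF _ PT_if_raw[OF assms(1) PT_const[of _ _ _ "enc_bool True"] PT_const[of _ _ _ "enc_bool False"]]])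
     (use assms(2) in auto)

lemma PT_not: "PT I N G (\<lambda>i. enc_bool (b i)) \<Longrightarrow> PT I N G (\<lambda>i. enc_bool (\<not> b i))"
  by (rule PT_cong[OF _ PT_if[of _ _ _ b, OF _ PT_const[of _ _ _ "enc_bool False"] PT_const[of _ _ _ "enc_bool True"]]]) auto

lemma PT_conj:
  assumes "PT I N G (\<lambda>i. enc_bool (b i))" "PT {i\<in>I. b i} N G (\<lambda>i. enc_bool (c i))"
  shows "PT I N G (\<lambda>i. enc_bool (b i \<and> c i))"
  by (rule PT_cong[OF _ PT_if[OF assms PT_const[of _ _ _ "enc_bool False"]]]) auto

lemma PT_disj:
  assumes "PT I N G (\<lambda>i. enc_bool (b i))" "PT {i\<in>I. \<not> b i} N G (\<lambda>i. enc_bool (c i))"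
  shows "PT I N G (\<lambda>i. enc_bool (b i \<or> c i))"
  by (rule PT_cong[OF _ PT_if[OF assms(1) PT_const[of _ _ _ "enc_bool True"] assms(2)]]) auto

lemma PT_eq_bool:
  assumes "PT I N G (\<lambda>i. enc_bool (b i))" "PT I N G (\<lambda>i. enc_bool (c i))"
  shows "PT I N G (\<lambda>i. enc_bool (b i = c i))"
  by (rule PT_cong[OF _ PT_if[OF assms(1) PT_subset[OF assms(2)] PT_subset[OF PT_not[OF assms(2)]]]]) auto

lemma PT_lift:
  assumes "PT I N G u" "\<And>p. p \<in> I' \<Longrightarrow> fst p \<in> I" "set (map (\<lambda>g p. g (fst p)) G) \<subseteq> set G'"
  shows "PT I' (\<lambda>p. N (fst p)) G' (\<lambda>p. u (fst p))"
proof (rule PT_call[OF assms(1), where \<phi> = fst])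
  show "PTs I' (\<lambda>p. N (fst p)) G' (map (\<lambda>g i. g (fst i)) G)"
    by (rule PTsI, rule PT_var) (use assms(3) in auto)
qed (use assms(2) in auto)

lemma poly_bounded_lift:
  "poly_bounded I N T \<Longrightarrow> (\<And>p. p \<in> I' \<Longrightarrow> fst p \<in> I) \<Longrightarrow> poly_bounded I' (\<lambda>p. N (fst p)) (\<lambda>p. T (fst p))"
  by (rule poly_bounded_reindex) auto

lemma PT_rec1:
  assumes bl: "PT I N G (\<lambda>i. enc_bool (b i))"
    and l: "\<And>g. g \<in> set G \<Longrightarrow> PT {i\<in>I. b i} N G (\<lambda>i. g (l i))"
    and step: "PT {i\<in>I. b i} N ((\<lambda>i. v (l i)) # G) v"
    and base: "PT {i\<in>I. \<not> b i} N G v"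
    and cl: "\<And>i. i \<in> I \<Longrightarrow> b i \<Longrightarrow> l i \<in> I \<and> N (l i) \<le> N i \<and> m (l i) < (m i :: nat)"
    and pm: "poly_bounded I N m"
  shows "PT I N G v"
proof (rule PT_rec[where br = "\<lambda>_. False" and r = "\<lambda>i. i" and m = "\<lambda>i. Suc (m i)", OF bl])
  let ?G = "(\<lambda>i. if b i then v (l i) else Leaf) # (\<lambda>i. if False then v i else Leaf) # G"
  show "PT I N ?G v"
  proof (rule PT_cong[OF _ PT_if[where b = b and u = v and v = v]])
    show "PT I N ?G (\<lambda>i. enc_bool (b i))" by (rule PT_trans[OF bl]) (auto intro: PT_var)
    show "PT {i \<in> I. \<not> b i} N ?G v" by (rule PT_trans[OF base]) (auto intro: PT_var)
    show "PT {i \<in> I. b i} N ?G v"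
    proof (rule PT_trans[OF step])
      fix g assume "g \<in> set ((\<lambda>i. v (l i)) # G)"
      then consider "g = (\<lambda>i. v (l i))" | "g \<in> set G" by auto
      then show "PT {i \<in> I. b i} N ?G g"
      proof cases
        case 1
        then show ?thesis
          by (intro PT_cong[OF _ PT_var[of "\<lambda>i. if b i then v (l i) else Leaf"]]) auto
      qed (auto intro: PT_var)
    qed
  qed auto
qed (use l cl pm in \<open>auto intro: PT_const PT_var poly_bounded_Suc\<close>)

lemma PT_null: "PT I N G (\<lambda>i. enc_list e (xs i)) \<Longrightarrow> PT I N G (\<lambda>i. enc_bool (xs i = []))"
proof -
  have "enc_list e ys = Leaf \<longleftrightarrow> ys = []" for ys by (cases ys) auto
  then show "PT I N G (\<lambda>i. enc_list e (xs i)) \<Longrightarrow> ?thesis"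
    using PT_not[OF PT_enc_bool[of I N G "\<lambda>i. enc_list e (xs i)" "\<lambda>i. xs i \<noteq> []"]] by simp
qed

lemma PT_hd:
  assumes "PT I N G (\<lambda>i. enc_list e (xs i))" "\<And>i. i \<in> I \<Longrightarrow> xs i \<noteq> []"
  shows "PT I N G (\<lambda>i. e (hd (xs i)))"
proof (rule PT_cong[OF _ PT_Hd[OF assms(1)]])
  fix i assume "i \<in> I"
  then show "e (hd (xs i)) = sexp_hd (enc_list e (xs i))" using assms(2)[of i] by (cases "xs i") auto
qed

lemma PT_tl: "PT I N G (\<lambda>i. enc_list e (xs i)) \<Longrightarrow> PT I N G (\<lambda>i. enc_list e (tl (xs i)))"
proof -
  have "enc_list e (tl ys) = sexp_tl (enc_list e ys)" for ys by (cases ys) auto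
  then show "PT I N G (\<lambda>i. enc_list e (xs i)) \<Longrightarrow> ?thesis" using PT_Tl by simp
qed

lemma PT_Nil: "PT I N G (\<lambda>i. enc_list e [])"
  by (simp add: PT_Leaf)

lemma PT_Cons: "PT I N G (\<lambda>i. e (x i)) \<Longrightarrow> PT I N G (\<lambda>i. enc_list e (xs i)) \<Longrightarrow>
    PT I N G (\<lambda>i. enc_list e (x i # xs i))"
  by (simp add: PT_Dot)

definition enc_pair :: "('a \<Rightarrow> sexp) \<Rightarrow> ('b \<Rightarrow> sexp) \<Rightarrow> 'a \<times> 'b \<Rightarrow> sexp" where
  "enc_pair e1 e2 p = Dot (e1 (fst p)) (e2 (snd p))"

lemma PT_pair: "PT I N G (\<lambda>i. e1 (x i)) \<Longrightarrow> PT I N G (\<lambda>i. e2 (y i)) \<Longrightarrow>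
    PT I N G (\<lambda>i. enc_pair e1 e2 (x i, y i))"
  by (simp add: enc_pair_def PT_Dot)

lemma PT_fst: "PT I N G (\<lambda>i. enc_pair e1 e2 (p i)) \<Longrightarrow> PT I N G (\<lambda>i. e1 (fst (p i)))"
  by (drule PT_Hd) (simp add: enc_pair_def)

lemma PT_snd: "PT I N G (\<lambda>i. enc_pair e1 e2 (p i)) \<Longrightarrow> PT I N G (\<lambda>i. e2 (snd (p i)))"
  by (drule PT_Tl) (simp add: enc_pair_def)

text \<open>The body is verified for all splittings of the list into a prefix, the current element
  and the remaining suffix. Size bounds known for the list of instance \<open>i\<close> thereby
  become available for the elements and for the intermediate results of the fold.\<close>

lemma PT_foldr:
  fixes xs :: "'w \<Rightarrow> 'a list" and z :: "'w \<Rightarrow> 'b"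
  assumes xs: "PT I N G (\<lambda>i. enc_list e (xs i))" and z: "PT I N G (\<lambda>i. e' (z i))"
    and len: "poly_bounded I N (\<lambda>i. length (xs i))"
    and body: "PT {p. fst p \<in> I \<and> (\<exists>us. xs (fst p) = us @ fst (snd p) # snd (snd p))} (\<lambda>p. N (fst p))
      ((\<lambda>p. e (fst (snd p))) # (\<lambda>p. e' (foldr (f (fst p)) (snd (snd p)) (z (fst p)))) # map (\<lambda>g p. g (fst p)) G)
      (\<lambda>p. e' (f (fst p) (fst (snd p)) (foldr (f (fst p)) (snd (snd p)) (z (fst p)))))"
  shows "PT I N G (\<lambda>i. e' (foldr (f i) (xs i) (z i)))"
proof -
  let ?I = "{p. fst p \<in> I \<and> (\<exists>us. xs (fst p) = us @ snd p)}"
  let ?N = "\<lambda>p :: 'w \<times> 'a list. N (fst p)"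
  let ?G = "(\<lambda>p. enc_list e (snd p)) # (\<lambda>p. e' (z (fst p))) # map (\<lambda>g p. g (fst p)) G"
  let ?v = "\<lambda>p. e' (foldr (f (fst p)) (snd p) (z (fst p)))"
  have list: "PT I' ?N (H @ ?G) (\<lambda>p. enc_list e (snd p))" for I' H by (rule PT_var) simp
  have "PT ?I ?N ?G ?v"
  proof (rule PT_rec1[where b = "\<lambda>p. snd p \<noteq> []" and l = "\<lambda>p. (fst p, tl (snd p))" and m = "\<lambda>p. length (snd p)"])
    show "PT ?I ?N ?G (\<lambda>p. enc_bool (snd p \<noteq> []))"
      using list[of _ "[]"] by (intro PT_not PT_null) simp
    show "PT {p \<in> ?I. snd p \<noteq> []} ?N ?G (\<lambda>p. g (fst p, tl (snd p)))" if g: "g \<in> set ?G" for g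
    proof -
      consider "g = (\<lambda>p. enc_list e (snd p))" | "g = (\<lambda>p. e' (z (fst p)))" | h where "h \<in> set G" "g = (\<lambda>p. h (fst p))"
        using g by (simp only: list.set set_map insert_iff image_iff) blast
      then show ?thesis
      proof cases
        case 1
        then show ?thesis using PT_tl[OF list[of _ "[]"]] by simp
      qed (auto intro!: PT_var)
    qed
    show "PT {p \<in> ?I. \<not> snd p \<noteq> []} ?N ?G ?v"
      by (rule PT_cong[OF _ PT_var[of "\<lambda>p. e' (z (fst p))"]]) auto
    let ?H = "(\<lambda>p. ?v (fst p, tl (snd p))) # ?G"
    have "PT {p \<in> ?I. snd p \<noteq> []} ?N ?H (\<lambda>p. e' (f (fst p) (hd (snd p)) (foldr (f (fst p)) (tl (snd p)) (z (fst p)))))"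
      (is "PT ?D _ _ _")
    proof -
      have "PT ?D ?N ?H (\<lambda>p. (\<lambda>p. e' (f (fst p) (fst (snd p)) (foldr (f (fst p)) (snd (snd p)) (z (fst p)))))
          (fst p, hd (snd p), tl (snd p)))"
      proof (rule PT_call[OF body])
        show "(fst p, hd (snd p), tl (snd p)) \<in> {p. fst p \<in> I \<and> (\<exists>us. xs (fst p) = us @ fst (snd p) # snd (snd p))}"
          if "p \<in> ?D" for p using that by auto
        have 1: "PT ?D ?N ?H (\<lambda>p. e (hd (snd p)))"
          using list[of _ "[\<lambda>p. ?v (fst p, tl (snd p))]"] by (intro PT_hd[where xs = snd]) auto
        have 2: "PT ?D ?N ?H (\<lambda>p. e' (foldr (f (fst p)) (tl (snd p)) (z (fst p))))"
          by (rule PT_var) simp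
        have 3: "PT ?D ?N ?H (\<lambda>p. g (fst p))" if "g \<in> set G" for g
          by (rule PT_var) (use that in auto)
        show "PTs ?D ?N ?H (map (\<lambda>g i. g (fst i, hd (snd i), tl (snd i)))
          ((\<lambda>p. e (fst (snd p))) # (\<lambda>p. e' (foldr (f (fst p)) (snd (snd p)) (z (fst p)))) # map (\<lambda>g p. g (fst p)) G))"
          by (rule PTsI) (use 1 2 3 in auto)
      qed (simp add: poly_bounded_id)
      then show ?thesis by simp
    qed
    then show "PT ?D ?N ?H ?v"
    proof (rule PT_cong[rotated])
      fix p assume "p \<in> ?D"
      then show "?v p = e' (f (fst p) (hd (snd p)) (foldr (f (fst p)) (tl (snd p)) (z (fst p))))"
        by (cases "snd p") auto
    qed
    show "(fst p, tl (snd p)) \<in> ?I \<and> N (fst (fst p, tl (snd p))) \<le> N (fst p) \<and>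
        length (snd (fst p, tl (snd p))) < length (snd p)" if "p \<in> ?I" "snd p \<noteq> []" for p
    proof -
      from that obtain us where "xs (fst p) = us @ snd p" by auto
      then have "xs (fst p) = (us @ [hd (snd p)]) @ tl (snd p)" using that(2) by simp
      then have "\<exists>us. xs (fst p) = us @ tl (snd p)" by blast
      then show ?thesis using that by simp
    qed
    show "poly_bounded ?I ?N (\<lambda>p. length (snd p))"
    proof (rule poly_bounded_mono)
      show "poly_bounded ?I ?N (\<lambda>p. length (xs (fst p)))" by (rule poly_bounded_lift[OF len]) auto
    qed auto
  qed
  then have "PT I N G (\<lambda>i. ?v (i, xs i))"
  proof (rule PT_call[where \<phi> = "\<lambda>i. (i, xs i)"])
    show "PTs I N G (map (\<lambda>g i. g (i, xs i)) ?G)"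
      by (rule PTsI) (use xs z in \<open>auto intro: PT_var\<close>)
  qed auto
  then show ?thesis by simp
qed

lemma PT_map:
  assumes "PT I N G (\<lambda>i. enc_list e (xs i))" "poly_bounded I N (\<lambda>i. length (xs i))"
    and body: "PT {p. fst p \<in> I \<and> snd p \<in> set (xs (fst p))} (\<lambda>p. N (fst p))
      ((\<lambda>p. e (snd p)) # map (\<lambda>g p. g (fst p)) G) (\<lambda>p. e' (f (fst p) (snd p)))"
  shows "PT I N G (\<lambda>i. enc_list e' (map (f i) (xs i)))"
proof -
  have m: "map g ys = foldr (\<lambda>x. (#) (g x)) ys []" for g :: "'b \<Rightarrow> 'c" and ys
    by (induction ys) auto
  have "PT I N G (\<lambda>i. enc_list e' (foldr (\<lambda>x. (#) (f i x)) (xs i) []))"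
  proof (rule PT_foldr[where e = e and e' = "enc_list e'" and z = "\<lambda>_. []" and f = "\<lambda>i x. (#) (f i x)", OF assms(1) _ assms(2)])
    show "PT I N G (\<lambda>i. enc_list e' [])" by (rule PT_Nil)
    let ?D = "{p. fst p \<in> I \<and> (\<exists>us. xs (fst p) = us @ fst (snd p) # snd (snd p))}"
    let ?H = "(\<lambda>p. e (fst (snd p))) # (\<lambda>p. enc_list e' (foldr (\<lambda>x. (#) (f (fst p) x)) (snd (snd p)) [])) # map (\<lambda>g p. g (fst p)) G"
    have "PT ?D (\<lambda>p. N (fst p)) ?H (\<lambda>p. (\<lambda>p. e' (f (fst p) (snd p))) (fst p, fst (snd p)))"
    proof (rule PT_call[OF body])
      show "PTs ?D (\<lambda>p. N (fst p)) ?H (map (\<lambda>g p. g (fst p, fst (snd p))) ((\<lambda>p. e (snd p)) # map (\<lambda>g p. g (fst p)) G))"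
        by (rule PTsI) (auto intro: PT_var)
    qed auto
    then show "PT ?D (\<lambda>p. N (fst p)) ?H (\<lambda>p. enc_list e' (f (fst p) (fst (snd p)) # foldr (\<lambda>x. (#) (f (fst p) x)) (snd (snd p)) []))"
      by (intro PT_Cons) (auto intro: PT_var)
  qed
  then show ?thesis unfolding m .
qed

lemma poly_bounded_fst:
  "poly_bounded I N T \<Longrightarrow> (\<And>p. P p \<Longrightarrow> fst p \<in> I) \<Longrightarrow> poly_bounded {p. P p} (\<lambda>p. N (fst p)) (\<lambda>p. T (fst p))"
  by (rule poly_bounded_lift) auto

lemma PT_lift':
  "PT I N G u \<Longrightarrow> (\<And>p. p \<in> I' \<Longrightarrow> fst p \<in> I) \<Longrightarrow>
    PT I' (\<lambda>p. N (fst p)) (x # map (\<lambda>g p. g (fst p)) G) (\<lambda>p. u (fst p))"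
  "PT I N G u \<Longrightarrow> (\<And>p. p \<in> I' \<Longrightarrow> fst p \<in> I) \<Longrightarrow>
    PT I' (\<lambda>p. N (fst p)) (x # y # map (\<lambda>g p. g (fst p)) G) (\<lambda>p. u (fst p))"
  by (erule PT_lift; auto)+

lemma PT_append:
  assumes "PT I N G (\<lambda>i. enc_list e (xs i))" "PT I N G (\<lambda>i. enc_list e (ys i))"
    "poly_bounded I N (\<lambda>i. length (xs i))"
  shows "PT I N G (\<lambda>i. enc_list e (xs i @ ys i))"
proof -
  have a: "us @ vs = foldr (#) us vs" for us vs by (induction us) auto
  have "PT I N G (\<lambda>i. enc_list e (foldr (#) (xs i) (ys i)))"
    by (rule PT_foldr[where e' = "enc_list e", OF assms(1,2,3)]) (intro PT_Cons; rule PT_var; simp)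
  then show ?thesis unfolding a .
qed

lemma PT_concat:
  assumes "PT I N G (\<lambda>i. enc_list (enc_list e) (xs i))"
    "poly_bounded I N (\<lambda>i. length (xs i))" "poly_bounded I N (\<lambda>i. length (concat (xs i)))"
  shows "PT I N G (\<lambda>i. enc_list e (concat (xs i)))"
proof -
  have "PT I N G (\<lambda>i. enc_list e (foldr (@) (xs i) []))"
  proof (rule PT_foldr[where e = "enc_list e" and e' = "enc_list e" and z = "\<lambda>_. []" and f = "\<lambda>_. (@)", OF assms(1) _ assms(2)])
    let ?D = "{p. fst p \<in> I \<and> (\<exists>us. xs (fst p) = us @ fst (snd p) # snd (snd p))}"
    have "poly_bounded ?D (\<lambda>p. N (fst p)) (\<lambda>p. length (concat (xs (fst p))))"
      by (rule poly_bounded_lift[OF assms(3)]) auto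
    then have "poly_bounded ?D (\<lambda>p. N (fst p)) (\<lambda>p. length (fst (snd p)))"
      by (rule poly_bounded_mono) auto
    then show "PT ?D (\<lambda>p. N (fst p)) ((\<lambda>p. enc_list e (fst (snd p))) # (\<lambda>p. enc_list e (foldr (@) (snd (snd p)) [])) # map (\<lambda>g p. g (fst p)) G)
      (\<lambda>p. enc_list e (fst (snd p) @ foldr (@) (snd (snd p)) []))"
      by (intro PT_append) (auto intro: PT_var)
  qed (rule PT_Nil)
  then show ?thesis by (simp add: concat_conv_foldr)
qed

lemma PT_rev:
  assumes "PT I N G (\<lambda>i. enc_list e (xs i))" "poly_bounded I N (\<lambda>i. length (xs i))"
  shows "PT I N G (\<lambda>i. enc_list e (rev (xs i)))"
proof -
  have r: "rev us = foldr (\<lambda>x acc. acc @ [x]) us []" for us by (induction us) auto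
  have "PT I N G (\<lambda>i. enc_list e (foldr (\<lambda>x acc. acc @ [x]) (xs i) []))"
  proof (rule PT_foldr[where e = e and e' = "enc_list e" and z = "\<lambda>_. []" and f = "\<lambda>_ x acc. acc @ [x]", OF assms(1) _ assms(2)])
    let ?D = "{p. fst p \<in> I \<and> (\<exists>us. xs (fst p) = us @ fst (snd p) # snd (snd p))}"
    let ?H = "(\<lambda>p. e (fst (snd p))) # (\<lambda>p. enc_list e (foldr (\<lambda>x acc. acc @ [x]) (snd (snd p)) [])) # map (\<lambda>g p. g (fst p)) G"
    have "poly_bounded ?D (\<lambda>p. N (fst p)) (\<lambda>p. length (xs (fst p)))"
      by (rule poly_bounded_lift[OF assms(2)]) auto
    then have "poly_bounded ?D (\<lambda>p. N (fst p)) (\<lambda>p. length (foldr (\<lambda>x acc. acc @ [x]) (snd (snd p)) []))"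
      unfolding r[symmetric] by (rule poly_bounded_mono) auto
    moreover have "PT ?D (\<lambda>p. N (fst p)) ?H (\<lambda>p. enc_list e [fst (snd p)])"
      by (intro PT_Cons PT_Nil PT_var) simp
    ultimately show "PT ?D (\<lambda>p. N (fst p)) ?H (\<lambda>p. enc_list e (foldr (\<lambda>x acc. acc @ [x]) (snd (snd p)) [] @ [fst (snd p)]))"
      by (intro PT_append) (auto intro: PT_var)
  qed (rule PT_Nil)
  then show ?thesis unfolding r .
qed

section \<open>Numbers in unary\<close>

definition enc_un :: "nat \<Rightarrow> sexp" where
  "enc_un n = enc_list (\<lambda>_. Leaf) (replicate n ())"

lemma PT_un_0: "PT I N G (\<lambda>_. enc_un 0)"
  by (rule PT_const)

lemma PT_un_const: "PT I N G (\<lambda>_. enc_un c)"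
  by (rule PT_const)

lemma PT_un_Suc: "PT I N G (\<lambda>i. enc_un (a i)) \<Longrightarrow> PT I N G (\<lambda>i. enc_un (Suc (a i)))"
  unfolding enc_un_def replicate_Suc by (rule PT_Cons[where e = "\<lambda>_. Leaf" and x = "\<lambda>_. ()", OF PT_Leaf])

lemma PT_un_is_0: "PT I N G (\<lambda>i. enc_un (a i)) \<Longrightarrow> PT I N G (\<lambda>i. enc_bool (a i = 0))"
  using PT_null[of I N G "\<lambda>_. Leaf" "\<lambda>i. replicate (a i) ()"] by (simp add: enc_un_def)

lemma PT_un_pred: "PT I N G (\<lambda>i. enc_un (a i)) \<Longrightarrow> PT I N G (\<lambda>i. enc_un (a i - 1))"
  using PT_tl[of I N G "\<lambda>_. Leaf" "\<lambda>i. replicate (a i) ()"] by (simp add: enc_un_def)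

lemma PT_un_add:
  assumes "PT I N G (\<lambda>i. enc_un (a i))" "PT I N G (\<lambda>i. enc_un (b i))" "poly_bounded I N a"
  shows "PT I N G (\<lambda>i. enc_un (a i + b i))"
  using PT_append[of I N G "\<lambda>_. Leaf" "\<lambda>i. replicate (a i) ()" "\<lambda>i. replicate (b i) ()"] assms
  by (simp add: enc_un_def replicate_add)

lemma PT_iterate:
  assumes "PT I N G (\<lambda>i. enc_un (a i))" "PT I N G (\<lambda>i. e (z i))" "poly_bounded I N a"
    and "PT {p. fst p \<in> I \<and> snd p < a (fst p)} (\<lambda>p. N (fst p))
      ((\<lambda>p. e ((f (fst p) ^^ snd p) (z (fst p)))) # map (\<lambda>g p. g (fst p)) G)
      (\<lambda>p. e (f (fst p) ((f (fst p) ^^ snd p) (z (fst p)))))"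
  shows "PT I N G (\<lambda>i. e ((f i ^^ a i) (z i)))"
proof -
  have fr: "foldr (\<lambda>_. g) us y = (g ^^ length us) y" for g :: "'b \<Rightarrow> 'b" and us :: "unit list" and y
    by (induction us) auto
  have "PT I N G (\<lambda>i. e (foldr (\<lambda>_. f i) (replicate (a i) ()) (z i)))"
  proof (rule PT_foldr[where e = "\<lambda>_. Leaf"])
    let ?D = "{p. fst p \<in> I \<and> (\<exists>us. replicate (a (fst p)) () = us @ fst (snd p) # snd (snd p))}"
    let ?H = "(\<lambda>p. Leaf) # (\<lambda>p. e (foldr (\<lambda>_. f (fst p)) (snd (snd p)) (z (fst p)))) # map (\<lambda>g p. g (fst p)) G"
    have "PT ?D (\<lambda>p. N (fst p)) ?H (\<lambda>p. (\<lambda>p. e (f (fst p) ((f (fst p) ^^ snd p) (z (fst p))))) (fst p, length (snd (snd p))))"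
    proof (rule PT_call[OF assms(4)])
      fix p assume "p \<in> ?D"
      then obtain us where *: "fst p \<in> I" "replicate (a (fst p)) () = us @ fst (snd p) # snd (snd p)" by auto
      then have "a (fst p) = length us + Suc (length (snd (snd p)))" by (metis length_append length_replicate length_Cons)
      then show "(fst p, length (snd (snd p))) \<in> {p. fst p \<in> I \<and> snd p < a (fst p)}" using * by simp
    next
      show "PTs ?D (\<lambda>p. N (fst p)) ?H (map (\<lambda>g p. g (fst p, length (snd (snd p))))
          ((\<lambda>p. e ((f (fst p) ^^ snd p) (z (fst p)))) # map (\<lambda>g p. g (fst p)) G))"
        by (rule PTsI) (auto simp: fr intro: PT_var)
    qed auto
    then show "PT ?D (\<lambda>p. N (fst p)) ?H (\<lambda>p. e (f (fst p) (foldr (\<lambda>_. f (fst p)) (snd (snd p)) (z (fst p)))))"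
      by (simp add: fr)
  qed (use assms in \<open>simp_all add: enc_un_def\<close>)
  then show ?thesis by (simp add: fr)
qed

lemma poly_bounded_iter:
  "poly_bounded I N T \<Longrightarrow> (\<And>p. fst p \<in> I \<Longrightarrow> snd p < a (fst p) \<Longrightarrow> S p \<le> T (fst p)) \<Longrightarrow>
    poly_bounded {p. fst p \<in> I \<and> snd p < a (fst p)} (\<lambda>p. N (fst p)) S"
  by (rule poly_bounded_mono[OF poly_bounded_fst[of I N T "\<lambda>p. fst p \<in> I \<and> snd p < a (fst p)"]]) auto

lemma PT_un_mult:
  assumes "PT I N G (\<lambda>i. enc_un (a i))" "PT I N G (\<lambda>i. enc_un (b i))" "poly_bounded I N a" "poly_bounded I N b"
  shows "PT I N G (\<lambda>i. enc_un (a i * b i))"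
proof -
  have m: "x * y = ((+) y ^^ x) 0" for x y :: nat by (induction x) auto
  have "PT I N G (\<lambda>i. enc_un (((+) (b i) ^^ a i) 0))"
    by (rule PT_iterate[where e = enc_un and z = "\<lambda>_. 0" and f = "\<lambda>i. (+) (b i)", OF assms(1) PT_un_0 assms(3)], rule PT_un_add)
       (auto intro: PT_lift'[OF assms(2)] PT_var poly_bounded_fst[OF assms(4)])
  then show ?thesis unfolding m[symmetric] .
qed

text \<open>The bound concerns the value \<open>2 ^ a i\<close> and not the exponent, as the result
  is written out in unary.\<close>

lemma PT_un_power2:
  assumes "PT I N G (\<lambda>i. enc_un (a i))" "poly_bounded I N (\<lambda>i. 2 ^ a i)"
  shows "PT I N G (\<lambda>i. enc_un (2 ^ a i))"
proof -
  have m: "2 ^ x = ((\<lambda>y. y + y) ^^ x) (1::nat)" for x by (induction x) auto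
  have a: "poly_bounded I N a" by (rule poly_bounded_mono[OF assms(2)]) (auto simp: less_imp_le)
  have "PT I N G (\<lambda>i. enc_un (((\<lambda>y. y + y) ^^ a i) 1))"
  proof (rule PT_iterate[where e = enc_un and z = "\<lambda>_. 1" and f = "\<lambda>_ y. y + y", OF assms(1) PT_un_const[where c = 1] a], rule PT_un_add)
    have "poly_bounded {p. fst p \<in> I \<and> snd p < a (fst p)} (\<lambda>p. N (fst p)) (\<lambda>p. 2 ^ snd p)"
      by (rule poly_bounded_iter[OF assms(2)]) (auto intro: power_increasing)
    then show "poly_bounded {p. fst p \<in> I \<and> snd p < a (fst p)} (\<lambda>p. N (fst p)) (\<lambda>p. ((\<lambda>y. y + y) ^^ snd p) 1)"
      unfolding m .
  qed (auto intro: PT_var)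
  then show ?thesis unfolding m[symmetric] .
qed

lemma PT_un_minus:
  assumes "PT I N G (\<lambda>i. enc_un (a i))" "PT I N G (\<lambda>i. enc_un (b i))" "poly_bounded I N b"
  shows "PT I N G (\<lambda>i. enc_un (a i - b i))"
proof -
  have m: "x - y = ((\<lambda>z. z - 1) ^^ y) x" for x y :: nat by (induction y) auto
  have "PT I N G (\<lambda>i. enc_un (((\<lambda>z. z - 1) ^^ b i) (a i)))"
    by (rule PT_iterate[where e = enc_un and f = "\<lambda>_ z. z - 1", OF assms(2,1,3)], rule PT_un_pred) (auto intro: PT_var)
  then show ?thesis unfolding m[symmetric] .
qed

lemma PT_un_le:
  assumes "PT I N G (\<lambda>i. enc_un (a i))" "PT I N G (\<lambda>i. enc_un (b i))" "poly_bounded I N b"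
  shows "PT I N G (\<lambda>i. enc_bool (a i \<le> b i))"
  using PT_un_is_0[OF PT_un_minus[OF assms]] by simp

lemma PT_un_max:
  assumes "PT I N G (\<lambda>i. enc_un (a i))" "PT I N G (\<lambda>i. enc_un (b i))" "poly_bounded I N b"
  shows "PT I N G (\<lambda>i. enc_un (max (a i) (b i)))"
  by (rule PT_cong[OF _ PT_if[OF PT_un_le[OF assms] PT_subset[OF assms(2)] PT_subset[OF assms(1)]]]) auto

section \<open>Lists with unary indices, and searching\<close>

lemma PT_length:
  assumes "PT I N G (\<lambda>i. enc_list e (xs i))" "poly_bounded I N (\<lambda>i. length (xs i))"
  shows "PT I N G (\<lambda>i. enc_un (length (xs i)))"
proof -
  have l: "length us = foldr (\<lambda>_. Suc) us 0" for us by (induction us) auto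
  have "PT I N G (\<lambda>i. enc_un (foldr (\<lambda>_. Suc) (xs i) 0))"
    by (rule PT_foldr[where e' = enc_un and f = "\<lambda>_ _. Suc" and z = "\<lambda>_. 0", OF assms(1) PT_un_0 assms(2)])
       (intro PT_un_Suc PT_var; simp)
  then show ?thesis unfolding l .
qed

lemma PT_drop:
  assumes "PT I N G (\<lambda>i. enc_un (a i))" "PT I N G (\<lambda>i. enc_list e (xs i))" "poly_bounded I N a"
  shows "PT I N G (\<lambda>i. enc_list e (drop (a i) (xs i)))"
proof -
  have d: "drop k us = (tl ^^ k) us" for k us
    by (induction k) (auto simp: drop_Suc tl_drop[symmetric])
  have "PT I N G (\<lambda>i. enc_list e ((tl ^^ a i) (xs i)))"
    by (rule PT_iterate[where e = "enc_list e" and f = "\<lambda>_. tl", OF assms(1,2,3)], rule PT_tl) (auto intro: PT_var)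
  then show ?thesis unfolding d[symmetric] .
qed

lemma PT_take:
  assumes "PT I N G (\<lambda>i. enc_un (a i))" "PT I N G (\<lambda>i. enc_list e (xs i))"
    "poly_bounded I N a" "poly_bounded I N (\<lambda>i. length (xs i))"
  shows "PT I N G (\<lambda>i. enc_list e (take (a i) (xs i)))"
proof -
  have t: "take k us = rev (drop (length us - k) (rev us))" for k us
    by (cases "k \<le> length us") (auto simp: rev_drop)
  have b: "poly_bounded I N (\<lambda>i. length (xs i) - a i)"
    by (rule poly_bounded_mono[OF assms(4)]) auto
  have c: "poly_bounded I N (\<lambda>i. length (drop (length (xs i) - a i) (rev (xs i))))"
    by (rule poly_bounded_mono[OF assms(4)]) auto
  have "PT I N G (\<lambda>i. enc_list e (rev (drop (length (xs i) - a i) (rev (xs i)))))"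
    by (intro PT_rev PT_drop PT_un_minus PT_length[where e = e] assms b c)
  then show ?thesis unfolding t[symmetric] .
qed

lemma PT_last:
  assumes "PT I N G (\<lambda>i. enc_list e (xs i))" "poly_bounded I N (\<lambda>i. length (xs i))"
    "\<And>i. i \<in> I \<Longrightarrow> xs i \<noteq> []"
  shows "PT I N G (\<lambda>i. e (last (xs i)))"
proof (rule PT_cong)
  show "PT I N G (\<lambda>i. e (hd (rev (xs i))))" using assms by (intro PT_hd PT_rev) auto
qed (use assms(3) in \<open>simp add: hd_rev\<close>)

lemma PT_list_nth:
  assumes "PT I N G (\<lambda>i. enc_un (a i))" "PT I N G (\<lambda>i. enc_list e (xs i))" "poly_bounded I N a"
    "\<And>i. i \<in> I \<Longrightarrow> a i < length (xs i)"
  shows "PT I N G (\<lambda>i. e (xs i ! a i))"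
proof (rule PT_cong)
  show "PT I N G (\<lambda>i. e (hd (drop (a i) (xs i))))" using assms(4) by (intro PT_hd PT_drop assms) fastforce
qed (use assms(4) in \<open>simp add: hd_drop_conv_nth\<close>)

text \<open>An upward search. The test only has to be polynomial for candidates up to the least
  solution, where values such as \<open>2 ^ k\<close> are still bounded.\<close>

lemma PT_Least:
  assumes ex: "\<And>i. i \<in> I \<Longrightarrow> \<exists>k. P i k" and pb: "poly_bounded I N (\<lambda>i. LEAST k. P i k)"
    and test: "PT {p. fst p \<in> I \<and> snd p \<le> (LEAST k. P (fst p) k)} (\<lambda>p. N (fst p))
      ((\<lambda>p. enc_un (snd p)) # map (\<lambda>g p. g (fst p)) G) (\<lambda>p. enc_bool (P (fst p) (snd p)))"
  shows "PT I N G (\<lambda>i. enc_un (LEAST k. P i k))"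
proof -
  let ?D = "{p. fst p \<in> I \<and> snd p \<le> (LEAST k. P (fst p) k)}"
  let ?G = "(\<lambda>p. enc_un (snd p)) # map (\<lambda>g p. g (fst p)) G"
  have "PT ?D (\<lambda>p. N (fst p)) ?G (\<lambda>p. enc_un (LEAST k. P (fst p) k))"
  proof (rule PT_rec1[where b = "\<lambda>p. \<not> P (fst p) (snd p)" and l = "\<lambda>p. (fst p, Suc (snd p))"
        and m = "\<lambda>p. (LEAST k. P (fst p) k) - snd p", OF PT_not[OF test]])
    show "PT {p \<in> ?D. \<not> P (fst p) (snd p)} (\<lambda>p. N (fst p)) ?G (\<lambda>p. g (fst p, Suc (snd p)))" if g: "g \<in> set ?G" for g
    proof -
      consider "g = (\<lambda>p. enc_un (snd p))" | h where "h \<in> set G" "g = (\<lambda>p. h (fst p))"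
        using g by (simp only: list.set set_map insert_iff image_iff) blast
      then show ?thesis
      proof cases
        case 1
        have "PT {p \<in> ?D. \<not> P (fst p) (snd p)} (\<lambda>p. N (fst p)) ?G (\<lambda>p. enc_un (Suc (snd p)))"
          by (intro PT_un_Suc PT_var) simp
        then show ?thesis using 1 by simp
      qed (auto intro!: PT_var)
    qed
    show "PT {p \<in> ?D. \<not> P (fst p) (snd p)} (\<lambda>p. N (fst p))
        ((\<lambda>p. enc_un (LEAST k. P (fst (fst p, Suc (snd p))) k)) # ?G) (\<lambda>p. enc_un (LEAST k. P (fst p) k))"
      by (rule PT_var) simp
    show "PT {p \<in> ?D. \<not> \<not> P (fst p) (snd p)} (\<lambda>p. N (fst p)) ?G (\<lambda>p. enc_un (LEAST k. P (fst p) k))"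
    proof (rule PT_cong[OF _ PT_var[of "\<lambda>p. enc_un (snd p)"]])
      fix p assume p: "p \<in> {p \<in> ?D. \<not> \<not> P (fst p) (snd p)}"
      then have "(LEAST k. P (fst p) k) \<le> snd p" by (intro Least_le) auto
      moreover from p have "snd p \<le> (LEAST k. P (fst p) k)" by simp
      ultimately have "(LEAST k. P (fst p) k) = snd p" by (rule le_antisym)
      then show "enc_un (LEAST k. P (fst p) k) = enc_un (snd p)" by (rule arg_cong)
    qed simp
    show "(fst p, Suc (snd p)) \<in> ?D \<and> N (fst (fst p, Suc (snd p))) \<le> N (fst p) \<and>
        (LEAST k. P (fst (fst p, Suc (snd p))) k) - snd (fst p, Suc (snd p)) < (LEAST k. P (fst p) k) - snd p"
      if "p \<in> ?D" "\<not> P (fst p) (snd p)" for p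
    proof -
      have "P (fst p) (LEAST k. P (fst p) k)" using ex[of "fst p"] that by (auto intro: LeastI_ex)
      then have "snd p \<noteq> (LEAST k. P (fst p) k)" using that by metis
      then show ?thesis using that by auto
    qed
    show "poly_bounded ?D (\<lambda>p. N (fst p)) (\<lambda>p. (LEAST k. P (fst p) k) - snd p)"
    proof (rule poly_bounded_mono)
      show "poly_bounded ?D (\<lambda>p. N (fst p)) (\<lambda>p. LEAST k. P (fst p) k)"
        by (rule poly_bounded_lift[OF pb]) auto
    qed auto
  qed
  then have "PT I N G (\<lambda>i. (\<lambda>p. enc_un (LEAST k. P (fst p) k)) (i, 0::nat))"
  proof (rule PT_call[where \<phi> = "\<lambda>i. (i, 0::nat)"])
    show "PTs I N G (map (\<lambda>g i. g (i, 0::nat)) ?G)"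
      by (rule PTsI) (auto intro: PT_var PT_un_const[of _ _ _ 0])
  qed auto
  then show ?thesis by simp
qed

lemma poly_bounded_le: "(\<And>i. i \<in> I \<Longrightarrow> T i \<le> N i) \<Longrightarrow> poly_bounded I N T"
  by (rule poly_bounded_mono[OF poly_bounded_id]) auto

lemma PT_rec2:
  assumes b: "PT I N G (\<lambda>i. enc_bool (b i))"
    and l: "\<And>g. g \<in> set G \<Longrightarrow> PT {i\<in>I. b i} N G (\<lambda>i. g (l i))"
    and r: "\<And>g. g \<in> set G \<Longrightarrow> PT {i\<in>I. b i} N G (\<lambda>i. g (r i))"
    and step: "PT {i\<in>I. b i} N ((\<lambda>i. v (l i)) # (\<lambda>i. v (r i)) # G) v"
    and base: "PT {i\<in>I. \<not> b i} N G v"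
    and cl: "\<And>i. i \<in> I \<Longrightarrow> b i \<Longrightarrow> l i \<in> I \<and> N (l i) \<le> N i \<and> r i \<in> I \<and> N (r i) \<le> N i \<and> m (l i) + m (r i) < (m i :: nat)"
    and pm: "poly_bounded I N m"
  shows "PT I N G v"
proof (rule PT_rec[where m = "\<lambda>i. Suc (2 * m i)", OF b b l r])
  let ?G = "(\<lambda>i. if b i then v (l i) else Leaf) # (\<lambda>i. if b i then v (r i) else Leaf) # G"
  show "PT I N ?G v"
  proof (rule PT_cong[OF _ PT_if[where b = b and u = v and v = v]])
    show "PT I N ?G (\<lambda>i. enc_bool (b i))" by (rule PT_trans[OF b]) (auto intro: PT_var)
    show "PT {i \<in> I. \<not> b i} N ?G v" by (rule PT_trans[OF base]) (auto intro: PT_var)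
    show "PT {i \<in> I. b i} N ?G v"
    proof (rule PT_trans[OF step])
      have "PT {i \<in> I. b i} N ?G (\<lambda>i. v (l i))" "PT {i \<in> I. b i} N ?G (\<lambda>i. v (r i))"
        by (rule PT_cong[OF _ PT_var[of "\<lambda>i. if b i then v (l i) else Leaf"]]
            PT_cong[OF _ PT_var[of "\<lambda>i. if b i then v (r i) else Leaf"]]; simp)+
      then show "PT {i \<in> I. b i} N ?G g" if "g \<in> set ((\<lambda>i. v (l i)) # (\<lambda>i. v (r i)) # G)" for g
        using that by (auto intro: PT_var)
    qed
  qed auto
  show "poly_bounded I N (\<lambda>i. Suc (2 * m i))"
    by (intro poly_bounded_Suc poly_bounded_mult poly_bounded_const pm)
  show "(if b i then Suc (2 * m (l i)) else 0) + (if b i then Suc (2 * m (r i)) else 0) < Suc (2 * m i)"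
    if "i \<in> I" for i using cl[OF that] by auto
qed (use cl in auto)

text \<open>The language has no equality test, so both expressions are traversed. As in many of the
  recursions that follow, the index starts with a number that stays fixed during the recursion and
  bounds the arguments; it serves as the size parameter, which must not increase.\<close>

lemma PT_sexp_eq:
  assumes "PT I N G x" "PT I N G y" "poly_bounded I N (\<lambda>i. size (x i))"
  shows "PT I N G (\<lambda>i. enc_bool (x i = y i))"
proof -
  let ?S = "{p :: nat \<times> sexp \<times> sexp. size (fst (snd p)) \<le> fst p}"
  let ?G = "[\<lambda>p. fst (snd p), \<lambda>p. snd (snd p)] :: (nat \<times> sexp \<times> sexp \<Rightarrow> sexp) list"
  have "PT ?S fst ?G (\<lambda>p. enc_bool (fst (snd p) = snd (snd p)))" (is "PT _ _ _ ?v")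
  proof (rule PT_rec2[where b = "\<lambda>p. fst (snd p) \<noteq> Leaf \<and> snd (snd p) \<noteq> Leaf"
        and l = "\<lambda>p. (fst p, sexp_hd (fst (snd p)), sexp_hd (snd (snd p)))"
        and r = "\<lambda>p. (fst p, sexp_tl (fst (snd p)), sexp_tl (snd (snd p)))" and m = "\<lambda>p. 2 * size (fst (snd p)) + 1"])
    let ?D = "{p \<in> ?S. fst (snd p) \<noteq> Leaf \<and> snd (snd p) \<noteq> Leaf}"
    let ?D' = "{p \<in> ?S. \<not> (fst (snd p) \<noteq> Leaf \<and> snd (snd p) \<noteq> Leaf)}"
    have nl: "PT D fst H (\<lambda>p. enc_bool (w p \<noteq> Leaf))" if "w \<in> set H" for D H and w :: "nat \<times> sexp \<times> sexp \<Rightarrow> sexp"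
      by (rule PT_enc_bool[OF PT_var[OF that]]) simp
    have x: "PT D fst ?G (\<lambda>p. fst (snd p))" and y: "PT D fst ?G (\<lambda>p. snd (snd p))" for D
      by (rule PT_var; simp)+
    show "PT ?S fst ?G (\<lambda>p. enc_bool (fst (snd p) \<noteq> Leaf \<and> snd (snd p) \<noteq> Leaf))"
      by (intro PT_conj nl) auto
    show "PT ?D fst ?G (\<lambda>p. g (fst p, sexp_hd (fst (snd p)), sexp_hd (snd (snd p))))"
      "PT ?D fst ?G (\<lambda>p. g (fst p, sexp_tl (fst (snd p)), sexp_tl (snd (snd p))))" if "g \<in> set ?G" for g
      using that PT_Hd[OF x] PT_Hd[OF y] PT_Tl[OF x] PT_Tl[OF y] by auto
    let ?H = "(\<lambda>p. ?v (fst p, sexp_hd (fst (snd p)), sexp_hd (snd (snd p)))) #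
      (\<lambda>p. ?v (fst p, sexp_tl (fst (snd p)), sexp_tl (snd (snd p)))) # ?G"
    have "PT ?D fst ?H (\<lambda>p. enc_bool (sexp_hd (fst (snd p)) = sexp_hd (snd (snd p)) \<and> sexp_tl (fst (snd p)) = sexp_tl (snd (snd p))))"
      by (intro PT_conj PT_var) auto
    then show "PT ?D fst ?H ?v"
    proof (rule PT_cong[rotated])
      fix p assume "p \<in> ?D"
      then show "?v p = enc_bool (sexp_hd (fst (snd p)) = sexp_hd (snd (snd p)) \<and> sexp_tl (fst (snd p)) = sexp_tl (snd (snd p)))"
        by (cases "fst (snd p)"; cases "snd (snd p)") auto
    qed
    have "PT ?D' fst ?G (\<lambda>p. enc_bool (\<not> fst (snd p) \<noteq> Leaf \<and> \<not> snd (snd p) \<noteq> Leaf))"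
      by (intro PT_conj PT_not nl) auto
    then show "PT ?D' fst ?G ?v" by (rule PT_cong[rotated]) auto
    show "poly_bounded ?S fst (\<lambda>p. 2 * size (fst (snd p)) + 1)"
      by (intro poly_bounded_add poly_bounded_mult poly_bounded_const poly_bounded_le) auto
    fix p assume "p \<in> ?S" "fst (snd p) \<noteq> Leaf \<and> snd (snd p) \<noteq> Leaf"
    then show "(fst p, sexp_hd (fst (snd p)), sexp_hd (snd (snd p))) \<in> ?S \<and>
        fst (fst p, sexp_hd (fst (snd p)), sexp_hd (snd (snd p))) \<le> fst p \<and>
        (fst p, sexp_tl (fst (snd p)), sexp_tl (snd (snd p))) \<in> ?S \<and>
        fst (fst p, sexp_tl (fst (snd p)), sexp_tl (snd (snd p))) \<le> fst p \<and>
        2 * size (fst (snd (fst p, sexp_hd (fst (snd p)), sexp_hd (snd (snd p))))) + 1 +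
        (2 * size (fst (snd (fst p, sexp_tl (fst (snd p)), sexp_tl (snd (snd p))))) + 1) < 2 * size (fst (snd p)) + 1"
      by (cases "fst (snd p)") auto
  qed
  then have "PT I N G (\<lambda>i. (\<lambda>p. enc_bool (fst (snd p) = snd (snd p))) (size (x i), x i, y i))"
    by (rule PT_call[where \<phi> = "\<lambda>i. (size (x i), x i, y i)"]) (use assms in \<open>auto intro!: PTsI\<close>)
  then show ?thesis by simp
qed

section \<open>Arithmetic of binary numbers\<close>

lemma enc_nat_tl: "sexp_tl (enc_nat x) = enc_nat (x div 2)"
  by (subst enc_nat.simps) (auto simp: enc_nat.simps[of 0])

lemma enc_nat_hd: "sexp_hd (enc_nat x) = enc_bool (odd x)"
  by (subst enc_nat.simps) auto

lemma enc_nat_Leaf [simp]: "enc_nat x = Leaf \<longleftrightarrow> x = 0"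
  by (subst enc_nat.simps) auto

lemma enc_nat_0 [simp]: "enc_nat 0 = Leaf"
  by simp

lemma size_enc_nat: "0 < x \<Longrightarrow> size (enc_nat x) = size (enc_nat (x div 2)) + Suc (of_bool (odd x))"
  by (subst enc_nat.simps) auto

lemma size_enc_nat_half: "0 < x \<Longrightarrow> size (enc_nat (x div 2)) < size (enc_nat x)"
  by (simp add: size_enc_nat)

text \<open>Size is not monotone, because a digit 1 takes two pairs and a digit 0 only one. A
  smaller number has no more digits, hence the factor 2.\<close>

lemma size_enc_nat_mono: "x \<le> y \<Longrightarrow> size (enc_nat x) \<le> 2 * size (enc_nat y)"
proof (induction y arbitrary: x rule: less_induct)
  case (less y)
  show ?case
  proof (cases "x = 0")
    case False
    then have "size (enc_nat (x div 2)) \<le> 2 * size (enc_nat (y div 2))"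
      using less.prems by (intro less.IH div_le_mono) auto
    then show ?thesis using False less.prems by (simp add: size_enc_nat)
  qed simp
qed

lemma size_enc_nat_le: "size (enc_nat x) \<le> 2 * x"
proof (induction x rule: less_induct)
  case (less x)
  show ?case
  proof (cases "x = 0")
    case False
    then show ?thesis using less.IH[of "x div 2"] by (cases "odd x") (auto simp: size_enc_nat elim!: evenE oddE)
  qed simp
qed

lemma PT_nat_is_0: "PT I N G (\<lambda>i. enc_nat (x i)) \<Longrightarrow> PT I N G (\<lambda>i. enc_bool (x i = 0))"
  using PT_not[OF PT_enc_bool[of I N G "\<lambda>i. enc_nat (x i)" "\<lambda>i. x i \<noteq> 0"]] by simp

lemma PT_nat_half: "PT I N G (\<lambda>i. enc_nat (x i)) \<Longrightarrow> PT I N G (\<lambda>i. enc_nat (x i div 2))"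
  by (drule PT_Tl) (simp add: enc_nat_tl)

lemma PT_nat_odd: "PT I N G (\<lambda>i. enc_nat (x i)) \<Longrightarrow> PT I N G (\<lambda>i. enc_bool (odd (x i)))"
  by (drule PT_Hd) (simp add: enc_nat_hd)

lemma PT_nat_Suc:
  assumes "PT I N G (\<lambda>i. enc_nat (x i))" "poly_bounded I N (\<lambda>i. size (enc_nat (x i)))"
  shows "PT I N G (\<lambda>i. enc_nat (Suc (x i)))"
proof -
  let ?S = "{p :: nat \<times> nat. size (enc_nat (snd p)) \<le> fst p}"
  let ?G = "[\<lambda>p. enc_nat (snd p)] :: (nat \<times> nat \<Rightarrow> sexp) list"
  have "PT ?S fst ?G (\<lambda>p. enc_nat (Suc (snd p)))" (is "PT _ _ _ ?v")
  proof (rule PT_rec1[where b = "\<lambda>p. odd (snd p)" and l = "\<lambda>p. (fst p, snd p div 2)" and m = "\<lambda>p. size (enc_nat (snd p))"])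
    have x: "PT D fst ?G (\<lambda>p. enc_nat (snd p))" for D by (rule PT_var) simp
    show "PT ?S fst ?G (\<lambda>p. enc_bool (odd (snd p)))" by (rule PT_nat_odd[OF x])
    show "PT {p \<in> ?S. odd (snd p)} fst ?G (\<lambda>p. g (fst p, snd p div 2))" if "g \<in> set ?G" for g
      using that PT_nat_half[OF x] by auto
    show "PT {p \<in> ?S. odd (snd p)} fst ((\<lambda>p. ?v (fst p, snd p div 2)) # ?G) ?v"
      by (rule PT_cong[OF _ PT_Dot[OF PT_Leaf PT_var[of "\<lambda>p. ?v (fst p, snd p div 2)"]]])
         (auto simp: enc_nat.simps[of "Suc _"] elim!: oddE)
    show "PT {p \<in> ?S. \<not> odd (snd p)} fst ?G ?v"
      by (rule PT_cong[OF _ PT_Dot[OF PT_const[of _ _ _ "enc_bool True"] PT_nat_half[OF PT_var]]])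
         (auto simp: enc_nat.simps[of "Suc _"])
    show "poly_bounded ?S fst (\<lambda>p. size (enc_nat (snd p)))" by (rule poly_bounded_le) auto
    fix p assume "p \<in> ?S" "odd (snd p)"
    then show "(fst p, snd p div 2) \<in> ?S \<and> fst (fst p, snd p div 2) \<le> fst p \<and>
      size (enc_nat (snd (fst p, snd p div 2))) < size (enc_nat (snd p))"
      using size_enc_nat_half[of "snd p"] odd_pos[of "snd p"] by auto
  qed
  then have "PT I N G (\<lambda>i. ?v (size (enc_nat (x i)), x i))"
    by (rule PT_call[where \<phi> = "\<lambda>i. (size (enc_nat (x i)), x i)"]) (use assms in \<open>auto intro!: PTsI\<close>)
  then show ?thesis by simp
qed

text \<open>Digits arrive least significant first. The Boolean in the index holds the comparison of
  the digits read so far, and any later difference overrides it.\<close>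

lemma PT_nat_le:
  assumes "PT I N G (\<lambda>i. enc_nat (x i))" "PT I N G (\<lambda>i. enc_nat (y i))"
    "poly_bounded I N (\<lambda>i. size (enc_nat (x i)))" "poly_bounded I N (\<lambda>i. size (enc_nat (y i)))"
  shows "PT I N G (\<lambda>i. enc_bool (x i \<le> y i))"
proof -
  let ?S = "{p :: nat \<times> bool \<times> nat \<times> nat. size (enc_nat (fst (snd (snd p)))) + size (enc_nat (snd (snd (snd p)))) \<le> fst p}"
  let ?G = "[\<lambda>p. enc_bool (fst (snd p)), \<lambda>p. enc_nat (fst (snd (snd p))), \<lambda>p. enc_nat (snd (snd (snd p)))]
    :: (nat \<times> bool \<times> nat \<times> nat \<Rightarrow> sexp) list"
  let ?b = "\<lambda>p. \<not> (fst (snd (snd p)) = 0 \<and> snd (snd (snd p)) = (0::nat))"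
  let ?c = "\<lambda>p. if odd (fst (snd (snd p))) = odd (snd (snd (snd p))) then fst (snd p) else odd (snd (snd (snd p)))"
  let ?l = "\<lambda>p. (fst p, ?c p, fst (snd (snd p)) div 2, snd (snd (snd p)) div 2)"
  have "PT ?S fst ?G (\<lambda>p. enc_bool (fst (snd (snd p)) < snd (snd (snd p)) \<or> fst (snd (snd p)) = snd (snd (snd p)) \<and> fst (snd p)))"
    (is "PT _ _ _ ?v")
  proof (rule PT_rec1[where b = ?b and l = ?l and m = "\<lambda>p. size (enc_nat (fst (snd (snd p)))) + size (enc_nat (snd (snd (snd p))))"])
    have x: "PT D fst (H @ ?G) (\<lambda>p. enc_nat (fst (snd (snd p))))" and y: "PT D fst (H @ ?G) (\<lambda>p. enc_nat (snd (snd (snd p))))"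
      and c: "PT D fst (H @ ?G) (\<lambda>p. enc_bool (fst (snd p)))" for D H by (rule PT_var; simp)+
    note x = x[of _ "[]", unfolded append_Nil] and y = y[of _ "[]", unfolded append_Nil] and c = c[of _ "[]", unfolded append_Nil]
    show "PT ?S fst ?G (\<lambda>p. enc_bool (?b p))" by (intro PT_not PT_conj PT_nat_is_0 x y)
    have "PT D fst ?G (\<lambda>p. enc_bool (?c p))" for D
      unfolding if_distrib[of enc_bool] by (intro PT_if PT_eq_bool PT_nat_odd x y c)
    then show "PT {p \<in> ?S. ?b p} fst ?G (\<lambda>p. g (?l p))" if "g \<in> set ?G" for g
      using that PT_nat_half[OF x] PT_nat_half[OF y] by auto
    have lt: "a < d \<or> a = d \<and> e \<longleftrightarrow> a div 2 < d div 2 \<or> a div 2 = d div 2 \<and> (if odd a = odd d then e else odd d)" for a d :: nat and e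
      by (cases "odd a"; cases "odd d"; cases e) (auto elim!: evenE oddE, presburger+)
    show "PT {p \<in> ?S. ?b p} fst ((\<lambda>p. ?v (?l p)) # ?G) ?v"
    proof (rule PT_cong[OF _ PT_var[of "\<lambda>p. ?v (?l p)"]])
      fix p
      show "?v p = ?v (?l p)" unfolding fst_conv snd_conv by (rule arg_cong[OF lt])
    qed simp
    show "PT {p \<in> ?S. \<not> ?b p} fst ?G ?v"
      by (rule PT_cong[OF _ c]) simp
    show "poly_bounded ?S fst (\<lambda>p. size (enc_nat (fst (snd (snd p)))) + size (enc_nat (snd (snd (snd p)))))"
      by (rule poly_bounded_le) auto
    fix p assume p: "p \<in> ?S" "?b p"
    have h: "size (enc_nat (z div 2)) \<le> size (enc_nat z)" for z
      using size_enc_nat_half[of z] by (cases "z = 0") auto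
    have "size (enc_nat (fst (snd (snd p)) div 2)) + size (enc_nat (snd (snd (snd p)) div 2)) <
        size (enc_nat (fst (snd (snd p)))) + size (enc_nat (snd (snd (snd p))))"
      using p(2) size_enc_nat_half[of "fst (snd (snd p))"] size_enc_nat_half[of "snd (snd (snd p))"]
        h[of "fst (snd (snd p))"] h[of "snd (snd (snd p))"]
      by (cases "fst (snd (snd p)) = 0"; cases "snd (snd (snd p)) = 0") auto
    then show "?l p \<in> ?S \<and> fst (?l p) \<le> fst p \<and>
      size (enc_nat (fst (snd (snd (?l p))))) + size (enc_nat (snd (snd (snd (?l p))))) <
        size (enc_nat (fst (snd (snd p)))) + size (enc_nat (snd (snd (snd p))))"
      using p(1) by auto
  qed
  then have "PT I N G (\<lambda>i. ?v (size (enc_nat (x i)) + size (enc_nat (y i)), True, x i, y i))"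
    by (rule PT_call[where \<phi> = "\<lambda>i. (size (enc_nat (x i)) + size (enc_nat (y i)), True, x i, y i)"])
       (use assms PT_const[of _ _ _ "enc_bool True"] in \<open>auto intro!: PTsI poly_bounded_add\<close>)
  then show ?thesis by (simp add: order_le_less)
qed

lemma PT_nat_max:
  assumes "PT I N G (\<lambda>i. enc_nat (x i))" "PT I N G (\<lambda>i. enc_nat (y i))"
    "poly_bounded I N (\<lambda>i. size (enc_nat (x i)))" "poly_bounded I N (\<lambda>i. size (enc_nat (y i)))"
  shows "PT I N G (\<lambda>i. enc_nat (max (x i) (y i)))"
  by (rule PT_cong[OF _ PT_if[OF PT_nat_le[OF assms] PT_subset[OF assms(2)] PT_subset[OF assms(1)]]]) auto

lemma PT_nat_eq:
  assumes "PT I N G (\<lambda>i. enc_nat (x i))" "PT I N G (\<lambda>i. enc_nat (y i))"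
    "poly_bounded I N (\<lambda>i. size (enc_nat (x i)))"
  shows "PT I N G (\<lambda>i. enc_bool (x i = y i))"
  using PT_sexp_eq[OF assms] by simp

section \<open>Polynomial time for terms and trees\<close>

text \<open>The head is \<open>Leaf\<close> exactly for inputs, so that one test separates the
  constructors. Times are unary for use as exponents, while names keep the encoding that the output
  needs.\<close>

fun enc_trm :: "adder_input trm \<Rightarrow> sexp" where
  "enc_trm (In k x) = Dot Leaf (Dot (enc_un k) (enc_adder_input x))"
| "enc_trm (Gt f s t) = Dot (Dot (enc_bool (f = OR)) Leaf) (Dot (enc_trm s) (enc_trm t))"

fun left_trm :: "'x trm \<Rightarrow> 'x trm" where
  "left_trm (Gt f s t) = s"
| "left_trm (In k x) = In k x"

fun right_trm :: "'x trm \<Rightarrow> 'x trm" where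
  "right_trm (Gt f s t) = t"
| "right_trm (In k x) = In k x"

lemma PT_is_leaf:
  assumes "PT I N G (\<lambda>i. enc_trm (t i))"
  shows "PT I N G (\<lambda>i. enc_bool (is_leaf (t i)))"
proof -
  have "is_leaf u \<longleftrightarrow> \<not> sexp_hd (enc_trm u) \<noteq> Leaf" for u by (cases u) auto
  then show ?thesis using PT_not[OF PT_enc_bool[OF PT_Hd[OF assms], of "\<lambda>i. \<not> is_leaf (t i)"]] by simp
qed

lemma PT_left_right:
  assumes "PT I N G (\<lambda>i. enc_trm (t i))" "\<And>i. i \<in> I \<Longrightarrow> \<not> is_leaf (t i)"
  shows "PT I N G (\<lambda>i. enc_trm (left_trm (t i)))" "PT I N G (\<lambda>i. enc_trm (right_trm (t i)))"
proof -
  have *: "enc_trm (left_trm u) = sexp_hd (sexp_tl (enc_trm u))" "enc_trm (right_trm u) = sexp_tl (sexp_tl (enc_trm u))"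
    if "\<not> is_leaf u" for u using that by (cases u; simp)+
  show "PT I N G (\<lambda>i. enc_trm (left_trm (t i)))" "PT I N G (\<lambda>i. enc_trm (right_trm (t i)))"
    by (rule PT_cong[OF _ PT_Hd[OF PT_Tl[OF assms(1)]]] PT_cong[OF _ PT_Tl[OF PT_Tl[OF assms(1)]]]; simp add: * assms(2))+
qed

lemma PT_Gt:
  assumes "PT I N G (\<lambda>i. enc_bool (f i = OR))" "PT I N G (\<lambda>i. enc_trm (s i))" "PT I N G (\<lambda>i. enc_trm (t i))"
  shows "PT I N G (\<lambda>i. enc_trm (Gt (f i) (s i) (t i)))"
  unfolding enc_trm.simps by (intro PT_Dot PT_Leaf assms)

lemma PT_op: "PT I N G (\<lambda>i. enc_bool (f = OR))"
  by (rule PT_const)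

lemma PT_dual: "PT I N G (\<lambda>i. enc_bool (f i = OR)) \<Longrightarrow> PT I N G (\<lambda>i. enc_bool (dual (f i) = OR))"
proof -
  have "dual g = OR \<longleftrightarrow> \<not> g = OR" for g by (cases g) auto
  then show "PT I N G (\<lambda>i. enc_bool (f i = OR)) \<Longrightarrow> ?thesis" using PT_not by simp
qed

text \<open>\<open>subterms\<close> lists occurrences, so this is the size of the formula as a tree.
  Bounds on \<open>2 ^ arr\<close> thus control the running time of all traversals.\<close>

lemma length_subterms_less: "length (subterms t) < 2 ^ arr t"
proof (induction t)
  case (Gt f s t)
  have "(2::nat) ^ arr s \<le> 2 ^ max (arr s) (arr t)" "(2::nat) ^ arr t \<le> 2 ^ max (arr s) (arr t)"
    by (intro power_increasing; simp)+
  then show ?case using Gt.IH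
    by (simp only: subterms.simps arr.simps power_Suc list.size length_append)
qed simp

lemma PT_arr:
  assumes "PT I N G (\<lambda>i. enc_trm (t i))" "poly_bounded I N (\<lambda>i. 2 ^ arr (t i))"
  shows "PT I N G (\<lambda>i. enc_un (arr (t i)))"
proof -
  let ?S = "{p :: nat \<times> adder_input trm. 2 ^ arr (snd p) \<le> fst p}"
  let ?G = "[\<lambda>p. enc_trm (snd p)] :: (nat \<times> adder_input trm \<Rightarrow> sexp) list"
  let ?l = "\<lambda>p. (fst p, left_trm (snd p))" and ?r = "\<lambda>p. (fst p, right_trm (snd p))"
  have "PT ?S fst ?G (\<lambda>p. enc_un (arr (snd p)))" (is "PT _ _ _ ?v")
  proof (rule PT_rec2[where b = "\<lambda>p. \<not> is_leaf (snd p)" and l = ?l and r = ?r and m = "\<lambda>p. 2 * length (subterms (snd p)) + 1"])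
    have t: "PT D fst ?G (\<lambda>p. enc_trm (snd p))" for D by (rule PT_var) simp
    show "PT ?S fst ?G (\<lambda>p. enc_bool (\<not> is_leaf (snd p)))" by (rule PT_not[OF PT_is_leaf[OF t]])
    have lr: "PT {p \<in> ?S. \<not> is_leaf (snd p)} fst ?G (\<lambda>p. enc_trm (left_trm (snd p)))"
      "PT {p \<in> ?S. \<not> is_leaf (snd p)} fst ?G (\<lambda>p. enc_trm (right_trm (snd p)))"
      by (rule PT_left_right[OF t]; simp)+
    then show "PT {p \<in> ?S. \<not> is_leaf (snd p)} fst ?G (\<lambda>p. g (?l p))" "PT {p \<in> ?S. \<not> is_leaf (snd p)} fst ?G (\<lambda>p. g (?r p))" if "g \<in> set ?G" for g
      using that by auto
    have *: "arr u = Suc (max (arr (left_trm u)) (arr (right_trm u)))" "length (subterms u) = Suc (length (subterms (left_trm u)) + length (subterms (right_trm u)))"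
      if "\<not> is_leaf u" for u :: "adder_input trm"
      using that by (cases u; simp)+
    show "PT {p \<in> ?S. \<not> is_leaf (snd p)} fst ((\<lambda>p. ?v (?l p)) # (\<lambda>p. ?v (?r p)) # ?G) ?v"
    proof (rule PT_cong[of _ _ "\<lambda>p. enc_un (Suc (max (arr (left_trm (snd p))) (arr (right_trm (snd p)))))"])
      have "poly_bounded {p \<in> ?S. \<not> is_leaf (snd p)} fst (\<lambda>p. 2 ^ arr (snd p))" by (rule poly_bounded_le) auto
      then have "poly_bounded {p \<in> ?S. \<not> is_leaf (snd p)} fst (\<lambda>p. arr (right_trm (snd p)))"
      proof (rule poly_bounded_mono)
        fix p assume "p \<in> {p \<in> ?S. \<not> is_leaf (snd p)}"
        then have "arr (right_trm (snd p)) \<le> arr (snd p)" using *(1)[of "snd p"] by simp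
        also have "\<dots> \<le> 2 ^ arr (snd p)" by (simp add: less_imp_le)
        finally show "arr (right_trm (snd p)) \<le> 2 ^ arr (snd p)" .
      qed
      then show "PT {p \<in> ?S. \<not> is_leaf (snd p)} fst ((\<lambda>p. ?v (?l p)) # (\<lambda>p. ?v (?r p)) # ?G)
          (\<lambda>p. enc_un (Suc (max (arr (left_trm (snd p))) (arr (right_trm (snd p))))))"
        by (intro PT_un_Suc PT_un_max PT_var) auto
    qed (use * in simp)
    show "PT {p \<in> ?S. \<not> \<not> is_leaf (snd p)} fst ?G ?v"
    proof (rule PT_cong[OF _ PT_Hd[OF PT_Tl[OF t]]])
      fix p assume "p \<in> {p \<in> ?S. \<not> \<not> is_leaf (snd p)}"
      then show "?v p = sexp_hd (sexp_tl (enc_trm (snd p)))" by (cases "snd p") auto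
    qed
    show "poly_bounded ?S fst (\<lambda>p. 2 * length (subterms (snd p)) + 1)"
    proof (intro poly_bounded_add poly_bounded_mult poly_bounded_const poly_bounded_le)
      fix p assume "p \<in> ?S"
      then show "length (subterms (snd p)) \<le> fst p" using length_subterms_less[of "snd p"] by simp
    qed
    fix p assume p: "p \<in> ?S" "\<not> is_leaf (snd p)"
    have "(2::nat) ^ arr (left_trm (snd p)) \<le> 2 ^ arr (snd p)" "(2::nat) ^ arr (right_trm (snd p)) \<le> 2 ^ arr (snd p)"
      by (intro power_increasing; simp add: *(1)[OF p(2)])+
    then have "2 ^ arr (left_trm (snd p)) \<le> fst p" "2 ^ arr (right_trm (snd p)) \<le> fst p"
      using p(1) by (auto simp del: power_increasing_iff)
    then show "?l p \<in> ?S \<and> fst (?l p) \<le> fst p \<and> ?r p \<in> ?S \<and> fst (?r p) \<le> fst p \<and>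
        2 * length (subterms (snd (?l p))) + 1 + (2 * length (subterms (snd (?r p))) + 1) < 2 * length (subterms (snd p)) + 1"
      using p(1) *(2)[OF p(2)] by auto
  qed
  then have "PT I N G (\<lambda>i. ?v (2 ^ arr (t i), t i))"
    by (rule PT_call[where \<phi> = "\<lambda>i. (2 ^ arr (t i), t i)"]) (use assms in \<open>auto intro!: PTsI\<close>)
  then show ?thesis by simp
qed

lemma PT_subterms:
  assumes "PT I N G (\<lambda>i. enc_trm (t i))" "poly_bounded I N (\<lambda>i. length (subterms (t i)))"
  shows "PT I N G (\<lambda>i. enc_list enc_trm (subterms (t i)))"
proof -
  let ?S = "{p :: nat \<times> adder_input trm. length (subterms (snd p)) \<le> fst p}"
  let ?G = "[\<lambda>p. enc_trm (snd p)] :: (nat \<times> adder_input trm \<Rightarrow> sexp) list"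
  let ?l = "\<lambda>p. (fst p, left_trm (snd p))" and ?r = "\<lambda>p. (fst p, right_trm (snd p))"
  have **: "length (subterms u) = Suc (length (subterms (left_trm u)) + length (subterms (right_trm u)))"
    if "\<not> is_leaf u" for u :: "adder_input trm"
      using that by (cases u; simp)
  have "PT ?S fst ?G (\<lambda>p. enc_list enc_trm (subterms (snd p)))" (is "PT _ _ _ ?v")
  proof (rule PT_rec2[where b = "\<lambda>p. \<not> is_leaf (snd p)" and l = ?l and r = ?r and m = "\<lambda>p. 2 * length (subterms (snd p)) + 1"])
    have t: "PT D fst ?G (\<lambda>p. enc_trm (snd p))" for D by (rule PT_var) simp
    show "PT ?S fst ?G (\<lambda>p. enc_bool (\<not> is_leaf (snd p)))" by (rule PT_not[OF PT_is_leaf[OF t]])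
    have lr: "PT {p \<in> ?S. \<not> is_leaf (snd p)} fst ?G (\<lambda>p. enc_trm (left_trm (snd p)))"
      "PT {p \<in> ?S. \<not> is_leaf (snd p)} fst ?G (\<lambda>p. enc_trm (right_trm (snd p)))"
      by (rule PT_left_right[OF t]; simp)+
    then show "PT {p \<in> ?S. \<not> is_leaf (snd p)} fst ?G (\<lambda>p. g (?l p))" "PT {p \<in> ?S. \<not> is_leaf (snd p)} fst ?G (\<lambda>p. g (?r p))" if "g \<in> set ?G" for g
      using that by auto
    have *: "subterms u = u # subterms (left_trm u) @ subterms (right_trm u)" if "\<not> is_leaf u" for u :: "adder_input trm"
      using that by (cases u; simp)
    show "PT {p \<in> ?S. \<not> is_leaf (snd p)} fst ((\<lambda>p. ?v (?l p)) # (\<lambda>p. ?v (?r p)) # ?G) ?v"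
    proof (rule PT_cong[of _ _ "\<lambda>p. enc_list enc_trm (snd p # subterms (left_trm (snd p)) @ subterms (right_trm (snd p)))"])
      have "poly_bounded {p \<in> ?S. \<not> is_leaf (snd p)} fst (\<lambda>p. length (subterms (left_trm (snd p))))"
        by (rule poly_bounded_le) (auto simp: **)
      then show "PT {p \<in> ?S. \<not> is_leaf (snd p)} fst ((\<lambda>p. ?v (?l p)) # (\<lambda>p. ?v (?r p)) # ?G)
          (\<lambda>p. enc_list enc_trm (snd p # subterms (left_trm (snd p)) @ subterms (right_trm (snd p))))"
        by (intro PT_Cons PT_append PT_var) auto
      show "?v p = enc_list enc_trm (snd p # subterms (left_trm (snd p)) @ subterms (right_trm (snd p)))"
        if "p \<in> {p \<in> ?S. \<not> is_leaf (snd p)}" for p using that by (subst *) auto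
    qed
    show "PT {p \<in> ?S. \<not> \<not> is_leaf (snd p)} fst ?G ?v"
    proof (rule PT_cong[OF _ PT_Leaf])
      fix p assume "p \<in> {p \<in> ?S. \<not> \<not> is_leaf (snd p)}"
      then show "?v p = Leaf" by (cases "snd p") auto
    qed
    show "poly_bounded ?S fst (\<lambda>p. 2 * length (subterms (snd p)) + 1)"
      by (intro poly_bounded_add poly_bounded_mult poly_bounded_const poly_bounded_le) auto
  qed (auto simp: **)
  then have "PT I N G (\<lambda>i. ?v (length (subterms (t i)), t i))"
    by (rule PT_call[where \<phi> = "\<lambda>i. (length (subterms (t i)), t i)"]) (use assms in \<open>auto intro!: PTsI\<close>)
  then show ?thesis by simp
qed

lemma length_le_weight: "length xs \<le> weight xs"
proof (induction xs)
  case (Cons x xs)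
  have "(1::nat) \<le> 2 ^ fst x" by simp
  then show ?case using Cons.IH weight_simps(2)[of x xs] by (simp only: list.size)
qed simp

lemma PT_weight:
  assumes "PT I N G (\<lambda>i. enc_list (enc_pair enc_un e) (xs i))" "poly_bounded I N (\<lambda>i. weight (xs i))"
  shows "PT I N G (\<lambda>i. enc_un (weight (xs i)))"
proof -
  have w: "weight us = foldr (\<lambda>x s. 2 ^ fst x + s) us 0" for us :: "(nat \<times> 'b) list"
    by (induction us) auto
  have "PT I N G (\<lambda>i. enc_un (foldr (\<lambda>x s. 2 ^ fst x + s) (xs i) 0))"
  proof (rule PT_foldr[where e = "enc_pair enc_un e" and e' = enc_un and z = "\<lambda>_. 0" and f = "\<lambda>_ x s. 2 ^ fst x + s", OF assms(1) PT_un_0])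
    show "poly_bounded I N (\<lambda>i. length (xs i))" by (rule poly_bounded_mono[OF assms(2) _ length_le_weight])
    let ?D = "{p. fst p \<in> I \<and> (\<exists>us. xs (fst p) = us @ fst (snd p) # snd (snd p))}"
    let ?H = "(\<lambda>p. enc_pair enc_un e (fst (snd p))) # (\<lambda>p. enc_un (foldr (\<lambda>x s. 2 ^ fst x + s) (snd (snd p)) 0)) # map (\<lambda>g p. g (fst p)) G"
    have "poly_bounded ?D (\<lambda>p. N (fst p)) (\<lambda>p. weight (xs (fst p)))" by (rule poly_bounded_fst[OF assms(2)]) auto
    then have b: "poly_bounded ?D (\<lambda>p. N (fst p)) (\<lambda>p. 2 ^ fst (fst (snd p)))"
      by (rule poly_bounded_mono) auto
    have "PT ?D (\<lambda>p. N (fst p)) ?H (\<lambda>p. enc_un (fst (fst (snd p))))"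
      by (rule PT_fst[where ?e2.0 = e], rule PT_var) simp
    then show "PT ?D (\<lambda>p. N (fst p)) ?H (\<lambda>p. enc_un (2 ^ fst (fst (snd p)) + foldr (\<lambda>x s. 2 ^ fst x + s) (snd (snd p)) 0))"
      by (intro PT_un_add PT_un_power2 b PT_var[of "\<lambda>p. enc_un (foldr (\<lambda>x s. 2 ^ fst x + s) (snd (snd p)) 0)"]) auto
  qed
  then show ?thesis unfolding w .
qed

abbreviation enc_wire :: "adder_input wire \<Rightarrow> sexp" where
  "enc_wire \<equiv> enc_pair enc_un enc_trm"

lemma PT_insort:
  assumes "PT I N G (\<lambda>i. enc_wire (w i))" "PT I N G (\<lambda>i. enc_list enc_wire (ws i))"
    "poly_bounded I N B" "\<And>i. i \<in> I \<Longrightarrow> length (ws i) \<le> B i \<and> (\<forall>v\<in>set (ws i). fst v \<le> B i)"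
  shows "PT I N G (\<lambda>i. enc_list enc_wire (insort_key fst (w i) (ws i)))"
proof -
  let ?S = "{p :: nat \<times> adder_input wire \<times> adder_input wire list. length (snd (snd p)) \<le> fst p \<and> (\<forall>v\<in>set (snd (snd p)). fst v \<le> fst p)}"
  let ?G = "[\<lambda>p. enc_wire (fst (snd p)), \<lambda>p. enc_list enc_wire (snd (snd p))] :: (nat \<times> adder_input wire \<times> adder_input wire list \<Rightarrow> sexp) list"
  let ?l = "\<lambda>p. (fst p, fst (snd p), tl (snd (snd p)))"
  let ?b = "\<lambda>p. snd (snd p) \<noteq> [] \<and> \<not> fst (fst (snd p)) \<le> fst (hd (snd (snd p)))"
  have "PT ?S fst ?G (\<lambda>p. enc_list enc_wire (insort_key fst (fst (snd p)) (snd (snd p))))" (is "PT _ _ _ ?v")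
  proof (rule PT_rec1[where b = ?b and l = ?l and m = "\<lambda>p. length (snd (snd p))"])
    have w: "PT D fst (H @ ?G) (\<lambda>p. enc_wire (fst (snd p)))" and ws: "PT D fst (H @ ?G) (\<lambda>p. enc_list enc_wire (snd (snd p)))" for D H
      by (rule PT_var; simp)+
    note w0 = w[of _ "[]", unfolded append_Nil] and ws0 = ws[of _ "[]", unfolded append_Nil]
    have hd: "PT {p \<in> ?S. snd (snd p) \<noteq> []} fst ?G (\<lambda>p. enc_wire (hd (snd (snd p))))"
      by (rule PT_hd[OF ws0]) auto
    have b: "poly_bounded {p \<in> ?S. snd (snd p) \<noteq> []} fst (\<lambda>p. fst (hd (snd (snd p))))"
      by (rule poly_bounded_le) auto
    show "PT ?S fst ?G (\<lambda>p. enc_bool (?b p))"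
      by (intro PT_conj PT_not PT_null[OF ws0] PT_un_le b PT_fst[OF w0] PT_fst[OF hd])
    show "PT {p \<in> ?S. ?b p} fst ?G (\<lambda>p. g (?l p))" if "g \<in> set ?G" for g
      using that w0 PT_tl[OF ws0] by auto
    let ?H = "(\<lambda>p. ?v (?l p)) # ?G"
    have "PT {p \<in> ?S. ?b p} fst ?H (\<lambda>p. enc_wire (hd (snd (snd p))))"
      by (rule PT_hd[OF ws[of _ "[\<lambda>p. ?v (?l p)]", unfolded append.simps]]) auto
    then have "PT {p \<in> ?S. ?b p} fst ?H (\<lambda>p. enc_list enc_wire (hd (snd (snd p)) # insort_key fst (fst (snd p)) (tl (snd (snd p)))))"
      by (rule PT_Cons) (rule PT_var, simp)
    then show "PT {p \<in> ?S. ?b p} fst ?H ?v"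
    proof (rule PT_cong[rotated])
      fix p assume "p \<in> {p \<in> ?S. ?b p}"
      then show "?v p = enc_list enc_wire (hd (snd (snd p)) # insort_key fst (fst (snd p)) (tl (snd (snd p))))"
        by (cases "snd (snd p)") auto
    qed
    have "PT {p \<in> ?S. \<not> ?b p} fst ?G (\<lambda>p. enc_list enc_wire (fst (snd p) # snd (snd p)))"
      by (intro PT_Cons w0 ws0)
    then show "PT {p \<in> ?S. \<not> ?b p} fst ?G ?v"
    proof (rule PT_cong[rotated])
      fix p assume "p \<in> {p \<in> ?S. \<not> ?b p}"
      then show "?v p = enc_list enc_wire (fst (snd p) # snd (snd p))"
        by (cases "snd (snd p)") auto
    qed
    show "poly_bounded ?S fst (\<lambda>p. length (snd (snd p)))" by (rule poly_bounded_le) auto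
    fix p assume p: "p \<in> ?S" "?b p"
    then obtain v vs where "snd (snd p) = v # vs" by (cases "snd (snd p)") auto
    then show "?l p \<in> ?S \<and> fst (?l p) \<le> fst p \<and> length (snd (snd (?l p))) < length (snd (snd p))"
      using p by auto
  qed
  then have "PT I N G (\<lambda>i. ?v (B i, w i, ws i))"
    by (rule PT_call[where \<phi> = "\<lambda>i. (B i, w i, ws i)"]) (use assms in \<open>auto intro!: PTsI\<close>)
  then show ?thesis by simp
qed

lemma PT_sort:
  assumes "PT I N G (\<lambda>i. enc_list enc_wire (ws i))"
    "poly_bounded I N B" "\<And>i. i \<in> I \<Longrightarrow> length (ws i) \<le> B i \<and> (\<forall>v\<in>set (ws i). fst v \<le> B i)"
  shows "PT I N G (\<lambda>i. enc_list enc_wire (sort_key fst (ws i)))"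
  unfolding sort_key_def
proof (rule PT_foldr[where e = enc_wire and e' = "enc_list enc_wire" and z = "\<lambda>_. []" and f = "\<lambda>_. insort_key fst", OF assms(1) PT_Nil])
  show "poly_bounded I N (\<lambda>i. length (ws i))" by (rule poly_bounded_mono[OF assms(2)]) (use assms(3) in auto)
  let ?D = "{p. fst p \<in> I \<and> (\<exists>us. ws (fst p) = us @ fst (snd p) # snd (snd p))}"
  let ?H = "(\<lambda>p. enc_wire (fst (snd p))) # (\<lambda>p. enc_list enc_wire (foldr (insort_key fst) (snd (snd p)) [])) # map (\<lambda>g p. g (fst p)) G"
  show "PT ?D (\<lambda>p. N (fst p)) ?H (\<lambda>p. enc_list enc_wire (insort_key fst (fst (snd p)) (foldr (insort_key fst) (snd (snd p)) [])))"
  proof (rule PT_insort[where B = "\<lambda>p. B (fst p)"])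
    show "poly_bounded ?D (\<lambda>p. N (fst p)) (\<lambda>p. B (fst p))" by (rule poly_bounded_fst[OF assms(2)]) auto
    fix p assume "p \<in> ?D"
    then show "length (foldr (insort_key fst) (snd (snd p)) []) \<le> B (fst p) \<and> (\<forall>v\<in>set (foldr (insort_key fst) (snd (snd p)) []). fst v \<le> B (fst p))"
      using assms(3)[of "fst p"] unfolding sort_key_def[symmetric] by auto
  qed (auto intro: PT_var)
qed

lemma PT_merge:
  assumes "PT I N G (\<lambda>i. enc_bool (f i = OR))" "PT I N G (\<lambda>i. enc_wire (v i))" "PT I N G (\<lambda>i. enc_wire (w i))"
    "poly_bounded I N (\<lambda>i. fst (w i))"
  shows "PT I N G (\<lambda>i. enc_wire (merge (f i) (v i) (w i)))"
  unfolding merge_def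
  by (intro PT_pair PT_Gt PT_un_Suc PT_un_max PT_fst[OF assms(2)] PT_fst[OF assms(3)] PT_snd[OF assms(2)] PT_snd[OF assms(3)] assms)

text \<open>A merge raises the largest relevant exponent by at most 1 and shortens the list by 1.
  Exponent plus length is therefore the quantity that stays bounded.\<close>

lemma PT_huffman:
  assumes "PT I N G (\<lambda>i. enc_bool (f i = OR))" "PT I N G (\<lambda>i. enc_list enc_wire (ws i))"
    "poly_bounded I N B" "\<And>i. i \<in> I \<Longrightarrow> ws i \<noteq> [] \<and> (\<forall>v\<in>set (ws i). fst v + length (ws i) \<le> B i)"
  shows "PT I N G (\<lambda>i. enc_wire (huffman (f i) (ws i)))"
proof -
  let ?S = "{p :: nat \<times> gate_op \<times> adder_input wire list. snd (snd p) \<noteq> [] \<and> (\<forall>v\<in>set (snd (snd p)). fst v + length (snd (snd p)) \<le> fst p)}"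
  let ?G = "[\<lambda>p. enc_bool (fst (snd p) = OR), \<lambda>p. enc_list enc_wire (snd (snd p))] :: (nat \<times> gate_op \<times> adder_input wire list \<Rightarrow> sexp) list"
  let ?c = "\<lambda>p. insort_key fst (merge (fst (snd p)) (hd (snd (snd p))) (hd (tl (snd (snd p))))) (tl (tl (snd (snd p))))"
  let ?l = "\<lambda>p. (fst p, fst (snd p), ?c p)"
  let ?b = "\<lambda>p. tl (snd (snd p)) \<noteq> []"
  have len: "length us \<le> k" if "us \<noteq> []" "\<forall>v\<in>set us. fst v + length us \<le> k" for us :: "adder_input wire list" and k
    using that by (cases us) auto
  have "PT ?S fst ?G (\<lambda>p. enc_wire (huffman (fst (snd p)) (snd (snd p))))" (is "PT _ _ _ ?v")
  proof (rule PT_rec1[where b = ?b and l = ?l and m = "\<lambda>p. length (snd (snd p))"])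
    have f: "PT D fst ?G (\<lambda>p. enc_bool (fst (snd p) = OR))" and ws: "PT D fst ?G (\<lambda>p. enc_list enc_wire (snd (snd p)))" for D
      by (rule PT_var; simp)+
    show "PT ?S fst ?G (\<lambda>p. enc_bool (?b p))"
      by (rule PT_not[OF PT_null[OF PT_tl[OF ws]]])
    let ?D = "{p \<in> ?S. ?b p}"
    have two: "\<exists>v w us. snd (snd p) = v # w # us" if "p \<in> ?D" for p
      using that by (cases "snd (snd p)"; cases "tl (snd (snd p))") auto
    have "PT ?D fst ?G (\<lambda>p. enc_list enc_wire (?c p))"
    proof (rule PT_insort[where B = fst, OF PT_merge[OF f]])
      show "PT ?D fst ?G (\<lambda>p. enc_wire (hd (snd (snd p))))" by (rule PT_hd[OF ws]) auto
      show "PT ?D fst ?G (\<lambda>p. enc_wire (hd (tl (snd (snd p)))))" by (rule PT_hd[OF PT_tl[OF ws]]) auto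
      show "poly_bounded ?D fst (\<lambda>p. fst (hd (tl (snd (snd p)))))"
        by (rule poly_bounded_le) (use two in fastforce)
      show "PT ?D fst ?G (\<lambda>p. enc_list enc_wire (tl (tl (snd (snd p)))))" by (rule PT_tl[OF PT_tl[OF ws]])
      show "poly_bounded ?D fst fst" by (rule poly_bounded_id)
      show "length (tl (tl (snd (snd p)))) \<le> fst p \<and> (\<forall>v\<in>set (tl (tl (snd (snd p)))). fst v \<le> fst p)" if "p \<in> ?D" for p
        using two[OF that] that by fastforce
    qed
    then show "PT ?D fst ?G (\<lambda>p. g (?l p))" if "g \<in> set ?G" for g
      using that f by auto
    show "PT ?D fst ((\<lambda>p. ?v (?l p)) # ?G) ?v"
    proof (rule PT_cong[OF _ PT_var[of "\<lambda>p. ?v (?l p)"]])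
      fix p assume "p \<in> ?D"
      then show "?v p = ?v (?l p)" using two[of p] by auto
    qed simp
    show "PT {p \<in> ?S. \<not> ?b p} fst ?G ?v"
    proof (rule PT_cong[OF _ PT_hd[OF ws]])
      fix p assume "p \<in> {p \<in> ?S. \<not> ?b p}"
      then show "?v p = enc_wire (hd (snd (snd p)))" by (cases "snd (snd p)") auto
    qed auto
    show "poly_bounded ?S fst (\<lambda>p. length (snd (snd p)))" by (rule poly_bounded_le) (use len in auto)
    fix p assume p: "p \<in> ?S" "?b p"
    then obtain v w us where "snd (snd p) = v # w # us" using two by blast
    then show "?l p \<in> ?S \<and> fst (?l p) \<le> fst p \<and> length (snd (snd (?l p))) < length (snd (snd p))"
      using p by (auto simp: set_insort_key merge_def)
  qed
  then have "PT I N G (\<lambda>i. ?v (B i, f i, ws i))"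
    by (rule PT_call[where \<phi> = "\<lambda>i. (B i, f i, ws i)"]) (use assms in \<open>auto intro!: PTsI\<close>)
  then show ?thesis by simp
qed

lemma PT_tree:
  assumes "PT I N G (\<lambda>i. enc_bool (f i = OR))" "PT I N G (\<lambda>i. enc_list enc_wire (ws i))"
    "poly_bounded I N (\<lambda>i. weight (ws i))" "\<And>i. i \<in> I \<Longrightarrow> ws i \<noteq> []"
  shows "PT I N G (\<lambda>i. enc_wire (tree (f i) (ws i)))"
proof -
  have b: "poly_bounded I N (\<lambda>i. weight (ws i) + weight (ws i))" using assms(3) by auto
  have *: "length us \<le> weight us" "v \<in> set us \<Longrightarrow> fst v \<le> weight us" for us :: "adder_input wire list" and v
    using length_le_weight[of us] order_trans[OF less_imp_le[OF less_exp] weight_mono_mem[of v us]] by auto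
  show ?thesis unfolding tree_def
    by (intro PT_huffman[OF assms(1) _ b] PT_sort[OF assms(2,3)])
       (use assms(4) * in \<open>auto intro!: add_mono\<close>)
qed

section \<open>Polynomial time for paths and blocks\<close>

lemma PT_cut:
  assumes "PT I N G (\<lambda>i. enc_un (c i))" "PT I N G (\<lambda>i. enc_un (r i))" "PT I N G (\<lambda>i. enc_list (enc_pair enc_un e) (xs i))"
    "poly_bounded I N c" "poly_bounded I N r" "poly_bounded I N (\<lambda>i. weight (xs i))"
  shows "PT I N G (\<lambda>i. enc_un (cut (c i) (r i) (xs i)))"
proof -
  let ?S = "{p :: nat \<times> nat \<times> nat \<times> 'b item list. fst (snd p) \<le> fst p \<and> fst (snd (snd p)) \<le> fst p \<and> weight (snd (snd (snd p))) \<le> fst p}"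
  let ?G = "[\<lambda>p. enc_un (fst (snd p)), \<lambda>p. enc_un (fst (snd (snd p))), \<lambda>p. enc_list (enc_pair enc_un e) (snd (snd (snd p)))]
    :: (nat \<times> nat \<times> nat \<times> 'b item list \<Rightarrow> sexp) list"
  let ?xs = "\<lambda>p :: nat \<times> nat \<times> nat \<times> 'b item list. snd (snd (snd p))"
  let ?l = "\<lambda>p. (fst p, fst (snd p), fst (snd (snd p)) - (fst (snd p) + 2) * 2 ^ fst (hd (?xs p)), tl (?xs p))"
  let ?b = "\<lambda>p. ?xs p \<noteq> [] \<and> 2 * 2 ^ fst (hd (?xs p)) \<le> fst (snd (snd p))"
  have "PT ?S fst ?G (\<lambda>p. enc_un (cut (fst (snd p)) (fst (snd (snd p))) (?xs p)))" (is "PT _ _ _ ?v")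
  proof (rule PT_rec1[where b = ?b and l = ?l and m = "\<lambda>p. length (?xs p)"])
    have c: "PT D fst ?G (\<lambda>p. enc_un (fst (snd p)))" and r: "PT D fst ?G (\<lambda>p. enc_un (fst (snd (snd p))))"
      and xs: "PT D fst ?G (\<lambda>p. enc_list (enc_pair enc_un e) (?xs p))" for D
      by (rule PT_var; simp)+
    have pb: "poly_bounded {p \<in> ?S. ?xs p \<noteq> []} fst (\<lambda>p. 2 ^ fst (hd (?xs p)))"
    proof (rule poly_bounded_le)
      fix p assume "p \<in> {p \<in> ?S. ?xs p \<noteq> []}"
      then show "2 ^ fst (hd (?xs p)) \<le> fst p" using weight_mono_mem[of "hd (?xs p)" "?xs p"] by auto
    qed
    have x: "PT {p \<in> ?S. ?xs p \<noteq> []} fst ?G (\<lambda>p. enc_un (2 ^ fst (hd (?xs p))))"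
      by (intro PT_un_power2 pb PT_fst[OF PT_hd[OF xs]]) auto
    have "PT {p \<in> ?S. ?xs p \<noteq> []} fst ?G (\<lambda>p. enc_bool (2 * 2 ^ fst (hd (?xs p)) \<le> fst (snd (snd p))))"
      by (intro PT_un_le PT_un_mult r x pb PT_un_const poly_bounded_const poly_bounded_le) auto
    then show "PT ?S fst ?G (\<lambda>p. enc_bool (?b p))"
      by (intro PT_conj PT_not[OF PT_null[OF xs]])
    have "PT {p \<in> ?S. ?xs p \<noteq> []} fst ?G (\<lambda>p. enc_un (fst (snd (snd p)) - (fst (snd p) + 2) * 2 ^ fst (hd (?xs p))))"
      by (intro PT_un_minus PT_un_mult PT_un_add r c x pb PT_un_const poly_bounded_const poly_bounded_mult poly_bounded_add poly_bounded_le) auto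
    then have r': "PT {p \<in> ?S. ?b p} fst ?G (\<lambda>p. enc_un (fst (snd (snd p)) - (fst (snd p) + 2) * 2 ^ fst (hd (?xs p))))"
      by (rule PT_subset) auto
    show "PT {p \<in> ?S. ?b p} fst ?G (\<lambda>p. g (?l p))" if "g \<in> set ?G" for g
      using that c r' PT_tl[OF xs] by auto
    have "PT {p \<in> ?S. ?b p} fst ((\<lambda>p. ?v (?l p)) # ?G) (\<lambda>p. enc_un (Suc (cut (fst (snd p)) (fst (snd (snd p)) - (fst (snd p) + 2) * 2 ^ fst (hd (?xs p))) (tl (?xs p)))))"
      by (rule PT_un_Suc, rule PT_var) simp
    then show "PT {p \<in> ?S. ?b p} fst ((\<lambda>p. ?v (?l p)) # ?G) ?v"
    proof (rule PT_cong[rotated])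
      fix p assume "p \<in> {p \<in> ?S. ?b p}"
      then show "?v p = enc_un (Suc (cut (fst (snd p)) (fst (snd (snd p)) - (fst (snd p) + 2) * 2 ^ fst (hd (?xs p))) (tl (?xs p))))"
        by (cases "?xs p") auto
    qed
    show "PT {p \<in> ?S. \<not> ?b p} fst ?G ?v"
    proof (rule PT_cong[OF _ PT_un_0])
      fix p assume "p \<in> {p \<in> ?S. \<not> ?b p}"
      then show "?v p = enc_un 0" by (cases "?xs p") auto
    qed
    show "poly_bounded ?S fst (\<lambda>p. length (?xs p))"
      by (rule poly_bounded_le) (auto intro: order_trans[OF length_le_weight])
    fix p assume p: "p \<in> ?S" "?b p"
    then obtain y ys where "?xs p = y # ys" by (cases "?xs p") auto
    then show "?l p \<in> ?S \<and> fst (?l p) \<le> fst p \<and> length (?xs (?l p)) < length (?xs p)" using p by auto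
  qed
  then have "PT I N G (\<lambda>i. ?v (c i + r i + weight (xs i), c i, r i, xs i))"
    by (rule PT_call[where \<phi> = "\<lambda>i. (c i + r i + weight (xs i), c i, r i, xs i)"])
       (use assms in \<open>auto intro!: PTsI poly_bounded_add\<close>)
  then show ?thesis by simp
qed

abbreviation enc_pp :: "adder_input pair \<Rightarrow> sexp" where
  "enc_pp \<equiv> enc_pair enc_trm enc_trm"

abbreviation enc_item :: "adder_input item \<Rightarrow> sexp" where
  "enc_item \<equiv> enc_pair enc_un enc_pp"

lemma
  assumes "PT I N G (\<lambda>i. enc_item (x i))"
  shows PT_wire1: "PT I N G (\<lambda>i. enc_wire (wire1 (x i)))"
    and PT_wire2: "PT I N G (\<lambda>i. enc_wire (wire2 (x i)))"
    and PT_swap: "PT I N G (\<lambda>i. enc_item (swap (x i)))"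
proof -
  note k = PT_fst[OF assms] and p = PT_snd[OF assms]
  note u = PT_fst[OF p] and v = PT_snd[OF p]
  show "PT I N G (\<lambda>i. enc_wire (wire1 (x i)))" "PT I N G (\<lambda>i. enc_wire (wire2 (x i)))"
    "PT I N G (\<lambda>i. enc_item (swap (x i)))"
    unfolding wire1_def wire2_def swap_def by (intro PT_pair k u v)+
qed

lemma PT_map_fun:
  assumes "PT I N G (\<lambda>i. enc_list e (xs i))" "poly_bounded I N (\<lambda>i. length (xs i))"
    and "\<And>I N G. PT I N G (\<lambda>p. e (snd p)) \<Longrightarrow> PT I N G (\<lambda>p :: 'w \<times> 'b. e' (f (snd p)))"
  shows "PT I N G (\<lambda>i::'w. enc_list e' (map f (xs i)))"
  by (rule PT_map[where e = e and f = "\<lambda>_. f", OF assms(1,2)]) (rule assms(3), rule PT_var, simp)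

lemma pieces_le:
  assumes "fits d s xs"
  shows "weight (pieces f e d s xs) \<le> 2 ^ d"
  using pieces_weight(1)[OF assms, of f e] by (cases "xs = []") auto

lemma fits_weight: "fits d s xs \<Longrightarrow> s \<le> 2 ^ d" "fits d s xs \<Longrightarrow> weight xs \<le> 2 ^ d"
  unfolding fits_def by (auto intro: order_trans[of _ "(3 * d + 2) * weight xs"])

lemma PT_pieces:
  assumes "PT I N G (\<lambda>i. enc_bool (f i = OR))" "PT I N G (\<lambda>i. enc_bool (e i))" "PT I N G (\<lambda>i. enc_un (d i))"
    "PT I N G (\<lambda>i. enc_un (s i))" "PT I N G (\<lambda>i. enc_list enc_item (xs i))"
    "poly_bounded I N (\<lambda>i. 2 ^ d i)" "\<And>i. i \<in> I \<Longrightarrow> fits (d i) (s i) (xs i)"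
  shows "PT I N G (\<lambda>i. enc_list enc_wire (pieces (f i) (e i) (d i) (s i) (xs i)))"
proof -
  define f' where "f' p = fst (snd p)" for p :: "nat \<times> gate_op \<times> bool \<times> nat \<times> nat \<times> adder_input item list"
  define e' where "e' p = fst (snd (snd p))" for p :: "nat \<times> gate_op \<times> bool \<times> nat \<times> nat \<times> adder_input item list"
  define d' where "d' p = fst (snd (snd (snd p)))" for p :: "nat \<times> gate_op \<times> bool \<times> nat \<times> nat \<times> adder_input item list"
  define s' where "s' p = fst (snd (snd (snd (snd p))))" for p :: "nat \<times> gate_op \<times> bool \<times> nat \<times> nat \<times> adder_input item list"
  define xs' where "xs' p = snd (snd (snd (snd (snd p))))" for p :: "nat \<times> gate_op \<times> bool \<times> nat \<times> nat \<times> adder_input item list"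
  have sel [simp]: "f' (a, b, c, x, y, z) = b" "e' (a, b, c, x, y, z) = c" "d' (a, b, c, x, y, z) = x" "s' (a, b, c, x, y, z) = y" "xs' (a, b, c, x, y, z) = z" for a b c x y z
    by (simp_all add: f'_def e'_def d'_def s'_def xs'_def)
  define S where "S = {p. fits (d' p) (s' p) (xs' p) \<and> 2 ^ d' p \<le> fst p}"
  define H where "H = [\<lambda>p. enc_bool (f' p = OR), \<lambda>p. enc_bool (e' p), \<lambda>p. enc_un (d' p), \<lambda>p. enc_un (s' p), \<lambda>p. enc_list enc_item (xs' p)]"
  define j where "j p = cut (3 * (d' p - 1) + 2) (2 ^ (d' p - 1) - s' p) (xs' p)" for p
  define W where "W p = weight (take (j p) (xs' p))" for p
  define L where "L p = take (j p - 1) (xs' p)" for p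
  define R where "R p = drop (j p) (xs' p)" for p
  define l where "l p = (if j p = 0 then (fst p, f' p, e' p, d' p - 1, s' p - 2 ^ (d' p - 1), xs' p)
    else (fst p, f' p, True, d' p - 1, s' p + 2 * W p, L p))" for p
  \<comment> \<open>\<open>PT_rec2\<close> always makes two calls; if nothing is cut off, the second
    one is a dummy on the empty path of depth 0. The measure chosen below leaves room for the dummy,
    whose own measure is 1.\<close>
  define r where "r p = (if j p = 0 then (fst p, f' p, e' p, 0, 0, [])
    else (fst p, dual (f' p), \<not> e' p, d' p - 1, W p, map swap (R p)))" for p
  define v where "v p = enc_list enc_wire (pieces (f' p) (e' p) (d' p) (s' p) (xs' p))" for p
  define D where "D = {p \<in> S. d' p \<noteq> 0 \<and> xs' p \<noteq> []}"
  have DS: "p \<in> D \<Longrightarrow> p \<in> S" for p by (simp add: D_def)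
  have rest: "fits (Suc (d' p - 1)) (s' p) (xs' p)" "xs' p \<noteq> []" if "p \<in> D" for p
    using that by (auto simp: D_def S_def)
  have jl: "j p \<le> length (xs' p)" for p unfolding j_def by (rule cut_le)
  have le: "d' p \<le> fst p" "2 ^ (d' p - 1) \<le> fst p" "s' p \<le> fst p" "weight (xs' p) \<le> fst p" "length (xs' p) \<le> fst p" if "p \<in> S" for p
  proof -
    have p: "fits (d' p) (s' p) (xs' p)" "2 ^ d' p \<le> fst p" using that by (auto simp: S_def)
    show "d' p \<le> fst p" using less_exp[of "d' p"] p(2) by linarith
    have "2 ^ (d' p - 1) \<le> (2::nat) ^ d' p" by (intro power_increasing) auto
    then show "2 ^ (d' p - 1) \<le> fst p" using p(2) by linarith
    show "s' p \<le> fst p" "weight (xs' p) \<le> fst p" using fits_weight[OF p(1)] p(2) by auto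
    then show "length (xs' p) \<le> fst p" using length_le_weight[of "xs' p"] by linarith
  qed
  have pb: "poly_bounded D' fst d'" "poly_bounded D' fst (\<lambda>p. 2 ^ (d' p - 1))" "poly_bounded D' fst s'"
      "poly_bounded D' fst (\<lambda>p. weight (xs' p))" "poly_bounded D' fst (\<lambda>p. length (xs' p))" if "D' \<subseteq> S" for D'
    by (rule poly_bounded_le, rule le, rule subsetD[OF that], assumption)+
  have wt: "W p \<le> weight (xs' p)" "weight (L p) \<le> weight (xs' p)" for p
  proof -
    have "weight (take k us) \<le> weight us" for k and us :: "adder_input item list"
      using weight_simps(3)[of "take k us" "drop k us"] by simp
    then show "W p \<le> weight (xs' p)" "weight (L p) \<le> weight (xs' p)" unfolding W_def L_def by auto
  qed
  have pbW: "poly_bounded D' fst W" "poly_bounded D' fst j" "poly_bounded D' fst (\<lambda>p. length (L p))" "poly_bounded D' fst (\<lambda>p. length (R p))" if "D' \<subseteq> S" for D'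
  proof -
    show "poly_bounded D' fst W" by (rule poly_bounded_mono[OF pb(4)[OF that] _ wt(1)])
    show "poly_bounded D' fst j" by (rule poly_bounded_mono[OF pb(5)[OF that] _ jl])
    show "poly_bounded D' fst (\<lambda>p. length (L p))" "poly_bounded D' fst (\<lambda>p. length (R p))"
      by (rule poly_bounded_mono[OF pb(5)[OF that]]; simp add: L_def R_def)+
  qed
  have xS: "PT D' fst H' (\<lambda>p. enc_list enc_item (xs' p))" "PT D' fst H' (\<lambda>p. enc_bool (f' p = OR))" "PT D' fst H' (\<lambda>p. enc_bool (e' p))"
     "PT D' fst H' (\<lambda>p. enc_un (d' p))" "PT D' fst H' (\<lambda>p. enc_un (s' p))" if "set H \<subseteq> set H'" for D' H'
    by (rule PT_var; use that in \<open>simp add: H_def\<close>)+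
  have jS: "PT D' fst H' (\<lambda>p. enc_un (j p))" if "D' \<subseteq> S" "set H \<subseteq> set H'" for D' H'
  proof -
    have b: "poly_bounded D' fst (\<lambda>p. d' p - 1)" by (rule poly_bounded_mono[OF pb(1)[OF that(1)]]) auto
    have r: "poly_bounded D' fst (\<lambda>p. 2 ^ (d' p - 1) - s' p)" by (rule poly_bounded_mono[OF pb(2)[OF that(1)]]) auto
    note d = PT_un_pred[OF xS(4)[OF that(2)]]
    have c: "PT D' fst H' (\<lambda>p. enc_un (3 * (d' p - 1) + 2))"
      by (intro PT_un_add[OF PT_un_mult[OF PT_un_const d] PT_un_const] poly_bounded_mult poly_bounded_const b)
    have "PT D' fst H' (\<lambda>p. enc_un (2 ^ (d' p - 1) - s' p))"
      by (rule PT_un_minus[OF PT_un_power2[OF d pb(2)[OF that(1)]] xS(5)[OF that(2)] pb(3)[OF that(1)]])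
    then show ?thesis unfolding j_def
      by (rule PT_cut[OF c _ xS(1)[OF that(2)] _ r pb(4)[OF that(1)]])
         (intro poly_bounded_add poly_bounded_mult poly_bounded_const b)
  qed
  have LS: "PT D' fst H' (\<lambda>p. enc_list enc_item (L p))" "PT D' fst H' (\<lambda>p. enc_list enc_item (R p))" "PT D' fst H' (\<lambda>p. enc_un (W p))"
    if "D' \<subseteq> S" "set H \<subseteq> set H'" for D' H'
  proof -
    have "poly_bounded D' fst (\<lambda>p. j p - 1)" by (rule poly_bounded_mono[OF pbW(2)[OF that(1)]]) auto
    then show "PT D' fst H' (\<lambda>p. enc_list enc_item (L p))"
      unfolding L_def by (intro PT_take PT_un_pred jS xS that pb)
    show "PT D' fst H' (\<lambda>p. enc_list enc_item (R p))"
      unfolding R_def by (intro PT_drop jS xS that pbW)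
    show "PT D' fst H' (\<lambda>p. enc_un (W p))"
      unfolding W_def by (intro PT_weight[where e = enc_pp] PT_take jS xS that pb pbW pbW(1)[unfolded W_def])
  qed
  have "PT S fst H v"
  proof (rule PT_rec2[where b = "\<lambda>p. d' p \<noteq> 0 \<and> xs' p \<noteq> []" and l = l and r = r and m = "\<lambda>p. 2 * d' p * length (xs' p) + 1"])
    show "PT S fst H (\<lambda>p. enc_bool (d' p \<noteq> 0 \<and> xs' p \<noteq> []))"
      by (intro PT_conj PT_not PT_un_is_0 PT_null[where e = enc_item] xS) auto
    have j0: "PT D fst H' (\<lambda>p. enc_bool (j p = 0))" if "set H \<subseteq> set H'" for H'
      by (intro PT_un_is_0 jS that) (auto simp: D_def)
    have sub: "{p \<in> D. j p = 0} \<subseteq> S" "{p \<in> D. j p \<noteq> 0} \<subseteq> S" by (auto simp: D_def)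
    have p0: "poly_bounded {p \<in> D. j p = 0} fst (\<lambda>p. 2 ^ (d' p - 1))" by (rule pb(2)[OF sub(1)])
    have l: "PT D fst H (\<lambda>p. if j p = 0 then enc_bool (f' p = OR) else enc_bool (f' p = OR))"
      "PT D fst H (\<lambda>p. if j p = 0 then enc_bool (e' p) else enc_bool True)"
      "PT D fst H (\<lambda>p. if j p = 0 then enc_un (d' p - 1) else enc_un (d' p - 1))"
      "PT D fst H (\<lambda>p. if j p = 0 then enc_un (s' p - 2 ^ (d' p - 1)) else enc_un (s' p + 2 * W p))"
      "PT D fst H (\<lambda>p. if j p = 0 then enc_list enc_item (xs' p) else enc_list enc_item (L p))"
      by (intro PT_if j0 order_refl PT_const PT_un_minus PT_un_pred PT_un_power2 PT_un_add PT_un_mult PT_un_const xS LS sub p0 pb pbW poly_bounded_const)+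
    show "PT {p \<in> S. d' p \<noteq> 0 \<and> xs' p \<noteq> []} fst H (\<lambda>p. g (l p))" if "g \<in> set H" for g
      using that l unfolding H_def D_def[symmetric]
      by (auto simp: l_def if_distrib cong: if_cong)
    have rr: "PT {p \<in> D. j p \<noteq> 0} fst H (\<lambda>p. enc_list enc_item (map swap (R p)))"
      by (rule PT_map_fun[where e = enc_item, OF LS(2)[OF sub(2) order_refl] pbW(4)[OF sub(2)]], rule PT_swap)
    have r: "PT D fst H (\<lambda>p. if j p = 0 then enc_bool (f' p = OR) else enc_bool (dual (f' p) = OR))"
      "PT D fst H (\<lambda>p. if j p = 0 then enc_bool (e' p) else enc_bool (\<not> e' p))"
      "PT D fst H (\<lambda>p. if j p = 0 then enc_un 0 else enc_un (d' p - 1))"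
      "PT D fst H (\<lambda>p. if j p = 0 then enc_un 0 else enc_un (W p))"
      "PT D fst H (\<lambda>p. if j p = 0 then enc_list enc_item [] else enc_list enc_item (map swap (R p)))"
      by (intro PT_if j0 order_refl PT_const PT_Nil PT_not PT_dual PT_un_0 PT_un_pred xS LS sub rr)+
    show "PT {p \<in> S. d' p \<noteq> 0 \<and> xs' p \<noteq> []} fst H (\<lambda>p. g (r p))" if "g \<in> set H" for g
      using that r unfolding H_def D_def[symmetric]
      by (auto simp: r_def if_distrib cong: if_cong)
    show "PT {p \<in> S. \<not> (d' p \<noteq> 0 \<and> xs' p \<noteq> [])} fst H v"
    proof (rule PT_cong[OF _ PT_Leaf])
      fix p assume "p \<in> {p \<in> S. \<not> (d' p \<noteq> 0 \<and> xs' p \<noteq> [])}"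
      then show "v p = Leaf" by (cases "d' p") (auto simp: v_def)
    qed
    show "poly_bounded S fst (\<lambda>p. 2 * d' p * length (xs' p) + 1)"
      by (intro poly_bounded_add poly_bounded_mult poly_bounded_const pb order_refl)
    show "l p \<in> S \<and> fst (l p) \<le> fst p \<and> r p \<in> S \<and> fst (r p) \<le> fst p \<and>
        2 * d' (l p) * length (xs' (l p)) + 1 + (2 * d' (r p) * length (xs' (r p)) + 1) < 2 * d' p * length (xs' p) + 1"
      if "p \<in> S" "d' p \<noteq> 0 \<and> xs' p \<noteq> []" for p
    proof -
      have p: "p \<in> D" using that by (simp add: D_def)
      obtain c where c: "d' p = Suc c" using p by (cases "d' p") (auto simp: D_def)
      have c1: "2 ^ c \<le> fst p" using le(2)[OF that(1)] c by simp
      have "1 \<le> fst p" by (rule order_trans[OF _ c1]) simp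
      note c2 = c1 this
      show ?thesis
      proof (cases "j p = 0")
        case True
        then have "fits c (s' p - 2 ^ c) (xs' p)" using cut_fits_rest(1)[OF rest[OF p] j_def] c by simp
        moreover have "2 * c * length (xs' p) + 1 < 2 * Suc c * length (xs' p)" using that(2) by (cases "xs' p") auto
        ultimately show ?thesis using True c c2 by (simp add: l_def r_def S_def fits_def[of 0])
      next
        case False
        then have *: "s' p + 2 * W p + (3 * c + 2) * weight (L p) \<le> 2 ^ c" "fits c (W p) (R p)"
          using cut_fits_rest(2,3)[OF rest[OF p] j_def] c by (simp_all add: W_def L_def R_def)
        obtain i where i: "j p = Suc i" using False by (cases "j p") auto
        have len: "length (L p) + length (R p) + 1 = length (xs' p)" using jl[of p] i by (simp add: L_def R_def)
        have "2 * c * length (L p) + (2 * c * length (R p) + 1) < 2 * Suc c * length (xs' p)"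
          unfolding len[symmetric] by (simp add: algebra_simps)
        then show ?thesis using False c c2 * by (simp add: l_def r_def S_def fits_def[of _ "s' p + 2 * W p"])
      qed
    qed
    define H' where "H' = (\<lambda>p. v (l p)) # (\<lambda>p. v (r p)) # H"
    have s: "set H \<subseteq> set H'" by (auto simp: H'_def)
    define x where "x p = xs' p ! (j p - 1)" for p
    define B where "B p = tree (dual (f' p)) (wire2 (x p) # map wire2 (L p) @ pieces (dual (f' p)) (\<not> e' p) (d' p - 1) (W p) (map swap (R p)))" for p
    define A where "A p = tree (dual (f' p)) (wire1 (x p) # map wire2 (L p))" for p
    define C where "C p = pieces (f' p) True (d' p - 1) (s' p + 2 * W p) (L p)" for p
    let ?D = "{p \<in> D. j p \<noteq> 0}"
    let ?E = "{p \<in> ?D. \<not> (R p = [] \<and> e' p)}"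
    note sub = sub(2) order_trans[OF _ sub(2), of ?E]
    have x: "PT ?D fst H' (\<lambda>p. enc_item (x p))"
      unfolding x_def
    proof (intro PT_list_nth PT_un_pred jS xS s sub)
      show "poly_bounded ?D fst (\<lambda>p. j p - 1)" by (rule poly_bounded_mono[OF pbW(2)[OF sub(1)]]) auto
      show "j p - 1 < length (xs' p)" if "p \<in> ?D" for p using jl[of p] that by auto
    qed
    have LL: "PT ?D fst H' (\<lambda>p. enc_list enc_wire (map wire2 (L p)))"
      by (rule PT_map_fun[where e = enc_item, OF LS(1)[OF sub(1) s] pbW(3)[OF sub(1)]], rule PT_wire2)
    have xw: "2 ^ fst (x p) + weight (L p) = W p" if "p \<in> ?D" for p
    proof -
      have "j p \<noteq> 0" using that by simp
      then obtain i where i: "j p = Suc i" by (cases "j p") auto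
      then have "take (j p) (xs' p) = L p @ [x p]" using jl[of p] by (simp add: L_def x_def take_Suc_conv_app_nth)
      then show ?thesis by (simp add: W_def)
    qed
    have A: "PT ?D fst H' (\<lambda>p. enc_wire (A p))"
      unfolding A_def
    proof (intro PT_tree PT_dual xS s PT_Cons PT_wire1 x LL)
      show "poly_bounded ?D fst (\<lambda>p. weight (wire1 (x p) # map wire2 (L p)))"
        by (rule poly_bounded_mono[OF pbW(1)[OF sub(1)]]) (use xw in auto)
    qed auto
    have vl: "v (l p) = enc_list enc_wire (C p)" "v (r p) = enc_list enc_wire (pieces (dual (f' p)) (\<not> e' p) (d' p - 1) (W p) (map swap (R p)))" if "p \<in> ?D" for p
      using that by (simp_all add: v_def l_def r_def C_def)
    have C: "PT ?D fst H' (\<lambda>p. enc_list enc_wire (C p))"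
      by (rule PT_cong[OF vl(1)[symmetric] PT_var]) (auto simp: H'_def)
    have Rp: "PT ?D fst H' (\<lambda>p. enc_list enc_wire (pieces (dual (f' p)) (\<not> e' p) (d' p - 1) (W p) (map swap (R p))))"
      by (rule PT_cong[OF vl(2)[symmetric] PT_var]) (auto simp: H'_def)
    have wR: "weight (pieces (dual (f' p)) (\<not> e' p) (d' p - 1) (W p) (map swap (R p))) \<le> 2 ^ (d' p - 1)"
      and wC: "length (C p) \<le> 2 ^ (d' p - 1)" if "p \<in> ?D" for p
    proof -
      have p: "p \<in> D" "0 < j p" using that by auto
      from cut_fits_rest(2,3)[OF rest[OF p(1)] j_def p(2)] show "weight (pieces (dual (f' p)) (\<not> e' p) (d' p - 1) (W p) (map swap (R p))) \<le> 2 ^ (d' p - 1)"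
        by (intro pieces_le) (simp add: W_def R_def)
      from cut_fits_rest(2,3)[OF rest[OF p(1)] j_def p(2)] have "weight (C p) \<le> 2 ^ (d' p - 1)"
        unfolding C_def by (intro pieces_le) (simp add: fits_def W_def L_def)
      then show "length (C p) \<le> 2 ^ (d' p - 1)" using length_le_weight[of "C p"] by linarith
    qed
    have B: "PT ?D fst H' (\<lambda>p. enc_wire (B p))"
      unfolding B_def
    proof (intro PT_tree PT_dual xS s PT_Cons PT_append PT_wire2 x LL Rp)
      show "poly_bounded ?D fst (\<lambda>p. length (map wire2 (L p)))" using pbW(3)[OF sub(1)] by simp
      show "poly_bounded ?D fst (\<lambda>p. weight (wire2 (x p) # map wire2 (L p) @ pieces (dual (f' p)) (\<not> e' p) (d' p - 1) (W p) (map swap (R p))))"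
        by (rule poly_bounded_mono[OF poly_bounded_add[OF pbW(1)[OF sub(1)] pb(2)[OF sub(1)]]]) (use xw wR in \<open>auto intro!: add_mono simp: add.assoc[symmetric]\<close>)
    qed auto
    have "PT ?D fst H' (\<lambda>p. if R p = [] \<and> e' p then enc_list enc_wire [] else enc_list enc_wire [B p])"
      by (intro PT_if PT_conj PT_null[where e = enc_item] LS xS s sub PT_Nil PT_Cons PT_subset[OF B]) auto
    then have 2: "PT ?D fst H' (\<lambda>p. enc_list enc_wire (A p # C p @ (if R p = [] \<and> e' p then [] else [B p])))"
      using poly_bounded_mono[OF pb(2)[OF sub(1)], of ?D "\<lambda>p. length (C p)"] wC
      by (intro PT_Cons PT_append A C) (auto simp: if_distrib cong: if_cong)
    have 1: "PT D fst H' (\<lambda>p. if j p = 0 then v (l p) else enc_list enc_wire (A p # C p @ (if R p = [] \<and> e' p then [] else [B p])))"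
      by (rule PT_if[OF j0[OF s] _ 2], rule PT_var) (simp add: H'_def)
    have "PT D fst H' v"
    proof (rule PT_cong[OF _ 1])
      fix p assume p: "p \<in> D"
      then obtain c where c: "d' p = Suc c" by (cases "d' p") (auto simp: D_def)
      have jj: "cut (3 * c + 2) (2 ^ c - s' p) (xs' p) = j p" by (simp add: j_def c)
      show "v p = (if j p = 0 then v (l p) else enc_list enc_wire (A p # C p @ (if R p = [] \<and> e' p then [] else [B p])))"
        using p unfolding v_def c pieces.simps Let_def jj
        by (simp add: D_def l_def c A_def B_def C_def L_def R_def W_def x_def)
    qed
    then show "PT {p \<in> S. d' p \<noteq> 0 \<and> xs' p \<noteq> []} fst ((\<lambda>p. v (l p)) # (\<lambda>p. v (r p)) # H) v"
      unfolding D_def H'_def .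
  qed
  then have "PT I N G (\<lambda>i. v (2 ^ d i, f i, e i, d i, s i, xs i))"
    by (rule PT_call[where \<phi> = "\<lambda>i. (2 ^ d i, f i, e i, d i, s i, xs i)"]) (use assms in \<open>auto intro!: PTsI simp: S_def H_def\<close>)
  then show ?thesis by (simp add: v_def)
qed

lemma depth_linear: "depth w \<le> 2 * w + 6"
proof -
  have "w \<le> 2 ^ w" by (rule less_imp_le) (rule less_exp)
  with linear_le_power[of w] have "(6 * w + 20) * w \<le> 2 ^ (w + 5) * 2 ^ w" by (rule mult_le_mono)
  also have "\<dots> \<le> 2 ^ (2 * w + 6)" unfolding power_add[symmetric] by (intro power_increasing) auto
  finally have "(3 * (2 * w + 6) + 2) * w \<le> 2 ^ (2 * w + 6)" by (simp add: algebra_simps)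
  then show ?thesis unfolding depth_def by (rule Least_le)
qed

text \<open>A path has budget \<open>2 ^ depth\<close>. As this is polynomial in the weight, all
  budgets, reserves and weights can be handled in unary.\<close>

lemma power_depth: "2 ^ depth w \<le> 6 * (2 * w + 6) * w + 1"
proof (cases "w = 0")
  case True
  then show ?thesis by (simp add: depth_def)
next
  case False
  then have "2 ^ depth w < 2 * (3 * depth w - 1) * w" using depth_less(2)[of w] by simp
  also have "\<dots> \<le> 2 * (3 * (2 * w + 6)) * w" using depth_linear[of w] by (intro mult_le_mono) auto
  finally show ?thesis by simp
qed

lemma PT_depth:
  assumes "PT I N G (\<lambda>i. enc_un (w i))" "poly_bounded I N w"
  shows "PT I N G (\<lambda>i. enc_un (depth (w i)))" "poly_bounded I N (\<lambda>i. 2 ^ depth (w i))"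
proof -
  have "poly_bounded I N (\<lambda>i. 6 * (2 * w i + 6) * w i + 1)"
    by (intro poly_bounded_add poly_bounded_mult poly_bounded_const assms(2))
  then show p: "poly_bounded I N (\<lambda>i. 2 ^ depth (w i))"
    by (rule poly_bounded_mono[OF _ _ power_depth])
  show "PT I N G (\<lambda>i. enc_un (depth (w i)))"
    unfolding depth_def
  proof (rule PT_Least)
    show "\<exists>k. (3 * k + 2) * w i \<le> 2 ^ k" for i by (rule depth_exists)
    show "poly_bounded I N (\<lambda>i. LEAST k. (3 * k + 2) * w i \<le> 2 ^ k)"
      unfolding depth_def[symmetric] by (rule poly_bounded_mono[OF p]) (auto intro: less_imp_le)
    let ?D = "{p. fst p \<in> I \<and> snd p \<le> (LEAST k. (3 * k + 2) * w (fst p) \<le> 2 ^ k)}"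
    let ?G = "(\<lambda>p. enc_un (snd p)) # map (\<lambda>g p. g (fst p)) G"
    have "poly_bounded ?D (\<lambda>p. N (fst p)) (\<lambda>p. 2 ^ depth (w (fst p)))"
      by (rule poly_bounded_fst[OF p]) auto
    then have b: "poly_bounded ?D (\<lambda>p. N (fst p)) (\<lambda>p. 2 ^ snd p)"
      by (rule poly_bounded_mono) (auto simp: depth_def)
    then have s: "poly_bounded ?D (\<lambda>p. N (fst p)) snd"
      by (rule poly_bounded_mono) (auto intro: less_imp_le)
    have w: "PT ?D (\<lambda>p. N (fst p)) ?G (\<lambda>p. enc_un (w (fst p)))" by (rule PT_lift'[OF assms(1)]) auto
    have k: "PT ?D (\<lambda>p. N (fst p)) ?G (\<lambda>p. enc_un (snd p))" by (rule PT_var) simp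
    have wb: "poly_bounded ?D (\<lambda>p. N (fst p)) (\<lambda>p. w (fst p))" by (rule poly_bounded_fst[OF assms(2)]) auto
    show "PT ?D (\<lambda>p. N (fst p)) ?G (\<lambda>p. enc_bool ((3 * snd p + 2) * w (fst p) \<le> 2 ^ snd p))"
      by (intro PT_un_le PT_un_power2 PT_un_mult[OF PT_un_add[OF PT_un_mult[OF PT_un_const k] PT_un_const] w]
          b s k wb poly_bounded_mult poly_bounded_add poly_bounded_const)
  qed
qed

lemma length_le_pair_weight: "length ps \<le> pair_weight ps"
proof (induction ps)
  case (Cons p ps)
  have "(1::nat) \<le> 2 ^ ready p" by simp
  then show ?case using Cons.IH pair_weight_simps(2)[of p ps] by (simp only: list.size)
qed simp

lemma weight_items_le: "weight (items b ps) \<le> pair_weight ps"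
  by (induction ps) (auto simp: items_def intro!: add_mono power_increasing)

lemma PT_ready:
  assumes "PT I N G (\<lambda>i. enc_pp (p i))" "poly_bounded I N (\<lambda>i. 2 ^ ready (p i))"
  shows "PT I N G (\<lambda>i. enc_un (ready (p i)))"
proof -
  have b: "poly_bounded I N (\<lambda>i. 2 ^ arr (fst (p i)))" "poly_bounded I N (\<lambda>i. 2 ^ arr (snd (p i)))"
    by (rule poly_bounded_mono[OF assms(2)]; auto simp: ready_def intro!: power_increasing)+
  show ?thesis unfolding ready_def
    by (intro PT_un_max PT_arr PT_fst[OF assms(1)] PT_snd[OF assms(1)] b)
       (rule poly_bounded_mono[OF b(2)]; auto intro: less_imp_le)
qed

lemma PT_items:
  assumes "PT I N G (\<lambda>i. enc_un (b i))" "PT I N G (\<lambda>i. enc_list enc_pp (ps i))"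
    "poly_bounded I N b" "poly_bounded I N (\<lambda>i. pair_weight (ps i))"
  shows "PT I N G (\<lambda>i. enc_list enc_item (items (b i) (ps i)))"
  unfolding items_def
proof (rule PT_map[where e = enc_pp and f = "\<lambda>i p. (ready p - b i, p)", OF assms(2)])
  show "poly_bounded I N (\<lambda>i. length (ps i))" by (rule poly_bounded_mono[OF assms(4) _ length_le_pair_weight])
  let ?D = "{p. fst p \<in> I \<and> snd p \<in> set (ps (fst p))}"
  let ?G = "(\<lambda>p. enc_pp (snd p)) # map (\<lambda>g p. g (fst p)) G"
  have p: "PT ?D (\<lambda>p. N (fst p)) ?G (\<lambda>p. enc_pp (snd p))" by (rule PT_var) simp
  have b: "PT ?D (\<lambda>p. N (fst p)) ?G (\<lambda>p. enc_un (b (fst p)))" by (rule PT_lift'[OF assms(1)]) auto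
  have "poly_bounded ?D (\<lambda>p. N (fst p)) (\<lambda>p. pair_weight (ps (fst p)))" by (rule poly_bounded_fst[OF assms(4)]) auto
  then have r: "poly_bounded ?D (\<lambda>p. N (fst p)) (\<lambda>p. 2 ^ ready (snd p))"
    by (rule poly_bounded_mono) (auto intro: pair_weight_mem)
  have "poly_bounded ?D (\<lambda>p. N (fst p)) (\<lambda>p. b (fst p))" by (rule poly_bounded_fst[OF assms(3)]) auto
  then show "PT ?D (\<lambda>p. N (fst p)) ?G (\<lambda>p. enc_item (ready (snd p) - b (fst p), snd p))"
    by (intro PT_pair[where ?e2.0 = enc_pp] PT_un_minus[OF PT_ready[OF p r] b] p)
qed

lemma base_le: "base ps \<le> pair_weight ps"
  unfolding base_def by (rule Least_le) (simp add: weight_items_large)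

lemma PT_base:
  assumes "PT I N G (\<lambda>i. enc_list enc_pp (ps i))" "poly_bounded I N (\<lambda>i. pair_weight (ps i))"
  shows "PT I N G (\<lambda>i. enc_un (base (ps i)))"
  unfolding base_def
proof (rule PT_Least)
  show "\<exists>b. weight (items b (ps i)) \<le> 8 * length (ps i)" for i
    by (rule exI[of _ "pair_weight (ps i)"]) (simp add: weight_items_large)
  show "poly_bounded I N (\<lambda>i. LEAST b. weight (items b (ps i)) \<le> 8 * length (ps i))"
    unfolding base_def[symmetric] by (rule poly_bounded_mono[OF assms(2) _ base_le])
  let ?D = "{p. fst p \<in> I \<and> snd p \<le> (LEAST b. weight (items b (ps (fst p))) \<le> 8 * length (ps (fst p)))}"
  let ?G = "(\<lambda>p. enc_un (snd p)) # map (\<lambda>g p. g (fst p)) G"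
  have w: "poly_bounded ?D (\<lambda>p. N (fst p)) (\<lambda>p. pair_weight (ps (fst p)))" by (rule poly_bounded_fst[OF assms(2)]) auto
  have ps: "PT ?D (\<lambda>p. N (fst p)) ?G (\<lambda>p. enc_list enc_pp (ps (fst p)))" by (rule PT_lift'[OF assms(1)]) auto
  have l: "poly_bounded ?D (\<lambda>p. N (fst p)) (\<lambda>p. length (ps (fst p)))" by (rule poly_bounded_mono[OF w _ length_le_pair_weight])
  have k: "poly_bounded ?D (\<lambda>p. N (fst p)) snd"
  proof (rule poly_bounded_mono[OF w])
    show "snd p \<le> pair_weight (ps (fst p))" if "p \<in> ?D" for p
      using that base_le[of "ps (fst p)"] unfolding base_def[symmetric] by simp
  qed
  have "PT ?D (\<lambda>p. N (fst p)) ?G (\<lambda>p. enc_list enc_item (items (snd p) (ps (fst p))))"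
    by (rule PT_items[OF _ ps k w], rule PT_var) simp
  then have "PT ?D (\<lambda>p. N (fst p)) ?G (\<lambda>p. enc_un (weight (items (snd p) (ps (fst p)))))"
    by (rule PT_weight) (rule poly_bounded_mono[OF w _ weight_items_le])
  then show "PT ?D (\<lambda>p. N (fst p)) ?G (\<lambda>p. enc_bool (weight (items (snd p) (ps (fst p))) \<le> 8 * length (ps (fst p))))"
    by (rule PT_un_le) (intro PT_un_mult PT_un_const PT_length[OF ps] l poly_bounded_mult poly_bounded_const)+
qed

lemma PT_path:
  assumes "PT I N G (\<lambda>i. enc_list enc_pp (ps i))" "poly_bounded I N (\<lambda>i. pair_weight (ps i))"
    "\<And>i. i \<in> I \<Longrightarrow> ps i \<noteq> []"
  shows "PT I N G (\<lambda>i. enc_trm (path (ps i)))"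
proof -
  let ?xs = "\<lambda>i. items (base (ps i)) (ps i)"
  have xs: "PT I N G (\<lambda>i. enc_list enc_item (?xs i))"
    by (rule PT_items[OF PT_base[OF assms(1,2)] assms(1) _ assms(2)]) (rule poly_bounded_mono[OF assms(2) _ base_le])
  have wb: "poly_bounded I N (\<lambda>i. weight (?xs i))" by (rule poly_bounded_mono[OF assms(2) _ weight_items_le])
  note d = PT_depth[OF PT_weight[OF xs wb] wb]
  have fits: "fits (depth (weight (?xs i))) 0 (?xs i)" for i
    unfolding fits_def using depth_fits[of "weight (?xs i)"] by simp
  have ne: "?xs i \<noteq> []" if "i \<in> I" for i
    using assms(3)[OF that] length_items[of "base (ps i)" "ps i"] by (metis length_0_conv)
  have p: "PT I N G (\<lambda>i. enc_list enc_wire (pieces OR True (depth (weight (?xs i))) 0 (?xs i)))"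
    by (rule PT_pieces[OF PT_op PT_const d(1) PT_un_0 xs d(2) fits])
  have "PT I N G (\<lambda>i. enc_wire (tree OR (pieces OR True (depth (weight (?xs i))) 0 (?xs i))))"
    by (rule PT_tree[OF PT_op p]) (use pieces_weight[OF fits ne] in \<open>auto intro!: poly_bounded_mono[OF d(2)]\<close>)
  from PT_snd[OF this] show ?thesis unfolding path_def path_of_def .
qed

lemma PT_conj_of:
  assumes "PT I N G (\<lambda>i. enc_list enc_pp (ps i))" "poly_bounded I N (\<lambda>i. pair_weight (ps i))"
    "\<And>i. i \<in> I \<Longrightarrow> ps i \<noteq> []"
  shows "PT I N G (\<lambda>i. enc_trm (conj_of (ps i)))"
  unfolding conj_of_def
proof (rule PT_snd[where ?e1.0 = enc_un], rule PT_tree[OF PT_op])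
  have *: "weight (map (\<lambda>p. (arr (snd p), snd p)) qs) \<le> pair_weight qs" for qs :: "adder_input pair list"
    by (induction qs) (auto simp: ready_def intro!: add_mono power_increasing)
  show "poly_bounded I N (\<lambda>i. weight (map (\<lambda>p. (arr (snd p), snd p)) (ps i)))"
    by (rule poly_bounded_mono[OF assms(2) _ *])
  let ?D = "{p. fst p \<in> I \<and> snd p \<in> set (ps (fst p))}"
  let ?G = "(\<lambda>p. enc_pp (snd p)) # map (\<lambda>g p. g (fst p)) G"
  have "poly_bounded ?D (\<lambda>p. N (fst p)) (\<lambda>p. pair_weight (ps (fst p)))" by (rule poly_bounded_fst[OF assms(2)]) auto
  then have r: "poly_bounded ?D (\<lambda>p. N (fst p)) (\<lambda>p. 2 ^ ready (snd p))"
    by (rule poly_bounded_mono) (auto intro: pair_weight_mem)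
  then have b: "poly_bounded ?D (\<lambda>p. N (fst p)) (\<lambda>p. 2 ^ arr (snd (snd p)))"
    by (rule poly_bounded_mono) (auto simp: ready_def intro!: power_increasing)
  have "PT ?D (\<lambda>p. N (fst p)) ?G (\<lambda>p. enc_pp (snd p))" by (rule PT_var) simp
  note t = PT_snd[OF this]
  have "PT ?D (\<lambda>p. N (fst p)) ?G (\<lambda>p. enc_wire (arr (snd (snd p)), snd (snd p)))"
    by (intro PT_pair[where ?e2.0 = enc_trm] PT_arr t b)
  then show "PT I N G (\<lambda>i. enc_list enc_wire (map (\<lambda>p. (arr (snd p), snd p)) (ps i)))"
    by (rule PT_map[where e = enc_pp and f = "\<lambda>_ p. (arr (snd p), snd p)", OF assms(1), rotated])
       (rule poly_bounded_mono[OF assms(2) _ length_le_pair_weight])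
qed (use assms(3) in simp)

lemma
  assumes "PT I N G (\<lambda>i. enc_list enc_pp (ps i))" "poly_bounded I N (\<lambda>i. pair_weight (ps i))"
    "\<And>i. i \<in> I \<Longrightarrow> ps i \<noteq> []"
  shows PT_block: "PT I N G (\<lambda>i. enc_pp (block (ps i)))"
    and PT_closed_block: "PT I N G (\<lambda>i. enc_pp (closed_block (ps i)))"
proof -
  have "PT I N G (\<lambda>i. enc_list enc_pp (rev (ps i)))"
    by (rule PT_rev[OF assms(1) poly_bounded_mono[OF assms(2) _ length_le_pair_weight]])
  then have p: "PT I N G (\<lambda>i. enc_trm (path (rev (ps i))))"
    by (rule PT_path) (use assms(2,3) in auto)
  have c: "PT I N G (\<lambda>i. enc_trm (conj_of (ps i)))" by (rule PT_conj_of[OF assms(1,2)]) (rule assms(3))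
  show "PT I N G (\<lambda>i. enc_pp (block (ps i)))" unfolding block_def by (rule PT_pair[where ?e1.0 = enc_trm and ?e2.0 = enc_trm, OF p c])
  show "PT I N G (\<lambda>i. enc_pp (closed_block (ps i)))" unfolding closed_block_def
    by (rule PT_pair[where ?e1.0 = enc_trm and ?e2.0 = enc_trm, OF p PT_Gt[OF PT_op p c]])
qed

lemma PT_compose:
  assumes "PT I N G (\<lambda>i. enc_pp (x i))" "PT I N G (\<lambda>i. enc_pp (y i))"
  shows "PT I N G (\<lambda>i. enc_pp (compose (x i) (y i)))"
  unfolding compose_def
  by (intro PT_pair[where ?e2.0 = enc_trm] PT_Gt PT_op PT_fst[OF assms(1)] PT_fst[OF assms(2)] PT_snd[OF assms(1)] PT_snd[OF assms(2)])

section \<open>Polynomial time for the adder\<close>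

lemma PT_un_half:
  assumes "PT I N G (\<lambda>i. enc_un (a i))" "poly_bounded I N a"
  shows "PT I N G (\<lambda>i. enc_un ((a i + 1) div 2))"
proof -
  have h: "(k + 1) div 2 = (LEAST h. k \<le> 2 * h)" for k :: nat
    by (rule Least_equality[symmetric]) auto
  have "PT I N G (\<lambda>i. enc_un (LEAST h. a i \<le> 2 * h))"
  proof (rule PT_Least)
    show "\<exists>h. a i \<le> 2 * h" for i by (rule exI[of _ "a i"]) simp
    show "poly_bounded I N (\<lambda>i. LEAST h. a i \<le> 2 * h)"
      unfolding h[symmetric] by (rule poly_bounded_mono[OF assms(2)]) auto
    let ?D = "{p. fst p \<in> I \<and> snd p \<le> (LEAST h. a (fst p) \<le> 2 * h)}"
    let ?G = "(\<lambda>p. enc_un (snd p)) # map (\<lambda>g p. g (fst p)) G"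
    have "poly_bounded ?D (\<lambda>p. N (fst p)) (\<lambda>p. a (fst p))" by (rule poly_bounded_fst[OF assms(2)]) auto
    then have s: "poly_bounded ?D (\<lambda>p. N (fst p)) snd"
      by (rule poly_bounded_mono) (auto simp: h[symmetric])
    have k: "PT ?D (\<lambda>p. N (fst p)) ?G (\<lambda>p. enc_un (snd p))" by (rule PT_var) simp
    have a: "PT ?D (\<lambda>p. N (fst p)) ?G (\<lambda>p. enc_un (a (fst p)))" by (rule PT_lift'[OF assms(1)]) auto
    show "PT ?D (\<lambda>p. N (fst p)) ?G (\<lambda>p. enc_bool (a (fst p) \<le> 2 * snd p))"
      by (rule PT_un_le[OF a PT_un_mult[OF PT_un_const k]]) (intro poly_bounded_mult poly_bounded_const s)+
  qed
  then show ?thesis unfolding h .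
qed

lemma PT_half:
  assumes "PT I N G (\<lambda>i. enc_list e (xs i))" "poly_bounded I N (\<lambda>i. length (xs i))"
  shows "PT I N G (\<lambda>i. enc_un (half (xs i)))" "poly_bounded I N (\<lambda>i. half (xs i))"
proof -
  show "PT I N G (\<lambda>i. enc_un (half (xs i)))" unfolding half_def by (rule PT_un_half[OF PT_length[OF assms] assms(2)])
  show "poly_bounded I N (\<lambda>i. half (xs i))" by (rule poly_bounded_mono[OF assms(2)]) (auto simp: half_def)
qed

lemma PT_short: 
  assumes "PT I N G (\<lambda>i. enc_list e (xs i))"
  shows "PT I N G (\<lambda>i. enc_bool (\<not> length (xs i) \<le> 1))"
proof -
  have "\<not> length us \<le> 1 \<longleftrightarrow> \<not> tl us = []" for us :: "'b list" by (cases us) (auto simp: le_Suc_eq)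
  then show ?thesis using PT_not[OF PT_null[OF PT_tl[OF assms]]] by simp
qed

lemma PT_sklansky:
  assumes "PT I N G (\<lambda>i. enc_list enc_pp (ps i))" "poly_bounded I N (\<lambda>i. length (ps i))"
  shows "PT I N G (\<lambda>i. enc_list enc_pp (sklansky (ps i)))"
proof -
  let ?S = "{p :: nat \<times> adder_input pair list. length (snd p) \<le> fst p}"
  let ?D = "{p \<in> ?S. \<not> length (snd p) \<le> 1}"
  let ?G = "[\<lambda>p. enc_list enc_pp (snd p)] :: (nat \<times> adder_input pair list \<Rightarrow> sexp) list"
  let ?l = "\<lambda>p. (fst p, take (half (snd p)) (snd p))" and ?r = "\<lambda>p. (fst p, drop (half (snd p)) (snd p))"
  have "PT ?S fst ?G (\<lambda>p. enc_list enc_pp (sklansky (snd p)))" (is "PT _ _ _ ?v")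
  proof (rule PT_rec2[where b = "\<lambda>p. \<not> length (snd p) \<le> 1" and l = ?l and r = ?r and m = "\<lambda>p. 2 * length (snd p) - 1"])
    have ps: "PT D fst ?G (\<lambda>p. enc_list enc_pp (snd p))" for D by (rule PT_var) simp
    have b: "poly_bounded ?D fst (\<lambda>p. length (snd p))" by (rule poly_bounded_le) auto
    note h = PT_half[OF ps b]
    show "PT ?S fst ?G (\<lambda>p. enc_bool (\<not> length (snd p) \<le> 1))" by (rule PT_short[OF ps])
    show "PT ?D fst ?G (\<lambda>p. g (?l p))" "PT ?D fst ?G (\<lambda>p. g (?r p))" if "g \<in> set ?G" for g
      using that PT_take[OF h(1) ps h(2) b] PT_drop[OF h(1) ps h(2)] by auto
    let ?H = "(\<lambda>p. ?v (?l p)) # (\<lambda>p. ?v (?r p)) # ?G"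
    have half: "0 < half (snd p) \<and> half (snd p) < length (snd p)" if "p \<in> ?D" for p
      using half_bounds[of "snd p"] that by auto
    have l: "PT ?D fst ?H (\<lambda>p. enc_list enc_pp (sklansky (take (half (snd p)) (snd p))))"
      and r: "PT ?D fst ?H (\<lambda>p. enc_list enc_pp (sklansky (drop (half (snd p)) (snd p))))"
      by (rule PT_var; simp)+
    have lb: "poly_bounded ?D fst (\<lambda>p. length (sklansky (take (half (snd p)) (snd p))))"
      and rb: "poly_bounded ?D fst (\<lambda>p. length (sklansky (drop (half (snd p)) (snd p))))"
      by (rule poly_bounded_mono[OF b]; simp)+
    have c: "PT ?D fst ?H (\<lambda>p. enc_pp (last (sklansky (take (half (snd p)) (snd p)))))"
    proof (rule PT_last[OF l lb])
      show "sklansky (take (half (snd p)) (snd p)) \<noteq> []" if "p \<in> ?D" for p using half[OF that] by auto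
    qed
    have "PT ?D fst ?H (\<lambda>p. enc_list enc_pp (map (\<lambda>x. compose x (last (sklansky (take (half (snd p)) (snd p))))) (sklansky (drop (half (snd p)) (snd p)))))"
      by (rule PT_map[where e = enc_pp and f = "\<lambda>p x. compose x (last (sklansky (take (half (snd p)) (snd p))))", OF r rb],
          rule PT_compose, rule PT_var, simp, rule PT_lift'[OF c], simp)
    then have "PT ?D fst ?H (\<lambda>p. enc_list enc_pp (sklansky (take (half (snd p)) (snd p)) @
        map (\<lambda>x. compose x (last (sklansky (take (half (snd p)) (snd p))))) (sklansky (drop (half (snd p)) (snd p)))))"
      by (rule PT_append[OF l _ lb])
    then show "PT ?D fst ?H ?v"
      by (rule PT_cong[rotated]) (subst sklansky.simps, simp)
    show "PT {p \<in> ?S. \<not> \<not> length (snd p) \<le> 1} fst ?G ?v"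
      by (rule PT_cong[OF _ ps]) (subst sklansky.simps, simp)
    show "poly_bounded ?S fst (\<lambda>p. 2 * length (snd p) - 1)"
    proof (rule poly_bounded_mono)
      show "poly_bounded ?S fst (\<lambda>p. 2 * length (snd p))"
        by (intro poly_bounded_mult poly_bounded_const poly_bounded_le) auto
    qed auto
    show "?l p \<in> ?S \<and> fst (?l p) \<le> fst p \<and> ?r p \<in> ?S \<and> fst (?r p) \<le> fst p \<and>
      2 * length (snd (?l p)) - 1 + (2 * length (snd (?r p)) - 1) < 2 * length (snd p) - 1"
      if "p \<in> ?S" "\<not> length (snd p) \<le> 1" for p using half[of p] that by auto
  qed
  then have "PT I N G (\<lambda>i. ?v (length (ps i), ps i))"
    by (rule PT_call[where \<phi> = "\<lambda>i. (length (ps i), ps i)"]) (use assms in \<open>auto intro!: PTsI\<close>)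
  then show ?thesis by (simp del: sklansky.simps)
qed

lemma PT_chunk:
  assumes "PT I N G (\<lambda>i. enc_un (q i))" "PT I N G (\<lambda>i. enc_list e (xs i))"
    "poly_bounded I N q" "poly_bounded I N (\<lambda>i. length (xs i))"
  shows "PT I N G (\<lambda>i. enc_list (enc_list e) (chunk (q i) (xs i)))"
proof -
  let ?S = "{p :: nat \<times> nat \<times> 'b list. fst (snd p) \<le> fst p \<and> length (snd (snd p)) \<le> fst p}"
  let ?b = "\<lambda>p. snd (snd p) \<noteq> [] \<and> fst (snd p) \<noteq> 0"
  let ?D = "{p \<in> ?S. ?b p}"
  let ?G = "[\<lambda>p. enc_un (fst (snd p)), \<lambda>p. enc_list e (snd (snd p))] :: (nat \<times> nat \<times> 'b list \<Rightarrow> sexp) list"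
  let ?l = "\<lambda>p. (fst p, fst (snd p), drop (fst (snd p)) (snd (snd p)))"
  have "PT ?S fst ?G (\<lambda>p. enc_list (enc_list e) (chunk (fst (snd p)) (snd (snd p))))" (is "PT _ _ _ ?v")
  proof (rule PT_rec1[where b = ?b and l = ?l and m = "\<lambda>p. length (snd (snd p))"])
    have q: "PT D fst (H @ ?G) (\<lambda>p. enc_un (fst (snd p)))" and xs: "PT D fst (H @ ?G) (\<lambda>p. enc_list e (snd (snd p)))" for D H by (rule PT_var; simp)+
    note q0 = q[of _ "[]", unfolded append_Nil] and xs0 = xs[of _ "[]", unfolded append_Nil]
    note q1 = q[of _ "[\<lambda>p. ?v (?l p)]", unfolded append.simps] and xs1 = xs[of _ "[\<lambda>p. ?v (?l p)]", unfolded append.simps]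
    have b: "poly_bounded ?D fst (\<lambda>p. fst (snd p))" "poly_bounded ?D fst (\<lambda>p. length (snd (snd p)))" by (rule poly_bounded_le; auto)+
    show "PT ?S fst ?G (\<lambda>p. enc_bool (?b p))" by (intro PT_conj PT_not PT_null[OF xs0] PT_un_is_0 q0)
    show "PT ?D fst ?G (\<lambda>p. g (?l p))" if "g \<in> set ?G" for g
      using that q0 PT_drop[OF q0 xs0 b(1)] by auto
    have "PT ?D fst ((\<lambda>p. ?v (?l p)) # ?G) (\<lambda>p. enc_list (enc_list e) (take (fst (snd p)) (snd (snd p)) # chunk (fst (snd p)) (drop (fst (snd p)) (snd (snd p)))))"
      by (rule PT_Cons[where e = "enc_list e", OF PT_take[OF q1 xs1 b]], rule PT_var) simp
    then show "PT ?D fst ((\<lambda>p. ?v (?l p)) # ?G) ?v"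
      by (rule PT_cong[rotated]) (subst chunk.simps, simp)
    show "PT {p \<in> ?S. \<not> ?b p} fst ?G ?v"
      by (rule PT_cong[OF _ PT_Leaf]) (subst chunk.simps, auto)
    show "poly_bounded ?S fst (\<lambda>p. length (snd (snd p)))" by (rule poly_bounded_le) auto
  qed auto
  then have "PT I N G (\<lambda>i. ?v (q i + length (xs i), q i, xs i))"
    by (rule PT_call[where \<phi> = "\<lambda>i. (q i + length (xs i), q i, xs i)"]) (use assms in \<open>auto intro!: PTsI poly_bounded_add\<close>)
  then show ?thesis by (simp del: chunk.simps)
qed

lemma PT_zip:
  assumes "PT I N G (\<lambda>i. enc_list e (xs i))" "PT I N G (\<lambda>i. enc_list e' (ys i))" "poly_bounded I N (\<lambda>i. length (xs i))"
  shows "PT I N G (\<lambda>i. enc_list (enc_pair e e') (zip (xs i) (ys i)))"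
proof -
  let ?S = "{p :: nat \<times> 'b list \<times> 'c list. length (fst (snd p)) \<le> fst p}"
  let ?b = "\<lambda>p. fst (snd p) \<noteq> [] \<and> snd (snd p) \<noteq> []"
  let ?D = "{p \<in> ?S. ?b p}"
  let ?G = "[\<lambda>p. enc_list e (fst (snd p)), \<lambda>p. enc_list e' (snd (snd p))] :: (nat \<times> 'b list \<times> 'c list \<Rightarrow> sexp) list"
  let ?l = "\<lambda>p. (fst p, tl (fst (snd p)), tl (snd (snd p)))"
  have "PT ?S fst ?G (\<lambda>p. enc_list (enc_pair e e') (zip (fst (snd p)) (snd (snd p))))" (is "PT _ _ _ ?v")
  proof (rule PT_rec1[where b = ?b and l = ?l and m = "\<lambda>p. length (fst (snd p))"])
    have xs: "PT D fst (H @ ?G) (\<lambda>p. enc_list e (fst (snd p)))" and ys: "PT D fst (H @ ?G) (\<lambda>p. enc_list e' (snd (snd p)))" for D H by (rule PT_var; simp)+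
    note xs0 = xs[of _ "[]", unfolded append_Nil] and ys0 = ys[of _ "[]", unfolded append_Nil]
    note xs1 = xs[of _ "[\<lambda>p. ?v (?l p)]", unfolded append.simps] and ys1 = ys[of _ "[\<lambda>p. ?v (?l p)]", unfolded append.simps]
    show "PT ?S fst ?G (\<lambda>p. enc_bool (?b p))" by (intro PT_conj PT_not PT_null[OF xs0] PT_null[OF ys0])
    show "PT ?D fst ?G (\<lambda>p. g (?l p))" if "g \<in> set ?G" for g
      using that PT_tl[OF xs0] PT_tl[OF ys0] by auto
    have "PT ?D fst ((\<lambda>p. ?v (?l p)) # ?G) (\<lambda>p. enc_pair e e' (hd (fst (snd p)), hd (snd (snd p))))"
      by (intro PT_pair PT_hd[OF xs1] PT_hd[OF ys1]) auto
    then have "PT ?D fst ((\<lambda>p. ?v (?l p)) # ?G) (\<lambda>p. enc_list (enc_pair e e') ((hd (fst (snd p)), hd (snd (snd p))) # zip (tl (fst (snd p))) (tl (snd (snd p)))))"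
      by (rule PT_Cons) (rule PT_var, simp)
    then show "PT ?D fst ((\<lambda>p. ?v (?l p)) # ?G) ?v"
    proof (rule PT_cong[rotated])
      fix p assume "p \<in> ?D"
      then show "?v p = enc_list (enc_pair e e') ((hd (fst (snd p)), hd (snd (snd p))) # zip (tl (fst (snd p))) (tl (snd (snd p))))"
        by (cases "fst (snd p)"; cases "snd (snd p)") auto
    qed
    show "PT {p \<in> ?S. \<not> ?b p} fst ?G ?v" by (rule PT_cong[OF _ PT_Leaf]) auto
    show "poly_bounded ?S fst (\<lambda>p. length (fst (snd p)))" by (rule poly_bounded_le) auto
  qed auto
  then have "PT I N G (\<lambda>i. ?v (length (xs i), xs i, ys i))"
    by (rule PT_call[where \<phi> = "\<lambda>i. (length (xs i), xs i, ys i)"]) (use assms in \<open>auto intro!: PTsI\<close>)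
  then show ?thesis by simp
qed

lemma length_concat_zip: "length (concat (map (\<lambda>p. map (g p) (snd p)) (zip cs pss))) \<le> length (concat pss)"
proof (induction pss arbitrary: cs)
  case (Cons ps pss)
  then show ?case by (cases cs) auto
qed simp

lemma length_mem_concat: "ps \<in> set pss \<Longrightarrow> length ps \<le> length (concat pss)"
  by (induction pss) auto

lemma length_tl_concat: "length (concat (tl pss)) \<le> length (concat pss)"
  by (cases pss) auto

lemma PT_combine:
  assumes "PT I N G (\<lambda>i. enc_list (enc_list enc_pp) (pss i))" "PT I N G (\<lambda>i. enc_list enc_pp (cs i))"
    "poly_bounded I N (\<lambda>i. length (cs i))" "poly_bounded I N (\<lambda>i. length (concat (pss i)))"
  shows "PT I N G (\<lambda>i. enc_list enc_pp (combine (pss i) (cs i)))"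
proof -
  let ?N = "{i \<in> I. pss i = []}" and ?D = "{i \<in> I. \<not> pss i = []}"
  have sub: "?D \<subseteq> I" by auto
  note pss = PT_subset[OF assms(1) sub] and cs = PT_subset[OF assms(2) sub]
  have cb: "poly_bounded ?D N (\<lambda>i. length (cs i))" by (rule poly_bounded_mono[OF assms(3)]) auto
  have pb: "poly_bounded ?D N (\<lambda>i. length (concat (pss i)))" by (rule poly_bounded_mono[OF assms(4)]) auto
  have hd: "PT ?D N G (\<lambda>i. enc_list enc_pp (hd (pss i)))" by (rule PT_hd[OF pss]) auto
  have hb: "poly_bounded ?D N (\<lambda>i. length (hd (pss i)))"
    by (rule poly_bounded_mono[OF pb]) (auto intro: length_mem_concat)
  note z = PT_zip[OF cs PT_tl[OF pss] cb]
  have zb: "poly_bounded ?D N (\<lambda>i. length (zip (cs i) (tl (pss i))))"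
    by (rule poly_bounded_mono[OF cb]) auto
  let ?f = "\<lambda>p. map (\<lambda>y. compose y (fst p)) (snd p)"
  let ?E = "{p. fst p \<in> ?D \<and> snd p \<in> set (zip (cs (fst p)) (tl (pss (fst p))))}"
  let ?H = "(\<lambda>p. enc_pair enc_pp (enc_list enc_pp) (snd p)) # map (\<lambda>g p. g (fst p)) G"
  have x: "PT ?E (\<lambda>p. N (fst p)) ?H (\<lambda>p. enc_pair enc_pp (enc_list enc_pp) (snd p))" by (rule PT_var) simp
  have "poly_bounded ?E (\<lambda>p. N (fst p)) (\<lambda>p. length (concat (pss (fst p))))" by (rule poly_bounded_fst[OF pb]) auto
  then have xb: "poly_bounded ?E (\<lambda>p. N (fst p)) (\<lambda>p. length (snd (snd p)))"
  proof (rule poly_bounded_mono)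
    fix p assume "p \<in> ?E"
    then have "snd (snd p) \<in> set (tl (pss (fst p)))" using set_zip_rightD[of "fst (snd p)" "snd (snd p)"] by auto
    then show "length (snd (snd p)) \<le> length (concat (pss (fst p)))"
      by (rule order_trans[OF length_mem_concat length_tl_concat])
  qed
  have f: "PT ?E (\<lambda>p. N (fst p)) ?H (\<lambda>p. enc_list enc_pp (?f (snd p)))"
    by (rule PT_map[where e = enc_pp and f = "\<lambda>p y. compose y (fst (snd p))", OF PT_snd[OF x] xb],
        rule PT_compose, rule PT_var, simp, rule PT_lift'[OF PT_fst[OF x]], simp)
  have "PT ?D N G (\<lambda>i. enc_list (enc_list enc_pp) (map ?f (zip (cs i) (tl (pss i)))))"
    by (rule PT_map[where e = "enc_pair enc_pp (enc_list enc_pp)" and f = "\<lambda>_. ?f", OF z zb f])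
  then have "PT ?D N G (\<lambda>i. enc_list enc_pp (concat (map ?f (zip (cs i) (tl (pss i))))))"
  proof (rule PT_concat)
    show "poly_bounded ?D N (\<lambda>i. length (map ?f (zip (cs i) (tl (pss i)))))" using zb by simp
    show "poly_bounded ?D N (\<lambda>i. length (concat (map ?f (zip (cs i) (tl (pss i))))))"
      by (rule poly_bounded_mono[OF pb _ order_trans[OF length_concat_zip length_tl_concat]])
  qed
  then have "PT ?D N G (\<lambda>i. enc_list enc_pp (hd (pss i) @ concat (map ?f (zip (cs i) (tl (pss i))))))"
    by (rule PT_append[OF hd _ hb])
  from PT_if[OF PT_null[OF assms(1)] PT_Nil[where e = enc_pp] this] show ?thesis
    unfolding combine_def by (simp add: if_distrib cong: if_cong)
qed

text \<open>A depth in closed form, far from optimal; it is only used to show that weights stay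
  polynomial.\<close>

lemma deep_enough_linear: "deep_enough (16 * m + 6) m"
proof -
  have "8 * m \<le> 2 ^ (8 * m)" by (rule less_imp_le) (rule less_exp)
  with linear_le_power[of "8 * m"] have "(6 * (8 * m) + 20) * (8 * m) \<le> 2 ^ (8 * m + 5) * 2 ^ (8 * m)" by (rule mult_le_mono)
  also have "\<dots> \<le> 2 ^ (16 * m + 6)" unfolding power_add[symmetric] by (intro power_increasing) auto
  finally show ?thesis by (simp add: deep_enough_def algebra_simps)
qed

text \<open>The coefficient is 6 (3 (16 m + 6) - 1), where 6 is an integer above 36 / 7 = 2 * 18 /
  7.\<close>

lemma closed_block_linear:
  assumes "ps \<noteq> []" "length ps \<le> m"
  shows "2 ^ ready (closed_block ps) \<le> (288 * m + 102) * pair_weight ps"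
proof -
  have "real (2 ^ ready (closed_block ps)) \<le> 2 * path_factor (16 * m + 6) * pair_weight ps"
    using block_bounds(2)[OF deep_enough_mono[OF deep_enough_linear assms(2)] assms(1)] by simp
  also have "\<dots> \<le> real (288 * m + 102) * pair_weight ps"
    by (rule mult_right_mono) (simp_all add: path_factor_def)
  finally show ?thesis unfolding of_nat_mult[symmetric] of_nat_le_iff .
qed

lemma PT_boundary_carries:
  assumes "PT I N G (\<lambda>i. enc_list enc_pp (acc i))" "PT I N G (\<lambda>i. enc_list enc_pp (ps i))"
    "poly_bounded I N (\<lambda>i. pair_weight (acc i))" "poly_bounded I N (\<lambda>i. pair_weight (ps i))"
  shows "PT I N G (\<lambda>i. enc_list enc_pp (boundary_carries (acc i) (ps i)))"
proof -
  \<comment> \<open>The invariant of the delay bound in integers: the weight of \<open>acc\<close>,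
    plus that of \<open>ps\<close> with the price of becoming closed blocks charged in advance, does
    not grow. \<open>m\<close> bounds the initial length and thereby keeps the coefficient
    fixed.\<close>
  define S where "S = {p :: nat \<times> adder_input pair list \<times> adder_input pair list.
    \<exists>m. length (snd (snd p)) \<le> m \<and> pair_weight (fst (snd p)) + (288 * m + 102) * pair_weight (snd (snd p)) \<le> fst p}"
  let ?b = "\<lambda>p. \<not> length (snd (snd p)) \<le> 1"
  let ?D = "{p \<in> S. ?b p}"
  let ?G = "[\<lambda>p. enc_list enc_pp (fst (snd p)), \<lambda>p. enc_list enc_pp (snd (snd p))]
    :: (nat \<times> adder_input pair list \<times> adder_input pair list \<Rightarrow> sexp) list"
  let ?T = "\<lambda>p. take (half (snd (snd p))) (snd (snd p))" and ?R = "\<lambda>p. drop (half (snd (snd p))) (snd (snd p))"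
  let ?l = "\<lambda>p. (fst p, fst (snd p), ?T p)" and ?r = "\<lambda>p. (fst p, closed_block (?T p) # fst (snd p), ?R p)"
  have w: "pair_weight (fst (snd p)) + pair_weight (snd (snd p)) \<le> fst p" if "p \<in> S" for p
  proof -
    from that obtain m where "pair_weight (fst (snd p)) + (288 * m + 102) * pair_weight (snd (snd p)) \<le> fst p"
      unfolding S_def by auto
    moreover have "1 * pair_weight (snd (snd p)) \<le> (288 * m + 102) * pair_weight (snd (snd p))" by (rule mult_le_mono1) simp
    ultimately show ?thesis unfolding mult_1 by (rule order_trans[OF add_left_mono, rotated])
  qed
  have "PT S fst ?G (\<lambda>p. enc_list enc_pp (boundary_carries (fst (snd p)) (snd (snd p))))" (is "PT _ _ _ ?v")
  proof (rule PT_rec2[where b = ?b and l = ?l and r = ?r and m = "\<lambda>p. 2 * length (snd (snd p)) - 1"])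
    have acc: "PT D fst ?G (\<lambda>p. enc_list enc_pp (fst (snd p)))" and ps: "PT D fst ?G (\<lambda>p. enc_list enc_pp (snd (snd p)))" for D by (rule PT_var; simp)+
    have b: "poly_bounded D fst (\<lambda>p. length (snd (snd p)))" "poly_bounded D fst (\<lambda>p. pair_weight (fst (snd p)) + pair_weight (snd (snd p)))" if "D \<subseteq> S" for D
    proof -
      show *: "poly_bounded D fst (\<lambda>p. pair_weight (fst (snd p)) + pair_weight (snd (snd p)))"
        by (rule poly_bounded_le) (use w that in blast)
      show "poly_bounded D fst (\<lambda>p. length (snd (snd p)))"
        by (rule poly_bounded_mono[OF *]) (use length_le_pair_weight in \<open>auto intro: trans_le_add2\<close>)
    qed
    have sub: "?D \<subseteq> S" by auto
    note h = PT_half[OF ps b(1)[OF sub]]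
    have half: "0 < half (snd (snd p)) \<and> half (snd (snd p)) < length (snd (snd p))" if "?b p" for p
      using half_bounds[of "snd (snd p)"] that by auto
    have pw: "pair_weight (?T p) + pair_weight (?R p) = pair_weight (snd (snd p))" for p
      unfolding pair_weight_simps(3)[symmetric] by simp
    have T: "PT ?D fst ?G (\<lambda>p. enc_list enc_pp (?T p))" by (rule PT_take[OF h(1) ps h(2) b(1)[OF sub]])
    have cb: "PT ?D fst ?G (\<lambda>p. enc_pp (closed_block (?T p)))"
    proof (rule PT_closed_block[OF T])
      show "poly_bounded ?D fst (\<lambda>p. pair_weight (?T p))"
      proof (rule poly_bounded_mono[OF b(2)[OF sub]])
        show "pair_weight (?T p) \<le> pair_weight (fst (snd p)) + pair_weight (snd (snd p))" for p
          using pw[of p] by linarith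
      qed
      show "?T p \<noteq> []" if "p \<in> ?D" for p using half[of p] that by auto
    qed
    show "PT S fst ?G (\<lambda>p. enc_bool (?b p))" by (rule PT_short[OF ps])
    show "PT ?D fst ?G (\<lambda>p. g (?l p))" if "g \<in> set ?G" for g
      using that acc T by auto
    show "PT ?D fst ?G (\<lambda>p. g (?r p))" if "g \<in> set ?G" for g
      using that PT_Cons[where e = enc_pp, OF cb acc] PT_drop[OF h(1) ps h(2)] by auto
    have "PT ?D fst ((\<lambda>p. ?v (?l p)) # (\<lambda>p. ?v (?r p)) # ?G) (\<lambda>p. enc_list enc_pp
        (boundary_carries (fst (snd p)) (?T p) @ boundary_carries (closed_block (?T p) # fst (snd p)) (?R p)))"
    proof (rule PT_append)
      show "poly_bounded ?D fst (\<lambda>p. length (boundary_carries (fst (snd p)) (?T p)))"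
        by (rule poly_bounded_mono[OF b(1)[OF sub]]) auto
    qed (rule PT_var, simp)+
    then show "PT ?D fst ((\<lambda>p. ?v (?l p)) # (\<lambda>p. ?v (?r p)) # ?G) ?v"
      by (rule PT_cong[rotated]) (subst boundary_carries.simps, simp)
    let ?D' = "{p \<in> S. \<not> ?b p}"
    have sub': "?D' \<subseteq> S" by auto
    let ?E = "{q. fst q \<in> ?D' \<and> snd q \<in> set (snd (snd (fst q)))}"
    let ?H = "(\<lambda>q. enc_pp (snd q)) # map (\<lambda>g q. g (fst q)) ?G"
    have "PT ?E (\<lambda>q. fst (fst q)) ?H (\<lambda>q. enc_list enc_pp (snd q # fst (snd (fst q))))"
      by (rule PT_Cons; rule PT_var; simp)
    then have "PT ?E (\<lambda>q. fst (fst q)) ?H (\<lambda>q. enc_trm (path (snd q # fst (snd (fst q)))))"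
    proof (rule PT_path)
      have "poly_bounded ?E (\<lambda>q. fst (fst q)) (\<lambda>q. pair_weight (fst (snd (fst q))) + pair_weight (snd (snd (fst q))))"
        by (rule poly_bounded_fst[OF b(2)[OF sub']]) auto
      then show "poly_bounded ?E (\<lambda>q. fst (fst q)) (\<lambda>q. pair_weight (snd q # fst (snd (fst q))))"
      proof (rule poly_bounded_mono)
        fix q assume "q \<in> ?E"
        then have "2 ^ ready (snd q) \<le> pair_weight (snd (snd (fst q)))" by (intro pair_weight_mem) simp
        then show "pair_weight (snd q # fst (snd (fst q))) \<le> pair_weight (fst (snd (fst q))) + pair_weight (snd (snd (fst q)))" by simp
      qed
    qed simp
    then have "PT ?E (\<lambda>q. fst (fst q)) ?H (\<lambda>q. enc_pp (path (snd q # fst (snd (fst q))), path (snd q # fst (snd (fst q)))))"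
      by (intro PT_pair[where ?e2.0 = enc_trm])
    then have "PT ?D' fst ?G (\<lambda>p. enc_list enc_pp (map (\<lambda>x. (path (x # fst (snd p)), path (x # fst (snd p)))) (snd (snd p))))"
      by (rule PT_map[where e = enc_pp and f = "\<lambda>p x. (path (x # fst (snd p)), path (x # fst (snd p)))", OF ps b(1)[OF sub']])
    then show "PT ?D' fst ?G ?v"
      by (rule PT_cong[rotated]) (subst boundary_carries.simps, simp)
    show "poly_bounded S fst (\<lambda>p. 2 * length (snd (snd p)) - 1)"
    proof (rule poly_bounded_mono)
      show "poly_bounded S fst (\<lambda>p. 2 * length (snd (snd p)))"
        by (intro poly_bounded_mult poly_bounded_const b order_refl)
    qed auto
    show "?l p \<in> S \<and> fst (?l p) \<le> fst p \<and> ?r p \<in> S \<and> fst (?r p) \<le> fst p \<and>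
      2 * length (snd (snd (?l p))) - 1 + (2 * length (snd (snd (?r p))) - 1) < 2 * length (snd (snd p)) - 1"
      if p: "p \<in> S" "?b p" for p
    proof -
      obtain m where m: "length (snd (snd p)) \<le> m" "pair_weight (fst (snd p)) + (288 * m + 102) * pair_weight (snd (snd p)) \<le> fst p"
        using p(1) unfolding S_def by auto
      have "2 ^ ready (closed_block (?T p)) \<le> (288 * m + 102) * pair_weight (?T p)"
        by (rule closed_block_linear) (use half[OF p(2)] m(1) in auto)
      moreover have "(288 * m + 102) * pair_weight (?T p) + (288 * m + 102) * pair_weight (?R p) = (288 * m + 102) * pair_weight (snd (snd p))"
        unfolding distrib_left[symmetric] pw ..
      ultimately have "?l p \<in> S" "?r p \<in> S" unfolding S_def using m by (auto intro!: exI[of _ m])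
      then show ?thesis using half[OF p(2)] by auto
    qed
  qed
  then have "PT I N G (\<lambda>i. ?v (pair_weight (acc i) + (288 * pair_weight (ps i) + 102) * pair_weight (ps i), acc i, ps i))"
  proof (rule PT_call[where \<phi> = "\<lambda>i. (pair_weight (acc i) + (288 * pair_weight (ps i) + 102) * pair_weight (ps i), acc i, ps i)"])
    show "(pair_weight (acc i) + (288 * pair_weight (ps i) + 102) * pair_weight (ps i), acc i, ps i) \<in> S" for i
      unfolding S_def using length_le_pair_weight[of "ps i"] by auto
    show "poly_bounded I N (\<lambda>i. fst (pair_weight (acc i) + (288 * pair_weight (ps i) + 102) * pair_weight (ps i), acc i, ps i))"
      unfolding fst_conv by (intro poly_bounded_add poly_bounded_mult poly_bounded_const assms)
  qed (use assms in \<open>auto intro!: PTsI\<close>)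
  then show ?thesis by (simp del: boundary_carries.simps)
qed

lemma poly_bounded_chunk:
  assumes "\<And>i. i \<in> I \<Longrightarrow> 0 < q i" "poly_bounded I N (\<lambda>i. length (ps i))"
  shows "poly_bounded I N (\<lambda>i. length (chunk (q i) (ps i)))"
  by (rule poly_bounded_mono[OF assms(2)]) (use assms(1) length_chunk_le in auto)

text \<open>Collects what the treatment of a single block may use: it is nonempty, its weight is
  bounded by that of the whole list, and values and bounds of the outer instance remain
  available.\<close>

lemma PT_map_chunk:
  assumes q: "PT I N G (\<lambda>i. enc_un (q i))" and ps: "PT I N G (\<lambda>i. enc_list enc_pp (ps i))"
    and qb: "poly_bounded I N q" "\<And>i. i \<in> I \<Longrightarrow> 0 < q i" and w: "poly_bounded I N (\<lambda>i. pair_weight (ps i))"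
    and body: "\<And>I' N' G'. PT I' N' G' (\<lambda>p. enc_list enc_pp (snd p)) \<Longrightarrow> poly_bounded I' N' (\<lambda>p. pair_weight (snd p)) \<Longrightarrow>
      (\<And>p. p \<in> I' \<Longrightarrow> fst p \<in> I \<and> snd p \<noteq> []) \<Longrightarrow>
      (\<And>u. PT I N G u \<Longrightarrow> PT I' N' G' (\<lambda>p. u (fst p))) \<Longrightarrow> (\<And>T. poly_bounded I N T \<Longrightarrow> poly_bounded I' N' (\<lambda>p. T (fst p))) \<Longrightarrow>
      PT I' N' G' (\<lambda>p :: 'w \<times> adder_input pair list. e (h (fst p) (snd p)))"
  shows "PT I N G (\<lambda>i::'w. enc_list e (map (h i) (chunk (q i) (ps i))))"
proof -
  have l: "poly_bounded I N (\<lambda>i. length (ps i))" by (rule poly_bounded_mono[OF w _ length_le_pair_weight])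
  show ?thesis
  proof (rule PT_map[where e = "enc_list enc_pp", OF PT_chunk[OF q ps qb(1) l] poly_bounded_chunk[OF qb(2) l]], assumption, rule body)
    let ?D = "{p. fst p \<in> I \<and> snd p \<in> set (chunk (q (fst p)) (ps (fst p)))}"
    show "PT ?D (\<lambda>p. N (fst p)) ((\<lambda>p. enc_list enc_pp (snd p)) # map (\<lambda>g p. g (fst p)) G) (\<lambda>p. enc_list enc_pp (snd p))"
      by (rule PT_var) simp
    show b: "poly_bounded ?D (\<lambda>p. N (fst p)) (\<lambda>p. T (fst p))" if "poly_bounded I N T" for T
      by (rule poly_bounded_fst[OF that]) auto
    show "poly_bounded ?D (\<lambda>p. N (fst p)) (\<lambda>p. pair_weight (snd p))"
      by (rule poly_bounded_mono[OF b[OF w]]) (use qb(2) pair_weight_chunk_le in auto)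
    show "PT ?D (\<lambda>p. N (fst p)) ((\<lambda>p. enc_list enc_pp (snd p)) # map (\<lambda>g p. g (fst p)) G) (\<lambda>p. u (fst p))" if "PT I N G u" for u
      by (rule PT_lift'[OF that]) auto
    show "fst p \<in> I \<and> snd p \<noteq> []" if "p \<in> ?D" for p
      using that chunk_props(2)[OF qb(2), of "fst p" "ps (fst p)"] by auto
  qed
qed

lemma length_group_prefix: "0 < q \<Longrightarrow> length (group_prefix q ps) = length ps"
  unfolding group_prefix_def using chunk_props(1)[of q ps] by (simp add: length_combine)

lemma PT_group_prefix:
  assumes "PT I N G (\<lambda>i. enc_un (q i))" "PT I N G (\<lambda>i. enc_list enc_pp (ps i))"
    "poly_bounded I N q" "\<And>i. i \<in> I \<Longrightarrow> 0 < q i" "poly_bounded I N (\<lambda>i. pair_weight (ps i))"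
  shows "PT I N G (\<lambda>i. enc_list enc_pp (group_prefix (q i) (ps i)))"
  unfolding group_prefix_def
proof (rule PT_combine)
  have l: "poly_bounded I N (\<lambda>i. length (ps i))" by (rule poly_bounded_mono[OF assms(5) _ length_le_pair_weight])
  note cl = poly_bounded_chunk[OF assms(4) l]
  show "PT I N G (\<lambda>i. enc_list (enc_list enc_pp) (map sklansky (chunk (q i) (ps i))))"
    by (rule PT_map_chunk[where h = "\<lambda>_. sklansky", OF assms], assumption)
       (erule PT_sklansky, erule poly_bounded_mono[OF _ _ length_le_pair_weight], assumption)
  have "PT I N G (\<lambda>i. enc_list enc_pp (map block (chunk (q i) (ps i))))"
    by (rule PT_map_chunk[where h = "\<lambda>_. block", OF assms], assumption) (rule PT_block; simp)
  then show "PT I N G (\<lambda>i. enc_list enc_pp (sklansky (map block (chunk (q i) (ps i)))))"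
    by (rule PT_sklansky) (use cl in simp)
  show "poly_bounded I N (\<lambda>i. length (sklansky (map block (chunk (q i) (ps i)))))"
    using cl by simp
  show "poly_bounded I N (\<lambda>i. length (concat (map sklansky (chunk (q i) (ps i)))))"
  proof (rule poly_bounded_mono[OF l])
    have "length (concat (map sklansky css)) = length (concat css)" for css :: "adder_input pair list list"
      by (induction css) auto
    then show "length (concat (map sklansky (chunk (q i) (ps i)))) \<le> length (ps i)" if "i \<in> I" for i
      using chunk_props(1)[OF assms(4)[OF that], of "ps i"] by simp
  qed
qed

lemma PT_adder:
  assumes "PT I N G (\<lambda>i. enc_un (q i))" "PT I N G (\<lambda>i. enc_list enc_pp (ps i))"
    "poly_bounded I N q" "\<And>i. i \<in> I \<Longrightarrow> 0 < q i" "poly_bounded I N (\<lambda>i. pair_weight (ps i))"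
  shows "PT I N G (\<lambda>i. enc_list enc_pp (adder (q i) (ps i)))"
  unfolding adder_def
proof (rule PT_combine)
  have l: "poly_bounded I N (\<lambda>i. length (ps i))" by (rule poly_bounded_mono[OF assms(5) _ length_le_pair_weight])
  have qq: "PT I N G (\<lambda>i. enc_un (q i * q i))" "poly_bounded I N (\<lambda>i. q i * q i)" "\<And>i. i \<in> I \<Longrightarrow> 0 < q i * q i"
    using assms(4) by (auto intro!: PT_un_mult poly_bounded_mult assms(1,3))
  note cl = poly_bounded_chunk[OF qq(3) l]
  show "PT I N G (\<lambda>i. enc_list (enc_list enc_pp) (map (group_prefix (q i)) (chunk (q i * q i) (ps i))))"
    by (rule PT_map_chunk[where h = "\<lambda>i. group_prefix (q i)", OF qq(1) assms(2) qq(2,3) assms(5)], assumption)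
       (rule PT_group_prefix, use assms(1,3,4) in auto)
  have cb: "PT I N G (\<lambda>i. enc_list enc_pp (map closed_block (chunk (q i * q i) (ps i))))"
    by (rule PT_map_chunk[where h = "\<lambda>_. closed_block", OF qq(1) assms(2) qq(2,3) assms(5)], assumption) (rule PT_closed_block; simp)
  have *: "pair_weight (map closed_block css) \<le> (288 * m + 102) * (\<Sum>c\<leftarrow>css. pair_weight c)"
    if "\<forall>c\<in>set css. c \<noteq> [] \<and> length c \<le> m" for css :: "adder_input pair list list" and m
    using that
  proof (induction css)
    case (Cons c css)
    then show ?case using closed_block_linear[of c m] by (simp add: distrib_left)
  qed simp
  have "poly_bounded I N (\<lambda>i. (288 * length (ps i) + 102) * pair_weight (ps i))"
    by (intro poly_bounded_add poly_bounded_mult poly_bounded_const l assms)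
  then have cw: "poly_bounded I N (\<lambda>i. pair_weight (map closed_block (chunk (q i * q i) (ps i))))"
  proof (rule poly_bounded_mono)
    fix i assume i: "i \<in> I"
    note c = chunk_props(1,2)[OF qq(3)[OF i], of "ps i"]
    have "\<forall>c\<in>set (chunk (q i * q i) (ps i)). c \<noteq> [] \<and> length c \<le> length (ps i)"
      using c(2) length_mem_concat[of _ "chunk (q i * q i) (ps i)"] unfolding c(1) by auto
    from *[OF this] show "pair_weight (map closed_block (chunk (q i * q i) (ps i))) \<le> (288 * length (ps i) + 102) * pair_weight (ps i)"
      unfolding pair_weight_chunk[OF qq(3)[OF i]] .
  qed
  show "PT I N G (\<lambda>i. enc_list enc_pp (boundary_carries [] (map closed_block (chunk (q i * q i) (ps i)))))"
    by (rule PT_boundary_carries[OF PT_Nil cb _ cw]) auto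
  show "poly_bounded I N (\<lambda>i. length (boundary_carries [] (map closed_block (chunk (q i * q i) (ps i)))))"
    using cl by simp
  show "poly_bounded I N (\<lambda>i. length (concat (map (group_prefix (q i)) (chunk (q i * q i) (ps i)))))"
  proof (rule poly_bounded_mono[OF l])
    have "0 < k \<Longrightarrow> length (concat (map (group_prefix k) css)) = length (concat css)" for css :: "adder_input pair list list" and k
      by (induction css) (auto simp: length_group_prefix)
    then show "length (concat (map (group_prefix (q i)) (chunk (q i * q i) (ps i)))) \<le> length (ps i)" if "i \<in> I" for i
      using chunk_props(1)[OF qq(3)[OF that], of "ps i"] assms(4)[OF that] by simp
  qed
qed

lemma power_clog_le: "2 ^ clog k \<le> 2 * k + 1"
proof (cases "1 < k")
  case True
  then show ?thesis using clog_less[of k] by simp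
next
  case False
  then have "clog k \<le> 0" unfolding clog_def by (intro Least_le) auto
  then show ?thesis by simp
qed

lemma PT_clog:
  assumes "PT I N G (\<lambda>i. enc_un (a i))" "poly_bounded I N a"
  shows "PT I N G (\<lambda>i. enc_un (clog (a i)))" "poly_bounded I N (\<lambda>i. 2 ^ clog (a i))" "poly_bounded I N (\<lambda>i. clog (a i))"
proof -
  have "poly_bounded I N (\<lambda>i. 2 * a i + 1)" by (intro poly_bounded_add poly_bounded_mult poly_bounded_const assms(2))
  then show p: "poly_bounded I N (\<lambda>i. 2 ^ clog (a i))" by (rule poly_bounded_mono[OF _ _ power_clog_le])
  then show c: "poly_bounded I N (\<lambda>i. clog (a i))" by (rule poly_bounded_mono) (auto intro: less_imp_le)
  show "PT I N G (\<lambda>i. enc_un (clog (a i)))"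
    unfolding clog_def
  proof (rule PT_Least)
    show "\<exists>k. a i \<le> 2 ^ k" for i by (rule exI[of _ "a i"]) (simp add: less_imp_le)
    show "poly_bounded I N (\<lambda>i. LEAST k. a i \<le> 2 ^ k)" using c unfolding clog_def .
    let ?D = "{p. fst p \<in> I \<and> snd p \<le> (LEAST k. a (fst p) \<le> 2 ^ k)}"
    let ?G = "(\<lambda>p. enc_un (snd p)) # map (\<lambda>g p. g (fst p)) G"
    have "poly_bounded ?D (\<lambda>p. N (fst p)) (\<lambda>p. 2 ^ clog (a (fst p)))" by (rule poly_bounded_fst[OF p]) auto
    then have b: "poly_bounded ?D (\<lambda>p. N (fst p)) (\<lambda>p. 2 ^ snd p)"
      by (rule poly_bounded_mono) (auto simp: clog_def)
    have a: "PT ?D (\<lambda>p. N (fst p)) ?G (\<lambda>p. enc_un (a (fst p)))" by (rule PT_lift'[OF assms(1)]) auto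
    show "PT ?D (\<lambda>p. N (fst p)) ?G (\<lambda>p. enc_bool (a (fst p) \<le> 2 ^ snd p))"
      by (rule PT_un_le[OF a PT_un_power2[OF PT_var b] b]) simp
  qed
qed

lemma PT_outputs_of:
  assumes "PT I N G (\<lambda>i. enc_list enc_pp (ps i))" "poly_bounded I N (\<lambda>i. pair_weight (ps i))"
  shows "PT I N G (\<lambda>i. enc_list enc_pp (outputs_of (ps i)))"
proof -
  have l: "poly_bounded I N (\<lambda>i. length (ps i))" by (rule poly_bounded_mono[OF assms(2) _ length_le_pair_weight])
  note c = PT_clog[OF PT_length[OF assms(1) l] l]
  have "PT I N G (\<lambda>i. if clog (length (ps i)) \<le> 12 then enc_list enc_pp (sklansky (ps i))
      else enc_list enc_pp (adder ((clog (length (ps i)) + 1) div 2) (ps i)))"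
  proof (rule PT_if[OF PT_un_le[OF c(1) PT_un_const poly_bounded_const]])
    show "PT {i \<in> I. clog (length (ps i)) \<le> 12} N G (\<lambda>i. enc_list enc_pp (sklansky (ps i)))"
      by (rule PT_subset[OF PT_sklansky[OF assms(1) l]]) auto
    let ?D = "{i \<in> I. \<not> clog (length (ps i)) \<le> 12}"
    show "PT ?D N G (\<lambda>i. enc_list enc_pp (adder ((clog (length (ps i)) + 1) div 2) (ps i)))"
    proof (rule PT_adder)
      show "PT ?D N G (\<lambda>i. enc_un ((clog (length (ps i)) + 1) div 2))"
        by (rule PT_subset[OF PT_un_half[OF c(1,3)]]) auto
      show "PT ?D N G (\<lambda>i. enc_list enc_pp (ps i))" by (rule PT_subset[OF assms(1)]) auto
      show "poly_bounded ?D N (\<lambda>i. (clog (length (ps i)) + 1) div 2)" by (rule poly_bounded_mono[OF c(3)]) auto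
      show "poly_bounded ?D N (\<lambda>i. pair_weight (ps i))" by (rule poly_bounded_mono[OF assms(2)]) auto
    qed auto
  qed
  then show ?thesis unfolding outputs_of_def by (simp add: if_distrib cong: if_cong)
qed

section \<open>Polynomial time for the circuit\<close>

text \<open>The number of steps is bounded by the unary \<open>K\<close>, and the counter never
  passes \<open>M\<close>. Its binary size is thus at most twice that of \<open>M\<close>, although
  \<open>M\<close> itself may be exponential in the input size.\<close>

lemma PT_rel_arrival:
  assumes "PT I N G (\<lambda>i. enc_un (K i))" "PT I N G (\<lambda>i. enc_nat (M i))" "PT I N G (\<lambda>i. enc_nat (x i))"
    "poly_bounded I N K" "poly_bounded I N (\<lambda>i. size (enc_nat (M i)))" "\<And>i. i \<in> I \<Longrightarrow> x i \<le> M i"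
  shows "PT I N G (\<lambda>i. enc_un (rel_arrival (K i) (M i) (x i)))"
proof -
  let ?S = "{p :: nat \<times> nat \<times> nat \<times> nat. snd (snd (snd p)) \<le> fst (snd (snd p)) \<and> fst (snd p) \<le> fst p \<and> 2 * size (enc_nat (fst (snd (snd p)))) \<le> fst p}"
  let ?b = "\<lambda>p. fst (snd p) \<noteq> 0 \<and> snd (snd (snd p)) \<noteq> fst (snd (snd p))"
  let ?D = "{p \<in> ?S. ?b p}"
  let ?G = "[\<lambda>p. enc_un (fst (snd p)), \<lambda>p. enc_nat (fst (snd (snd p))), \<lambda>p. enc_nat (snd (snd (snd p)))] :: (nat \<times> nat \<times> nat \<times> nat \<Rightarrow> sexp) list"
  let ?l = "\<lambda>p. (fst p, fst (snd p) - 1, fst (snd (snd p)), Suc (snd (snd (snd p))))"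
  have "PT ?S fst ?G (\<lambda>p. enc_un (rel_arrival (fst (snd p)) (fst (snd (snd p))) (snd (snd (snd p)))))" (is "PT _ _ _ ?v")
  proof (rule PT_rec1[where b = ?b and l = ?l and m = "\<lambda>p. fst (snd p)"])
    have K: "PT D fst ?G (\<lambda>p. enc_un (fst (snd p)))" and M: "PT D fst ?G (\<lambda>p. enc_nat (fst (snd (snd p))))"
      and x: "PT D fst ?G (\<lambda>p. enc_nat (snd (snd (snd p))))" for D by (rule PT_var; simp)+
    have sz: "size (enc_nat (snd (snd (snd p)))) \<le> fst p" if "p \<in> ?S" for p
      using that size_enc_nat_mono[of "snd (snd (snd p))" "fst (snd (snd p))"] by simp
    have xb: "poly_bounded D fst (\<lambda>p. size (enc_nat (snd (snd (snd p)))))" if "D \<subseteq> ?S" for D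
      by (rule poly_bounded_le, rule sz) (use that in blast)
    have sub: "{p \<in> ?S. fst (snd p) \<noteq> 0} \<subseteq> ?S" "?D \<subseteq> ?S" by blast+
    show "PT ?S fst ?G (\<lambda>p. enc_bool (?b p))"
      by (intro PT_conj PT_not PT_un_is_0 K PT_nat_eq x M xb sub)
    show "PT ?D fst ?G (\<lambda>p. g (?l p))" if "g \<in> set ?G" for g
      using that PT_un_pred[OF K] M PT_nat_Suc[OF x xb[OF sub(2)]] by auto
    show "PT ?D fst ((\<lambda>p. ?v (?l p)) # ?G) ?v"
    proof (rule PT_cong[OF _ PT_var[of "\<lambda>p. ?v (?l p)"]])
      fix p assume "p \<in> ?D"
      then show "?v p = ?v (?l p)" by (cases "fst (snd p)") auto
    qed simp
    show "PT {p \<in> ?S. \<not> ?b p} fst ?G ?v"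
    proof (rule PT_cong[OF _ K])
      fix p assume "p \<in> {p \<in> ?S. \<not> ?b p}"
      then show "?v p = enc_un (fst (snd p))" by (cases "fst (snd p)") auto
    qed
    show "poly_bounded ?S fst (\<lambda>p. fst (snd p))" by (rule poly_bounded_le) auto
  qed auto
  then have "PT I N G (\<lambda>i. ?v (K i + 2 * size (enc_nat (M i)), K i, M i, x i))"
  proof (rule PT_call[where \<phi> = "\<lambda>i. (K i + 2 * size (enc_nat (M i)), K i, M i, x i)"])
    show "poly_bounded I N (\<lambda>i. fst (K i + 2 * size (enc_nat (M i)), K i, M i, x i))"
      unfolding fst_conv by (intro poly_bounded_add poly_bounded_mult poly_bounded_const assms)
  qed (use assms in \<open>auto intro!: PTsI\<close>)
  then show ?thesis by simp
qed

abbreviation enc_times :: "(nat \<times> nat) list \<Rightarrow> sexp" where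
  "enc_times \<equiv> enc_list (enc_pair enc_nat enc_nat)"

lemma size_enc_times:
  "length ts \<le> size (enc_times ts)"
  "t \<in> set ts \<Longrightarrow> size (enc_nat (fst t)) \<le> size (enc_times ts) \<and> size (enc_nat (snd t)) \<le> size (enc_times ts)"
  "size (enc_nat (latest ts)) \<le> size (enc_times ts)"
  by (induction ts) (auto simp: enc_pair_def latest_def max_def)

lemma PT_latest:
  assumes "PT I N G (\<lambda>i. enc_times (ts i))" "poly_bounded I N (\<lambda>i. size (enc_times (ts i)))"
  shows "PT I N G (\<lambda>i. enc_nat (latest (ts i)))"
  unfolding latest_def
proof (rule PT_foldr[where e = "enc_pair enc_nat enc_nat" and e' = enc_nat and z = "\<lambda>_. 0" and f = "\<lambda>_ t m. max (fst t) (max (snd t) m)", OF assms(1) PT_const])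
  show "poly_bounded I N (\<lambda>i. length (ts i))" by (rule poly_bounded_mono[OF assms(2) _ size_enc_times(1)])
  let ?D = "{p. fst p \<in> I \<and> (\<exists>us. ts (fst p) = us @ fst (snd p) # snd (snd p))}"
  let ?m = "\<lambda>p. foldr (\<lambda>t m. max (fst t) (max (snd t) m)) (snd (snd p)) 0"
  let ?H = "(\<lambda>p. enc_pair enc_nat enc_nat (fst (snd p))) # (\<lambda>p. enc_nat (?m p)) # map (\<lambda>g p. g (fst p)) G"
  have sb: "poly_bounded ?D (\<lambda>p. N (fst p)) (\<lambda>p. size (enc_times (ts (fst p))))" by (rule poly_bounded_fst[OF assms(2)]) auto
  have app: "size (enc_times vs) \<le> size (enc_times (us @ vs))" for us vs by (induction us) auto
  have sz: "size (enc_nat (fst (fst (snd p)))) \<le> size (enc_times (ts (fst p)))" "size (enc_nat (snd (fst (snd p)))) \<le> size (enc_times (ts (fst p)))"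
    "size (enc_nat (?m p)) \<le> size (enc_times (ts (fst p)))" if "p \<in> ?D" for p
  proof -
    from that obtain us where us: "ts (fst p) = us @ fst (snd p) # snd (snd p)" by auto
    show "size (enc_nat (fst (fst (snd p)))) \<le> size (enc_times (ts (fst p)))" "size (enc_nat (snd (fst (snd p)))) \<le> size (enc_times (ts (fst p)))"
      using size_enc_times(2)[of "fst (snd p)" "ts (fst p)"] us by auto
    have "size (enc_nat (?m p)) \<le> size (enc_times (snd (snd p)))" using size_enc_times(3)[of "snd (snd p)"] by (simp add: latest_def)
    also have "\<dots> \<le> size (enc_times (ts (fst p)))" using app[of "snd (snd p)" "us @ [fst (snd p)]"] us by simp
    finally show "size (enc_nat (?m p)) \<le> size (enc_times (ts (fst p)))" .
  qed
  have b: "poly_bounded ?D (\<lambda>p. N (fst p)) (\<lambda>p. size (enc_nat (fst (fst (snd p)))))" "poly_bounded ?D (\<lambda>p. N (fst p)) (\<lambda>p. size (enc_nat (snd (fst (snd p)))))"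
    "poly_bounded ?D (\<lambda>p. N (fst p)) (\<lambda>p. size (enc_nat (?m p)))"
    by (rule poly_bounded_mono[OF sb]; (rule sz)?; assumption)+
  have b': "poly_bounded ?D (\<lambda>p. N (fst p)) (\<lambda>p. size (enc_nat (max (snd (fst (snd p))) (?m p))))"
    by (rule poly_bounded_mono[OF poly_bounded_add[OF b(2,3)]]) (auto simp: max_def)
  have t: "PT ?D (\<lambda>p. N (fst p)) ?H (\<lambda>p. enc_pair enc_nat enc_nat (fst (snd p)))" and m: "PT ?D (\<lambda>p. N (fst p)) ?H (\<lambda>p. enc_nat (?m p))"
    by (rule PT_var; simp)+
  show "PT ?D (\<lambda>p. N (fst p)) ?H (\<lambda>p. enc_nat (max (fst (fst (snd p))) (max (snd (fst (snd p))) (?m p))))"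
    by (intro PT_nat_max PT_fst[OF t] PT_snd[OF t] m b b')
qed

lemma PT_rel_times:
  assumes "PT I N G (\<lambda>i. enc_times (ts i))" "poly_bounded I N (\<lambda>i. size (enc_times (ts i)))"
  shows "PT I N G (\<lambda>i. enc_list (enc_pair enc_un enc_un) (rel_times (ts i)))"
proof -
  have l: "poly_bounded I N (\<lambda>i. length (ts i))" by (rule poly_bounded_mono[OF assms(2) _ size_enc_times(1)])
  have Mb: "poly_bounded I N (\<lambda>i. size (enc_nat (latest (ts i))))" by (rule poly_bounded_mono[OF assms(2) _ size_enc_times(3)])
  note c = PT_clog[OF PT_length[OF assms(1) l] l]
  have K: "PT I N G (\<lambda>i. enc_un (clog (length (ts i)) + 4))" by (rule PT_un_add[OF c(1) PT_un_const c(3)])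
  have Kb: "poly_bounded I N (\<lambda>i. clog (length (ts i)) + 4)" by (intro poly_bounded_add poly_bounded_const c)
  note M = PT_latest[OF assms]
  let ?D = "{p. fst p \<in> I \<and> snd p \<in> set (ts (fst p))}"
  let ?H = "(\<lambda>p. enc_pair enc_nat enc_nat (snd p)) # map (\<lambda>g p. g (fst p)) G"
  let ?f = "\<lambda>us t. (rel_arrival (clog (length us) + 4) (latest us) (fst t), rel_arrival (clog (length us) + 4) (latest us) (snd t))"
  have t: "PT ?D (\<lambda>p. N (fst p)) ?H (\<lambda>p. enc_pair enc_nat enc_nat (snd p))" by (rule PT_var) simp
  have K': "PT ?D (\<lambda>p. N (fst p)) ?H (\<lambda>p. enc_un (clog (length (ts (fst p))) + 4))" by (rule PT_lift'[OF K]) auto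
  have M': "PT ?D (\<lambda>p. N (fst p)) ?H (\<lambda>p. enc_nat (latest (ts (fst p))))" by (rule PT_lift'[OF M]) auto
  have Kb': "poly_bounded ?D (\<lambda>p. N (fst p)) (\<lambda>p. clog (length (ts (fst p))) + 4)" by (rule poly_bounded_fst[OF Kb]) auto
  have Mb': "poly_bounded ?D (\<lambda>p. N (fst p)) (\<lambda>p. size (enc_nat (latest (ts (fst p)))))" by (rule poly_bounded_fst[OF Mb]) auto
  have "PT ?D (\<lambda>p. N (fst p)) ?H (\<lambda>p. enc_pair enc_un enc_un (?f (ts (fst p)) (snd p)))"
    by (rule PT_pair[where ?e1.0 = enc_un and ?e2.0 = enc_un, OF PT_rel_arrival[OF K' M' PT_fst[OF t] Kb' Mb'] PT_rel_arrival[OF K' M' PT_snd[OF t] Kb' Mb']])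
       (use latest_ge in auto)
  then have "PT I N G (\<lambda>i. enc_list (enc_pair enc_un enc_un) (map (?f (ts i)) (ts i)))"
    by (rule PT_map[where e = "enc_pair enc_nat enc_nat" and f = "\<lambda>i. ?f (ts i)", OF assms(1) l])
  then show ?thesis unfolding rel_times_def .
qed

lemma PT_In_propagate:
  assumes "PT I N G (\<lambda>i. enc_un (k i))" "PT I N G (\<lambda>i. enc_nat (m i))"
  shows "PT I N G (\<lambda>i. enc_trm (In (k i) (Propagate (m i))))" "PT I N G (\<lambda>i. enc_trm (In (k i) (Generate (m i))))"
  unfolding enc_trm.simps enc_adder_input.simps by (intro PT_Dot PT_Leaf PT_const assms)+

lemma PT_inputs:
  assumes "PT I N G (\<lambda>i. enc_list (enc_pair enc_un enc_un) (rs i))" "poly_bounded I N (\<lambda>i. length (rs i))"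
  shows "PT I N G (\<lambda>i. enc_list enc_pp (inputs (rs i)))"
proof -
  let ?F = "\<lambda>p. (In (fst (snd p)) (Propagate (fst p)), In (snd (snd p)) (Generate (fst p)))"
  let ?S = "{p :: nat \<times> nat \<times> (nat \<times> nat) list. fst (snd p) + length (snd (snd p)) \<le> fst p}"
  let ?b = "\<lambda>p. snd (snd p) \<noteq> []"
  let ?D = "{p \<in> ?S. ?b p}"
  let ?G = "[\<lambda>p. enc_nat (fst (snd p)), \<lambda>p. enc_list (enc_pair enc_un enc_un) (snd (snd p))] :: (nat \<times> nat \<times> (nat \<times> nat) list \<Rightarrow> sexp) list"
  let ?l = "\<lambda>p. (fst p, Suc (fst (snd p)), tl (snd (snd p)))"
  have "PT ?S fst ?G (\<lambda>p. enc_list enc_pp (map ?F (zip [fst (snd p)..<fst (snd p) + length (snd (snd p))] (snd (snd p)))))" (is "PT _ _ _ ?v")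
  proof (rule PT_rec1[where b = ?b and l = ?l and m = "\<lambda>p. length (snd (snd p))"])
    have i: "PT D fst (H @ ?G) (\<lambda>p. enc_nat (fst (snd p)))" and rs: "PT D fst (H @ ?G) (\<lambda>p. enc_list (enc_pair enc_un enc_un) (snd (snd p)))" for D H by (rule PT_var; simp)+
    note i0 = i[of _ "[]", unfolded append_Nil] and rs0 = rs[of _ "[]", unfolded append_Nil]
    note i1 = i[of _ "[\<lambda>p. ?v (?l p)]", unfolded append.simps] and rs1 = rs[of _ "[\<lambda>p. ?v (?l p)]", unfolded append.simps]
    have "poly_bounded ?D fst (\<lambda>p. 2 * fst (snd p))" by (intro poly_bounded_mult poly_bounded_const poly_bounded_le) auto
    then have ib: "poly_bounded ?D fst (\<lambda>p. size (enc_nat (fst (snd p))))"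
      by (rule poly_bounded_mono[OF _ _ size_enc_nat_le])
    show "PT ?S fst ?G (\<lambda>p. enc_bool (?b p))" by (rule PT_not[OF PT_null[OF rs0]])
    show "PT ?D fst ?G (\<lambda>p. g (?l p))" if "g \<in> set ?G" for g
      using that PT_nat_Suc[OF i0 ib] PT_tl[OF rs0] by auto
    let ?H = "(\<lambda>p. ?v (?l p)) # ?G"
    have h: "PT ?D fst ?H (\<lambda>p. enc_pair enc_un enc_un (hd (snd (snd p))))" by (rule PT_hd[OF rs1]) auto
    let ?h = "\<lambda>p. (In (fst (hd (snd (snd p)))) (Propagate (fst (snd p))), In (snd (hd (snd (snd p)))) (Generate (fst (snd p))))"
    have "PT ?D fst ?H (\<lambda>p. enc_pp (?h p))"
      by (intro PT_pair PT_In_propagate i1 PT_fst[OF h] PT_snd[OF h])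
    then have "PT ?D fst ?H (\<lambda>p. enc_list enc_pp (?h p #
        map ?F (zip [Suc (fst (snd p))..<Suc (fst (snd p)) + length (tl (snd (snd p)))] (tl (snd (snd p))))))"
      by (rule PT_Cons) (rule PT_var, simp)
    then show "PT ?D fst ?H ?v"
    proof (rule PT_cong[rotated])
      fix p assume "p \<in> ?D"
      then show "?v p = enc_list enc_pp (?h p #
        map ?F (zip [Suc (fst (snd p))..<Suc (fst (snd p)) + length (tl (snd (snd p)))] (tl (snd (snd p)))))"
        by (cases "snd (snd p)") (auto simp: upt_conv_Cons simp del: upt_Suc)
    qed
    show "PT {p \<in> ?S. \<not> ?b p} fst ?G ?v" by (rule PT_cong[OF _ PT_Leaf]) auto
    show "poly_bounded ?S fst (\<lambda>p. length (snd (snd p)))" by (rule poly_bounded_le) auto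
    fix p assume p: "p \<in> ?S" "?b p"
    then obtain r us where "snd (snd p) = r # us" by (cases "snd (snd p)") auto
    then show "?l p \<in> ?S \<and> fst (?l p) \<le> fst p \<and> length (snd (snd (?l p))) < length (snd (snd p))" using p by auto
  qed
  then have "PT I N G (\<lambda>i. ?v (length (rs i), 0, rs i))"
    by (rule PT_call[where \<phi> = "\<lambda>i. (length (rs i), 0, rs i)"]) (use assms PT_Leaf in \<open>auto intro!: PTsI\<close>)
  then show ?thesis by (simp add: inputs_def)
qed

lemma PT_elements:
  assumes "PT I N G (\<lambda>i. enc_list enc_pp (ins i))" "poly_bounded I N (\<lambda>i. length (ins i))"
  shows "PT I N G (\<lambda>i. enc_list enc_pp (elements (ins i)))"
  unfolding elements_def
proof (rule PT_map_fun[OF assms])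
  fix I :: "('a \<times> adder_input pair) set" and N G
  assume p: "PT I N G (\<lambda>p. enc_pp (snd p))"
  show "PT I N G (\<lambda>p. enc_pp (snd (snd p), Gt OR (snd (snd p)) (fst (snd p))))"
    by (intro PT_pair[where ?e2.0 = enc_trm] PT_Gt PT_op PT_fst[OF p] PT_snd[OF p])
qed

lemma PT_leaf_list:
  assumes "PT I N G (\<lambda>i. enc_list enc_pp (ins i))" "poly_bounded I N (\<lambda>i. length (ins i))"
  shows "PT I N G (\<lambda>i. enc_list enc_trm (leaf_list (ins i)))"
  unfolding leaf_list_def
proof (rule PT_concat)
  show "PT I N G (\<lambda>i. enc_list (enc_list enc_trm) (map (\<lambda>p. [fst p, snd p]) (ins i)))"
  proof (rule PT_map_fun[OF assms])
    fix I :: "('a \<times> adder_input pair) set" and N G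
    assume p: "PT I N G (\<lambda>p. enc_pp (snd p))"
    show "PT I N G (\<lambda>p. enc_list enc_trm [fst (snd p), snd (snd p)])"
      by (intro PT_Cons PT_Nil PT_fst[OF p] PT_snd[OF p])
  qed
  show "poly_bounded I N (\<lambda>i. length (map (\<lambda>p. [fst p, snd p]) (ins i)))" using assms(2) by simp
  have *: "length (concat (map (\<lambda>p. [fst p, snd p]) us)) = 2 * length us" for us :: "(adder_input trm \<times> adder_input trm) list"
    by (induction us) auto
  show "poly_bounded I N (\<lambda>i. length (concat (map (\<lambda>p. [fst p, snd p]) (ins i))))"
    unfolding * by (intro poly_bounded_mult poly_bounded_const assms)
qed

lemma enc_un_inject [simp]: "enc_un k = enc_un l \<longleftrightarrow> k = l"
proof (induction k arbitrary: l)
  case 0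
  then show ?case by (cases l) (auto simp: enc_un_def)
next
  case (Suc k)
  then show ?case by (cases l) (auto simp: enc_un_def)
qed

lemma enc_trm_inject [simp]: "enc_trm s = enc_trm t \<longleftrightarrow> s = t"
proof (induction s arbitrary: t)
  case (In k x)
  have "enc_adder_input x = enc_adder_input y \<longleftrightarrow> x = y" for y
    by (cases x; cases y) (auto simp del: enc_bool.simps)
  then show ?case by (cases t) auto
next
  case (Gt f s u)
  have "(f = OR) = (g = OR) \<longleftrightarrow> f = g" for g by (cases f; cases g) auto
  then show ?case using Gt by (cases t) auto
qed

lemma PT_trm_eq:
  assumes "PT I N G (\<lambda>i. enc_trm (s i))" "PT I N G (\<lambda>i. enc_trm (t i))" "poly_bounded I N (\<lambda>i. size (enc_trm (s i)))"
  shows "PT I N G (\<lambda>i. enc_bool (s i = t i))"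
  using PT_sexp_eq[OF assms] by simp

lemma PT_position:
  assumes "PT I N G (\<lambda>i. enc_list enc_trm (ns i))" "PT I N G (\<lambda>i. enc_trm (t i))"
    "poly_bounded I N (\<lambda>i. length (ns i))" "poly_bounded I N (\<lambda>i. size (enc_trm (t i)))"
  shows "PT I N G (\<lambda>i. enc_nat (position (ns i) (t i)))"
proof -
  have r: "position us x = foldr (\<lambda>y k. if x = y then 0 else Suc k) us 0" for us and x :: "adder_input trm"
    by (induction us) auto
  have "PT I N G (\<lambda>i. enc_nat (foldr (\<lambda>y k. if t i = y then 0 else Suc k) (ns i) 0))"
  proof (rule PT_foldr[where e = enc_trm and e' = enc_nat and z = "\<lambda>_. 0" and f = "\<lambda>i y k. if t i = y then 0 else Suc k", OF assms(1) PT_const assms(3)])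
    let ?D = "{p. fst p \<in> I \<and> (\<exists>us. ns (fst p) = us @ fst (snd p) # snd (snd p))}"
    let ?k = "\<lambda>p. foldr (\<lambda>y k. if t (fst p) = y then 0 else Suc k) (snd (snd p)) 0"
    let ?H = "(\<lambda>p. enc_trm (fst (snd p))) # (\<lambda>p. enc_nat (?k p)) # map (\<lambda>g p. g (fst p)) G"
    have y: "PT ?D (\<lambda>p. N (fst p)) ?H (\<lambda>p. enc_trm (fst (snd p)))" by (rule PT_var) simp
    have t: "PT ?D (\<lambda>p. N (fst p)) ?H (\<lambda>p. enc_trm (t (fst p)))" by (rule PT_lift'[OF assms(2)]) auto
    have tb: "poly_bounded ?D (\<lambda>p. N (fst p)) (\<lambda>p. size (enc_trm (t (fst p))))" by (rule poly_bounded_fst[OF assms(4)]) auto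
    let ?E = "{p \<in> ?D. \<not> t (fst p) = fst (snd p)}"
    have "poly_bounded ?D (\<lambda>p. N (fst p)) (\<lambda>p. length (ns (fst p)))" by (rule poly_bounded_fst[OF assms(3)]) auto
    then have "poly_bounded ?D (\<lambda>p. N (fst p)) (\<lambda>p. 2 * length (ns (fst p)))" by (intro poly_bounded_mult poly_bounded_const)
    then have kb: "poly_bounded ?E (\<lambda>p. N (fst p)) (\<lambda>p. size (enc_nat (?k p)))"
    proof (rule poly_bounded_mono)
      fix p assume p: "p \<in> ?E"
      have "position us x \<le> length us" for us and x :: "adder_input trm" by (induction us) auto
      from this[of "snd (snd p)" "t (fst p)"] have "?k p \<le> length (ns (fst p))" using p unfolding r by auto
      then show "size (enc_nat (?k p)) \<le> 2 * length (ns (fst p))" using size_enc_nat_le[of "?k p"] by linarith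
    qed blast
    have "PT ?E (\<lambda>p. N (fst p)) ?H (\<lambda>p. enc_nat (Suc (?k p)))"
      by (rule PT_nat_Suc[OF PT_var kb]) simp
    from PT_if[OF PT_trm_eq[OF t y tb] PT_const[of _ _ _ "enc_nat 0"] this]
    show "PT ?D (\<lambda>p. N (fst p)) ?H (\<lambda>p. enc_nat (if t (fst p) = fst (snd p) then 0 else Suc (?k p)))"
      by (simp add: if_distrib cong: if_cong)
  qed
  then show ?thesis unfolding r .
qed

lemma PT_member:
  assumes "PT I N G (\<lambda>i. enc_list enc_trm (ns i))" "PT I N G (\<lambda>i. enc_trm (t i))"
    "poly_bounded I N (\<lambda>i. length (ns i))" "poly_bounded I N (\<lambda>i. size (enc_trm (t i)))"
  shows "PT I N G (\<lambda>i. enc_bool (t i \<in> set (ns i)))"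
proof -
  have r: "x \<in> set us \<longleftrightarrow> foldr (\<lambda>y b. x = y \<or> b) us False" for us and x :: "adder_input trm"
    by (induction us) auto
  have "PT I N G (\<lambda>i. enc_bool (foldr (\<lambda>y b. t i = y \<or> b) (ns i) False))"
  proof (rule PT_foldr[where e = enc_trm and e' = enc_bool and z = "\<lambda>_. False" and f = "\<lambda>i y b. t i = y \<or> b", OF assms(1) PT_const assms(3)])
    let ?D = "{p. fst p \<in> I \<and> (\<exists>us. ns (fst p) = us @ fst (snd p) # snd (snd p))}"
    let ?k = "\<lambda>p. foldr (\<lambda>y b. t (fst p) = y \<or> b) (snd (snd p)) False"
    let ?H = "(\<lambda>p. enc_trm (fst (snd p))) # (\<lambda>p. enc_bool (?k p)) # map (\<lambda>g p. g (fst p)) G"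
    have y: "PT ?D (\<lambda>p. N (fst p)) ?H (\<lambda>p. enc_trm (fst (snd p)))" by (rule PT_var) simp
    have t: "PT ?D (\<lambda>p. N (fst p)) ?H (\<lambda>p. enc_trm (t (fst p)))" by (rule PT_lift'[OF assms(2)]) auto
    have tb: "poly_bounded ?D (\<lambda>p. N (fst p)) (\<lambda>p. size (enc_trm (t (fst p))))" by (rule poly_bounded_fst[OF assms(4)]) auto
    show "PT ?D (\<lambda>p. N (fst p)) ?H (\<lambda>p. enc_bool (t (fst p) = fst (snd p) \<or> ?k p))"
      by (rule PT_disj[OF PT_trm_eq[OF t y tb]], rule PT_var) simp
  qed
  then show ?thesis unfolding r .
qed

lemma PT_remdups:
  assumes "PT I N G (\<lambda>i. enc_list enc_trm (xs i))" "poly_bounded I N (\<lambda>i. length (xs i))"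
    "poly_bounded I N B" "\<And>i x. i \<in> I \<Longrightarrow> x \<in> set (xs i) \<Longrightarrow> size (enc_trm x) \<le> B i"
  shows "PT I N G (\<lambda>i. enc_list enc_trm (remdups (xs i)))"
proof -
  let ?f = "\<lambda>x acc. if x \<in> set acc then acc else x # acc"
  have r: "remdups us = foldr ?f us []" for us :: "adder_input trm list"
  proof (induction us)
    case (Cons u us)
    then show ?case unfolding remdups.simps foldr_Cons comp_apply Cons.IH[symmetric] set_remdups by simp
  qed simp
  have "PT I N G (\<lambda>i. enc_list enc_trm (foldr ?f (xs i) []))"
  proof (rule PT_foldr[where e = enc_trm and e' = "enc_list enc_trm" and z = "\<lambda>_. []" and f = "\<lambda>_. ?f", OF assms(1) PT_Nil assms(2)])
    let ?D = "{p. fst p \<in> I \<and> (\<exists>us. xs (fst p) = us @ fst (snd p) # snd (snd p))}"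
    let ?k = "\<lambda>p. foldr ?f (snd (snd p)) []"
    let ?H = "(\<lambda>p. enc_trm (fst (snd p))) # (\<lambda>p. enc_list enc_trm (?k p)) # map (\<lambda>g p. g (fst p)) G"
    have y: "PT D (\<lambda>p. N (fst p)) ?H (\<lambda>p. enc_trm (fst (snd p)))" and k: "PT D (\<lambda>p. N (fst p)) ?H (\<lambda>p. enc_list enc_trm (?k p))" for D
      by (rule PT_var; simp)+
    have "poly_bounded ?D (\<lambda>p. N (fst p)) (\<lambda>p. B (fst p))" by (rule poly_bounded_fst[OF assms(3)]) auto
    then have yb: "poly_bounded ?D (\<lambda>p. N (fst p)) (\<lambda>p. size (enc_trm (fst (snd p))))"
      by (rule poly_bounded_mono) (use assms(4) in auto)
    have "poly_bounded ?D (\<lambda>p. N (fst p)) (\<lambda>p. length (xs (fst p)))" by (rule poly_bounded_fst[OF assms(2)]) auto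
    then have kb: "poly_bounded ?D (\<lambda>p. N (fst p)) (\<lambda>p. length (?k p))"
      unfolding r[symmetric] by (rule poly_bounded_mono) (auto intro!: trans_le_add2 le_SucI)
    from PT_if[OF PT_member[OF k y kb yb] k PT_Cons[where e = enc_trm, OF y k]]
    show "PT ?D (\<lambda>p. N (fst p)) ?H (\<lambda>p. enc_list enc_trm (?f (fst (snd p)) (?k p)))"
      by (simp add: if_distrib cong: if_cong)
  qed
  then show ?thesis unfolding r .
qed

lemma PT_vertex:
  assumes "PT I N G (\<lambda>i. enc_list enc_trm (ns i))" "PT I N G (\<lambda>i. enc_trm (t i))"
    "poly_bounded I N (\<lambda>i. length (ns i))" "poly_bounded I N (\<lambda>i. size (enc_trm (t i)))"
  shows "PT I N G (\<lambda>i. enc_vertex enc_adder_input (vertex_of (ns i) (t i)))"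
proof -
  let ?D = "{i \<in> I. \<not> is_leaf (t i)}"
  let ?op = "\<lambda>i. sexp_hd (sexp_hd (enc_trm (t i)))"
  let ?x = "\<lambda>i. sexp_tl (sexp_tl (enc_trm (t i)))"
  have sub: "?D \<subseteq> I" by auto
  note ns = PT_subset[OF assms(1) sub] and t = PT_subset[OF assms(2) sub]
  have nb: "poly_bounded ?D N (\<lambda>i. length (ns i))" by (rule poly_bounded_mono[OF assms(3)]) auto
  have tb: "poly_bounded ?D N (\<lambda>i. size (enc_trm (t i)))" by (rule poly_bounded_mono[OF assms(4)]) auto
  have lr: "PT ?D N G (\<lambda>i. enc_trm (left_trm (t i)))" "PT ?D N G (\<lambda>i. enc_trm (right_trm (t i)))"
    by (rule PT_left_right[OF t]; simp)+
  have "size (enc_trm (left_trm u)) \<le> size (enc_trm u)" "size (enc_trm (right_trm u)) \<le> size (enc_trm u)" for u by (cases u; simp)+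
  then have b: "poly_bounded ?D N (\<lambda>i. size (enc_trm (left_trm (t i))))" "poly_bounded ?D N (\<lambda>i. size (enc_trm (right_trm (t i))))"
    by (auto intro!: poly_bounded_mono[OF tb])
  have "PT ?D N G (\<lambda>i. Dot (enc_nat 2) (Dot (?op i) (Dot (enc_nat (position (ns i) (left_trm (t i)))) (enc_nat (position (ns i) (right_trm (t i)))))))"
    by (intro PT_Dot PT_const PT_Hd t PT_position[OF ns lr(1) nb b(1)] PT_position[OF ns lr(2) nb b(2)])
  moreover have "PT {i \<in> I. is_leaf (t i)} N G (\<lambda>i. Dot (enc_nat 0) (?x i))"
    by (intro PT_Dot PT_const PT_Tl PT_subset[OF assms(2)]) auto
  ultimately have "PT I N G (\<lambda>i. if is_leaf (t i) then Dot (enc_nat 0) (?x i) else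
      Dot (enc_nat 2) (Dot (?op i) (Dot (enc_nat (position (ns i) (left_trm (t i)))) (enc_nat (position (ns i) (right_trm (t i)))))))"
    by (intro PT_if PT_is_leaf assms(2))
  then show ?thesis
  proof (rule PT_cong[rotated])
    show "enc_vertex enc_adder_input (vertex_of (ns i) (t i)) = (if is_leaf (t i) then Dot (enc_nat 0) (?x i) else
      Dot (enc_nat 2) (Dot (?op i) (Dot (enc_nat (position (ns i) (left_trm (t i)))) (enc_nat (position (ns i) (right_trm (t i)))))))" for i
      by (cases "t i") auto
  qed
qed

lemma size_enc_gates: "s \<in> gates t \<Longrightarrow> size (enc_trm s) \<le> size (enc_trm t)"
  by (induction t) auto

text \<open>All occurrences of subformulas are listed first and duplicates are removed afterwards,
  so that the bounds concern the unshared formulas.\<close>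

lemma PT_circuit_of:
  assumes ls: "PT I N G (\<lambda>i. enc_list enc_trm (ls i))" and ts: "PT I N G (\<lambda>i. enc_list enc_trm (ts i))"
    and lb: "poly_bounded I N (\<lambda>i. length (ls i))" and tb: "poly_bounded I N (\<lambda>i. length (ts i))"
    and gb: "poly_bounded I N (\<lambda>i. length (concat (map subterms (ts i))))"
    and B: "poly_bounded I N B" "\<And>i t. i \<in> I \<Longrightarrow> t \<in> set (ls i) \<union> set (ts i) \<Longrightarrow> size (enc_trm t) \<le> B i"
  shows "PT I N G (\<lambda>i. enc_circuit (circuit_of (ls i) (ts i)))"
proof -
  let ?ns = "\<lambda>i. nodes (ls i) (ts i)"
  have szg: "size (enc_trm s) \<le> B i" if "i \<in> I" "t \<in> set (ts i)" "s \<in> gates t" for i s t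
    using size_enc_gates[OF that(3)] B(2)[OF that(1), of t] that(2) by auto
  have "PT I N G (\<lambda>i. enc_list (enc_list enc_trm) (map subterms (ts i)))"
  proof (rule PT_map[where e = enc_trm and f = "\<lambda>_. subterms", OF ts tb])
    let ?D = "{p. fst p \<in> I \<and> snd p \<in> set (ts (fst p))}"
    have "poly_bounded ?D (\<lambda>p. N (fst p)) (\<lambda>p. length (concat (map subterms (ts (fst p)))))" by (rule poly_bounded_fst[OF gb]) auto
    then have "poly_bounded ?D (\<lambda>p. N (fst p)) (\<lambda>p. length (subterms (snd p)))"
      by (rule poly_bounded_mono) (auto intro: length_mem_concat)
    then show "PT ?D (\<lambda>p. N (fst p)) ((\<lambda>p. enc_trm (snd p)) # map (\<lambda>g p. g (fst p)) G) (\<lambda>p. enc_list enc_trm (subterms (snd p)))"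
      by (rule PT_subterms[rotated]) (rule PT_var, simp)
  qed
  then have "PT I N G (\<lambda>i. enc_list enc_trm (concat (map subterms (ts i))))"
    by (rule PT_concat) (use tb gb in simp_all)
  then have "PT I N G (\<lambda>i. enc_list enc_trm (remdups (concat (map subterms (ts i)))))"
    by (rule PT_remdups[OF _ gb B(1)]) (auto intro: szg)
  then have ns: "PT I N G (\<lambda>i. enc_list enc_trm (?ns i))"
    unfolding nodes_def distinct_subterms_def by (rule PT_append[OF ls _ lb])
  have "length (?ns i) \<le> length (ls i) + length (concat (map subterms (ts i)))" for i
    unfolding nodes_def distinct_subterms_def by simp
  then have nb: "poly_bounded I N (\<lambda>i. length (?ns i))"
    by (intro poly_bounded_mono[OF poly_bounded_add[OF lb gb]])
  have szn: "size (enc_trm t) \<le> B i" if "i \<in> I" "t \<in> set (?ns i)" for i t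
    using that szg B(2) by (auto simp: nodes_def distinct_subterms_def)
  have "PT I N G (\<lambda>i. enc_list (enc_vertex enc_adder_input) (map (vertex_of (?ns i)) (?ns i)))"
  proof (rule PT_map[where e = enc_trm and f = "\<lambda>i. vertex_of (?ns i)", OF ns nb])
    let ?D = "{p. fst p \<in> I \<and> snd p \<in> set (?ns (fst p))}"
    let ?H = "(\<lambda>p. enc_trm (snd p)) # map (\<lambda>g p. g (fst p)) G"
    have "poly_bounded ?D (\<lambda>p. N (fst p)) (\<lambda>p. B (fst p))" by (rule poly_bounded_fst[OF B(1)]) auto
    then have sb: "poly_bounded ?D (\<lambda>p. N (fst p)) (\<lambda>p. size (enc_trm (snd p)))"
      by (rule poly_bounded_mono) (use szn in auto)
    have n: "PT ?D (\<lambda>p. N (fst p)) ?H (\<lambda>p. enc_list enc_trm (?ns (fst p)))" by (rule PT_lift'[OF ns]) auto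
    have l: "poly_bounded ?D (\<lambda>p. N (fst p)) (\<lambda>p. length (?ns (fst p)))" by (rule poly_bounded_fst[OF nb]) auto
    show "PT ?D (\<lambda>p. N (fst p)) ?H (\<lambda>p. enc_vertex enc_adder_input (vertex_of (?ns (fst p)) (snd p)))"
      by (rule PT_vertex[OF n _ l sb], rule PT_var) simp
  qed
  moreover have "PT I N G (\<lambda>i. enc_list enc_nat (map (position (?ns i)) (ts i)))"
  proof (rule PT_map[where e = enc_trm and f = "\<lambda>i. position (?ns i)", OF ts tb])
    let ?D = "{p. fst p \<in> I \<and> snd p \<in> set (ts (fst p))}"
    let ?H = "(\<lambda>p. enc_trm (snd p)) # map (\<lambda>g p. g (fst p)) G"
    have "poly_bounded ?D (\<lambda>p. N (fst p)) (\<lambda>p. B (fst p))" by (rule poly_bounded_fst[OF B(1)]) auto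
    then have sb: "poly_bounded ?D (\<lambda>p. N (fst p)) (\<lambda>p. size (enc_trm (snd p)))"
      by (rule poly_bounded_mono) (use B(2) in auto)
    have n: "PT ?D (\<lambda>p. N (fst p)) ?H (\<lambda>p. enc_list enc_trm (?ns (fst p)))" by (rule PT_lift'[OF ns]) auto
    have l: "poly_bounded ?D (\<lambda>p. N (fst p)) (\<lambda>p. length (?ns (fst p)))" by (rule poly_bounded_fst[OF nb]) auto
    show "PT ?D (\<lambda>p. N (fst p)) ?H (\<lambda>p. enc_nat (position (?ns (fst p)) (snd p)))"
      by (rule PT_position[OF n _ l sb], rule PT_var) simp
  qed
  ultimately show ?thesis unfolding enc_circuit_def circuit_of_def circuit.sel by (rule PT_Dot)
qed

lemma rel_arrival_le: "rel_arrival K M x \<le> K"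
  by (induction K arbitrary: x) (auto intro: le_SucI)

lemma rel_le: "3 \<le> n \<Longrightarrow> rel n a x \<le> clog n + 4"
  unfolding rel_def by (rule rel_arrival_le)

text \<open>The purpose of truncating the arrival times: ready times are at most
  \<open>clog n + 5\<close>, including the gate for g or p, and all weights are polynomial in
  \<open>n\<close> whatever the true times are.\<close>

lemma pair_weight_elements_le:
  assumes "3 \<le> n"
  shows "pair_weight (the_elements n a) \<le> n * (32 * (2 * n + 1))"
proof -
  have m: "pair_weight ps \<le> length ps * c" if "\<forall>p\<in>set ps. 2 ^ ready p \<le> c" for ps :: "adder_input pair list" and c
    using that by (induction ps) auto
  have "2 ^ ready p \<le> 32 * (2 * n + 1)" if "p \<in> set (the_elements n a)" for p
  proof -
    from that obtain i where "p = (in_g n a i, Gt OR (in_g n a i) (in_p n a i))"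
      unfolding the_elements_def[OF assms] by auto
    then have "ready p \<le> clog n + 5"
      using rel_le[OF assms, of a "Propagate i"] rel_le[OF assms, of a "Generate i"]
      by (simp add: ready_def in_p_def[OF assms] in_g_def[OF assms])
    then have "(2::nat) ^ ready p \<le> 2 ^ (clog n + 5)" by (intro power_increasing) auto
    also have "\<dots> \<le> 32 * (2 * n + 1)" using power_clog_le[of n] by (simp add: power_add)
    finally show ?thesis .
  qed
  with m[of "the_elements n a"] show ?thesis using length_the_elements[OF assms] by auto
qed

lemma size_enc_un [simp]: "size (enc_un k) = k"
  by (induction k) (auto simp: enc_un_def)

lemma size_enc_leaf:
  assumes "3 \<le> n" "l \<in> set (leaf_list (the_ins n a))"
  shows "size (enc_trm l) \<le> 4 * n + 10"
proof -
  have "clog n < 2 ^ clog n" by (rule less_exp)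
  then have "clog n \<le> 2 * n" using power_clog_le[of n] by linarith
  then have "rel n a x \<le> 2 * n + 4" for x using rel_le[OF assms(1), of a x] by linarith
  note r = this
  have b: "size (enc_trm (In k (Propagate i))) \<le> k + size (enc_nat i) + 4" "size (enc_trm (In k (Generate i))) \<le> k + size (enc_nat i) + 4" for k i
    by simp_all
  obtain i where i: "i < n" "l = in_p n a i \<or> l = in_g n a i"
    using assms(2) unfolding set_leaf_list[OF assms(1)] by auto
  from i(2) have "size (enc_trm l) \<le> 2 * n + 4 + size (enc_nat i) + 4"
  proof
    assume "l = in_p n a i"
    then show ?thesis using b(1)[of "rel n a (Propagate i)" i] r[of "Propagate i"] unfolding in_p_def[OF assms(1)] by simp
  next
    assume "l = in_g n a i"
    then show ?thesis using b(2)[of "rel n a (Generate i)" i] r[of "Generate i"] unfolding in_g_def[OF assms(1)] by simp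
  qed
  then show ?thesis using size_enc_nat_le[of i] i(1) by linarith
qed

lemma size_enc_trm:
  "\<forall>l\<in>leaves t. size (enc_trm l) \<le> b \<Longrightarrow> size (enc_trm t) \<le> (2 * length (subterms t) + 1) * (b + 4)"
proof (induction t)
  case (Gt f s t)
  have "size (enc_bool (f = OR)) \<le> 1" by (cases "f = OR") auto
  then have "size (enc_trm (Gt f s t)) \<le> size (enc_trm s) + size (enc_trm t) + 4" by simp
  also have "\<dots> \<le> (2 * length (subterms s) + 1) * (b + 4) + (2 * length (subterms t) + 1) * (b + 4) + (b + 4)"
    using Gt by (intro add_mono) auto
  also have "\<dots> = (2 * length (subterms (Gt f s t)) + 1) * (b + 4)" by (simp add: algebra_simps)
  finally show ?case .
qed simp

lemma enc_instance_times: "enc_instance (n, a) = enc_times (times n a)"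
proof -
  have "enc_list e (map f xs) = enc_list (\<lambda>x. e (f x)) xs" for e :: "nat \<times> nat \<Rightarrow> sexp" and f :: "nat \<Rightarrow> nat \<times> nat" and xs
    by (induction xs) auto
  then show ?thesis by (simp add: times_def enc_pair_def)
qed

lemma length_concat_le_mult: "\<forall>x\<in>set xs. length (f x) \<le> c \<Longrightarrow> length (concat (map f xs)) \<le> length xs * c"
  by (induction xs) auto

lemma PT_circuit_of_times:
  "PT {(n, a). 3 \<le> n} (\<lambda>p. size (enc_instance p)) [enc_instance] (\<lambda>(n, a). enc_circuit (circuit_of_times (times n a)))"
proof -
  let ?I = "{(n, a). 3 \<le> n} :: (nat \<times> (adder_input \<Rightarrow> nat)) set"
  let ?N = "\<lambda>p. size (enc_instance p)"
  let ?n = "fst :: nat \<times> (adder_input \<Rightarrow> nat) \<Rightarrow> nat"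
  let ?ts = "\<lambda>p. times (fst p) (snd p)" and ?ins = "\<lambda>p. the_ins (fst p) (snd p)"
  have n: "3 \<le> ?n p" if "p \<in> ?I" for p using that by auto
  have eN: "enc_instance p = enc_times (?ts p)" for p using enc_instance_times[of "fst p" "snd p"] by simp
  have len: "length (?ts p) = ?n p" for p by (simp add: times_def)
  have nb: "poly_bounded ?I ?N ?n"
    by (rule poly_bounded_le) (metis size_enc_times(1) eN len)
  have ts: "PT ?I ?N [enc_instance] (\<lambda>p. enc_times (?ts p))"
    unfolding eN[symmetric] by (rule PT_var) simp
  have "poly_bounded ?I ?N (\<lambda>p. size (enc_times (?ts p)))" unfolding eN[symmetric] by (rule poly_bounded_id)
  note rt = PT_rel_times[OF ts this]
  have "PT ?I ?N [enc_instance] (\<lambda>p. enc_list enc_pp (inputs (rel_times (?ts p))))"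
    by (rule PT_inputs[OF rt]) (simp add: rel_times_def len nb)
  then have ins: "PT ?I ?N [enc_instance] (\<lambda>p. enc_list enc_pp (?ins p))"
    by (rule PT_cong[rotated]) (use n inputs_times in fastforce)
  have ib: "poly_bounded ?I ?N (\<lambda>p. length (?ins p))"
    by (rule poly_bounded_mono[OF nb]) (use n the_ins_def in fastforce)+
  have "PT ?I ?N [enc_instance] (\<lambda>p. enc_list enc_pp (elements (?ins p)))" by (rule PT_elements[OF ins ib])
  then have els: "PT ?I ?N [enc_instance] (\<lambda>p. enc_list enc_pp (the_elements (fst p) (snd p)))"
    by (rule PT_cong[rotated]) (use n elements_times in fastforce)
  have "poly_bounded ?I ?N (\<lambda>p. ?n p * (32 * (2 * ?n p + 1)))"
    by (intro poly_bounded_mult poly_bounded_add poly_bounded_const nb)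
  then have wb: "poly_bounded ?I ?N (\<lambda>p. pair_weight (the_elements (fst p) (snd p)))"
    by (rule poly_bounded_mono) (use n pair_weight_elements_le in fastforce)+
  note outs = PT_outputs_of[OF els wb]
  have ol: "length (outputs_of (the_elements (fst p) (snd p))) = ?n p" if "p \<in> ?I" for p
    using outputs_of_props(1) length_the_elements[OF n[OF that]] by metis
  have "PT ?I ?N [enc_instance] (\<lambda>p. enc_list enc_trm (map fst (outputs_of (the_elements (fst p) (snd p)))))"
    by (rule PT_map_fun[where e = enc_pp, OF outs]) (use ol in \<open>auto intro: poly_bounded_mono[OF nb] PT_fst\<close>)
  then have terms: "PT ?I ?N [enc_instance] (\<lambda>p. enc_list enc_trm (the_terms (fst p) (snd p)))"
    by (rule PT_cong[rotated]) (use n the_terms_def in fastforce)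
  \<comment> \<open>Bounds the number of gate occurrences in a single output formula, by combining
    \<open>terms_arr_bound\<close> with the bound on the input weight.\<close>
  define A where "A p = 500000 * ?n p ^ 6 * (?n p * (32 * (2 * ?n p + 1)))" for p
  have A: "poly_bounded ?I ?N A"
    unfolding A_def by (intro poly_bounded_mult poly_bounded_add poly_bounded_power poly_bounded_const nb)
  have st: "length (subterms t) \<le> A p" if "p \<in> ?I" "t \<in> set (the_terms (fst p) (snd p))" for p t
  proof -
    have "length (subterms t) \<le> 2 ^ arr t" using length_subterms_less[of t] by simp
    also have "\<dots> \<le> 500000 * ?n p ^ 6 * pair_weight (the_elements (fst p) (snd p))"
      by (rule terms_arr_bound[OF n[OF that(1)] that(2)])
    also have "\<dots> \<le> A p" unfolding A_def by (intro mult_le_mono2 pair_weight_elements_le n that)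
    finally show ?thesis .
  qed
  let ?B = "\<lambda>p. (2 * A p + 1) * ((4 * ?n p + 10) + 4)"
  have "PT ?I ?N [enc_instance] (\<lambda>p. enc_circuit (circuit_of (leaf_list (?ins p)) (the_terms (fst p) (snd p))))"
  proof (rule PT_circuit_of[OF PT_leaf_list[OF ins ib] terms, where B = ?B])
    have "length (leaf_list us) = 2 * length us" for us :: "(adder_input trm \<times> adder_input trm) list"
      by (induction us) (auto simp: leaf_list_def)
    then show "poly_bounded ?I ?N (\<lambda>p. length (leaf_list (?ins p)))"
      by (simp only: poly_bounded_mult poly_bounded_const ib)
    show "poly_bounded ?I ?N (\<lambda>p. length (the_terms (fst p) (snd p)))"
      by (rule poly_bounded_mono[OF nb]) (use n the_terms_length in fastforce)+
    have "poly_bounded ?I ?N (\<lambda>p. ?n p * A p)" by (rule poly_bounded_mult[OF nb A])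
    then show "poly_bounded ?I ?N (\<lambda>p. length (concat (map subterms (the_terms (fst p) (snd p)))))"
    proof (rule poly_bounded_mono)
      fix p assume p: "p \<in> ?I"
      show "length (concat (map subterms (the_terms (fst p) (snd p)))) \<le> ?n p * A p"
        using length_concat_le_mult[of "the_terms (fst p) (snd p)" subterms "A p"] st[OF p] the_terms_length[OF n[OF p]] by simp
    qed
    show "poly_bounded ?I ?N ?B"
      by (intro poly_bounded_mult poly_bounded_add poly_bounded_const nb A)
    show "size (enc_trm t) \<le> ?B p" if p: "p \<in> ?I" and t: "t \<in> set (leaf_list (?ins p)) \<union> set (the_terms (fst p) (snd p))" for p t
    proof (cases "t \<in> set (leaf_list (?ins p))")
      case True
      have "1 * (4 * ?n p + 10) \<le> ?B p" by (rule mult_le_mono) auto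
      then show ?thesis unfolding mult_1 by (rule order_trans[OF size_enc_leaf[OF n[OF p] True]])
    next
      case False
      then have t': "t \<in> set (the_terms (fst p) (snd p))" using t by blast
      have "size (enc_trm t) \<le> (2 * length (subterms t) + 1) * ((4 * ?n p + 10) + 4)"
        by (rule size_enc_trm) (use leaves_terms[OF n[OF p] t'] size_enc_leaf[OF n[OF p]] in blast)
      also have "\<dots> \<le> ?B p" using st[OF p t'] by (intro mult_le_mono1) simp
      finally show ?thesis .
    qed
  qed
  then show ?thesis
    by (rule PT_cong[rotated]) (auto simp: circuit_of_times)
qed

text \<open>Execution starts in function 0, so the evaluated expression is put in front of the
  program as a function of its own, and calls are shifted by 1. The polynomial is the power of X + 2
  from \<open>poly_bounded\<close>.\<close>

lemma poly_time_computable_if_PT: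
  assumes "PT A (\<lambda>x. size (enc_in x)) [enc_in] (\<lambda>x. enc_out (F x))"
  shows "poly_time_computable A enc_in enc_out F"
proof -
  obtain prog e T where T: "poly_bounded A (\<lambda>x. size (enc_in x)) T"
    and ev: "\<And>x. x \<in> A \<Longrightarrow> \<exists>t\<le>T x. eval prog (map (\<lambda>g. g x) [enc_in]) e (enc_out (F x)) t"
    by (rule PTE[OF assms], rule that)
  from T obtain k where k: "\<And>x. x \<in> A \<Longrightarrow> T x \<le> (size (enc_in x) + 2) ^ k"
    by (auto simp: poly_bounded_def)
  let ?prog = "[shift_expr 1 e] @ map (shift_expr 1) prog @ []"
  have "\<exists>t. runs ?prog (enc_in x) (enc_out (F x)) t \<and> t \<le> poly ([:2, 1:] ^ k) (size (enc_in x))" if x: "x \<in> A" for x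
  proof -
    obtain t where t: "t \<le> T x" "eval prog [enc_in x] e (enc_out (F x)) t" using ev[OF x] by auto
    have "runs ?prog (enc_in x) (enc_out (F x)) t"
      using eval_shift(1)[OF t(2), of "[shift_expr 1 e]" "[]"] by (simp add: runs_def)
    moreover have "t \<le> poly ([:2, 1:] ^ k) (size (enc_in x))"
      using order_trans[OF t(1) k[OF x]] by (simp add: poly_power add.commute)
    ultimately show ?thesis by blast
  qed
  then show ?thesis unfolding poly_time_computable_def by blast
qed

theorem theorem5p16:
  "\<exists>C :: nat \<Rightarrow> (adder_input \<Rightarrow> nat) \<Rightarrow> adder_input circuit.
     poly_time_computable {(n, a). n \<ge> 3} enc_instance enc_circuit (\<lambda>(n, a). C n a) \<and>
     (\<forall>(n :: nat) (a :: adder_input \<Rightarrow> nat) (W :: real).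
        n \<ge> 3 \<longrightarrow> W = (\<Sum>i<n. 2 ^ a (Propagate i) + 2 ^ a (Generate i)) \<longrightarrow>
          adder_circuit n (C n a) \<and>
          real (delay (C n a) a)
            \<le> log 2 W + 3 * log 2 (log 2 (real n)) + 3 * log 2 (log 2 (log 2 (real n))) + 11.085 \<and>
          real (circuit_size (C n a)) \<le> 24.436 * real n * log 2 (log 2 (real n)))"
proof (intro exI[of _ "\<lambda>n a. circuit_of_times (times n a)"] conjI allI impI)
  have "(\<lambda>(n, a). enc_circuit (circuit_of_times (times n a))) = (\<lambda>p. enc_circuit ((\<lambda>(n, a). circuit_of_times (times n a)) p))"
    by auto
  with PT_circuit_of_times
  show "poly_time_computable {(n, a). n \<ge> 3} enc_instance enc_circuit (\<lambda>(n, a). circuit_of_times (times n a))"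
    by (intro poly_time_computable_if_PT) simp
  fix n :: nat and a :: "adder_input \<Rightarrow> nat" and w :: real
  assume n: "n \<ge> 3" and w: "w = (\<Sum>i<n. 2 ^ a (Propagate i) + 2 ^ a (Generate i))"
  show "adder_circuit n (circuit_of_times (times n a))" by (rule adder_circuit_times[OF n])
  show "real (delay (circuit_of_times (times n a)) a)
      \<le> log 2 w + 3 * log 2 (log 2 (real n)) + 3 * log 2 (log 2 (log 2 (real n))) + 11.085"
    using delay_bound[OF n, of a] unfolding input_weight_def[OF n] w .
  show "real (circuit_size (circuit_of_times (times n a))) \<le> 24.436 * real n * log 2 (log 2 (real n))"
    by (rule arrival_size_bounds(2)[OF n])
qed

end
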